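(* Let $X$ be a finite topological graph distinct from a singleton and from a doubleton, such that the space $\mathcal{X}^r(X)$ is not connected, and let $Y_1,\dots,Y_m$ be the (possibly empty) family of homeomorphism types of all blocks of $X$. Then $$\mathcal{X}^r(X)\cong\widetilde\sqcup\bigl(\mathcal{X}^r(Y_1),\dots,\mathcal{X}^r(Y_m)\bigr).$$
   Context: **Graphs and blocks.** A (topological) graph $X$ is the underlying topological space of a finite simplicial graph. An essential vertex of $X$ is a point which locally splits $X$ into a number of connected components different from $2$. An (open) essential edge of $X$ is a connected component of the complement in $X$ of the set of all essential vertices; a connected component of $X$ homeomorphic to the circle is also regarded as an essential (loop) edge. These form the natural cell structure of $X$. A graph is non-separable if it is connected and has no separating essential vertex (in particular the circle is non-separable). A block of $X$ is any subgraph of $X$ (for the natural cell structure) which is maximal for inclusion in the family of all non-separable subgraphs of $X$, and which is not homeomorphic to a segment and not a single isolated vertex of $X$. Subgraphs are viewed as topological graphs with their own natural cell structures. **Blow-ups.** For a point $x$ of a graph $X$, the blow-up $X^\#(x)$ is the graph obtained from $X\setminus\{x\}$ by attaching as many points (vertices of valence $1$) as there are components into which $x$ splits a small normal neighbourhood of $x$, one at the end of each of these components. $P_x$ denotes the set of attached points. For a finite $J\subset X$, $X^\#(J)$ is obtained by blowing up at all points of $J$; for finite $J\subset K$ the blow-down map $\rho_{K,J}:X^\#(K)\to X^\#(J)$ collapses each $P_x$, $x\in K\setminus J$, to $x$ and is the identity elsewhere. **Reflection tree of graphs.** Let $D\subset X$ be a countable dense subset containing all essential vertices. Let $T$ be a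 tree each of whose vertices has valence $|D|$, with vertex set $V_T$ and (unoriented) edge set $E_T$, and let $\lambda:E_T\to D$ be a labelling whose restriction to the set of edges adjacent to any given vertex is a bijection onto $D$. Let $\mathcal{F}$ be the poset of finite subtrees of $T$ ordered by inclusion. For $t\in V_T$ let $X_t$ be a copy of $X$. For $F\in\mathcal{F}$ and a vertex $t$ of $F$ let $A_tF$ be the set of edges of $F$ adjacent to $t$, and put $X_F=\bigsqcup_{t\in V_F}X_t^\#(\lambda(A_tF))/\sim$, where for each edge $e=[t_1,t_2]$ of $F$ and each $p\in P_{\lambda(e)}$ the point $p\in P_{\lambda(e)}\subset X_{t_1}^\#(\lambda(A_{t_1}F))$ is identified with $p\in P_{\lambda(e)}\subset X_{t_2}^\#(\lambda(A_{t_2}F))$. For $F\subset F'$ the map $\pi_{F',F}:X_{F'}\to X_F$ is the blow-down map $\rho_{\lambda(A_tF'),\lambda(A_tF)}$ on $X_t^\#(\lambda(A_tF'))$ for $t\in V_F$, and for $t\in V_{F'}\setminus V_F$ it maps $X_t^\#(\lambda(A_tF'))$ to the single point $\lambda(e)\in X_s^\#(\lambda(A_sF))\subset X_F$, where $s$ is the vertex of $F$ closest to $t$ and $e$ is the first edge on the path from $s$ to $t$. The reflection tree of graphs $X$ is $\mathcal{X}^r(X)=\varprojlim(\{X_F\},\{\pi_{F',F}\})$; up to homeomorphism it does not depend on the choices of $D$ and $\lambda$. **Dense amalgam.** For nonempty metric compacta $B_1,\dots,B_k$ the dense amalgam $A=\widetilde\sqcup(B_1,\dots,B_k)$ is the metric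 compactum, determined uniquely up to homeomorphism, which can be equipped with a countably infinite family $\mathcal{A}=\mathcal{A}_1\sqcup\dots\sqcup\mathcal{A}_k$ of subsets such that: (a1) the subsets in $\mathcal{A}$ are pairwise disjoint and each $\mathcal{A}_i$ consists of embedded copies of $B_i$; (a2) $\mathcal{A}$ is null, i.e. for any metric compatible with the topology the diameters of sets in $\mathcal{A}$ converge to $0$; (a3) each set in $\mathcal{A}$ has dense complement in $A$; (a4) for each $i$ the union of the family $\mathcal{A}_i$ is dense in $A$; (a5) any two points of $A$ which do not belong to the same subset of $\mathcal{A}$ can be separated by an open and closed subset $H\subset A$ which is $\mathcal{A}$-saturated (every element of $\mathcal{A}$ is contained in or disjoint from $H$). Conventions: the dense amalgam of the empty family, and $\widetilde\sqcup(\emptyset)$, are the Cantor set $C$; $\widetilde\sqcup(\emptyset,B_1,\dots,B_k)=\widetilde\sqcup(B_1,\dots,B_k)$. *)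

theory Defs
  imports "HOL-Analysis.Analysis"
begin

section \<open>Topological graphs\<close>

text \<open>
  A finite simplicial graph is a finite simplicial complex of dimension at most 1. Every such
  complex has a linear realization in 3-space, so no generality is lost by fixing that space.
\<close>

definition topological_graph :: "'a topology \<Rightarrow> bool" where
  "topological_graph X \<longleftrightarrow>
     (\<exists>K :: (real ^ 3) set set.
        simplicial_complex K \<and> (\<forall>S\<in>K. aff_dim S \<le> 1) \<and>
        X homeomorphic_space top_of_set (\<Union>K))"

text \<open>
  A normal neighbourhood of \<open>x\<close> is an open star centred at \<open>x\<close>: each of the finitely many
  components into which \<open>x\<close> splits it becomes, together with \<open>x\<close>, a half-open arc issuing from
  \<open>x\<close>. An isolated point has the normal neighbourhood \<open>{x}\<close>, with no components.
\<close>

definition punctured_components :: "'a topology \<Rightarrow> 'a \<Rightarrow> 'a set \<Rightarrow> 'a set set" where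
  "punctured_components X x N = connected_components_of (subtopology X (N - {x}))"

definition normal_neighbourhood :: "'a topology \<Rightarrow> 'a \<Rightarrow> 'a set \<Rightarrow> bool" where
  "normal_neighbourhood X x N \<longleftrightarrow>
     openin X N \<and> x \<in> N \<and> finite (punctured_components X x N) \<and>
     (\<forall>C \<in> punctured_components X x N.
        \<exists>h. homeomorphic_map (top_of_set {0..<1::real}) (subtopology X (insert x C)) h \<and> h 0 = x)"

definition essential_vertices :: "'a topology \<Rightarrow> 'a set" where
  "essential_vertices X =
     {x \<in> topspace X.
        \<exists>N. normal_neighbourhood X x N \<and> card (punctured_components X x N) \<noteq> 2}"

text \<open>
  A connected component homeomorphic to the circle contains no essential vertex, so the loop
  edges are among the components below.
\<close>

definition essential_edges :: "'a topology \<Rightarrow> 'a set set" where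
  "essential_edges X =
     connected_components_of (subtopology X (topspace X - essential_vertices X))"

text \<open>Subgraphs for the natural cell structure, i.e. closed unions of cells.\<close>

definition natural_subgraph :: "'a topology \<Rightarrow> 'a set \<Rightarrow> bool" where
  "natural_subgraph X S \<longleftrightarrow>
     closedin X S \<and>
     (\<exists>V \<E>. V \<subseteq> essential_vertices X \<and> \<E> \<subseteq> essential_edges X \<and> S = V \<union> \<Union>\<E>)"

definition non_separable :: "'a topology \<Rightarrow> bool" where
  "non_separable X \<longleftrightarrow>
     connected_space X \<and>
     (\<forall>v \<in> essential_vertices X. connected_space (subtopology X (topspace X - {v})))"

text \<open>
  Non-separability of a subgraph refers to its own essential vertices, i.e. those of the
  subspace \<open>S\<close>; an essential vertex of \<open>X\<close> in \<open>S\<close> need not be one of \<open>S\<close>.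
\<close>

definition block :: "'a topology \<Rightarrow> 'a set \<Rightarrow> bool" where
  "block X S \<longleftrightarrow>
     natural_subgraph X S \<and> non_separable (subtopology X S) \<and>
     (\<forall>S'. natural_subgraph X S' \<and> non_separable (subtopology X S') \<and> S \<subseteq> S' \<longrightarrow> S' = S) \<and>
     \<not> subtopology X S homeomorphic_space top_of_set {0..1::real} \<and>
     \<not> (\<exists>v. S = {v} \<and> openin X {v})"


section \<open>Blow-ups\<close>

text \<open>
  The points of a blow-up at \<open>J\<close> are the points of \<open>X\<close> outside \<open>J\<close>, and for each \<open>x \<in> J\<close> one
  point \<open>End x C\<close> for each component \<open>C\<close> into which \<open>x\<close> splits a normal neighbourhood,
  fixed once and for all. The choice is immaterial: any two normal neighbourhoods of \<open>x\<close> have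
  the same components near \<open>x\<close>.
\<close>

datatype 'a blow_up_point = Pt 'a | End 'a "'a set"

definition branches :: "'a topology \<Rightarrow> 'a \<Rightarrow> 'a set set" where
  "branches X x = punctured_components X x (SOME N. normal_neighbourhood X x N)"

definition blow_up_points :: "'a topology \<Rightarrow> 'a set \<Rightarrow> 'a blow_up_point set" where
  "blow_up_points X J = Pt ` (topspace X - J) \<union> (\<Union>x \<in> J \<inter> topspace X. End x ` branches X x)"

text \<open>
  Basic neighbourhoods of \<open>End x C\<close> consist of \<open>End x C\<close> and the part of \<open>C\<close> close to \<open>x\<close>. As
  \<open>J\<close> is finite, other points of \<open>J\<close> do not occur close to \<open>x\<close>.
\<close>

definition blow_up_open :: "'a topology \<Rightarrow> 'a set \<Rightarrow> 'a blow_up_point set \<Rightarrow> bool" where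
  "blow_up_open X J W \<longleftrightarrow>
     W \<subseteq> blow_up_points X J \<and>
     openin (subtopology X (topspace X - J)) {y. Pt y \<in> W} \<and>
     (\<forall>x C. End x C \<in> W \<longrightarrow> (\<exists>U. openin X U \<and> x \<in> U \<and> Pt ` (U \<inter> C - J) \<subseteq> W))"

definition blow_up :: "'a topology \<Rightarrow> 'a set \<Rightarrow> 'a blow_up_point topology" where
  "blow_up X J = topology (blow_up_open X J)"

lemma blow_up_openI:
  assumes "W \<subseteq> blow_up_points X J"
    and "openin (subtopology X (topspace X - J)) {y. Pt y \<in> W}"
    and "\<And>x C. End x C \<in> W \<Longrightarrow> \<exists>U. openin X U \<and> x \<in> U \<and> Pt ` (U \<inter> C - J) \<subseteq> W"
  shows "blow_up_open X J W"
  unfolding blow_up_open_def by (intro conjI allI impI assms)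

lemma blow_up_openD:
  assumes "blow_up_open X J W"
  shows "W \<subseteq> blow_up_points X J"
    and "openin (subtopology X (topspace X - J)) {y. Pt y \<in> W}"
    and "End x C \<in> W \<Longrightarrow> \<exists>U. openin X U \<and> x \<in> U \<and> Pt ` (U \<inter> C - J) \<subseteq> W"
  by (rule assms[unfolded blow_up_open_def, THEN conjunct1])
     (rule assms[unfolded blow_up_open_def, THEN conjunct2, THEN conjunct1],
      rule assms[unfolded blow_up_open_def, THEN conjunct2, THEN conjunct2, rule_format])

lemma istopology_blow_up_open: "istopology (blow_up_open X J)"
  unfolding istopology_def
proof (intro conjI allI impI)
  fix S T
  assume S: "blow_up_open X J S" and T: "blow_up_open X J T"
  show "blow_up_open X J (S \<inter> T)"
  proof (rule blow_up_openI)
    show "S \<inter> T \<subseteq> blow_up_points X J"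
      using blow_up_openD(1)[OF S] by (rule le_infI1)
    have "{y. Pt y \<in> S \<inter> T} = {y. Pt y \<in> S} \<inter> {y. Pt y \<in> T}"
      by (simp add: Collect_conj_eq)
    then show "openin (subtopology X (topspace X - J)) {y. Pt y \<in> S \<inter> T}"
      using openin_Int[OF blow_up_openD(2)[OF S] blow_up_openD(2)[OF T]] by (simp only:)
  next
    fix x C
    assume x: "End x C \<in> S \<inter> T"
    obtain U where U: "openin X U" "x \<in> U" "Pt ` (U \<inter> C - J) \<subseteq> S"
      using blow_up_openD(3)[OF S IntD1[OF x]] by (elim exE conjE)
    obtain U' where U': "openin X U'" "x \<in> U'" "Pt ` (U' \<inter> C - J) \<subseteq> T"
      using blow_up_openD(3)[OF T IntD2[OF x]] by (elim exE conjE)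
    show "\<exists>U. openin X U \<and> x \<in> U \<and> Pt ` (U \<inter> C - J) \<subseteq> S \<inter> T"
    proof (intro exI conjI)
      show "openin X (U \<inter> U')"
        using U(1) U'(1) by (rule openin_Int)
      show "x \<in> U \<inter> U'"
        using U(2) U'(2) by (rule IntI)
      show "Pt ` (U \<inter> U' \<inter> C - J) \<subseteq> S \<inter> T"
      proof (rule image_subsetI)
        fix y
        assume "y \<in> U \<inter> U' \<inter> C - J"
        then have "y \<in> U \<inter> C - J" "y \<in> U' \<inter> C - J"
          by simp_all
        then show "Pt y \<in> S \<inter> T"
          using subsetD[OF U(3), OF imageI] subsetD[OF U'(3), OF imageI] by (intro IntI)
      qed
    qed
  qed
next
  fix \<K>
  assume "\<forall>W\<in>\<K>. blow_up_open X J W"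
  then have K: "blow_up_open X J W" if "W \<in> \<K>" for W
    using that by (rule bspec)
  show "blow_up_open X J (\<Union>\<K>)"
  proof (rule blow_up_openI)
    show "\<Union>\<K> \<subseteq> blow_up_points X J"
      using blow_up_openD(1)[OF K] by (rule Union_least)
    have "{y. Pt y \<in> \<Union>\<K>} = (\<Union>W\<in>\<K>. {y. Pt y \<in> W})"
      by (rule set_eqI) simp
    moreover have "openin (subtopology X (topspace X - J)) (\<Union>W\<in>\<K>. {y. Pt y \<in> W})"
    proof (rule openin_Union)
      fix Z
      assume "Z \<in> (\<lambda>W. {y. Pt y \<in> W}) ` \<K>"
      then obtain W where "Z = {y. Pt y \<in> W}" "W \<in> \<K>"
        by (rule imageE)
      then show "openin (subtopology X (topspace X - J)) Z"
        using blow_up_openD(2)[OF K] by (simp only:)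
    qed
    ultimately show "openin (subtopology X (topspace X - J)) {y. Pt y \<in> \<Union>\<K>}"
      by (simp only:)
  next
    fix x C
    assume "End x C \<in> \<Union>\<K>"
    then obtain W where W: "W \<in> \<K>" "End x C \<in> W"
      by (rule UnionE)
    obtain U where U: "openin X U" "x \<in> U" "Pt ` (U \<inter> C - J) \<subseteq> W"
      using blow_up_openD(3)[OF K[OF W(1)] W(2)] by (elim exE conjE)
    show "\<exists>U. openin X U \<and> x \<in> U \<and> Pt ` (U \<inter> C - J) \<subseteq> \<Union>\<K>"
      by (intro exI[of _ U] conjI U(1,2) order_trans[OF U(3) Union_upper[OF W(1)]])
  qed
qed

lemma openin_blow_up: "openin (blow_up X J) W \<longleftrightarrow> blow_up_open X J W"
  by (simp add: blow_up_def istopology_blow_up_open)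

lemma topspace_blow_up [simp]: "topspace (blow_up X J) = blow_up_points X J"
proof (rule subset_antisym)
  show "topspace (blow_up X J) \<subseteq> blow_up_points X J"
    by (rule blow_up_openD(1)) (rule openin_topspace[of "blow_up X J", unfolded openin_blow_up])
  have "{y. Pt y \<in> blow_up_points X J} = topspace (subtopology X (topspace X - J))"
    by (auto simp: blow_up_points_def)
  then have 1: "openin (subtopology X (topspace X - J)) {y. Pt y \<in> blow_up_points X J}"
    by (metis openin_topspace)
  have 2: "\<exists>U. openin X U \<and> x \<in> U \<and> Pt ` (U \<inter> C - J) \<subseteq> blow_up_points X J"
    if "End x C \<in> blow_up_points X J" for x C
  proof (intro exI conjI)
    show "openin X (topspace X)"
      by (rule openin_topspace)
    show "x \<in> topspace X" "Pt ` (topspace X \<inter> C - J) \<subseteq> blow_up_points X J"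
      using that by (auto simp: blow_up_points_def)
  qed
  have "openin (blow_up X J) (blow_up_points X J)"
    unfolding openin_blow_up blow_up_open_def using 1 2 by simp
  then show "blow_up_points X J \<subseteq> topspace (blow_up X J)"
    by (rule openin_subset)
qed

text \<open>The blow-down map to the blow-up at \<open>J\<close> from the blow-up at any larger finite set.\<close>

fun blow_down :: "'a set \<Rightarrow> 'a blow_up_point \<Rightarrow> 'a blow_up_point" where
  "blow_down J (Pt y) = Pt y"
| "blow_down J (End x C) = (if x \<in> J then End x C else Pt x)"


section \<open>Labelled trees\<close>

text \<open>Graphs are given by a vertex set and a set of unoriented edges \<open>{s, t}\<close>.\<close>

definition path_in :: "'v set set \<Rightarrow> 'v \<Rightarrow> 'v list \<Rightarrow> 'v \<Rightarrow> bool" where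
  "path_in E s p t \<longleftrightarrow>
     p \<noteq> [] \<and> distinct p \<and> successively (\<lambda>u v. {u, v} \<in> E) p \<and> hd p = s \<and> last p = t"

definition is_tree :: "'v set \<Rightarrow> 'v set set \<Rightarrow> bool" where
  "is_tree V E \<longleftrightarrow>
     V \<noteq> {} \<and>
     (\<forall>e\<in>E. \<exists>s\<in>V. \<exists>t\<in>V. s \<noteq> t \<and> e = {s, t}) \<and>
     (\<forall>s\<in>V. \<forall>t\<in>V. \<exists>p. path_in E s p t) \<and>
     \<not> (\<exists>s p t. path_in E s p t \<and> 3 \<le> length p \<and> {s, t} \<in> E)"

text \<open>The bijections below also make every vertex of the tree have valence \<open>|D|\<close>.\<close>

definition reflection_data ::
  "'a topology \<Rightarrow> 'a set \<Rightarrow> 'v set \<Rightarrow> 'v set set \<Rightarrow> ('v set \<Rightarrow> 'a) \<Rightarrow> bool" where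
  "reflection_data X D V E lab \<longleftrightarrow>
     countable D \<and> D \<subseteq> topspace X \<and> X closure_of D = topspace X \<and>
     essential_vertices X \<subseteq> D \<and>
     is_tree V E \<and>
     (\<forall>t\<in>V. bij_betw lab {e \<in> E. t \<in> e} D)"

text \<open>
  A subtree of a tree contains every edge of the tree joining two of its vertices, so a finite
  subtree is represented by its vertex set \<open>F\<close>.
\<close>

definition edges_of :: "'v set set \<Rightarrow> 'v set \<Rightarrow> 'v set set" where
  "edges_of E F = {e \<in> E. e \<subseteq> F}"

definition finite_subtrees :: "'v set \<Rightarrow> 'v set set \<Rightarrow> 'v set set" where
  "finite_subtrees V E = {F. F \<subseteq> V \<and> finite F \<and> is_tree F (edges_of E F)}"

definition adjacent_edges :: "'v set set \<Rightarrow> 'v set \<Rightarrow> 'v \<Rightarrow> 'v set set" where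
  "adjacent_edges E F t = {e \<in> edges_of E F. t \<in> e}"

definition tree_path :: "'v set set \<Rightarrow> 'v \<Rightarrow> 'v \<Rightarrow> 'v list" where
  "tree_path E s t = (THE p. path_in E s p t)"

definition closest_vertex :: "'v set set \<Rightarrow> 'v set \<Rightarrow> 'v \<Rightarrow> 'v" where
  "closest_vertex E F t = arg_min (\<lambda>s. length (tree_path E s t)) (\<lambda>s. s \<in> F)"

definition first_edge :: "'v set set \<Rightarrow> 'v \<Rightarrow> 'v \<Rightarrow> 'v set" where
  "first_edge E s t = {tree_path E s t ! 0, tree_path E s t ! 1}"


section \<open>The reflection tree of graphs\<close>

definition quotient_topology :: "'a topology \<Rightarrow> ('a \<times> 'a) set \<Rightarrow> 'a set topology" where
  "quotient_topology X r =
     topology (\<lambda>U. U \<subseteq> topspace X // r \<and> openin X {x \<in> topspace X. r `` {x} \<in> U})"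

lemma openin_quotient_topology:
  "openin (quotient_topology X r) U \<longleftrightarrow>
     U \<subseteq> topspace X // r \<and> openin X {x \<in> topspace X. r `` {x} \<in> U}"
proof -
  have 1: "{x \<in> topspace X. r `` {x} \<in> S \<inter> T} =
      {x \<in> topspace X. r `` {x} \<in> S} \<inter> {x \<in> topspace X. r `` {x} \<in> T}" for S T
    by auto
  have 2: "{x \<in> topspace X. r `` {x} \<in> \<Union>\<K>} = (\<Union>K\<in>\<K>. {x \<in> topspace X. r `` {x} \<in> K})" for \<K>
    by auto
  have "istopology (\<lambda>U. U \<subseteq> topspace X // r \<and> openin X {x \<in> topspace X. r `` {x} \<in> U})"
    unfolding istopology_def
  proof (intro conjI allI impI)
    fix S T
    assume "S \<subseteq> topspace X // r \<and> openin X {x \<in> topspace X. r `` {x} \<in> S}"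
      and "T \<subseteq> topspace X // r \<and> openin X {x \<in> topspace X. r `` {x} \<in> T}"
    then show "S \<inter> T \<subseteq> topspace X // r" "openin X {x \<in> topspace X. r `` {x} \<in> S \<inter> T}"
      unfolding 1 by (simp_all only: le_infI1 openin_Int)
  next
    fix \<K>
    assume *: "\<forall>K\<in>\<K>. K \<subseteq> topspace X // r \<and> openin X {x \<in> topspace X. r `` {x} \<in> K}"
    then show "\<Union>\<K> \<subseteq> topspace X // r"
      by (simp add: Sup_le_iff)
    show "openin X {x \<in> topspace X. r `` {x} \<in> \<Union>\<K>}"
      unfolding 2
    proof (rule openin_Union)
      fix Z
      assume "Z \<in> (\<lambda>K. {x \<in> topspace X. r `` {x} \<in> K}) ` \<K>"
      then obtain K where "K \<in> \<K>" "Z = {x \<in> topspace X. r `` {x} \<in> K}"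
        by (rule imageE)
      then show "openin X Z"
        using * by simp
    qed
  qed
  then show ?thesis
    by (simp add: quotient_topology_def)
qed

lemma quotient_map_quotient_topology:
  "quotient_map X (quotient_topology X r) (\<lambda>x. r `` {x})"
proof -
  have "{x \<in> topspace X. r `` {x} \<in> topspace X // r} = topspace X"
    by (auto simp: quotient_def)
  then have "openin (quotient_topology X r) (topspace X // r)"
    by (simp add: openin_quotient_topology)
  then have "topspace X // r \<subseteq> topspace (quotient_topology X r)"
    by (rule openin_subset)
  moreover have "topspace (quotient_topology X r) \<subseteq> topspace X // r"
    using openin_topspace[of "quotient_topology X r"] unfolding openin_quotient_topology by simp
  ultimately have top: "topspace (quotient_topology X r) = topspace X // r"
    by simp
  have "(\<lambda>x. r `` {x}) ` topspace X = topspace X // r"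
    by (auto simp: quotient_def)
  then show ?thesis
    by (simp add: quotient_map_def openin_quotient_topology top)
qed

definition inverse_limit ::
  "'i set \<Rightarrow> ('i \<Rightarrow> 'i \<Rightarrow> bool) \<Rightarrow> ('i \<Rightarrow> 'p topology) \<Rightarrow> ('i \<Rightarrow> 'i \<Rightarrow> 'p \<Rightarrow> 'p) \<Rightarrow> ('i \<Rightarrow> 'p) topology"
  where
  "inverse_limit I le X f =
     subtopology (product_topology X I)
       {x. \<forall>i\<in>I. \<forall>j\<in>I. le i j \<longrightarrow> f j i (x j) = x i}"

context
  fixes X :: "'a topology" and E :: "'v set set" and lab :: "'v set \<Rightarrow> 'a"
begin

definition pieces :: "'v set \<Rightarrow> ('v \<times> 'a blow_up_point) topology" where
  "pieces F = sum_topology (\<lambda>t. blow_up X (lab ` adjacent_edges E F t)) F"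

text \<open>
  For a labelling which is injective around each vertex, at most two points of \<open>pieces F\<close> get
  identified at a time, so this relation is already transitive.
\<close>

definition gluing :: "'v set \<Rightarrow> (('v \<times> 'a blow_up_point) \<times> ('v \<times> 'a blow_up_point)) set" where
  "gluing F =
     Id_on (topspace (pieces F)) \<union>
     {((t1, End (lab e) C), (t2, End (lab e) C)) | t1 t2 e C.
        e \<in> edges_of E F \<and> e = {t1, t2} \<and> t1 \<noteq> t2 \<and> C \<in> branches X (lab e)}"

definition stage :: "'v set \<Rightarrow> ('v \<times> 'a blow_up_point) set topology" where
  "stage F = quotient_topology (pieces F) (gluing F)"

definition collapse :: "'v set \<Rightarrow> 'v \<times> 'a blow_up_point \<Rightarrow> 'v \<times> 'a blow_up_point" where
  "collapse F z =
     (case z of (t, q) \<Rightarrow>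
        if t \<in> F then (t, blow_down (lab ` adjacent_edges E F t) q)
        else (let s = closest_vertex E F t in (s, Pt (lab (first_edge E s t)))))"

text \<open>
  Points of \<open>stage F'\<close> are equivalence classes \<open>c\<close>; all elements of \<open>c\<close> collapse to the same
  class of \<open>stage F\<close>.
\<close>

definition bonding :: "'v set \<Rightarrow> 'v set \<Rightarrow> ('v \<times> 'a blow_up_point) set \<Rightarrow> ('v \<times> 'a blow_up_point) set"
  where
  "bonding F' F c = gluing F `` (collapse F ` c)"

end

definition reflection_tree ::
  "'a topology \<Rightarrow> 'v set \<Rightarrow> 'v set set \<Rightarrow> ('v set \<Rightarrow> 'a) \<Rightarrow> ('v set \<Rightarrow> ('v \<times> 'a blow_up_point) set) topology"
  where
  "reflection_tree X V E lab =
     inverse_limit (finite_subtrees V E) (\<subseteq>) (stage X E lab) (bonding X E lab)"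


section \<open>Dense amalgams\<close>

definition cantor_space :: "(nat \<Rightarrow> bool) topology" where
  "cantor_space = product_topology (\<lambda>_. discrete_topology UNIV) UNIV"

text \<open>
  A family is null if for each \<open>\<epsilon> > 0\<close> only finitely many of its members have
  diameter greater than \<open>\<epsilon>\<close>, with respect to any compatible metric.
\<close>

definition null_family :: "'a topology \<Rightarrow> 'a set set \<Rightarrow> bool" where
  "null_family A \<S> \<longleftrightarrow>
     (\<forall>d. Metric_space (topspace A) d \<and> Metric_space.mtopology (topspace A) d = A \<longrightarrow>
        (\<forall>\<epsilon>>0. finite {S \<in> \<S>. \<exists>x\<in>S. \<exists>y\<in>S. d x y > \<epsilon>}))"

definition dense_amalgam_family ::
  "'c topology \<Rightarrow> nat set \<Rightarrow> (nat \<Rightarrow> 'b topology) \<Rightarrow> (nat \<Rightarrow> 'c set set) \<Rightarrow> bool" where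
  "dense_amalgam_family A I B \<A> \<longleftrightarrow>
     countable (\<Union>i\<in>I. \<A> i) \<and> infinite (\<Union>i\<in>I. \<A> i) \<and> disjoint_family_on \<A> I \<and>
     disjoint (\<Union>i\<in>I. \<A> i) \<and>
     (\<forall>i\<in>I. \<forall>S\<in>\<A> i. S \<subseteq> topspace A \<and> subtopology A S homeomorphic_space B i) \<and>
     null_family A (\<Union>i\<in>I. \<A> i) \<and>
     (\<forall>S \<in> (\<Union>i\<in>I. \<A> i). A closure_of (topspace A - S) = topspace A) \<and>
     (\<forall>i\<in>I. A closure_of (\<Union>(\<A> i)) = topspace A) \<and>
     (\<forall>x \<in> topspace A. \<forall>y \<in> topspace A.
        x \<noteq> y \<and> \<not> (\<exists>S \<in> (\<Union>i\<in>I. \<A> i). x \<in> S \<and> y \<in> S) \<longrightarrow>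
        (\<exists>H. openin A H \<and> closedin A H \<and> x \<in> H \<and> y \<notin> H \<and>
             (\<forall>S \<in> (\<Union>i\<in>I. \<A> i). S \<subseteq> H \<or> S \<inter> H = {})))"

text \<open>
  \<open>is_dense_amalgam k B A\<close> says that \<open>A\<close> is, up to homeomorphism, the dense amalgam of the metric
  compacta \<open>B 0, \<dots>, B (k - 1)\<close>. By convention empty spaces are discarded, and the dense amalgam
  of the family with no members (left) is the Cantor set.
\<close>

definition is_dense_amalgam :: "nat \<Rightarrow> (nat \<Rightarrow> 'b topology) \<Rightarrow> 'c topology \<Rightarrow> bool" where
  "is_dense_amalgam k B A \<longleftrightarrow>
     (\<forall>i<k. compact_space (B i) \<and> metrizable_space (B i)) \<and>
     compact_space A \<and> metrizable_space A \<and>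
     (let I = {i. i < k \<and> topspace (B i) \<noteq> {}} in
        if I = {} then A homeomorphic_space cantor_space
        else \<exists>\<A>. dense_amalgam_family A I B \<A>)"

end

theory Submission
 imports Defs
begin

text \<open>
  Choosing a base vertex identifies the vertices of the tree with the reduced words over \<open>D\<close>, and a
  point of the reflection tree amounts to a family \<open>p\<close> of projections to the copies of \<open>X\<close>, coherent in
  the sense that for adjacent words \<open>w\<close>, \<open>nbr w x\<close> at least one of the two projections is \<open>x\<close>, together
  with a branch at \<open>x\<close> if both are. The blocks are the maximal closed connected sets \<open>S\<close> without cut
  points. The points whose projections, along the subtree of labels in \<open>S\<close> through the vertex \<open>t\<close>, stay in
  \<open>S\<close> form a copy of the reflection tree of \<open>S\<close>; these sets \<open>member t S\<close> are the members of the amalgam.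

  If \<open>x \<in> D\<close> cuts \<open>X\<close> into \<open>K\<close> and \<open>L\<close>, then for every edge labelled \<open>x\<close> the points lying on the side of
  \<open>K\<close> form a clopen set that is saturated for the members, and two points not separated in this way lie in
  one member, because two points of \<open>X\<close> which are not separated by a point of \<open>D\<close> lie in one block. If \<open>X\<close>
  were itself a block, its reflection tree would be connected; so each block is a proper subset, and density
  follows since every nonempty open set contains a full fibre of some projection over a point of \<open>D\<close>. The
  reflection tree of \<open>S\<close> does not depend on the dense set by a back-and-forth argument on the edges. Without
  blocks, Brouwer's characterization yields the Cantor set.
\<close>

section \<open>Reduced words\<close>

text \<open>The reduced words are the elements of the free product of copies of Z/2 indexed by
  \<open>D\<close>, and the tree is the Cayley graph of this group. The group acts on the model, so
  that it suffices to study one copy of each member. Two obstacles shape the proof. The inverse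
  limit consists of threads of equivalence classes; therefore all topology is done in the coordinate
  model, a compact space whose points have three kinds: some projection lies outside
  \<open>D\<close>, or an edge is central, or the point is an end of the tree. The shadows of the
  edges shrink to the ends. Secondly, blocks are defined through essential vertices, whereas the
  clopen separations use every point of \<open>D\<close>, essential or not. Sets without any cut
  point treat all points alike, and the two notions differ only by arcs, points and the empty set,
  since a non-separable graph with a cut point is an arc. A block containing two unseparated points
  is found along an arc between them: each interior point of the arc in \<open>D\<close> can be
  bypassed, the detour closes up to a circle, and the blocks of these circles fit together along the
  arc.\<close>

definition words :: "'a set => 'a list set" where
 "words D = {w. set w <= D & distinct_adj w}"

text \<open>Words grow at the head: the last letter is the step nearest to the base vertex, and
  \<open>tl w\<close> is the neighbour of \<open>w\<close> towards the base.\<close>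

definition nbr :: "'a list => 'a => 'a list" where
 "nbr w x = (if w ~= [] & hd w = x then tl w else x # w)"

text \<open>Group multiplication read as a walk: start at \<open>r\<close> and follow the letters of
  \<open>w\<close>, the last one first. For fixed \<open>r\<close> this is the label-preserving
  automorphism of the tree that sends the empty word to \<open>r\<close>; its inverse belongs to
  \<open>rev r\<close>.\<close>

fun act :: "'a list => 'a list => 'a list" where
 "act r [] = r"
| "act r (x # w) = nbr (act r w) x"

lemma words_Nil [simp]: "[]:words D"
 by (simp add: words_def)

lemma words_Cons: "x # w:words D \<longleftrightarrow> x:D & w:words D & (w = [] | hd w ~= x)"
 by (cases w) (auto simp: words_def)

lemma words_append1: "u @ v:words D ==> u:words D"
 by (auto simp: words_def distinct_adj_append_iff)

lemma words_append2: "u @ v:words D ==> v:words D"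
 by (auto simp: words_def distinct_adj_append_iff)

lemma words_rev [simp]: "rev w:words D \<longleftrightarrow> w:words D"
 by (simp add: words_def)

lemma words_mono: "A <= B ==> words A <= words B"
 by (auto simp: words_def)

lemma nbr_words [simp]: "w:words D ==> x:D ==> nbr w x:words D"
 by (cases w) (auto simp: nbr_def words_Cons)

lemma nbr_Cons: "x # w:words D ==> nbr w x = x # w"
 by (auto simp: nbr_def words_Cons)

lemma nbr_Cons_same [simp]: "nbr (x # w) x = w"
 by (simp add: nbr_def)

lemma nbr_nbr [simp]: "w:words D ==> nbr (nbr w x) x = w"
 by (cases w) (auto simp: nbr_def words_Cons)

lemma nbr_neq [simp]: "nbr w x ~= w"
 by (cases w) (auto simp: nbr_def)

lemma act_words [simp]: "r:words D ==> set w <= D ==> act r w:words D"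
 by (induction w) auto

lemma act_words' [simp]: "r:words D ==> w:words D ==> act r w:words D"
 by (rule act_words) (auto simp: words_def)

lemma act_Nil [simp]: "w:words D ==> act [] w = w"
proof (induction w)
 case (Cons x w)
 then have "w:words D" by (simp add: words_Cons)
 then show ?case using Cons nbr_Cons[of x w D] by simp
qed simp

lemma act_append: "act r (u @ v) = act (act r v) u"
 by (induction u) auto

lemma act_nbr: "r:words D ==> w:words D ==> x:D ==> act r (nbr w x) = nbr (act r w) x"
proof (cases w)
 case (Cons y v)
 assume *: "r:words D" "w:words D" "x:D"
 then have "act r v:words D" using Cons by (simp add: words_Cons)
 then show ?thesis using Cons by (auto simp: nbr_def[of "y # v"])
qed (simp add: nbr_def)

lemma act_assoc: "s:words D ==> r:words D ==> w:words D ==> act s (act r w) = act (act s r) w"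
proof (induction w)
 case (Cons x w)
 then have "w:words D" "x:D" by (auto simp: words_Cons)
 then show ?case using Cons act_nbr[of s D "act r w" x] by simp
qed simp

lemma act_rev [simp]: "w:words D ==> act w (rev w) = []"
 by (induction w) (auto simp: act_append words_Cons)

lemma act_rev' [simp]: "w:words D ==> act (rev w) w = []"
 using act_rev[of "rev w" D] by simp

lemma act_act_rev: "r:words D ==> u:words D ==> act r (act (rev r) u) = u"
 by (subst act_assoc[of _ D]) auto

lemma act_rev_act: "r:words D ==> u:words D ==> act (rev r) (act r u) = u"
 by (subst act_assoc[of _ D]) auto

lemma act_surj: "r:words D ==> u:words D ==> EX v:words D. u = act r v"
 by (metis act_act_rev act_words' words_rev)

lemma countable_words: "countable D ==> countable (words D)"
 by (rule countable_subset[of _ "lists D"]) (auto simp: words_def)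


section \<open>Normal neighbourhoods\<close>

abbreviation emb :: "real set => 'a topology => (real => 'a) => bool" where
 "emb A \<equiv> embedding_map (top_of_set A)"

text \<open>The condition on a branch in \<open>normal_neighbourhood\<close>, phrased through an
  embedding so that rays can be restricted, reparametrised and composed; \<open>ray_iff\<close>
  compares the two forms.\<close>

definition ray :: "'a topology => 'a => 'a set => (real => 'a) => bool" where
 "ray X x C h \<longleftrightarrow> emb {0..<1} X h & h 0 = x & h ` {0<..<1} = C"

lemma embedding_map_affine:
 fixes a s :: real
 assumes "a ~= 0" "(%t. s + a * t) ` A <= B"
 shows "emb A (top_of_set B) (%t. s + a * t)"
proof -
 have eq: "B Int (%t. s + a * t) ` A = (%t. s + a * t) ` A" using assms by blast
 have "homeomorphic_maps (top_of_set A) (top_of_set ((%t. s + a * t) ` A)) (%t. s + a * t) (%u. (u - s) / a)"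
  unfolding homeomorphic_maps_def using assms(1) by (auto simp: image_iff intro!: continuous_intros)
 then show ?thesis unfolding embedding_map_def homeomorphic_map_maps by (auto simp: subtopology_subtopology eq)
qed

lemma
 assumes "emb A X h"
 shows embedding_cont: "continuous_map (top_of_set A) X h"
  and embedding_inj: "inj_on h A"
  and embedding_into: "h ` A <= topspace X"
  and embedding_openin: "openin (top_of_set A) I ==> openin (subtopology X (h ` A)) (h ` I)"
proof -
 have hm: "homeomorphic_map (top_of_set A) (subtopology X (h ` A)) h" using assms by (simp add: embedding_map_def)
 show c: "continuous_map (top_of_set A) X h"
  using homeomorphic_imp_continuous_map[OF hm] by (simp add: continuous_map_in_subtopology)
 show "inj_on h A" using homeomorphic_imp_injective_map[OF hm] by simp
 show "h ` A <= topspace X" using continuous_map_image_subset_topspace[OF c] by simp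
 show "openin (subtopology X (h ` A)) (h ` I)" if "openin (top_of_set A) I"
  using homeomorphic_imp_open_map[OF hm] that by (simp add: open_map_def)
qed

lemma embedding_map_restrict:
 assumes "emb A X h" "B <= A"
 shows "emb B X h"
proof -
 have hm: "homeomorphic_map (top_of_set A) (subtopology X (h ` A)) h" using assms by (simp add: embedding_map_def)
 have "homeomorphic_map (subtopology (top_of_set A) B) (subtopology (subtopology X (h ` A)) (h ` B)) h"
 proof (rule homeomorphic_map_subtopologies[OF hm])
  show "h ` (topspace (top_of_set A) Int B) = topspace (subtopology X (h ` A)) Int h ` B"
   using assms(2) embedding_into[OF assms(1)] by auto
 qed
 moreover have "A Int B = B" "h ` A Int h ` B = h ` B" using assms(2) by auto
 ultimately show ?thesis by (simp add: embedding_map_def subtopology_subtopology)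
qed

lemma embedding_connected:
 assumes "emb A X h" "I <= A" "connected I"
 shows "connectedin X (h ` I)" using connectedin_continuous_map_image[OF embedding_cont[OF assms(1)]] assms(2,3)
 by (simp add: connectedin_subtopology)

lemma embedding_compact:
 assumes "emb A X h" "I <= A" "compact I"
 shows "compactin X (h ` I)" using image_compactin[OF _ embedding_cont[OF assms(1)]] assms(2,3)
 by (simp add: compactin_subtopology)

lemma ray_small:
 assumes "ray X x C h" "openin X U" "x:U"
 shows "EX d. 0 < d & d <= 1 & h ` {0..<d} <= U"
proof -
 have "openin (top_of_set {0..<1::real}) {t:{0..<1}. h t:U}"
  using openin_continuous_map_preimage[OF embedding_cont[of "{0..<1}" X h] assms(2)] assms(1) by (simp add: ray_def)
 then obtain T where T: "open T" "{t:{0..<1::real}. h t:U} = {0..<1} Int T" unfolding openin_open by blast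
 have "0:{t:{0..<1}. h t:U}" using assms by (auto simp: ray_def)
 then have "0:T" using T(2) by blast
 then obtain e where e: "e > 0" "ball 0 e <= T" using openE[OF T(1)] by blast
 have "h ` {0..<min e 1} <= U"
 proof
  fix y assume "y:h ` {0..<min e 1}"
  then obtain t where t: "t:{0..<min e 1}" "y = h t" by blast
  then have "t:{0..<1} Int T" using e(2) by (auto simp: subset_iff)
  then have "t:{t:{0..<1::real}. h t:U}" using T(2) by blast
  then show "y:U" using t by simp
 qed
 then show ?thesis using e(1) by (intro exI[of _ "min e 1"]) auto
qed

text \<open>Initial segments are relatively open in the ray because \<open>h\<close> is a
  homeomorphism onto its image. Together with \<open>ray_small\<close> this makes them a base for
  the germ of \<open>C\<close> at \<open>x\<close>.\<close>

lemma ray_germ: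
 assumes "ray X x C h" "0 < d"
 shows "EX U. openin X U & x:U & U Int C <= h ` ({0<..<d} Int {0<..<1})"
proof -
 have op: "openin (top_of_set {0..<1::real}) ({..<d} Int {0..<1})"
  unfolding openin_open by (intro exI[of _ "{..<d}"]) auto
 have "openin (subtopology X (h ` {0..<1})) (h ` ({..<d} Int {0..<1}))"
  by (rule embedding_openin[OF _ op]) (use assms(1) in \<open>auto simp: ray_def\<close>)
 then obtain U where U: "openin X U" "h ` ({..<d} Int {0..<1}) = U Int h ` {0..<1}" by (auto simp: openin_subtopology)
 have "x:h ` ({..<d} Int {0..<1})" using assms by (auto simp: ray_def image_iff intro!: bexI[of _ 0])
 then have "x:U" using U by auto
 moreover have "U Int C <= h ` ({0<..<d} Int {0<..<1})"
 proof
  fix y assume y: "y:U Int C"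
  then obtain t where t: "t:{0<..<1}" "y = h t" using assms(1) by (auto simp: ray_def)
  then have "y:h ` ({..<d} Int {0..<1})" using U(2) y by force
  then obtain t' where t': "t' < d" "t':{0..<1}" "y = h t'" by auto
  have "t = t'" using inj_onD[OF embedding_inj[of "{0..<1}" X h], of t t'] t t' assms(1) by (auto simp: ray_def)
  then show "y:h ` ({0<..<d} Int {0<..<1})" using t t' by auto
 qed
 ultimately show ?thesis using U(1) by blast
qed

lemma ray_notin: "ray X x C h ==> x ~: C"
 unfolding ray_def using embedding_inj[of "{0..<1}" X h] by (force dest: inj_onD)

lemma ray_image: "ray X x C h ==> h ` {0..<1} = insert x C"
proof -
 assume r: "ray X x C h"
 have e: "{0..<1::real} = insert 0 {0<..<1}" by auto
 show ?thesis using r unfolding e ray_def by simp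
qed

lemma ray_iff:
 assumes "x ~: C" "insert x C <= topspace X"
 shows "ray X x C h \<longleftrightarrow> homeomorphic_map (top_of_set {0..<1::real}) (subtopology X (insert x C)) h & h 0 = x"
proof
 assume "ray X x C h"
 then show "homeomorphic_map (top_of_set {0..<1::real}) (subtopology X (insert x C)) h & h 0 = x"
  using ray_image[of X x C h] by (auto simp: ray_def embedding_map_def)
next
 assume h: "homeomorphic_map (top_of_set {0..<1::real}) (subtopology X (insert x C)) h & h 0 = x"
 then have im: "h ` {0..<1} = insert x C" using homeomorphic_imp_surjective_map[of _ _ h] assms(2) by fastforce
 have inj: "inj_on h {0..<1}" using h homeomorphic_imp_injective_map[of _ _ h] by fastforce
 have "h ` {0<..<1} = C"
 proof -
  have "h ` {0<..<1} = h ` ({0..<1} - {0})" by (rule arg_cong[where f="image h"]) auto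
  also have "\<dots> = h ` {0..<1} - h ` {0}" by (rule inj_on_image_set_diff[OF inj]) auto
  also have "\<dots> = C" using im h assms(1) by auto
  finally show ?thesis .
 qed
 then show "ray X x C h" using h im by (auto simp: ray_def embedding_map_def)
qed

lemma ray_reparam:
 assumes "emb A X h" "a ~= 0" "(%t. s + a * t) ` {0..<1} <= A"
 shows "ray X (h s) (h ` (%t. s + a * t) ` {0<..<1}) (%t. h (s + a * t))"
 unfolding ray_def using embedding_map_compose[OF embedding_map_affine[OF assms(2,3)] assms(1)]
 by (auto simp: o_def image_image)

text \<open>The union of the other members is open as well, so a connected set that meets a member
  cannot leave it.\<close>

lemma components_eqI:
 assumes "\<Union>\<A> = topspace Z" "disjoint \<A>" "!!A. A:\<A> ==> openin Z A"
  "!!A. A:\<A> ==> connectedin Z A" "{} ~: \<A>"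
 shows "connected_components_of Z = \<A>"
proof -
 have *: "C = A" if C: "C:connected_components_of Z" and A: "A:\<A>" "A Int C ~= {}" for C A
 proof -
  have "A <= C" using connected_components_of_maximal[OF C assms(4)[OF A(1)]] A(2) by (auto simp: disjnt_def)
  moreover have "C <= A"
  proof (rule ccontr)
   assume n: "~ C <= A"
   have "openin Z (\<Union>(\<A> - {A}))" using assms(3) by blast
   moreover have "C <= A Un \<Union>(\<A> - {A})" using connected_components_of_subset[OF C] assms(1) by auto
   moreover have "A Int \<Union>(\<A> - {A}) = {}" using assms(2) A(1) by (auto simp: disjoint_def)
   moreover have "\<Union>(\<A> - {A}) Int C ~= {}" using n calculation by blast
   ultimately show False
    using connectedinD[OF connectedin_connected_components_of[OF C] assms(3)[OF A(1)], of "\<Union>(\<A> - {A})"] A(2)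
    by blast
  qed
  ultimately show ?thesis by simp
 qed
 show ?thesis
 proof (intro set_eqI iffI)
  fix C assume C: "C:connected_components_of Z"
  then obtain y where y: "y:C" using nonempty_connected_components_of by fastforce
  then obtain A where "A:\<A>" "y:A" using assms(1) connected_components_of_subset[OF C] by auto
  then show "C:\<A>" using *[OF C, of A] y by blast
 next
  fix A assume A: "A:\<A>"
  then obtain y where y: "y:A" using assms(5) by fastforce
  then have "y:\<Union>(connected_components_of Z)" using assms(1) A by (auto simp: Union_connected_components_of)
  then obtain C where C: "C:connected_components_of Z" "y:C" by blast
  then have "C = A" using *[OF C(1) A] y by blast
  then show "A:connected_components_of Z" using C by simp
 qed
qed

text \<open>The criterion by which all concrete normal neighbourhoods are produced; it also
  identifies their components with the given branches.\<close>

lemma normal_neighbourhoodI: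
 assumes "openin X N" "x:N" "finite \<C>" "\<Union>\<C> = N - {x}" "disjoint \<C>"
  and "!!C. C:\<C> ==> openin X C" "!!C. C:\<C> ==> EX h. ray X x C h"
 shows "normal_neighbourhood X x N" "punctured_components X x N = \<C>"
proof -
 have sub: "N <= topspace X" using assms(1) by (rule openin_subset)
 show *: "punctured_components X x N = \<C>" unfolding punctured_components_def
 proof (rule components_eqI)
  show "\<Union>\<C> = topspace (subtopology X (N - {x}))" unfolding assms(4) using sub by auto
  show "openin (subtopology X (N - {x})) A" if "A:\<C>" for A
   using assms(6)[OF that] that assms(4) by (auto simp: openin_subtopology intro!: exI[of _ A])
  show "connectedin (subtopology X (N - {x})) A" if A: "A:\<C>" for A
  proof -
   obtain h where h: "ray X x A h" using assms(7)[OF A] ..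
   then have "connectedin X (h ` {0<..<1})" by (intro embedding_connected[of "{0..<1}"]) (auto simp: ray_def)
   then show ?thesis using h A assms(4) by (auto simp: ray_def connectedin_subtopology)
  qed
  show "{} ~: \<C>"
  proof
   assume "{}:\<C>"
   then obtain h where h: "ray X x {} h" using assms(7) by blast
   then have "h (1/2):h ` {0<..<1}" by (intro imageI) simp
   then show False using h by (simp add: ray_def)
  qed
 qed (use assms in auto)
 have "EX h. homeomorphic_map (top_of_set {0..<1::real}) (subtopology X (insert x C)) h & h 0 = x"
  if C: "C:\<C>" for C
 proof -
  obtain h where h: "ray X x C h" using assms(7)[OF C] ..
  have "insert x C <= topspace X" using embedding_into[of "{0..<1}" X h] ray_image[OF h] h by (auto simp: ray_def)
  then show ?thesis using h ray_iff[of x C X h] ray_notin[OF h] by auto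
 qed
 then show "normal_neighbourhood X x N" unfolding normal_neighbourhood_def * using assms by auto
qed

locale nnbhd =
 fixes X :: "'a topology" and x N
 assumes Haus: "Hausdorff_space X" and nn: "normal_neighbourhood X x N"
begin

abbreviation "\<C> \<equiv> punctured_components X x N"

lemma N_open: "openin X N" and x_in: "x:N" and fin: "finite \<C>"
 using nn by (auto simp: normal_neighbourhood_def)

lemma N_sub: "N <= topspace X"
 using N_open openin_subset by blast

lemma x_top: "x:topspace X"
 using N_sub x_in by auto

lemma Nx_open: "openin X (N - {x})"
 by (meson Haus Hausdorff_imp_t1_space N_open closedin_t1_singleton openin_diff x_top)

lemma Union_C: "\<Union>\<C> = N - {x}"
 using N_sub by (auto simp: punctured_components_def Union_connected_components_of)

lemma N_eq: "N = insert x (\<Union>\<C>)"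
 using Union_C x_in by auto

lemma C_sub: "C:\<C> ==> C <= N - {x}"
 using Union_C by auto

lemma x_notin: "C:\<C> ==> x ~: C"
 using C_sub by auto

lemma C_top: "C:\<C> ==> C <= topspace X"
 using C_sub N_sub by auto

lemma C_nonempty: "C:\<C> ==> C ~= {}"
 using nonempty_connected_components_of by (auto simp: punctured_components_def)

lemma C_conn: "C:\<C> ==> connectedin X C"
 using connectedin_connected_components_of[of C "subtopology X (N - {x})"]
 by (simp add: punctured_components_def connectedin_subtopology)

lemma C_disj: "disjoint \<C>"
 using pairwise_disjoint_connected_components_of[of "subtopology X (N - {x})"]
 by (simp add: punctured_components_def disjoint_def pairwise_def disjnt_def)

lemma C_disjD: "C:\<C> ==> C':\<C> ==> y:C ==> y:C' ==> C = C'"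
 using C_disj by (auto simp: disjoint_def)

text \<open>Components are closed, and the union of the finitely many others is the complement of
  \<open>C\<close> in the open set \<open>N - {x}\<close>.\<close>

lemma C_open: "C:\<C> ==> openin X C"
proof -
 assume C: "C:\<C>"
 have fin': "finite (\<C> - {C})" using fin by simp
 have "closedin (subtopology X (N - {x})) (\<Union>(\<C> - {C}))"
  using fin' by (intro closedin_Union) (auto simp: punctured_components_def closedin_connected_components_of)
 then have "openin (subtopology X (N - {x})) (topspace (subtopology X (N - {x})) - \<Union>(\<C> - {C}))" by blast
 moreover have "topspace (subtopology X (N - {x})) = \<Union>\<C>" unfolding Union_C using N_sub by auto
 moreover have "\<Union>\<C> - \<Union>(\<C> - {C}) = C"
 proof (intro set_eqI iffI)
  fix y assume y: "y:C"
  have "y ~: D" if D: "D:\<C> - {C}" for D using C_disjD[OF C _ y, of D] D by auto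
  then show "y:\<Union>\<C> - \<Union>(\<C> - {C})" using UnionI[OF C y] by simp
 next
  fix y assume y: "y:\<Union>\<C> - \<Union>(\<C> - {C})"
  then obtain D where "D:\<C>" "y:D" by (elim DiffE UnionE)
  then show "y:C" using y by (cases "D = C") simp_all
 qed
 ultimately have "openin (subtopology X (N - {x})) C" by simp
 then show ?thesis using openin_trans_full[OF _ Nx_open] by blast
qed

lemma C_ray: "C:\<C> ==> EX h. ray X x C h"
proof -
 assume C: "C:\<C>"
 then obtain h where "homeomorphic_map (top_of_set {0..<1::real}) (subtopology X (insert x C)) h & h 0 = x"
  using nn by (auto simp: normal_neighbourhood_def)
 then show ?thesis using ray_iff[of x C X h] x_notin[OF C] C_top[OF C] x_top by auto
qed

lemma maximal: "connectedin X T ==> T <= N - {x} ==> C:\<C> ==> T Int C ~= {} ==> T <= C"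
 using connected_components_of_maximal[of C "subtopology X (N - {x})" T]
 by (auto simp: punctured_components_def connectedin_subtopology disjnt_def)

lemma C_limit: "C:\<C> ==> openin X U ==> x:U ==> U Int C ~= {}"
proof -
 assume C: "C:\<C>" and U: "openin X U" "x:U"
 obtain h where h: "ray X x C h" using C_ray[OF C] ..
 obtain d where d: "0 < d" "d <= 1" "h ` {0..<d} <= U" using ray_small[OF h U] by auto
 then have "h (d/2):U" by auto
 moreover have "h (d/2):C" using h d unfolding ray_def by auto
 ultimately show ?thesis by auto
qed

text \<open>A short initial piece of the ray without \<open>x\<close> is connected and stays in
  \<open>N - {x}\<close>, hence in one component.\<close>

lemma germ_into:
 assumes "ray X x C h"
 shows "EX B:\<C>. EX U. openin X U & x:U & U Int C <= B & U Int C ~= {}"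
proof -
 obtain d where d: "0 < d" "d <= 1" "h ` {0..<d} <= N" using ray_small[OF assms N_open x_in] by auto
 have emb: "emb {0..<1} X h" using assms by (simp add: ray_def)
 have "connectedin X (h ` {0<..<d})" using d by (intro embedding_connected[OF emb]) auto
 moreover have sub: "h ` {0<..<d} <= N - {x}"
 proof
  fix y assume "y:h ` {0<..<d}"
  then obtain t where t: "0 < t" "t < d" "y = h t" by auto
  then have "y:N" using d(3) by (simp add: image_subset_iff)
  moreover have "y:C" using t d(2) assms unfolding ray_def by auto
  ultimately show "y:N - {x}" using ray_notin[OF assms] by blast
 qed
 moreover have hd: "h (d/2):h ` {0<..<d}" using d by auto
 moreover obtain B where B: "B:\<C>" "h (d/2):B"
 proof -
  have "h (d/2):\<Union>\<C>" unfolding Union_C using subsetD[OF sub hd] .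
  then show ?thesis using that by (elim UnionE)
 qed
 ultimately have B': "h ` {0<..<d} <= B" using maximal[OF _ _ B(1)] by blast
 obtain U where U: "openin X U" "x:U" "U Int C <= h ` ({0<..<d} Int {0<..<1})" using ray_germ[OF assms d(1)] by auto
 obtain d' where d': "0 < d'" "d' <= 1" "h ` {0..<d'} <= U" using ray_small[OF assms U(1,2)] by auto
 then have "h (d'/2):U Int C" using assms by (auto simp: ray_def)
 then have "U Int C ~= {}" by blast
 moreover have "U Int C <= B" using U(3) B' by (meson Int_lower1 image_mono order_trans)
 ultimately show ?thesis using U(1,2) by (intro bexI[OF _ B(1)] exI[of _ U] conjI)
qed

end

text \<open>
  Germs of branches do not depend on the normal neighbourhood, and those of a subgraph are among
  those of the whole space.
\<close>

lemma germ_bijection: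
 assumes "Hausdorff_space X" "normal_neighbourhood X x N"
  and S: "x:S" "S <= topspace X"
  and sat: "!!C. C:punctured_components X x N ==> C <= S | C Int S = {}"
  and N': "normal_neighbourhood (subtopology X S) x N'"
 obtains \<beta> where "bij_betw \<beta> (punctured_components (subtopology X S) x N') {C:punctured_components X x N. C <= S}"
  "!!B. B:punctured_components (subtopology X S) x N' ==> EX U. openin X U & x:U & U Int B = U Int \<beta> B"
proof -
 interpret A: nnbhd X x N using assms by unfold_locales
 interpret B: nnbhd "subtopology X S" x N' using assms by unfold_locales (auto simp: Hausdorff_space_subtopology)
 have rayS: "ray X x B h" if "ray (subtopology X S) x B h" for B h
  using that by (auto simp: ray_def embedding_map_in_subtopology)
 have *: "EX C:A.\<C>. C <= S & (EX U. openin X U & x:U & U Int B <= C)" if B: "B:B.\<C>" for B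
 proof -
  obtain h where "ray (subtopology X S) x B h" using B.C_ray[OF B] ..
  then have h: "ray X x B h" by (rule rayS)
  obtain C U where CU: "C:A.\<C>" "openin X U" "x:U" "U Int B <= C" "U Int B ~= {}" using A.germ_into[OF h] by auto
  moreover have "B <= S" using B.C_top[OF B] by auto
  ultimately have "C Int S ~= {}" by auto
  then show ?thesis using sat CU by blast
 qed
 have **: "EX B:B.\<C>. EX U. openin X U & x:U & U Int C <= B" if C: "C:A.\<C>" "C <= S" for C
 proof -
  obtain h where h: "ray X x C h" using A.C_ray[OF C(1)] ..
  have "h ` {0..<1} <= S" using ray_image[OF h] C S by auto
  then have "ray (subtopology X S) x C h" using h S by (auto simp: ray_def embedding_map_in_subtopology)
  then obtain B U where BU: "B:B.\<C>" "openin (subtopology X S) U" "x:U" "U Int C <= B" using B.germ_into by blast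
  then obtain U' where "openin X U'" "U = U' Int S" by (auto simp: openin_subtopology)
  then show ?thesis using BU C by (intro bexI[of _ B] exI[of _ U']) auto
 qed
 have ex: "EX C:A.\<C>. C <= S & (EX U. openin X U & x:U & U Int B = U Int C)" if B: "B:B.\<C>" for B
 proof -
  obtain C U where C: "C:A.\<C>" "C <= S" and U: "openin X U" "x:U" "U Int B <= C" using *[OF B] by auto
  obtain B' U' where B': "B':B.\<C>" and U': "openin X U'" "x:U'" "U' Int C <= B'" using **[OF C] by auto
  have op: "openin X (U Int U')" using U U' by auto
  then have "openin (subtopology X S) (U Int U' Int S)" by (auto simp: openin_subtopology)
  then have "U Int U' Int S Int B ~= {}" using B.C_limit[OF B] U U' S(1) by blast
  then obtain y where y: "y:U" "y:U'" "y:B" by auto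
  then have "y:B'" using U U' by auto
  then have "B' = B" using B.C_disjD[OF B' B] y by auto
  then have "U Int U' Int B = U Int U' Int C" using U U' by auto
  then show ?thesis using C op U U' by blast
 qed
 then obtain \<beta> where \<beta>: "!!B. B:B.\<C> ==> \<beta> B:A.\<C> & \<beta> B <= S & (EX U. openin X U & x:U & U Int B = U Int \<beta> B)"
  by metis
 have "bij_betw \<beta> B.\<C> {C:A.\<C>. C <= S}"
 proof (rule bij_betw_imageI)
  show "inj_on \<beta> B.\<C>"
  proof (rule inj_onI)
  fix B B' assume B: "B:B.\<C>" "B':B.\<C>" "\<beta> B = \<beta> B'"
  obtain U where U: "openin X U" "x:U" "U Int B = U Int \<beta> B" using \<beta>[OF B(1)] by auto
  obtain U' where U': "openin X U'" "x:U'" "U' Int B' = U' Int \<beta> B'" using \<beta>[OF B(2)] by auto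
  have "openin (subtopology X S) (U Int U' Int S)" using U U' by (auto simp: openin_subtopology)
  then have "U Int U' Int S Int B ~= {}" using B.C_limit[OF B(1)] U U' S(1) by blast
  then obtain y where y: "y:U" "y:U'" "y:B" by auto
  then have "y:B'" using U U' B(3) by auto
  then show "B = B'" using B.C_disjD[OF B(1,2)] y by auto
  qed
  have "C:\<beta> ` B.\<C>" if "C:{C:A.\<C>. C <= S}" for C
  proof -
  have C: "C:A.\<C>" "C <= S" using that by auto
  obtain B U where B: "B:B.\<C>" and U: "openin X U" "x:U" "U Int C <= B" using **[OF C] by auto
  obtain U' where U': "openin X U'" "x:U'" "U' Int B = U' Int \<beta> B" using \<beta>[OF B] by auto
  have "openin X (U Int U')" using U U' by auto
  then have "U Int U' Int C ~= {}" using A.C_limit[OF C(1)] U U' by blast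
  then obtain y where y: "y:U" "y:U'" "y:C" by auto
  then have "y:\<beta> B" using U U' by auto
  then have "\<beta> B = C" using A.C_disjD[of "\<beta> B" C y] \<beta>[OF B] C y by auto
  then show ?thesis using B by auto
  qed
  then show "\<beta> ` B.\<C> = {C:A.\<C>. C <= S}" using \<beta> by blast
 qed
 then show ?thesis using that \<beta> by blast
qed

text \<open>The case of \<open>germ_bijection\<close> in which \<open>S\<close> is the whole
  space.\<close>

lemma punctured_components_card_unique:
 assumes "Hausdorff_space X" "normal_neighbourhood X x N" "normal_neighbourhood X x N'"
 shows "card (punctured_components X x N') = card (punctured_components X x N)"
proof -
 interpret A: nnbhd X x N using assms by unfold_locales
 have "normal_neighbourhood (subtopology X (topspace X)) x N'" using assms by simp
 moreover have "C <= topspace X | C Int topspace X = {}" if "C:A.\<C>" for C using A.C_top[OF that] by simp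
 ultimately obtain \<beta> where "bij_betw \<beta> (punctured_components (subtopology X (topspace X)) x N') {C:A.\<C>. C <= topspace X}"
  using germ_bijection[OF assms(1,2) A.x_top order_refl, of N'] by metis
 moreover have "{C:A.\<C>. C <= topspace X} = A.\<C>" using A.C_top by auto
 ultimately show ?thesis by (simp add: bij_betw_same_card)
qed

lemma essential_iff:
 assumes "Hausdorff_space X" "normal_neighbourhood X x N"
 shows "x:essential_vertices X \<longleftrightarrow> card (punctured_components X x N) ~= 2"
proof
 assume "x:essential_vertices X"
 then obtain N' where "normal_neighbourhood X x N'" "card (punctured_components X x N') ~= 2"
  by (auto simp: essential_vertices_def)
 then show "card (punctured_components X x N) ~= 2" using punctured_components_card_unique[OF assms] by simp
next
 assume *: "card (punctured_components X x N) ~= 2"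
 interpret nnbhd X x N using assms by unfold_locales
 show "x:essential_vertices X"
  unfolding essential_vertices_def using * x_top assms(2) by (intro CollectI conjI exI[of _ N])
qed

lemma affine_image_right:
 fixes s b :: real assumes "s < b"
 shows "(%t. s + (b - s) * t) ` {0<..<1} = {s<..<b}"
proof (intro set_eqI iffI)
 fix u assume "u:(%t. s + (b - s) * t) ` {0<..<1}"
 then obtain t where t: "0 < t" "t < 1" "u = s + (b - s) * t" by auto
 have "(b - s) * t < (b - s) * 1" using t assms by (intro mult_strict_left_mono) auto
 moreover have "0 < (b - s) * t" using t assms by simp
 ultimately show "u:{s<..<b}" using t by auto
next
 fix u assume "u:{s<..<b}"
 then show "u:(%t. s + (b - s) * t) ` {0<..<1}"
  using assms by (intro image_eqI[of _ _ "(u - s) / (b - s)"]) (auto simp: field_simps)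
qed

lemma affine_image_left:
 fixes s a :: real assumes "a < s"
 shows "(%t. s + (a - s) * t) ` {0<..<1} = {a<..<s}"
proof -
 have "(%t. s + (a - s) * t) ` {0<..<1} = uminus ` (%t. - s + (- a - - s) * t) ` {0<..<1}"
  by (simp add: image_image algebra_simps)
 also have "\<dots> = uminus ` {- s<..<- a}" using affine_image_right[of "- s" "- a"] assms by simp
 finally show ?thesis by simp
qed

text \<open>The affine maps with slopes \<open>b - s\<close> and \<open>a - s\<close> turn the two
  halves of the arc into rays issuing from \<open>h s\<close>.\<close>

lemma interior_normal_neighbourhood:
 fixes a b s :: real
 assumes "Hausdorff_space X" and h: "emb A X h" "openin X (h ` {a<..<b})"
  and s: "a < s" "s < b" "{a<..<b} <= A"
 shows "normal_neighbourhood X (h s) (h ` {a<..<b})"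
  and "punctured_components X (h s) (h ` {a<..<b}) = {h ` {a<..<s}, h ` {s<..<b}}"
  and "h s ~: essential_vertices X"
proof -
 have h': "emb {a<..<b} X h" by (rule embedding_map_restrict[OF h(1) s(3)])
 have opI: "openin X (h ` I)" if "open I" "I <= {a<..<b}" for I
 proof -
  have "openin (subtopology X (h ` {a<..<b})) (h ` I)"
   by (rule embedding_openin[OF h']) (use that in \<open>auto intro!: open_subset\<close>)
  then show ?thesis using h(2) openin_trans_full by blast
 qed
 have inj: "inj_on h {a<..<b}" by (rule embedding_inj[OF h'])
 have aff: "(%t. s + (b - s) * t) ` {0<..<1} = {s<..<b}" "(%t. s + (a - s) * t) ` {0<..<1} = {a<..<s}"
  using affine_image_right[OF s(2)] affine_image_left[OF s(1)] by auto
 have aff': "(%t. s + (b - s) * t) ` {0..<1} <= {a<..<b}" "(%t. s + (a - s) * t) ` {0..<1} <= {a<..<b}"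
 proof -
  have e: "{0..<1::real} = insert 0 {0<..<1}" by auto
  show "(%t. s + (b - s) * t) ` {0..<1} <= {a<..<b}" "(%t. s + (a - s) * t) ` {0..<1} <= {a<..<b}"
   unfolding e image_insert aff using s by auto
 qed
 have r1: "ray X (h s) (h ` {s<..<b}) (%t. h (s + (b - s) * t))" using ray_reparam[OF h' _ aff'(1)] s aff by auto
 have r2: "ray X (h s) (h ` {a<..<s}) (%t. h (s + (a - s) * t))" using ray_reparam[OF h' _ aff'(2)] s aff by auto
 have un: "\<Union>{h ` {a<..<s}, h ` {s<..<b}} = h ` {a<..<b} - {h s}" using inj s by (fastforce dest: inj_onD)
 have dj: "h ` {a<..<s} Int h ` {s<..<b} = {}" using inj s by (fastforce dest: inj_onD)
 then have "disjoint {h ` {a<..<s}, h ` {s<..<b}}" by (auto simp: disjoint_def)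
 note * = normal_neighbourhoodI[OF h(2) _ _ un this]
 have o: "openin X (h ` {a<..<s})" "openin X (h ` {s<..<b})"
 proof -
  have "{a<..<s} <= {a<..<b}" "{s<..<b} <= {a<..<b}" using s by auto
  then show "openin X (h ` {a<..<s})" "openin X (h ` {s<..<b})" by (auto intro: opI)
 qed
 show n: "normal_neighbourhood X (h s) (h ` {a<..<b})" by (rule *) (use s r1 r2 o in auto)
 show p: "punctured_components X (h s) (h ` {a<..<b}) = {h ` {a<..<s}, h ` {s<..<b}}"
  by (rule *) (use s r1 r2 o in auto)
 have "h ((a+s)/2):h ` {a<..<s}" using s by auto
 then have "h ` {a<..<s} ~= h ` {s<..<b}" using dj by blast
 then show "h s ~: essential_vertices X" using essential_iff[OF assms(1) n] p by auto
qed

lemma (in nnbhd) C_nonessential: "C:\<C> ==> y:C ==> y ~: essential_vertices X"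
proof -
 assume C: "C:\<C>" "y:C"
 then obtain h where h: "ray X x C h" using C_ray by blast
 then obtain s where s: "0 < s" "s < 1" "y = h s" using C by (auto simp: ray_def)
 have "h s ~: essential_vertices X"
  by (rule interior_normal_neighbourhood(3)[OF Haus, of "{0..<1}" h 0 1]) (use h s C_open[OF C(1)] in \<open>auto simp: ray_def\<close>)
 then show ?thesis using s by simp
qed


section \<open>The coordinate model of the reflection tree\<close>

locale graph_space =
 fixes X :: "'a topology"
 assumes compact_X: "compact_space X" and Haus_X: "Hausdorff_space X" and second_X: "second_countable X"
  and normal_nbhd_ex: "x:topspace X ==> EX N. normal_neighbourhood X x N"
begin

text \<open>The same choice as the one inside \<open>branches\<close>, so that the components of
  this neighbourhood are literally the branches.\<close>

definition nnb :: "'a => 'a set" where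
 "nnb x = (SOME N. normal_neighbourhood X x N)"

lemma nnb: "x:topspace X ==> normal_neighbourhood X x (nnb x)"
 unfolding nnb_def using normal_nbhd_ex someI_ex[of "normal_neighbourhood X x"] by blast

lemma nnbhd_nnb: "x:topspace X ==> nnbhd X x (nnb x)"
 using nnb Haus_X by unfold_locales

lemma branches_eq: "branches X x = punctured_components X x (nnb x)"
 by (simp add: branches_def nnb_def)

lemma
 assumes "x:topspace X"
 shows br_finite: "finite (branches X x)"
  and br_notin: "C:branches X x ==> x ~: C"
  and br_top: "C:branches X x ==> C <= topspace X"
  and br_nonempty: "C:branches X x ==> C ~= {}"
  and br_conn: "C:branches X x ==> connectedin X C"
  and br_disj: "C:branches X x ==> C':branches X x ==> y:C ==> y:C' ==> C = C'"
  and br_open: "C:branches X x ==> openin X C"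
  and br_ray: "C:branches X x ==> EX h. ray X x C h"
  and br_limit: "C:branches X x ==> openin X U ==> x:U ==> U Int C ~= {}"
  and nnb_eq: "nnb x = insert x (\<Union>(branches X x))"
  and nnb_open: "openin X (nnb x)"
proof -
 interpret nnbhd X x "nnb x" by (rule nnbhd_nnb[OF assms])
 show "finite (branches X x)" using fin by (simp add: branches_eq)
 show "C:branches X x ==> x ~: C" using x_notin by (simp add: branches_eq)
 show "C:branches X x ==> C <= topspace X" using C_top by (simp add: branches_eq)
 show "C:branches X x ==> C ~= {}" using C_nonempty by (simp add: branches_eq)
 show "C:branches X x ==> connectedin X C" using C_conn by (simp add: branches_eq)
 show "C:branches X x ==> C':branches X x ==> y:C ==> y:C' ==> C = C'"
  using C_disjD[of C C' y] by (simp add: branches_eq)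
 show "C:branches X x ==> openin X C" using C_open by (simp add: branches_eq)
 show "C:branches X x ==> EX h. ray X x C h" using C_ray by (simp add: branches_eq)
 show "C:branches X x ==> openin X U ==> x:U ==> U Int C ~= {}" using C_limit by (simp add: branches_eq)
 show "nnb x = insert x (\<Union>(branches X x))" using N_eq by (simp add: branches_eq)
 show "openin X (nnb x)" by (rule N_open)
qed

end

text \<open>
  A point of the reflection tree is recorded by its projections \<open>p w\<close> to the copies of \<open>X\<close>
  indexed by the reduced words \<open>w\<close>; if it lies on the gluing locus between two adjacent copies, it
  is one of the ends of the blow-up there, and \<open>c\<close> is the corresponding branch (otherwise \<open>c\<close> is
  empty).
\<close>

definition central :: "('a list => 'a) => 'a list => 'a => bool" where
 "central p w x \<longleftrightarrow> p w = x & p (nbr w x) = x"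

definition rpoints :: "'a topology => 'a set => (('a list => 'a) \<times> 'a set) set" where
 "rpoints X D = {(p, c). p:words D \<rightarrow>\<^sub>E topspace X &
   (ALL w:words D. ALL x:D. p w = x | p (nbr w x) = x) &
   (ALL w:words D. ALL x:D. central p w x --> c:branches X x) &
   ((ALL w:words D. ALL x:D. ~ central p w x) --> c = {})}"

definition at_set :: "'a topology => 'a set => 'a list => 'a set => (('a list => 'a) \<times> 'a set) set" where
 "at_set X D w U = {m:rpoints X D. fst m w:U}"

text \<open>A basic neighbourhood of the end \<open>C\<close> shared by the copies \<open>w\<close>
  and \<open>nbr w x\<close>: the end itself and, in both copies, the part of \<open>C\<close> near
  \<open>x\<close> with everything attached to it.\<close>

definition edge_set :: "'a topology => 'a set => 'a list => 'a => 'a set => 'a set => (('a list => 'a) \<times> 'a set) set" where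
 "edge_set X D w x C U = {m:rpoints X D. fst m w:U Int C | fst m (nbr w x):U Int C |
   central (fst m) w x & snd m = C}"

definition rsubbase :: "'a topology => 'a set => (('a list => 'a) \<times> 'a set) set set" where
 "rsubbase X D = {at_set X D w U |w U. w:words D & openin X U} Un
   {edge_set X D w x C U |w x C U. w:words D & x:D & C:branches X x & openin X U & x:U}"

definition rtop :: "'a topology => 'a set => (('a list => 'a) \<times> 'a set) topology" where
 "rtop X D = topology_generated_by (rsubbase X D)"

lemma topspace_rtop [simp]: "topspace (rtop X D) = rpoints X D"
proof -
 have "\<Union>(rsubbase X D) <= rpoints X D" by (auto simp: rsubbase_def at_set_def edge_set_def)
 moreover have "rpoints X D = at_set X D [] (topspace X)" by (auto simp: at_set_def rpoints_def)
 then have "rpoints X D:rsubbase X D" unfolding rsubbase_def by fastforce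
 ultimately show ?thesis unfolding rtop_def by auto
qed

lemma openin_at_set: "w:words D ==> openin X U ==> openin (rtop X D) (at_set X D w U)"
 unfolding rtop_def by (rule topology_generated_by_Basis) (auto simp: rsubbase_def)

lemma openin_edge_set:
 "w:words D ==> x:D ==> C:branches X x ==> openin X U ==> x:U ==> openin (rtop X D) (edge_set X D w x C U)"
 unfolding rtop_def by (rule topology_generated_by_Basis) (unfold rsubbase_def, blast)

lemma continuous_map_into_rtop:
 assumes "f:topspace Z \<rightarrow> rpoints X D"
  and "!!w U. w:words D ==> openin X U ==> openin Z {z:topspace Z. fst (f z) w:U}"
  and "!!w x C U. w:words D ==> x:D ==> C:branches X x ==> openin X U ==> x:U ==>
   openin Z {z:topspace Z. fst (f z) w:U Int C | fst (f z) (nbr w x):U Int C |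
    central (fst (f z)) w x & snd (f z) = C}"
 shows "continuous_map Z (rtop X D) f" unfolding rtop_def
proof (rule continuous_on_generated_topo)
 fix W assume "W:rsubbase X D"
 then consider w U where "w:words D" "openin X U" "W = at_set X D w U"
  | w x C U where "w:words D" "x:D" "C:branches X x" "openin X U" "x:U" "W = edge_set X D w x C U"
  unfolding rsubbase_def by blast
 then show "openin Z (f -` W Int topspace Z)"
 proof cases
  case 1
  have "f -` W Int topspace Z = {z:topspace Z. fst (f z) w:U}" using assms(1) by (auto simp: 1(3) at_set_def)
  then show ?thesis using assms(2)[OF 1(1,2)] by simp
 next
  case 2
  have "f -` W Int topspace Z = {z:topspace Z. fst (f z) w:U Int C | fst (f z) (nbr w x):U Int C |
    central (fst (f z)) w x & snd (f z) = C}" using assms(1) by (auto simp: 2(6) edge_set_def)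
  then show ?thesis using assms(3)[OF 2(1-5)] by simp
 qed
next
 have "topspace (rtop X D) = rpoints X D" by simp
 then show "f ` topspace Z <= \<Union>(rsubbase X D)" using assms(1) unfolding rtop_def by auto
qed

section \<open>The model is a compact Hausdorff space\<close>

locale marked_graph = graph_space +
 fixes D :: "'a set"
 assumes D_sub: "D <= topspace X" and D_count: "countable D"
  and D_dense: "X closure_of D = topspace X" and D_ess: "essential_vertices X <= D"
begin

abbreviation "M \<equiv> rpoints X D"
abbreviation "W \<equiv> words D"
abbreviation "RT \<equiv> rtop X D"

lemma D_top: "x:D ==> x:topspace X"
 using D_sub by auto

lemma D_meets: "openin X U ==> U ~= {} ==> U Int D ~= {}"
 using D_dense dense_intersects_open[of X D] by blast

lemma M_top: "m:M ==> w:W ==> fst m w:topspace X"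
 by (auto simp: rpoints_def)

lemma M_cons: "m:M ==> w:W ==> x:D ==> fst m w ~= x ==> fst m (nbr w x) = x"
 by (cases m) (simp add: rpoints_def, blast)

lemma M_br: "m:M ==> w:W ==> x:D ==> central (fst m) w x ==> snd m:branches X x"
 by (auto simp: rpoints_def)

lemma M_nocentral: "m:M ==> (!!w x. w:W ==> x:D ==> ~ central (fst m) w x) ==> snd m = {}"
 by (auto simp: rpoints_def)

lemma M_ext: "m:M ==> m':M ==> (!!w. w:W ==> fst m w = fst m' w) ==> snd m = snd m' ==> m = m'"
 using PiE_ext[of "fst m" W "%_. topspace X" "fst m'"] by (cases m; cases m') (simp add: rpoints_def)

lemma central_sym: "w:W ==> central p (nbr w x) x \<longleftrightarrow> central p w x"
 by (auto simp: central_def)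

text \<open>The point does not lie across the first edge of the walk. So every later vertex sees it
  in the direction of the way back, at the label of the edge by which the vertex was
  entered.\<close>

lemma pointing:
 assumes "m:M" "r:W" "w:W" "w ~= []" "fst m r ~= last w"
 shows "fst m (act r w) = hd w" using assms(3,4,5)
proof (induction w)
 case (Cons x w)
 then have w: "w:W" "x:D" by (auto simp: words_Cons)
 have "fst m (act r w) ~= x"
 proof (cases "w = []")
  case False
  then have "fst m (act r w) = hd w" using Cons w by simp
  then show ?thesis using Cons.prems False by (auto simp: words_Cons)
 qed (use Cons in auto)
 then show ?case using M_cons[OF assms(1)] w assms(2) by simp
qed simp

text \<open>Behind an edge that the point does not cross all projections point back. As consecutive
  labels of a reduced word differ, no edge there is seen at its own label from both ends.\<close>

lemma not_central_beyond:
 assumes m: "m:M" "r:W" "u:W" "u ~= []" "fst m r ~= last u" "y:D"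
 shows "~ central (fst m) (act r u) y"
proof
 assume c: "central (fst m) (act r u) y"
 have "fst m (act r u) = hd u" by (rule pointing) fact+
 then have y: "y = hd u" using c by (simp add: central_def)
 obtain v where v: "u = y # v" using y m(4) by (cases u) auto
 have vW: "v:W" "act r v:W" using m v by (auto simp: words_Cons)
 have "fst m (act r v) = y" using c v vW by (simp add: central_def)
 show False
 proof (cases "v = []")
  case True
  then show ?thesis using m(5) v \<open>fst m (act r v) = y\<close> by simp
 next
  case False
  have "fst m (act r v) = hd v" by (rule pointing) (use m v vW False in auto)
  then show ?thesis using \<open>fst m (act r v) = y\<close> False m(3) v by (auto simp: words_Cons)
 qed
qed

text \<open>A walk from one central edge to another cannot begin with a different label, by
  \<open>not_central_beyond\<close>. It thus crosses the central edge, and the same argument applies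
  from the other end of that edge.\<close>

lemma central_unique:
 assumes m: "m:M" and w: "w:W" "x:D" "central (fst m) w x"
  and v: "v:W" "y:D" "central (fst m) v y"
 shows "x = y & (v = w | v = nbr w x)"
proof -
 obtain u where u: "u:W" "v = act w u" using act_surj[OF w(1) v(1)] by auto
 show ?thesis
 proof (cases "u = []")
  case True
  then show ?thesis using u v w by (auto simp: central_def)
 next
  case False
  then obtain u' z where u': "u = u' @ [z]" by (metis rev_exhaust)
  have "z = x" using not_central_beyond[OF m w(1) u(1) False _ v(2)] u v(3) w(3) u' by (auto simp: central_def)
  then have v': "v = act (nbr w x) u'" using u u' by (simp add: act_append)
  have u'W: "u':W" using u(1) u' words_append1 by blast
  show ?thesis
  proof (cases "u' = []")
   case True
   then show ?thesis using v' v w by (auto simp: central_def)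
  next
   case False
   have "last u' ~= x" using u(1) u' \<open>z = x\<close> False by (auto simp: words_def distinct_adj_append_iff)
   then show ?thesis
    using not_central_beyond[OF m nbr_words[OF w(1,2)] u'W False _ v(2)] v(3) v' w(3) by (auto simp: central_def)
  qed
 qed
qed

lemma edge_set_disjoint:
 assumes "w:W" "x:D" "C:branches X x" "C':branches X x" "C ~= C'"
 shows "edge_set X D w x C U Int edge_set X D w x C' U' = {}"
proof -
 have x: "x:topspace X" using assms(2) D_top by blast
 note d = br_disj[OF x assms(3,4)] and n = br_notin[OF x assms(3)] br_notin[OF x assms(4)]
 have "False" if m: "m:edge_set X D w x C U" "m:edge_set X D w x C' U'" for m
 proof -
  have mM: "m:M" using m by (simp add: edge_set_def)
  have 1: "fst m w:C | fst m (nbr w x):C | central (fst m) w x & snd m = C"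
   and 2: "fst m w:C' | fst m (nbr w x):C' | central (fst m) w x & snd m = C'" using m by (auto simp: edge_set_def)
  have 3: "fst m w = x | fst m (nbr w x) = x" using M_cons[OF mM assms(1,2)] by blast
  show False using 1 2 3 d n assms(5) unfolding central_def by metis
 qed
 then show ?thesis by blast
qed

text \<open>Distinct points with equal projections differ in their branches, so some edge is central
  for both of them; there the edge sets of different branches are disjoint.\<close>

lemma Hausdorff_RT: "Hausdorff_space RT"
 unfolding Hausdorff_space_def
proof (intro allI impI)
 fix m n assume mn: "m:topspace RT & n:topspace RT & m ~= n"
 then have m: "m:M" and n: "n:M" by auto
 show "EX U V. openin RT U & openin RT V & m:U & n:V & disjnt U V"
 proof (cases "EX w:W. fst m w ~= fst n w")
  case True
  then obtain w where w: "w:W" "fst m w ~= fst n w" by blast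
  then obtain U V where UV: "openin X U" "openin X V" "fst m w:U" "fst n w:V" "disjnt U V"
   using Haus_X M_top[OF m w(1)] M_top[OF n w(1)] unfolding Hausdorff_space_def by metis
  have "disjnt (at_set X D w U) (at_set X D w V)" using UV(5) by (auto simp: disjnt_def at_set_def)
  moreover have "m:at_set X D w U" "n:at_set X D w V" using m n UV by (auto simp: at_set_def)
  ultimately show ?thesis using openin_at_set[OF w(1)] UV by metis
 next
  case False
  then have eq: "fst m w = fst n w" if "w:W" for w using that by blast
  then have cn: "snd m ~= snd n" using M_ext[OF m n] mn by blast
  have ceq: "central (fst m) w x \<longleftrightarrow> central (fst n) w x" if "w:W" "x:D" for w x
   using eq that by (simp add: central_def)
  have "EX w:W. EX x:D. central (fst m) w x"
  proof (rule ccontr)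
   assume a: "~ ?thesis"
   then have "snd m = {}" using M_nocentral[OF m] by blast
   moreover have "snd n = {}" using M_nocentral[OF n] a ceq by blast
   ultimately show False using cn by simp
  qed
  then obtain w x where w: "w:W" "x:D" "central (fst m) w x" by blast
  then have c': "central (fst n) w x" using ceq by blast
  have C: "snd m:branches X x" "snd n:branches X x" using M_br[OF m w] M_br[OF n w(1,2) c'] by auto
  have x: "x:topspace X" using w D_top by blast
  have "disjnt (edge_set X D w x (snd m) (topspace X)) (edge_set X D w x (snd n) (topspace X))"
   using edge_set_disjoint[OF w(1,2) C cn] by (simp add: disjnt_def)
  moreover have "m:edge_set X D w x (snd m) (topspace X)" "n:edge_set X D w x (snd n) (topspace X)"
   using m n w c' by (auto simp: edge_set_def)
  moreover have "openin RT (edge_set X D w x (snd m) (topspace X))" "openin RT (edge_set X D w x (snd n) (topspace X))"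
   using C w x by (auto intro!: openin_edge_set)
  ultimately show ?thesis by blast
 qed
qed

lemma continuous_coord: "w:W ==> continuous_map RT X (%m. fst m w)"
 using M_top openin_at_set[of w D X] by (auto simp: continuous_map_def at_set_def)

text \<open>Locally, the topology is the product topology except at the ends of a central edge.\<close>

lemma RT_local:
 assumes "openin RT Z" "m:Z"
 shows "EX Q. openin (product_topology (%_. X) W) Q & fst m:Q &
  (ALL n:M. fst n:Q & (ALL w:W. ALL x:D. central (fst m) w x --> n:edge_set X D w x (snd m) (topspace X)) --> n:Z)"
proof -
 let ?P = "product_topology (%_. X) W"
 have coord: "openin ?P {q:topspace ?P. q w:U}" if "w:W" "openin X U" for w U
  using openin_continuous_map_preimage[OF continuous_map_product_projection[of w W "%_. X"]] that by auto
 have inP: "fst n:topspace ?P" if "n:M" for n using that by (auto simp: rpoints_def)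
 have "generate_topology_on (rsubbase X D) Z" using assms(1) by (simp add: rtop_def openin_topology_generated_by_iff)
 then have "m:Z ==> m:M & (EX Q. openin ?P Q & fst m:Q &
  (ALL n:M. fst n:Q & (ALL w:W. ALL x:D. central (fst m) w x --> n:edge_set X D w x (snd m) (topspace X)) --> n:Z))"
 proof (induction rule: generate_topology_on.induct)
  case (Int a b)
  then have mab: "m:a" "m:b" by auto
  from Int.IH(1)[OF mab(1)] obtain Q1 where Q1: "m:M" "openin ?P Q1" "fst m:Q1"
   "ALL n:M. fst n:Q1 & (ALL w:W. ALL x:D. central (fst m) w x --> n:edge_set X D w x (snd m) (topspace X)) --> n:a"
   by (elim conjE exE)
  from Int.IH(2)[OF mab(2)] obtain Q2 where Q2: "openin ?P Q2" "fst m:Q2"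
   "ALL n:M. fst n:Q2 & (ALL w:W. ALL x:D. central (fst m) w x --> n:edge_set X D w x (snd m) (topspace X)) --> n:b"
   by (elim conjE exE)
  have "openin ?P (Q1 Int Q2)" "fst m:Q1 Int Q2" using Q1 Q2 by auto
  then show ?case using Q1(1,4) Q2(3) by (intro conjI exI[of _ "Q1 Int Q2"]) simp_all
 next
  case (UN K)
  then obtain k where "k:K" "m:k" by blast
  then show ?case using UN.IH[of k] by blast
 next
  case (Basis s)
  then have mM: "m:M" unfolding rsubbase_def at_set_def edge_set_def by blast
  from Basis consider w U where "w:W" "openin X U" "s = at_set X D w U"
   | w x C U where "w:W" "x:D" "C:branches X x" "openin X U" "x:U" "s = edge_set X D w x C U"
   unfolding rsubbase_def by blast
  then show ?case
  proof cases
   case 1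
   then show ?thesis using mM coord[of w U] inP[OF mM] Basis(2)
    by (intro conjI exI[of _ "{q:topspace ?P. q w:U}"]) (auto simp: at_set_def)
  next
   case 2
   have UC: "openin X (U Int C)" using br_open[OF D_top[OF 2(2)] 2(3)] 2(4) by blast
   have w': "nbr w x:W" using 2 by simp
   from Basis(2) consider (a) v where "v = w | v = nbr w x" "fst m v:U Int C"
    | (b) "central (fst m) w x" "snd m = C" by (auto simp: 2(6) edge_set_def)
   then show ?thesis
   proof cases
    case a
    then have v: "v:W" using 2 w' by auto
    have "n:s" if "n:M" "fst n:{q:topspace ?P. q v:U Int C}" for n using that a(1) by (auto simp: 2(6) edge_set_def)
    then show ?thesis
     using mM inP[OF mM] a(2) coord[OF v UC] by (intro conjI exI[of _ "{q:topspace ?P. q v:U Int C}"]) auto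
   next
    case b
    let ?Q = "{q:topspace ?P. q w:U} Int {q:topspace ?P. q (nbr w x):U}"
    have op: "openin ?P ?Q" using coord[OF 2(1,4)] coord[OF w' 2(4)] by (rule openin_Int)
    have mQ: "fst m:?Q" using inP[OF mM] b 2(5) by (auto simp: central_def)
    have "n:s" if "n:M" "fst n:?Q"
     "ALL w:W. ALL x:D. central (fst m) w x --> n:edge_set X D w x (snd m) (topspace X)" for n
    proof -
     have "n:edge_set X D w x C (topspace X)" using that(3) 2 b by blast
     then show ?thesis using that(1,2) by (auto simp: 2(6) edge_set_def)
    qed
    then show ?thesis using mM op mQ by blast
   qed
  qed
 qed simp
 then show ?thesis using assms(2) by blast
qed

text \<open>Reduces compactness to the compactness of a product. The fibres are finite, and a
  neighbourhood of a fibre is found separately for a family that is incoherent at some edge (empty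
  fibre), one without a central edge (one point), and one with a central edge (one point for each
  branch).\<close>

lemma proper_coords: "proper_map RT (product_topology (%_. X) W) fst"
 unfolding proper_map_def
proof
 let ?P = "product_topology (%_. X) W"
 have coord: "openin ?P {q:topspace ?P. q w:U}" if "w:W" "openin X U" for w U
  using openin_continuous_map_preimage[OF continuous_map_product_projection[of w W "%_. X"]] that by auto
 have fib: "EX V. openin ?P V & q:V & {m:topspace RT. fst m:V} <= U"
  if U: "openin RT U" and q: "q:topspace ?P" and sub: "{m:topspace RT. fst m = q} <= U" for U q
 proof -
  consider (inc) w x where "w:W" "x:D" "q w ~= x" "q (nbr w x) ~= x"
   | (non) "ALL w:W. ALL x:D. q w = x | q (nbr w x) = x" "ALL w:W. ALL x:D. ~ central q w x"
   | (cen) w x where "ALL w:W. ALL x:D. q w = x | q (nbr w x) = x" "w:W" "x:D" "central q w x" by blast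
  then show ?thesis
  proof cases
   case inc
   let ?T = "topspace X - {x}"
   have T: "openin X ?T"
    by (meson D_top Haus_X Hausdorff_imp_t1_space closedin_t1_singleton inc(2) openin_diff openin_topspace)
   let ?V = "{q:topspace ?P. q w:?T} Int {q:topspace ?P. q (nbr w x):?T}"
   have "openin ?P ?V" using coord[OF inc(1) T] coord[OF nbr_words[OF inc(1,2)] T] by (rule openin_Int)
   moreover have "q:?V" using inc q nbr_words[OF inc(1,2)] by (auto simp: PiE_iff)
   moreover have "m:U" if "m:topspace RT" "fst m:?V" for m using that M_cons[of m w x] inc by auto
   ultimately show ?thesis by blast
  next
   case non
   have "(q, {}):M" using q non by (auto simp: rpoints_def)
   then have "(q, {}):U" using sub by auto
   from RT_local[OF U this] non show ?thesis by auto
  next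
   case cen
   have x: "x:topspace X" using cen D_top by blast
   have qM: "(q, C):M" if CB: "C:branches X x" for C
   proof -
    have qE: "q:W \<rightarrow>\<^sub>E topspace X" using q by simp
    have "C:branches X y" if v: "v:W" "y:D" "central q v y" for v y
    proof -
     \<comment> \<open>\<open>central_unique\<close> speaks of points of the model, but membership
       of \<open>(q, C)\<close> is still being shown. Its argument is therefore repeated for the
       bare family \<open>q\<close>.\<close>
     have "x = y"
     proof (rule ccontr)
      assume xy: "x ~= y"
      obtain u where u: "u:W" "v = act w u" using act_surj[OF cen(2) v(1)] by auto
      have point: "q (act r u) = hd u & ~ central q (act r u) y" if "r:W" "u:W" "u ~= []" "q r ~= last u" for r u
       using that
      proof (induction u)
       case (Cons a u)
       then have w: "u:W" "a:D" by (auto simp: words_Cons)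
       have *: "q (act r u) ~= a"
       proof (cases "u = []")
        case False
        then have "q (act r u) = hd u" using Cons w by simp
        then show ?thesis using Cons.prems False by (auto simp: words_Cons)
       qed (use Cons in auto)
       have rW: "act r u:W" using w Cons by simp
       have 1: "q (act r (a # u)) = a" using * cen(1) w rW by auto
       moreover have "~ central q (act r (a # u)) y"
       proof
        assume c: "central q (act r (a # u)) y"
        then have "a = y" using 1 by (simp add: central_def)
        then show False using c * rW by (simp add: central_def)
       qed
       ultimately show ?case by simp
      qed simp
      have "u ~= []" using u v cen xy by (auto simp: central_def)
      then obtain u' z where u': "u = u' @ [z]" by (metis rev_exhaust)
      have "z = x" using point[of w u] u cen v(3) u' by (auto simp: central_def)
      then have v': "v = act (nbr w x) u'" using u u' by (simp add: act_append)
      have u'W: "u':W" using u(1) u' words_append1 by blast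
      have "u' ~= []" using v' v cen xy by (auto simp: central_def)
      moreover have "last u' ~= x" using u(1) u' \<open>z = x\<close> calculation by (auto simp: words_def distinct_adj_append_iff)
      ultimately show False using point[of "nbr w x" u'] u'W v' v(3) cen by (auto simp: central_def)
     qed
     then show ?thesis using CB by simp
    qed
    then show ?thesis using qE cen by (auto simp: rpoints_def)
   qed
   have w': "nbr w x:W" using cen by simp
   have "EX Q. openin ?P Q & q:Q & (ALL n:M. fst n:Q & n:edge_set X D w x C (topspace X) --> n:U)"
    if C: "C:branches X x" for C
   proof -
    have "(q, C):U" using sub qM[OF C] by auto
    from RT_local[OF U this] obtain Q where Q: "openin ?P Q" "q:Q"
     "!!n. n:M ==> fst n:Q ==> (ALL v:W. ALL y:D. central q v y --> n:edge_set X D v y C (topspace X)) ==> n:U"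
     by auto
    have "n:U" if n: "n:M" "fst n:Q" "n:edge_set X D w x C (topspace X)" for n
    proof (rule Q(3)[OF n(1,2)], intro ballI impI)
     fix v y assume v: "v:W" "y:D" "central q v y"
     have "x = y & (v = w | v = nbr w x)" using central_unique[OF qM[OF C] cen(2,3), of v y] cen(4) v by auto
     then show "n:edge_set X D v y C (topspace X)" using n(3) cen(2) by (auto simp: edge_set_def central_def)
    qed
    then show ?thesis using Q by blast
   qed
   then obtain Q where Q: "!!C. C:branches X x ==> openin ?P (Q C) & q:Q C &
    (ALL n:M. fst n:Q C & n:edge_set X D w x C (topspace X) --> n:U)" by metis
   \<comment> \<open>With both projections in the normal neighbourhood of \<open>x\<close>, every
     point of \<open>?V\<close> lies in the edge set of some branch, to which the corresponding
     \<open>Q\<close> applies.\<close>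
   let ?Vn = "{q:topspace ?P. q w:nnb x} Int {q:topspace ?P. q (nbr w x):nnb x}"
   let ?V = "?Vn Int (topspace ?P Int \<Inter>(Q ` branches X x))"
   have "openin ?P ?Vn" using coord[OF cen(2) nnb_open[OF x]] coord[OF w' nnb_open[OF x]] by (rule openin_Int)
   moreover have "openin ?P (topspace ?P Int \<Inter>(Q ` branches X x))"
   proof (cases "branches X x = {}")
    case False
    then have "openin ?P (\<Inter>(Q ` branches X x))" using br_finite[OF x] Q by (intro openin_INT2) auto
    then show ?thesis by blast
   next
    case True
    then show ?thesis using openin_topspace[of ?P] by (simp del: topspace_product_topology)
   qed
   ultimately have "openin ?P ?V" by (rule openin_Int)
   moreover have "q:?V" using q Q cen(4) nnb_eq[OF x] by (auto simp: central_def)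
   moreover have "n:U" if n: "n:topspace RT" "fst n:?V" for n
   proof -
    have nM: "n:M" using n by simp
    have nn: "fst n w:nnb x" "fst n (nbr w x):nnb x" using n(2) by auto
    have "EX C:branches X x. n:edge_set X D w x C (topspace X)"
    proof (cases "central (fst n) w x")
     case True
     then show ?thesis using M_br[OF nM cen(2,3) True] nM by (auto simp: edge_set_def)
    next
     case False
     then obtain v where v: "v = w | v = nbr w x" "fst n v ~= x" by (auto simp: central_def)
     then obtain C where C: "C:branches X x" "fst n v:C" using nn nnb_eq[OF x] by auto
     then have "fst n v:topspace X" using br_top[OF x] by blast
     then show ?thesis using C v nM by (auto simp: edge_set_def)
    qed
    then show ?thesis using Q n(2) nM by blast
   qed
   ultimately show ?thesis by blast
  qed
 qed
 have into: "fst:topspace RT \<rightarrow> topspace ?P" by (auto simp: rpoints_def)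
 show "closed_map RT ?P fst" unfolding closed_map_fibre_neighbourhood using into fib by (intro conjI allI impI) auto
 show "ALL q:topspace ?P. compactin RT {m:topspace RT. fst m = q}"
 proof
  fix q assume "q:topspace ?P"
  have "finite (snd ` {m:topspace RT. fst m = q})"
  proof (cases "EX w:W. EX x:D. central q w x")
   case True
   then obtain w x where wx: "w:W" "x:D" "central q w x" by blast
   then have "snd ` {m:topspace RT. fst m = q} <= branches X x" using M_br by auto
   then show ?thesis using br_finite[OF D_top[OF wx(2)]] finite_subset by blast
  next
   case False
   then have "snd ` {m:topspace RT. fst m = q} <= {{}}" using M_nocentral by auto
   then show ?thesis using finite_subset by blast
  qed
  moreover have "{m:topspace RT. fst m = q} <= {q} \<times> snd ` {m:topspace RT. fst m = q}"
   by (force simp: image_iff)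
  ultimately have "finite {m:topspace RT. fst m = q}" using finite_subset by blast
  then show "compactin RT {m:topspace RT. fst m = q}" by (intro finite_imp_compactin) auto
 qed
qed

lemma compact_RT: "compact_space RT"
proof -
 let ?P = "product_topology (%_. X) W"
 have "compact_space ?P" using compact_X by (simp add: compact_space_product_topology)
 then have "compactin RT {m. m:topspace RT & fst m:topspace ?P}"
  using compactin_proper_map_preimage[OF proper_coords] by (simp add: compact_space_def)
 moreover have "{m. m:topspace RT & fst m:topspace ?P} = topspace RT" by (auto simp: rpoints_def)
 ultimately show ?thesis by (simp add: compact_space_def)
qed

end


section \<open>Metrizability and spread families\<close>

lemma second_countableE:
 assumes "second_countable Z"
 obtains \<B> where "countable \<B>" "!!V. V:\<B> ==> openin Z V"
  "!!U x. openin Z U ==> x:U ==> EX V:\<B>. x:V & V <= U"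
proof -
 obtain \<B> where B: "countable \<B>" "ALL V:\<B>. openin Z V"
  "ALL U x. openin Z U & x:U --> (EX V:\<B>. x:V & V <= U)"
  using assms unfolding second_countable_def by (elim exE conjE)
 show thesis by (rule that[OF B(1)]) (use B(2,3) in auto)
qed

lemma second_countableI:
 assumes "countable \<B>" "!!V. V:\<B> ==> openin Z V"
  "!!U x. openin Z U ==> x:U ==> EX V:\<B>. x:V & V <= U"
 shows "second_countable Z" unfolding second_countable_def by (rule exI[of _ \<B>]) (use assms in auto)

lemma closed_map_tube:
 assumes "closed_map Z Y f" "openin Z U" "y:topspace Y" "{x:topspace Z. f x = y} <= U"
 obtains V where "openin Y V" "y:V" "{x:topspace Z. f x:V} <= U"
proof -
 have "ALL U y. openin Z U & y:topspace Y & {x:topspace Z. f x = y} <= U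
   --> (EX V. openin Y V & y:V & {x:topspace Z. f x:V} <= U)"
  using assms(1) unfolding closed_map_fibre_neighbourhood by (rule conjunct2)
 from this[rule_format, of U y, OF conjI[OF assms(2) conjI[OF assms(3,4)]]] obtain V
  where "openin Y V" "y:V" "{x:topspace Z. f x:V} <= U" by (elim exE conjE)
 then show thesis by (rule that)
qed

text \<open>Urysohn's metrization theorem: one Urysohn function for each pair of basic sets with
  disjoint closures, and these functions embed \<open>Z\<close> in a countable product of
  lines.\<close>

lemma metrizable_space_if_second_countable:
 assumes Z: "compact_space Z" "Hausdorff_space Z" "second_countable Z"
 shows "metrizable_space Z"
proof -
 obtain \<B> where B: "countable \<B>" "!!V. V:\<B> ==> openin Z V"
  "!!U x. openin Z U ==> x:U ==> EX V:\<B>. x:V & V <= U" by (rule second_countableE[OF Z(3)]) (rule that)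
 have normal: "normal_space Z" using Z compact_Hausdorff_or_regular_imp_normal_space by blast
 define I where "I = {(B, B'). B:\<B> & B':\<B> & Z closure_of B Int Z closure_of B' = {}}"
 have "EX f. continuous_map Z euclideanreal f & f ` (Z closure_of fst i) <= {0} & f ` (Z closure_of snd i) <= {1}"
  if "i:I" for i
 proof -
  have "disjnt (Z closure_of fst i) (Z closure_of snd i)" using that by (auto simp: I_def disjnt_def)
  then show ?thesis
   using Urysohn_lemma_alt[OF normal, of "Z closure_of fst i" "Z closure_of snd i" 0 1] by (metis closedin_closure_of)
 qed
 then obtain f where f: "!!i. i:I ==> continuous_map Z euclideanreal (f i)"
  "!!i. i:I ==> f i ` (Z closure_of fst i) <= {0::real}" "!!i. i:I ==> f i ` (Z closure_of snd i) <= {1}" by metis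
 define e where "e z = (\<lambda>i\<in>I. f i z)" for z
 let ?P = "product_topology (%_. euclideanreal) I"
 have shrink: "EX V:\<B>. x:V & Z closure_of V <= U" if "openin Z U" "x:U" for U x
 proof -
  have "x:topspace Z" using that openin_subset by blast
  then have "closedin Z {x}" using Z(2) by (simp add: closedin_Hausdorff_singleton)
  moreover have "closedin Z (topspace Z - U)" using that by blast
  moreover have "disjnt {x} (topspace Z - U)" using that by (auto simp: disjnt_def)
  ultimately obtain U1 U2 where U: "openin Z U1" "openin Z U2" "{x} <= U1" "topspace Z - U <= U2" "disjnt U1 U2"
   using normal unfolding normal_space_def by metis
  obtain V where V: "V:\<B>" "x:V" "V <= U1" using B(3)[OF U(1), of x] U(3) by auto
  have "closedin Z (topspace Z - U2)" using U(2) by blast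
  moreover have "V <= topspace Z - U2" using V U(1,5) openin_subset[OF U(1)] by (auto simp: disjnt_def)
  ultimately have "Z closure_of V <= topspace Z - U2" by (simp add: closure_of_minimal)
  then have "Z closure_of V <= U" using U(4) by blast
  then show ?thesis using V by blast
 qed
 have "continuous_map Z ?P e" unfolding continuous_map_componentwise using f(1) by (auto simp: e_def)
 moreover have "inj_on e (topspace Z)"
 proof (rule inj_onI, rule ccontr)
  fix x y assume xy: "x:topspace Z" "y:topspace Z" "e x = e y" "x ~= y"
  obtain U V where UV: "openin Z U" "openin Z V" "x:U" "y:V" "disjnt U V"
   using Z(2) xy unfolding Hausdorff_space_def by metis
  obtain B1 where B1: "B1:\<B>" "x:B1" "Z closure_of B1 <= U" using shrink UV by blast
  obtain B2 where B2: "B2:\<B>" "y:B2" "Z closure_of B2 <= V" using shrink UV by blast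
  have i: "(B1, B2):I" using B1 B2 UV by (auto simp: I_def disjnt_def)
  have "x:Z closure_of B1" "y:Z closure_of B2" using B1 B2 closure_of_subset[OF openin_subset[OF B(2)]] by blast+
  then have "f (B1, B2) x = 0" "f (B1, B2) y = 1" using f(2)[OF i] f(3)[OF i] by (auto simp: image_subset_iff)
  moreover have "f (B1, B2) x = f (B1, B2) y" using xy(3) i by (auto simp: e_def fun_eq_iff split: if_splits)
  ultimately show False by simp
 qed
 moreover have "Hausdorff_space ?P" by (simp add: Hausdorff_space_product_topology)
 ultimately have "embedding_map Z ?P e" using continuous_imp_embedding_map Z(1) by blast
 moreover have "metrizable_space ?P"
 proof -
  have "countable I" by (rule countable_subset[of _ "\<B> \<times> \<B>"]) (use B(1) in \<open>auto simp: I_def\<close>)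
  then have "countable {i:I. ~ (EX a. topspace euclideanreal <= {a})}" by (rule countable_subset[rotated]) auto
  then show ?thesis unfolding metrizable_space_product_topology using metrizable_space_euclidean by blast
 qed
 ultimately show ?thesis
  using embedding_map_imp_homeomorphic_space homeomorphic_metrizable_space metrizable_space_subtopology by blast
qed

text \<open>
  In a spread family, any two distinct points have neighbourhoods that only finitely many members
  can meet simultaneously. This is a metric-free form of being null.
\<close>

definition spread :: "'z topology => 'i set => ('i => 'z set) => bool" where
 "spread Z I A \<longleftrightarrow> (ALL a:topspace Z. ALL b:topspace Z. a ~= b -->
   (EX U V. openin Z U & openin Z V & a:U & b:V & finite {i:I. A i Int U ~= {} & A i Int V ~= {}}))"

lemma spreadD:
 assumes "spread Z I A" "a:topspace Z" "b:topspace Z" "a ~= b"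
 shows "EX U V. openin Z U & openin Z V & a:U & b:V & finite {i:I. A i Int U ~= {} & A i Int V ~= {}}"
 using assms(1)[unfolded spread_def, rule_format, OF assms(2-4)] .

text \<open>Finitely many of the open boxes provided by \<open>spread\<close> cover
  \<open>Q\<close>, and each of them takes pairs from finitely many members only.\<close>

lemma spread_compact:
 assumes "spread Z I A" "compactin (prod_topology Z Z) Q" "!!a. (a, a) ~: Q"
 shows "finite {i:I. EX a:A i. EX b:A i. (a, b):Q}"
proof -
 define \<U> where "\<U> = {U \<times> V |U V. openin Z U & openin Z V & finite {i:I. A i Int U ~= {} & A i Int V ~= {}}}"
 have Qsub: "Q <= topspace Z \<times> topspace Z" using compactin_subset_topspace[OF assms(2)] by simp
 have "ALL S:\<U>. openin (prod_topology Z Z) S" by (auto simp: \<U>_def openin_prod_Times_iff)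
 moreover have "Q <= \<Union>\<U>"
 proof
  fix q assume q: "q:Q"
  then obtain a b where ab: "q = (a, b)" "a:topspace Z" "b:topspace Z" "a ~= b" using Qsub assms(3) by (cases q) blast
  then obtain U V where "openin Z U" "openin Z V" "a:U" "b:V" "finite {i:I. A i Int U ~= {} & A i Int V ~= {}}"
   using spreadD[OF assms(1) ab(2,3,4)] by (elim exE conjE)
  then have "q:U \<times> V" "U \<times> V:\<U>" using ab(1) by (auto simp: \<U>_def)
  then show "q:\<Union>\<U>" by blast
 qed
 ultimately obtain \<F> where F: "finite \<F>" "\<F> <= \<U>" "Q <= \<Union>\<F>"
  using assms(2) unfolding compactin_def by meson
 have "finite (UN S:\<F>. {i:I. EX a:A i. EX b:A i. (a, b):S})"
 proof (rule finite_UN_I[OF F(1)])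
  fix S assume "S:\<F>"
  then obtain U V where S: "S = U \<times> V" "finite {i:I. A i Int U ~= {} & A i Int V ~= {}}"
   using F(2) unfolding \<U>_def by blast
  show "finite {i:I. EX a:A i. EX b:A i. (a, b):S}" by (rule finite_subset[OF _ S(2)]) (use S(1) in blast)
 qed
 then show ?thesis by (rule finite_subset[rotated]) (use F(3) in blast)
qed

lemma spread_disjoint_compact:
 assumes "spread Z I A" "compactin Z K" "compactin Z L" "K Int L = {}"
 shows "finite {i:I. A i Int K ~= {} & A i Int L ~= {}}"
proof -
 have "finite {i:I. EX a:A i. EX b:A i. (a, b):K \<times> L}"
  by (rule spread_compact[OF assms(1)]) (use assms in \<open>auto simp: compactin_Times\<close>)
 then show ?thesis by (rule finite_subset[rotated]) blast
qed

text \<open>\<open>spread_compact\<close> applied to the closed, hence compact, set of pairs at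
  distance at least \<open>\<epsilon>\<close>.\<close>

lemma spread_null_family:
 assumes "compact_space Z" "spread Z \<S> (%S. S)" "\<Union>\<S> <= topspace Z"
 shows "null_family Z \<S>" unfolding null_family_def
proof (intro allI impI)
 fix d :: "'a => 'a => real" and \<epsilon> :: real
 assume d: "Metric_space (topspace Z) d & Metric_space.mtopology (topspace Z) d = Z" and e: "\<epsilon> > 0"
 interpret Metric_space "topspace Z" d using d by blast
 have mt: "mtopology = Z" using d by blast
 let ?Q = "{q:topspace Z \<times> topspace Z. d (fst q) (snd q) \<ge> \<epsilon>}"
 have "openin (prod_topology Z Z) (topspace Z \<times> topspace Z - ?Q)" unfolding openin_prod_topology_alt
 proof (intro allI impI)
  fix x y assume "(x, y):topspace Z \<times> topspace Z - ?Q"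
  then have xy: "x:topspace Z" "y:topspace Z" "d x y < \<epsilon>" by auto
  define r where "r = (\<epsilon> - d x y) / 2"
  have r: "r > 0" using xy by (simp add: r_def)
  have "mball x r \<times> mball y r <= topspace Z \<times> topspace Z - ?Q"
  proof
   fix q assume "q:mball x r \<times> mball y r"
   then obtain a b where q: "q = (a, b)" "a:topspace Z" "b:topspace Z" "d x a < r" "d y b < r"
    by (cases q) (auto simp: in_mball)
   have "d a b <= d a x + d x b" "d x b <= d x y + d y b" using triangle xy q by blast+
   moreover have "d a x = d x a" by (rule commute)
   ultimately have "d a b < \<epsilon>" using q unfolding r_def by argo
   then show "q:topspace Z \<times> topspace Z - ?Q" using q by simp
  qed
  moreover have "openin Z (mball x r)" "openin Z (mball y r)" using openin_mball mt by auto
  ultimately show "EX U V. openin Z U & openin Z V & x:U & y:V & U \<times> V <= topspace Z \<times> topspace Z - ?Q"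
   using xy r by (intro exI[of _ "mball x r"] exI[of _ "mball y r"]) (auto simp: centre_in_mball_iff)
 qed
 then have "closedin (prod_topology Z Z) ?Q" unfolding closedin_def by auto
 moreover have "compact_space (prod_topology Z Z)" using assms(1) by (simp add: compact_space_prod_topology)
 ultimately have "compactin (prod_topology Z Z) ?Q" by (simp add: closedin_compact_space)
 then have fin: "finite {i:\<S>. EX a:i. EX b:i. (a, b):?Q}"
  by (rule spread_compact[OF assms(2)]) (use e mdist_zero in auto)
 have "{S:\<S>. EX x:S. EX y:S. \<epsilon> < d x y} <= {S:\<S>. EX a:S. EX b:S. (a, b):?Q}"
 proof
  fix S assume "S:{S:\<S>. EX x:S. EX y:S. \<epsilon> < d x y}"
  then obtain x y where S: "S:\<S>" and xy: "x:S" "y:S" "\<epsilon> < d x y" by blast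
  then have "(x, y):?Q" using assms(3) by auto
  then show "S:{S:\<S>. EX a:S. EX b:S. (a, b):?Q}" using S xy by blast
 qed
 then show "finite {S:\<S>. EX x:S. EX y:S. \<epsilon> < d x y}" using fin finite_subset by auto
qed

section \<open>Metrizability of the model, shadows of edges, and fibres inside open sets\<close>

context marked_graph
begin

text \<open>Restricting the sets \<open>U\<close> of the subbase to a countable base of
  \<open>X\<close> leaves countably many subbasic sets, and their finite intersections still form a
  base. A point of an edge set that is not an end is caught by some \<open>at_set\<close>
  instead.\<close>

lemma second_countable_RT: "second_countable RT"
proof -
 obtain \<B> where B: "countable \<B>" "!!V. V:\<B> ==> openin X V"
  "!!U x. openin X U ==> x:U ==> EX V:\<B>. x:V & V <= U" by (rule second_countableE[OF second_X]) (rule that)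
 have cW: "countable W" by (rule countable_words[OF D_count])
 define S1 where "S1 = (%(w, V). at_set X D w V) ` (W \<times> \<B>)"
 define S2 where "S2 = (UN x:D. (%(w, V, C). edge_set X D w x C V) ` (W \<times> {V:\<B>. x:V} \<times> branches X x))"
 have "countable S1" unfolding S1_def using cW B(1) by auto
 moreover have "countable S2" unfolding S2_def using cW B(1) br_finite[OF D_top]
  by (intro countable_UN countable_image countable_SIGMA D_count countable_Collect) (auto intro: countable_finite)
 ultimately have cS: "countable (S1 Un S2)" by auto
 have openS: "openin RT s" if "s:S1 Un S2" for s
  using that B(2) by (auto simp: S1_def S2_def intro!: openin_at_set openin_edge_set)
 let ?N = "(%F. topspace RT Int \<Inter>F) ` {F. finite F & F <= S1 Un S2}"
 have "countable ?N" using cS by (intro countable_image countable_Collect_finite_subset)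
 moreover have "openin RT V" if "V:?N" for V
 proof -
  from that obtain F where F: "finite F" "F <= S1 Un S2" "V = topspace RT Int \<Inter>F" by blast
  show ?thesis
  proof (cases "F = {}")
   case True
   then show ?thesis using F(3) openin_topspace[of RT] by (simp del: topspace_rtop)
  next
   case False
   then have "openin RT (\<Inter>F)" using F(1,2) openS by (intro openin_Inter) auto
   then show ?thesis unfolding F(3) by blast
  qed
 qed
 moreover have "EX V:?N. m:V & V <= U" if U: "openin RT U" "m:U" for U m
 proof -
  have "generate_topology_on (rsubbase X D) U" using U(1) by (simp add: rtop_def openin_topology_generated_by_iff)
  then have "m:U ==> m:M & (EX F. finite F & F <= S1 Un S2 & m:\<Inter>F & M Int \<Inter>F <= U)"
  proof (induction rule: generate_topology_on.induct)
   case (Int a b)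
   then have ab: "m:a" "m:b" by auto
   from Int.IH(1)[OF ab(1)] obtain F where F: "m:M" "finite F" "F <= S1 Un S2" "m:\<Inter>F" "M Int \<Inter>F <= a" by blast
   from Int.IH(2)[OF ab(2)] obtain G where G: "finite G" "G <= S1 Un S2" "m:\<Inter>G" "M Int \<Inter>G <= b" by blast
   have "M Int \<Inter>(F Un G) <= a Int b" using F(5) G(4) by blast
   then show ?case using F G by (intro conjI exI[of _ "F Un G"]) auto
  next
   case (UN K)
   then obtain k where k: "k:K" "m:k" by blast
   from UN.IH[OF k] obtain F where F: "m:M" "finite F" "F <= S1 Un S2" "m:\<Inter>F" "M Int \<Inter>F <= k" by (elim exE conjE)
   have "M Int \<Inter>F <= \<Union>K" using F(5) k(1) by (rule order_trans[OF _ Union_upper])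
   then show ?case using F by (intro conjI exI[of _ F])
  next
   case (Basis s)
   then have mM: "m:M" unfolding rsubbase_def at_set_def edge_set_def by blast
   have one: "EX t:S1 Un S2. m:t & t <= s"
   proof -
    from Basis consider w U where "w:W" "openin X U" "s = at_set X D w U"
     | w x C U where "w:W" "x:D" "C:branches X x" "openin X U" "x:U" "s = edge_set X D w x C U"
     unfolding rsubbase_def by blast
    then show ?thesis
    proof cases
     case 1
     then have "fst m w:U" using Basis by (simp add: at_set_def)
     then obtain V where V: "V:\<B>" "fst m w:V" "V <= U" using B(3)[OF 1(2)] by blast
     then have "at_set X D w V:S1" "m:at_set X D w V" "at_set X D w V <= s"
      using 1 mM by (auto simp: S1_def at_set_def)
     then show ?thesis by blast
    next
     case 2
     have UC: "openin X (U Int C)" using br_open[OF D_top[OF 2(2)] 2(3)] 2(4) by blast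
     have w': "nbr w x:W" using 2 by simp
     from Basis(2) consider (a) v where "v = w | v = nbr w x" "fst m v:U Int C"
      | (b) "central (fst m) w x" "snd m = C" by (auto simp: 2(6) edge_set_def)
     then show ?thesis
     proof cases
      case a
      then have v: "v:W" using 2 w' by auto
      obtain V where V: "V:\<B>" "fst m v:V" "V <= U Int C" using B(3)[OF UC a(2)] by blast
      then have "at_set X D v V:S1" "m:at_set X D v V" "at_set X D v V <= s"
       using v a(1) mM by (auto simp: S1_def at_set_def 2(6) edge_set_def)
      then show ?thesis by blast
     next
      case b
      obtain V where V: "V:\<B>" "x:V" "V <= U" using B(3)[OF 2(4,5)] by blast
      then have "edge_set X D w x C V:S2" using 2 by (force simp: S2_def)
      moreover have "m:edge_set X D w x C V" "edge_set X D w x C V <= s"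
       using b mM V by (auto simp: 2(6) edge_set_def)
      ultimately show ?thesis by blast
     qed
    qed
   qed
   then obtain t where "t:S1 Un S2" "m:t" "t <= s" by blast
   then show ?case using mM by (intro conjI exI[of _ "{t}"]) auto
  qed simp
  then obtain F where "m:M" "finite F" "F <= S1 Un S2" "m:\<Inter>F" "M Int \<Inter>F <= U" using U(2) by blast
  then show ?thesis by (intro bexI[of _ "topspace RT Int \<Inter>F"]) auto
 qed
 ultimately show ?thesis by (rule second_countableI)
qed

lemma metrizable_RT: "metrizable_space RT"
 by (intro metrizable_space_if_second_countable compact_RT Hausdorff_RT second_countable_RT)

text \<open>Two points are separated by a projection, or by the branches at a common central edge. A
  member meeting both neighbourhoods is then non-constant in that projection, or in one of the two
  at the edge, or has the edge central.\<close>

lemma spread_RT: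
 assumes "!!i. i:I ==> A i <= M"
  and "!!w. w:W ==> finite {i:I. EX m:A i. EX n:A i. fst m w ~= fst n w}"
  and "!!w x. w:W ==> x:D ==> finite {i:I. EX m:A i. central (fst m) w x}"
 shows "spread RT I A" unfolding spread_def
proof (intro ballI impI)
 fix m n assume m': "m:topspace RT" "n:topspace RT" and mn: "m ~= n"
 then have m: "m:M" and n: "n:M" by auto
 show "EX U V. openin RT U & openin RT V & m:U & n:V & finite {i:I. A i Int U ~= {} & A i Int V ~= {}}"
 proof (cases "EX w:W. fst m w ~= fst n w")
  case True
  then obtain w where w: "w:W" "fst m w ~= fst n w" by blast
  then obtain U V where UV: "openin X U" "openin X V" "fst m w:U" "fst n w:V" "disjnt U V"
   using Haus_X M_top[OF m w(1)] M_top[OF n w(1)] unfolding Hausdorff_space_def by metis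
  have "{i:I. A i Int at_set X D w U ~= {} & A i Int at_set X D w V ~= {}} <= {i:I. EX m:A i. EX n:A i. fst m w ~= fst n w}"
  proof (intro subsetI CollectI conjI)
   fix i assume i: "i:{i:I. A i Int at_set X D w U ~= {} & A i Int at_set X D w V ~= {}}"
   then obtain a b where ab: "a:A i" "a:at_set X D w U" "b:A i" "b:at_set X D w V" by blast
   then have "fst a w ~= fst b w" using UV(5) by (auto simp: at_set_def disjnt_def)
   then show "EX m:A i. EX n:A i. fst m w ~= fst n w" using ab by blast
  qed simp
  then have "finite {i:I. A i Int at_set X D w U ~= {} & A i Int at_set X D w V ~= {}}"
   using assms(2)[OF w(1)] finite_subset by blast
  moreover have "m:at_set X D w U" "n:at_set X D w V" using m n UV by (auto simp: at_set_def)
  ultimately have "openin RT (at_set X D w U) & openin RT (at_set X D w V) & m:at_set X D w U & n:at_set X D w V &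
    finite {i:I. A i Int at_set X D w U ~= {} & A i Int at_set X D w V ~= {}}"
   using openin_at_set[OF w(1) UV(1)] openin_at_set[OF w(1) UV(2)] by simp
  then show ?thesis by (intro exI)
 next
  case False
  then have eq: "fst m w = fst n w" if "w:W" for w using that by blast
  then have cn: "snd m ~= snd n" using M_ext[OF m n] mn by blast
  have ceq: "central (fst m) w x \<longleftrightarrow> central (fst n) w x" if wx: "w:W" "x:D" for w x
   using eq[OF wx(1)] eq[OF nbr_words[OF wx]] by (simp add: central_def)
  have "EX w:W. EX x:D. central (fst m) w x"
  proof (rule ccontr)
   assume a: "~ ?thesis"
   then have "snd m = {}" using M_nocentral[OF m] by blast
   moreover have "snd n = {}" using M_nocentral[OF n] a ceq by blast
   ultimately show False using cn by simp
  qed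
  then obtain w x where w: "w:W" "x:D" "central (fst m) w x" by blast
  then have c': "central (fst n) w x" using ceq by blast
  have C: "snd m:branches X x" "snd n:branches X x" using M_br[OF m w] M_br[OF n w(1,2) c'] by auto
  have x: "x:topspace X" using w D_top by blast
  let ?U = "edge_set X D w x (snd m) (topspace X)" and ?V = "edge_set X D w x (snd n) (topspace X)"
  have "{i:I. A i Int ?U ~= {} & A i Int ?V ~= {}} <= {i:I. EX m:A i. EX n:A i. fst m w ~= fst n w} Un
   {i:I. EX m:A i. EX n:A i. fst m (nbr w x) ~= fst n (nbr w x)} Un {i:I. EX m:A i. central (fst m) w x}"
  proof
   fix i assume i: "i:{i:I. A i Int ?U ~= {} & A i Int ?V ~= {}}"
   then obtain a b where ab: "a:A i" "a:?U" "b:A i" "b:?V" by blast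
   have "False" if eqs: "fst a w = fst b w" "fst a (nbr w x) = fst b (nbr w x)" and nc: "~ central (fst a) w x"
   proof -
    have ncb: "~ central (fst b) w x" using eqs nc by (simp add: central_def)
    have "b:?U" using ab nc ncb eqs by (auto simp: edge_set_def)
    then show False using ab(4) edge_set_disjoint[OF w(1,2) C cn] by blast
   qed
   then show "i:{i:I. EX m:A i. EX n:A i. fst m w ~= fst n w} Un
    {i:I. EX m:A i. EX n:A i. fst m (nbr w x) ~= fst n (nbr w x)} Un {i:I. EX m:A i. central (fst m) w x}"
    using i ab(1,3) by blast
  qed
  then have "finite {i:I. A i Int ?U ~= {} & A i Int ?V ~= {}}"
   using assms(2)[OF w(1)] assms(2)[OF nbr_words[OF w(1,2)]] assms(3)[OF w(1,2)] by (meson finite_UnI finite_subset)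
  moreover have "m:?U" "n:?V" using m n w c' by (auto simp: edge_set_def)
  moreover have "openin RT ?U" "openin RT ?V" using C w x by (auto intro!: openin_edge_set)
  ultimately show ?thesis by blast
 qed
qed

text \<open>For a non-empty word \<open>s\<close>, the points on or beyond the edge that leads from
  \<open>tl s\<close> to \<open>s\<close>.\<close>

definition shadow :: "'a list => (('a list => 'a) \<times> 'a set) set" where
 "shadow s = {m:M. fst m (tl s) = hd s}"

lemma act_eq_append: "v @ s:W ==> act s v = v @ s"
proof (induction v)
 case (Cons x v)
 then have "v @ s:W" by (auto simp: words_Cons)
 then show ?case using Cons nbr_Cons[of x "v @ s" D] by simp
qed simp

lemma words_append_join: "v @ [x]:W ==> x # u:W ==> v @ x # u:W"
proof (induction v)
 case (Cons y v)
 then show ?case by (cases v) (auto simp: words_Cons)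
qed simp

text \<open>The position of the vertex \<open>w\<close> relative to that edge: behind it, or at its
  near end, or in another direction from the near end.\<close>

lemma suffix_or_beyond:
 assumes s: "s:W" "s ~= []" and w: "w:W"
 shows "(EX v. w = v @ s) | w = tl s | (EX v:W. v ~= [] & last v ~= hd s & w = act (tl s) v)"
proof -
 have t: "tl s:W" using s by (cases s) (auto simp: words_Cons)
 obtain v where v: "v:W" "w = act (tl s) v" using act_surj[OF t w] by auto
 show ?thesis
 proof (cases "v = [] | last v ~= hd s")
  case True
  show ?thesis
  proof (cases "v = []")
   case False
   then show ?thesis using v True by blast
  qed (use v in simp)
 next
  case False
  then obtain v' where v': "v = v' @ [hd s]" by (metis append_butlast_last_id)
  have st: "s = hd s # tl s" using s by simp
  have "v' @ s:W" using words_append_join[of v' "hd s" "tl s"] v v' s st by simp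
  moreover have "w = act s v'" using v v' st s nbr_Cons[of "hd s" "tl s" D] by (simp add: act_append)
  ultimately show ?thesis using act_eq_append by metis
 qed
qed

lemma finite_suffixes: "finite {s. EX v. w = v @ s}"
proof (rule finite_subset)
 show "{s. EX v. w = v @ s} <= (%n. drop n w) ` {..length w}"
 proof
  fix s assume "s:{s. EX v. w = v @ s}"
  then obtain v where "w = v @ s" by blast
  then show "s:(%n. drop n w) ` {..length w}" by (intro image_eqI[of _ _ "length v"]) auto
 qed
qed simp

text \<open>Unless \<open>s\<close> is a suffix of \<open>w\<close>, all points of the shadow of
  \<open>s\<close> have the same projection at \<open>w\<close>; and a word has finitely many
  suffixes.\<close>

lemma spread_shadow: "spread RT (W - {[]}) shadow"
proof (rule spread_RT)
 show "shadow i <= M" for i by (auto simp: shadow_def)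
 fix w assume w: "w:W"
 show "finite {s:W - {[]}. EX m:shadow s. EX n:shadow s. fst m w ~= fst n w}"
 proof (rule finite_subset[OF _ finite_suffixes[of w]], intro subsetI CollectI)
  fix s assume "s:{s:W - {[]}. EX m:shadow s. EX n:shadow s. fst m w ~= fst n w}"
  then obtain m n where s: "s:W" "s ~= []" and mn: "m:shadow s" "n:shadow s" "fst m w ~= fst n w" by blast
  have t: "tl s:W" using s by (cases s) (auto simp: words_Cons)
  have "w ~= tl s" using mn by (auto simp: shadow_def)
  moreover have False if v: "v:W" "v ~= []" "last v ~= hd s" "w = act (tl s) v" for v
  proof -
   have "fst m w = hd v" "fst n w = hd v" using pointing[of _ "tl s" v] mn t v by (auto simp: shadow_def)
   then show False using mn by simp
  qed
  ultimately show "EX v. w = v @ s" using suffix_or_beyond[OF s w] by blast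
 qed
 fix x assume x: "x:D"
 \<comment> \<open>Besides the suffixes only the case \<open>w = tl s\<close> remains; then the
   central edge is the one leading to \<open>s\<close>, so \<open>s\<close> is
   \<open>nbr w x\<close>.\<close>
 have "finite (insert (nbr w x) {s. EX v. w = v @ s})" using finite_suffixes[of w] by simp
 then show "finite {s:W - {[]}. EX m:shadow s. central (fst m) w x}"
 proof (rule finite_subset[rotated], intro subsetI)
  fix s assume "s:{s:W - {[]}. EX m:shadow s. central (fst m) w x}"
  then obtain m where s: "s:W" "s ~= []" and m: "m:shadow s" "central (fst m) w x" by blast
  have t: "tl s:W" using s by (cases s) (auto simp: words_Cons)
  have mM: "m:M" "fst m (tl s) = hd s" using m by (auto simp: shadow_def)
  have "s = nbr w x" if "w = tl s"
  proof -
   have "x = hd s" using m mM that by (simp add: central_def)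
   then show ?thesis using that s nbr_Cons[of "hd s" "tl s" D] by simp
  qed
  moreover have False if v: "v:W" "v ~= []" "last v ~= hd s" "w = act (tl s) v" for v
   using not_central_beyond[OF mM(1) t v(1,2) _ x] m v mM by auto
  ultimately show "s:insert (nbr w x) {s. EX v. w = v @ s}" using suffix_or_beyond[OF s w] by blast
 qed
qed

text \<open>The projection at \<open>t\<close> is the label of no edge, so \<open>pointing\<close>
  applies in every direction from \<open>t\<close> and determines all other projections.\<close>

lemma determined_off_D:
 assumes "m:M" "n:M" "t:W" "fst m t ~: D" "fst n t = fst m t"
 shows "m = n"
proof -
 have nl: "fst k t ~= last v" if "v:W" "v ~= []" "k:{m, n}" for v k
 proof -
  have "last v:D" using that last_in_set[of v] by (auto simp: words_def)
  then show ?thesis using that assms by auto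
 qed
 have hd: "fst k (act t v) = hd v" if "v:W" "v ~= []" "k:{m, n}" for v k
  using pointing[of k t v] nl that assms by auto
 have nc: "~ central (fst k) w x" if w: "w:W" "x:D" and k: "k:{m, n}" for w x k
 proof -
  obtain v where v: "v:W" "w = act t v" using act_surj[OF assms(3) w(1)] by auto
  show ?thesis
  proof (cases "v = []")
   case True
   then show ?thesis using v assms w k by (auto simp: central_def)
  next
   case False
   then show ?thesis using not_central_beyond[of k t v x] nl[of v k] assms v w k by auto
  qed
 qed
 show ?thesis
 proof (rule M_ext[OF assms(1,2)])
  show "fst m w = fst n w" if w: "w:W" for w
  proof -
   obtain v where v: "v:W" "w = act t v" using act_surj[OF assms(3) w] by auto
   then show ?thesis using hd[of v m] hd[of v n] assms(5) by (cases "v = []") auto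
  qed
  have "snd m = {}" using M_nocentral[OF assms(1)] nc by blast
  moreover have "snd n = {}" using M_nocentral[OF assms(2)] nc by blast
  ultimately show "snd m = snd n" by simp
 qed
qed

text \<open>\<open>pointing\<close> is applied from each end of the central edge to the vertices on
  its own side.\<close>

lemma determined_central:
 assumes "m:M" "n:M" "t:W" "x:D" "central (fst m) t x" "central (fst n) t x" "w:W"
 shows "fst m w = fst n w"
proof -
 obtain v where v: "v:W" "w = act t v" using act_surj[OF assms(3,7)] by auto
 consider "v = []" | "v ~= []" "last v ~= x" | v' where "v = v' @ [x]" by (metis append_butlast_last_id)
 then show ?thesis
 proof cases
  case 1
  then show ?thesis using v assms by (simp add: central_def)
 next
  case 2
  then show ?thesis using pointing[OF _ assms(3) v(1)] assms v by (simp add: central_def)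
 next
  case 3
  have w: "w = act (nbr t x) v'" using v 3 by (simp add: act_append)
  show ?thesis
  proof (cases "v' = []")
   case True
   then show ?thesis using w assms by (simp add: central_def)
  next
   case False
   have v'W: "v':W" using v(1) 3 words_append1 by blast
   have "last v' ~= x" using v(1) 3 False by (auto simp: words_def distinct_adj_append_iff)
   then show ?thesis using pointing[OF _ nbr_words[OF assms(3,4)] v'W False] assms w by (simp add: central_def)
  qed
 qed
qed

text \<open>If a point of \<open>Z\<close> has a projection outside \<open>D\<close>, the fibre of
  that projection is a single point; if it has a central edge, two adjacent projections fix it up to
  the branch. In both cases the tube lemma and the density of \<open>D\<close> give a fibre.
  Otherwise the point is an end of the tree, and the shadows around it become small.\<close>

lemma open_contains_fibre:
 assumes Z: "openin RT Z" "Z ~= {}"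
 shows "EX t:W. EX x:D. {m:M. fst m t = x} <= Z"
proof -
 obtain m where m: "m:Z" "m:M" using Z openin_subset[OF Z(1)] by auto
 consider (off) t where "t:W" "fst m t ~: D" | (cen) t x where "t:W" "x:D" "central (fst m) t x"
  | (tree_end) "!!t. t:W ==> fst m t:D" "!!t x. t:W ==> x:D ==> ~ central (fst m) t x" by blast
 then show ?thesis
 proof cases
  case off
  have cl: "closed_map RT X (%m. fst m t)"
   by (rule continuous_imp_closed_map[OF continuous_coord[OF off(1)] compact_RT Haus_X])
  have fb: "{n:topspace RT. fst n t = fst m t} <= Z" using determined_off_D[OF m(2) _ off] m(1) by auto
  from closed_map_tube[OF cl Z(1) M_top[OF m(2) off(1)] fb] obtain V
   where V: "openin X V" "fst m t:V" "{n:topspace RT. fst n t:V} <= Z" .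
  then obtain x where "x:V" "x:D" using D_meets[of V] by blast
  then show ?thesis using V(3) off(1) by (intro bexI[of _ t] bexI[of _ x]) auto
 next
  case cen
  let ?P = "product_topology (%_. X) W"
  have x: "x:topspace X" using cen D_top by blast
  have t': "nbr t x:W" using cen by simp
  have C: "snd m:branches X x" using M_br[OF m(2) cen] .
  obtain Q where Q: "openin ?P Q" "fst m:Q"
   "!!n. n:M ==> fst n:Q ==> (ALL w:W. ALL y:D. central (fst m) w y --> n:edge_set X D w y (snd m) (topspace X)) ==> n:Z"
   using RT_local[OF Z(1) m(1)] by blast
  have cfst: "continuous_map RT ?P fst"
   unfolding continuous_map_componentwise using continuous_coord by (auto simp: rpoints_def PiE_iff)
  have oQ: "openin RT {n:topspace RT. fst n:Q}" using openin_continuous_map_preimage[OF cfst Q(1)] .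
  have "continuous_map RT (prod_topology X X) (%n. (fst n t, fst n (nbr t x)))"
   using continuous_coord[OF cen(1)] continuous_coord[OF t'] by (simp add: continuous_map_paired)
  then have cl: "closed_map RT (prod_topology X X) (%n. (fst n t, fst n (nbr t x)))"
   by (rule continuous_imp_closed_map[OF _ compact_RT]) (simp add: Haus_X Hausdorff_space_prod_topology)
  have fb: "{n:topspace RT. (fst n t, fst n (nbr t x)) = (x, x)} <= {n:topspace RT. fst n:Q}"
  proof (intro subsetI CollectI conjI)
   fix n assume n: "n:{n:topspace RT. (fst n t, fst n (nbr t x)) = (x, x)}"
   then have nM: "n:M" "central (fst n) t x" by (auto simp: central_def)
   have "fst n:W \<rightarrow>\<^sub>E topspace X" "fst m:W \<rightarrow>\<^sub>E topspace X" using m(2) nM(1) by (auto simp: rpoints_def)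
   then have "fst n = fst m" by (rule PiE_ext) (simp add: determined_central[OF m(2) nM(1) cen(1,2,3) nM(2)])
   then show "fst n:Q" using Q by simp
  qed simp
  have "(x, x):topspace (prod_topology X X)" using x by simp
  from closed_map_tube[OF cl oQ this fb] obtain V where V: "openin (prod_topology X X) V" "(x, x):V"
   "{n:topspace RT. (fst n t, fst n (nbr t x)):V} <= {n:topspace RT. fst n:Q}" .
  then obtain U1 U2 where U: "openin X U1" "openin X U2" "x:U1" "x:U2" "U1 \<times> U2 <= V"
   using V(1)[unfolded openin_prod_topology_alt, rule_format, OF V(2)] by (elim exE conjE)
  have "openin X (U1 Int snd m)" using U(1) br_open[OF x C] by blast
  moreover have "U1 Int snd m ~= {}" using br_limit[OF x C U(1,3)] .
  \<comment> \<open>A point of \<open>D\<close> on the branch of \<open>m\<close>, so close to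
    \<open>x\<close> that the fibre over it at \<open>t\<close> stays in \<open>Q\<close>; being on
    the branch, it also keeps the fibre in the required edge sets.\<close>
  ultimately obtain y where y: "y:U1" "y:snd m" "y:D" using D_meets by blast
  have yx: "y ~= x" using y br_notin[OF x C] by blast
  have "n:Z" if n: "n:M" "fst n t = y" for n
  proof (rule Q(3)[OF n(1)])
   have "fst n (nbr t x) = x" using M_cons[OF n(1) cen(1,2)] n(2) yx by simp
   then have "(fst n t, fst n (nbr t x)):V" using U y n by auto
   then show "fst n:Q" using V(3) n(1) by auto
   show "ALL w:W. ALL z:D. central (fst m) w z --> n:edge_set X D w z (snd m) (topspace X)"
   proof (intro ballI impI)
    fix w z assume w: "w:W" "z:D" "central (fst m) w z"
    then have *: "x = z & (w = t | w = nbr t x)" using central_unique[OF m(2) cen w] by blast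
    have "y:topspace X Int snd m" using y D_top by blast
    then show "n:edge_set X D w z (snd m) (topspace X)" using * n cen(1) by (auto simp: edge_set_def)
   qed
  qed
  then show ?thesis using cen(1) y(3) by blast
 next
  case tree_end
  \<comment> \<open>The projection at \<open>s\<close> lies in \<open>D\<close> and is not the label
    of the edge just crossed, which is not central; so it supplies the next letter.\<close>
  have "EX s:W. length s = Suc k & m:shadow s" for k
  proof (induction k)
   case 0
   have "[fst m []]:W" using tree_end(1)[of "[]"] by (simp add: words_Cons)
   then show ?case using m by (intro bexI[of _ "[fst m []]"]) (auto simp: shadow_def)
  next
   case (Suc k)
   then obtain s where s: "s:W" "length s = Suc k" "m:shadow s" by blast
   then obtain y u where yu: "s = y # u" by (cases s) auto
   have u: "u:W" "y:D" using s yu by (auto simp: words_Cons)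
   have "fst m u = y" using s yu by (simp add: shadow_def)
   then have "fst m s ~= y" using tree_end(2)[OF u] nbr_Cons[of y u D] s yu by (auto simp: central_def)
   then have "fst m s # s:W" using s yu tree_end(1)[OF s(1)] by (auto simp: words_Cons)
   then show ?case using s m by (intro bexI[of _ "fst m s # s"]) (auto simp: shadow_def)
  qed
  then have sh: "!!k. EX s. s:W & length s = Suc k & m:shadow s" by blast
  have inf: "infinite {s:W - {[]}. m:shadow s}"
  proof
   assume fin: "finite {s:W - {[]}. m:shadow s}"
   have "range Suc <= length ` {s:W - {[]}. m:shadow s}"
   proof
    fix j assume "j:range Suc"
    then obtain k where k: "j = Suc k" by blast
    obtain s where "s:W" "length s = Suc k" "m:shadow s" using sh by blast
    then show "j:length ` {s:W - {[]}. m:shadow s}" using k by (intro image_eqI[of _ _ s]) auto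
   qed
   then have "finite (range Suc)" using fin finite_surj by blast
   then show False using finite_imageD[of Suc UNIV] by simp
  qed
  have "closedin RT (topspace RT - Z)" using Z(1) by blast
  then have "compactin RT (topspace RT - Z)" using compact_RT closedin_compact_space by blast
  moreover have "compactin RT {m}" using m(2) by simp
  \<comment> \<open>Since the shadows are spread, only finitely many of those around
    \<open>m\<close> reach the compact complement of \<open>Z\<close>.\<close>
  ultimately have "finite {s:W - {[]}. shadow s Int {m} ~= {} & shadow s Int (topspace RT - Z) ~= {}}"
   using spread_disjoint_compact[OF spread_shadow] m(1) by blast
  then obtain s where s: "s:W" "s ~= []" "m:shadow s" "shadow s Int (topspace RT - Z) = {}"
   using inf by (smt (verit, ccfv_threshold) Collect_cong Diff_iff Int_insert_right_if1 insert_not_empty insertI1 mem_Collect_eq finite_subset subsetI)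
  then obtain y u where yu: "s = y # u" by (cases s) auto
  then have u: "u:W" "y:D" using s by (auto simp: words_Cons)
  have "{m:M. fst m u = y} <= Z" using s(4) yu by (auto simp: shadow_def)
  then show ?thesis using u by blast
 qed
qed

end


section \<open>Blocks of a graph\<close>

lemma connectedin_add:
 assumes "connectedin X S" "connectedin X A" "A = {} | S Int A ~= {}"
 shows "connectedin X (S Un A)" using assms connectedin_Un[of X S A] by auto

lemma affine_image_closed:
 fixes a b :: real assumes "a < b"
 shows "(%t. a + (b - a) * t) ` {0..1} = {a..b}"
proof (intro set_eqI iffI)
 fix u assume "u:(%t. a + (b - a) * t) ` {0..1}"
 then obtain t where t: "0 <= t" "t <= 1" "u = a + (b - a) * t" by auto
 have "(b - a) * t <= (b - a) * 1" using t assms by (intro mult_left_mono) auto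
 moreover have "0 <= (b - a) * t" using t assms by simp
 ultimately show "u:{a..b}" using t by auto
next
 fix u assume "u:{a..b}"
 then show "u:(%t. a + (b - a) * t) ` {0..1}"
  using assms by (intro image_eqI[of _ _ "(u - a) / (b - a)"]) (auto simp: field_simps)
qed

lemma embedding_subarc:
 fixes a b :: real
 assumes "emb A X q" "a < b" "{a..b} <= A"
 shows "emb {0..1} X (%t. q (a + (b - a) * t))"
  "(%t. q (a + (b - a) * t)) ` {0..1} = q ` {a..b}"
proof -
 have "emb {0..1} (top_of_set A) (%t. a + (b - a) * t)"
  by (rule embedding_map_affine) (use assms affine_image_closed[OF assms(2)] in auto)
 then show "emb {0..1} X (%t. q (a + (b - a) * t))" using embedding_map_compose[OF _ assms(1)] by (auto simp: o_def)
 show "(%t. q (a + (b - a) * t)) ` {0..1} = q ` {a..b}" using affine_image_closed[OF assms(2)] by (metis image_image)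
qed

lemma embedding_preimage_compact:
 assumes "emb A X q" "compact A" "closedin X K"
 shows "compact {s:A. q s:K}"
proof -
 have "closedin (top_of_set A) {s:topspace (top_of_set A). q s:K}"
  using closedin_continuous_map_preimage[OF embedding_cont[OF assms(1)] assms(3)] .
 then show ?thesis using closedin_compact[OF assms(2)] by simp
qed

lemma embedding_small:
 fixes q :: "real => 'a"
 assumes "emb A X q" "{a..b} <= A" "a < b" "openin X U" "q a:U"
 shows "EX e. 0 < e & e <= b - a & q ` {a..<a + e} <= U"
proof -
 have "(%t. a + (b - a) * t) ` {0..<1} <= {a..b}"
  using affine_image_closed[OF assms(3)] by (metis atLeastLessThan_subseteq_atLeastAtMost_iff image_mono order_refl)
 then have "ray X (q a) (q ` (%t. a + (b - a) * t) ` {0<..<1}) (%t. q (a + (b - a) * t))"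
  using ray_reparam[OF assms(1), of "b - a" a] assms(2,3) by auto
 from ray_small[OF this assms(4,5)] obtain d where d: "0 < d" "d <= 1"
  "(%t. q (a + (b - a) * t)) ` {0..<d} <= U" by auto
 have "q ` {a..<a + (b - a) * d} <= U"
 proof
  fix y assume "y:q ` {a..<a + (b - a) * d}"
  then obtain s where s: "a <= s" "s < a + (b - a) * d" "y = q s" by auto
  have "y = q (a + (b - a) * ((s - a) / (b - a)))" using s assms(3) by simp
  moreover have "(s - a) / (b - a):{0..<d}" using s assms(3) by (auto simp: field_simps)
  ultimately show "y:U" using subsetD[OF d(3) imageI, of "(s - a) / (b - a)"] by simp
 qed
 then show ?thesis using d assms(3) by (intro exI[of _ "(b - a) * d"]) auto
qed

definition split :: "'a topology => 'a => 'a set => 'a set => bool" where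
 "split X x K L \<longleftrightarrow> openin X K & openin X L & K Int L = {} & K Un L = topspace X - {x}"

text \<open>
  Cyclic sets are the closed connected sets without cut points; the maximal ones turn out to be
  the blocks.
\<close>

definition cyc :: "'a topology => 'a set => bool" where
 "cyc X S \<longleftrightarrow> closedin X S & connectedin X S & (ALL z. connectedin X (S - {z})) & (EX a:S. EX b:S. a ~= b)"

definition cblock :: "'a topology => 'a set => bool" where
 "cblock X S \<longleftrightarrow> cyc X S & (ALL S'. cyc X S' & S <= S' --> S' = S)"

lemma
 assumes "cyc X S"
 shows cyc_closed: "closedin X S" and cyc_conn: "connectedin X S" and cyc_minus: "connectedin X (S - {z})"
  and cyc_other: "EX b:S. b ~= a"
proof -
 show "closedin X S" "connectedin X S" "connectedin X (S - {z})" using assms by (auto simp: cyc_def)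
 obtain u v where "u:S" "v:S" "u ~= v" using assms by (auto simp: cyc_def)
 then show "EX b:S. b ~= a" by (cases "u = a") auto
qed

lemma cyc_sub: "cyc X S ==> S <= topspace X"
 by (simp add: closedin_subset cyc_closed)

lemma cblock_cyc: "cblock X S ==> cyc X S"
 by (simp add: cblock_def)

lemma cblockD: "cblock X S ==> cyc X T ==> S <= T ==> T = S"
 by (simp add: cblock_def)

lemma connectedin_two_opens:
 assumes "connectedin X T" "openin X E1" "openin X E2" "T <= E1 Un E2" "E1 Int E2 Int T = {}" "a:T" "a:E1"
 shows "T <= E1" using connectedinD[OF assms(1-5)] assms(4-7) by blast

lemma split_connected:
 assumes "split X x K L" "connectedin X T" "x ~: T" "a:T" "a:K"
 shows "T <= K"
proof (rule connectedin_two_opens[OF assms(2), of K L a])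
 show "T <= K Un L" using assms connectedin_subset_topspace[OF assms(2)] by (auto simp: split_def)
qed (use assms in \<open>auto simp: split_def\<close>)

lemma split_sym: "split X x K L ==> split X x L K"
 by (auto simp: split_def)

lemma split_cases: "split X x K L ==> y:topspace X ==> y ~= x ==> y:K | y:L"
 by (auto simp: split_def)

text \<open>Whichever point is removed, one of the two common points remains and holds the two sets
  together.\<close>

lemma cyc_Un:
 assumes "cyc X S" "cyc X S'" "a:S Int S'" "b:S Int S'" "a ~= b"
 shows "cyc X (S Un S')" unfolding cyc_def
proof (intro conjI allI)
 show "connectedin X (S Un S')" using assms cyc_conn by (intro connectedin_Un) auto
 show "connectedin X (S Un S' - {z})" for z
 proof -
  have "S Un S' - {z} = (S - {z}) Un (S' - {z})" by blast
  moreover have "(S - {z}) Int (S' - {z}) ~= {}" using assms(3-5) by (cases "z = a") auto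
  ultimately show ?thesis using cyc_minus[OF assms(1)] cyc_minus[OF assms(2)] connectedin_Un by metis
 qed
qed (use assms cyc_closed in auto)

lemma cblock_eqI:
 assumes "cblock X S" "cblock X S'" "a:S Int S'" "b:S Int S'" "a ~= b"
 shows "S = S'" using cyc_Un[OF cblock_cyc[OF assms(1)] cblock_cyc[OF assms(2)] assms(3-5)]
  cblockD[OF assms(1), of "S Un S'"] cblockD[OF assms(2), of "S Un S'"] by auto

lemma arc_minus:
 assumes "emb {0..1::real} X q" "0 <= t" "t <= 1"
 shows "q ` {0..1} - {q t} = q ` {0..<t} Un q ` {t<..1}"
proof -
 have "q ` {0..1} - q ` {t} = q ` ({0..1} - {t})"
  using inj_on_image_set_diff[OF embedding_inj[OF assms(1)], of "{0..1}" "{t}"] assms(2,3) by auto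
 also have "{0..1} - {t} = {0..<t} Un {t<..1}" using assms by auto
 finally show ?thesis by (simp add: image_Un)
qed

lemma arc_closed:
 assumes "Hausdorff_space X" "emb A X q" "{a..b::real} <= A"
 shows "closedin X (q ` {a..b})" using compactin_imp_closedin[OF assms(1)] embedding_compact[OF assms(2,3)] by auto

text \<open>Removing a point of the arc leaves at most two pieces of it, and each still hangs on
  \<open>S\<close> at its own end.\<close>

lemma cyc_add_arc:
 assumes H: "Hausdorff_space X" and S: "cyc X S"
  and q: "emb {0..1::real} X q" "q 0:S" "q 1:S"
 shows "cyc X (S Un q ` {0..1})" unfolding cyc_def
proof (intro conjI allI)
 let ?Q = "q ` {0..1}"
 have Qc: "connectedin X ?Q" by (rule embedding_connected[OF q(1)]) auto
 have q01: "q 0 ~= q 1" using inj_onD[OF embedding_inj[OF q(1)], of 0 1] by auto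
 have in01: "q 0:?Q" "q 1:?Q" by auto
 show "closedin X (S Un ?Q)" using cyc_closed[OF S] arc_closed[OF H q(1)] by (intro closedin_Un) auto
 show "connectedin X (S Un ?Q)" using cyc_conn[OF S] Qc q(2) in01 by (intro connectedin_Un) auto
 show "connectedin X (S Un ?Q - {z})" for z
 proof (cases "z:?Q")
  case True
  then obtain t where t: "0 <= t" "t <= 1" "z = q t" by auto
  have A: "connectedin X (q ` {0..<t})" "connectedin X (q ` {t<..1})"
   using t by (auto intro!: embedding_connected[OF q(1)])
  have "q ` {0..<t} = {} | (S - {z}) Int q ` {0..<t} ~= {}"
  proof (cases "t = 0")
   case False
   then have "q 0:q ` {0..<t}" using t by auto
   moreover have "q 0 ~= z" using t False inj_onD[OF embedding_inj[OF q(1)], of 0 t] by auto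
   ultimately show ?thesis using q(2) by blast
  qed simp
  then have 1: "connectedin X ((S - {z}) Un q ` {0..<t})" using connectedin_add[OF cyc_minus[OF S] A(1)] by blast
  have "q ` {t<..1} = {} | (S - {z} Un q ` {0..<t}) Int q ` {t<..1} ~= {}"
  proof (cases "t = 1")
   case False
   then have "q 1:q ` {t<..1}" using t by auto
   moreover have "q 1 ~= z" using t False inj_onD[OF embedding_inj[OF q(1)], of 1 t] by auto
   ultimately show ?thesis using q(3) by blast
  qed simp
  then have "connectedin X ((S - {z}) Un q ` {0..<t} Un q ` {t<..1})" using connectedin_add[OF 1 A(2)] by blast
  moreover have "S Un ?Q - {z} = (S - {z}) Un q ` {0..<t} Un q ` {t<..1}" using arc_minus[OF q(1) t(1,2)] t(3) by auto
  ultimately show ?thesis by simp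
 next
  case False
  then have "S Un ?Q - {z} = (S - {z}) Un ?Q" "q 0:(S - {z}) Int ?Q" using q(2) in01 by auto
  then show ?thesis using connectedin_Un[OF cyc_minus[OF S] Qc] by (metis empty_iff)
 qed
 show "EX a:S Un ?Q. EX b:S Un ?Q. a ~= b" using q01 in01 by blast
qed

text \<open>Without an interior point of \<open>q\<close>, the two remaining pieces hang on the ends
  of \<open>r\<close>; without an end, two half-open arcs are left that share the other end.\<close>

lemma cycle_minus_aux:
 assumes q: "emb {0..1::real} X q" "emb {0..1::real} X r"
  and e: "q 0 = r 0" "q 1 = r 1" "q ` {0..1} Int r ` {0..1} <= {q 0, q 1}"
  and z: "z:q ` {0..1}"
 shows "connectedin X (q ` {0..1} Un r ` {0..1} - {z})"
proof -
 obtain t where t: "0 <= t" "t <= 1" "z = q t" using z by auto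
 have A: "connectedin X (q ` {0..<t})" "connectedin X (q ` {t<..1})"
  using t by (auto intro!: embedding_connected[OF q(1)])
 have Rc: "connectedin X (r ` {0..1})" by (rule embedding_connected[OF q(2)]) auto
 have inj: "q u = q v \<longleftrightarrow> u = v" if "u:{0..1}" "v:{0..1}" for u v
  using inj_onD[OF embedding_inj[OF q(1)]] that by blast
 consider "t = 0" | "t = 1" | "0 < t" "t < 1" using t by linarith
 then show ?thesis
 proof cases
  case 1
  have "r ` {0..1} - {r 0} = r ` {0<..1}" using arc_minus[OF q(2), of 0] by simp
  moreover have "q ` {0..1} - {q 0} = q ` {0<..1}" using arc_minus[OF q(1), of 0] by simp
  moreover have "z = q 0" "z = r 0" using 1 t e by auto
  ultimately have "q ` {0..1} Un r ` {0..1} - {z} = q ` {0<..1} Un r ` {0<..1}" by (metis Un_Diff)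
  moreover have "connectedin X (q ` {0<..1})" "connectedin X (r ` {0<..1})"
   by (auto intro!: embedding_connected[OF q(1)] embedding_connected[OF q(2)])
  moreover have "q 1:q ` {0<..1} Int r ` {0<..1}"
   using imageI[of 1 "{0<..1::real}" r] imageI[of 1 "{0<..1::real}" q] e(2) by auto
  then have "q ` {0<..1} Int r ` {0<..1} ~= {}" by blast
  ultimately show ?thesis using connectedin_Un[of X "q ` {0<..1}" "r ` {0<..1}"] by simp
 next
  case 2
  have "r ` {0..1} - {r 1} = r ` {0..<1}" using arc_minus[OF q(2), of 1] by simp
  moreover have "q ` {0..1} - {q 1} = q ` {0..<1}" using arc_minus[OF q(1), of 1] by simp
  moreover have "z = q 1" "z = r 1" using 2 t e by auto
  ultimately have "q ` {0..1} Un r ` {0..1} - {z} = q ` {0..<1} Un r ` {0..<1}" by (metis Un_Diff)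
  moreover have "connectedin X (q ` {0..<1})" "connectedin X (r ` {0..<1})"
   by (auto intro!: embedding_connected[OF q(1)] embedding_connected[OF q(2)])
  moreover have "q 0:q ` {0..<1} Int r ` {0..<1}"
   using imageI[of 0 "{0..<1::real}" r] imageI[of 0 "{0..<1::real}" q] e(1) by auto
  then have "q ` {0..<1} Int r ` {0..<1} ~= {}" by blast
  ultimately show ?thesis using connectedin_Un[of X "q ` {0..<1}" "r ` {0..<1}"] by simp
 next
  case 3
  have "z ~= q 0" "z ~= q 1" using 3 t inj[of t 0] inj[of t 1] by auto
  then have zr: "z ~: r ` {0..1}" using e(3) z by blast
  have "q 0:r ` {0..1}" "q 1:r ` {0..1}"
   using imageI[of 0 "{0..1::real}" r] imageI[of 1 "{0..1::real}" r] e(1,2) by auto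
  then have "r ` {0..1} Int q ` {0..<t} ~= {}" "r ` {0..1} Int q ` {t<..1} ~= {}" using 3 by force+
  then have "connectedin X (r ` {0..1} Un q ` {0..<t} Un q ` {t<..1})" by (intro connectedin_add A Rc disjI2) auto
  moreover have "q ` {0..1} Un r ` {0..1} - {z} = r ` {0..1} Un (q ` {0..1} - {z})" using zr by blast
  then have "q ` {0..1} Un r ` {0..1} - {z} = r ` {0..1} Un q ` {0..<t} Un q ` {t<..1}"
   unfolding t(3) arc_minus[OF q(1) t(1,2)] by blast
  ultimately show ?thesis by simp
 qed
qed

lemma cyc_cycle:
 assumes H: "Hausdorff_space X"
  and q: "emb {0..1::real} X q" "emb {0..1::real} X r"
  and e: "q 0 = r 0" "q 1 = r 1" "q ` {0..1} Int r ` {0..1} <= {q 0, q 1}"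
 shows "cyc X (q ` {0..1} Un r ` {0..1})" unfolding cyc_def
proof (intro conjI allI)
 have c: "connectedin X (q ` {0..1})" "connectedin X (r ` {0..1})"
  by (auto intro!: embedding_connected[OF q(1)] embedding_connected[OF q(2)])
 have q01: "q 0 ~= q 1" using inj_onD[OF embedding_inj[OF q(1)], of 0 1] by auto
 have in01: "q 0:q ` {0..1}" "q 1:q ` {0..1}" by auto
 have in0r: "q 0:r ` {0..1}" unfolding e(1) by simp
 show cc: "connectedin X (q ` {0..1} Un r ` {0..1})" using connectedin_Un[OF c] in01(1) in0r by blast
 show "closedin X (q ` {0..1} Un r ` {0..1})" using arc_closed[OF H q(1)] arc_closed[OF H q(2)] by (intro closedin_Un) auto
 show "connectedin X (q ` {0..1} Un r ` {0..1} - {z})" for z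
 proof -
  consider "z:q ` {0..1}" | "z:r ` {0..1}" | "q ` {0..1} Un r ` {0..1} - {z} = q ` {0..1} Un r ` {0..1}" by blast
  then show ?thesis
  proof cases
   case 1
   then show ?thesis using cycle_minus_aux[OF q e] by blast
  next
   case 2
   have "r ` {0..1} Int q ` {0..1} <= {r 0, r 1}" using e by auto
   from cycle_minus_aux[OF q(2,1) e(1,2)[symmetric] this 2] show ?thesis by (simp add: Un_commute)
  next
   case 3
   then show ?thesis using cc by simp
  qed
 qed
 show "EX a:q ` {0..1} Un r ` {0..1}. EX b:q ` {0..1} Un r ` {0..1}. a ~= b" using q01 in01 by blast
qed

text \<open>Let \<open>h a\<close> be the last point of \<open>S\<close> before the missing point
  \<open>h t\<close>. Each earlier \<open>h z\<close> would cut \<open>h a\<close> off from whatever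
  lies outside the arc piece, so \<open>S\<close> is confined to the piece from \<open>z\<close> to
  \<open>t\<close>; letting \<open>z\<close> tend to \<open>a\<close> leaves only the point
  \<open>h a\<close>.\<close>

lemma cyc_arc_aux:
 fixes s t :: real
 assumes H: "Hausdorff_space X" and S: "cyc X S"
  and h: "emb {0<..<1::real} X h" "openin X (h ` {0<..<1})"
  and st: "0 < s" "s < t" "t < 1" "h s:S"
 shows "h t:S"
proof (rule ccontr)
 assume tn: "h t ~: S"
 have he: "emb {s..t} X h" by (rule embedding_map_restrict[OF h(1)]) (use st in auto)
 let ?K = "{u:{s..t}. h u:S}"
 have "compact ?K" by (rule embedding_preimage_compact[OF he _ cyc_closed[OF S]]) simp
 moreover have "s:?K" using st by simp
 then have "?K ~= {}" by blast
 ultimately obtain a where a: "a:?K" "!!u. u:?K ==> u <= a" using compact_attains_sup[of ?K] by blast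
 have at: "a < t" using a(1) tn by (cases "a = t") auto
 have inj: "h u = h v ==> u = v" if "u:{0<..<1}" "v:{0<..<1}" for u v
  using inj_onD[OF embedding_inj[OF h(1)]] that by blast
 \<comment> \<open>\<open>S - {h z}\<close> contains neither of the boundary points
   \<open>h z\<close> and \<open>h t\<close>, so the open piece between them and the outside of the
   closed piece would disconnect it.\<close>
 have sub: "S <= h ` {z..<t}" if z: "0 < z" "z < a" for z
 proof -
  have op: "openin X (h ` {z<..<t})"
  proof -
   have "openin (top_of_set {0<..<1}) {z<..<t}" using z st by (intro open_subset) auto
   then have "openin (subtopology X (h ` {0<..<1})) (h ` {z<..<t})" by (rule embedding_openin[OF h(1)])
   then show ?thesis using h(2) openin_trans_full by blast
  qed
  have cl: "closedin X (h ` {z..t})" using z st at by (intro arc_closed[OF H h(1)]) auto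
  have "S - {h z} <= h ` {z<..<t}"
  proof (rule connectedin_two_opens[OF cyc_minus[OF S, of "h z"] op, of "topspace X - h ` {z..t}" "h a"])
   show "openin X (topspace X - h ` {z..t})" using cl by blast
   show "S - {h z} <= h ` {z<..<t} Un (topspace X - h ` {z..t})"
   proof
    fix y assume y: "y:S - {h z}"
    show "y:h ` {z<..<t} Un (topspace X - h ` {z..t})"
    proof (cases "y:h ` {z..t}")
     case True
     then obtain u where u: "z <= u" "u <= t" "y = h u" by auto
     then have "u ~= z" "u ~= t" using y tn by auto
     then show ?thesis using u by auto
    next
     case False
     then show ?thesis using y cyc_sub[OF S] by auto
    qed
   qed
   show "h ` {z<..<t} Int (topspace X - h ` {z..t}) Int (S - {h z}) = {}" by auto
   show "h a:h ` {z<..<t}" using z at by auto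
   show "h a:S - {h z}" using a(1) inj[of a z] z at st by auto
  qed
  moreover have "h z:h ` {z..<t}" using z at by auto
  moreover have "h ` {z<..<t} <= h ` {z..<t}" by auto
  ultimately show ?thesis by blast
 qed
 have "y = h a" if y: "y:S" for y
 proof -
  have sa: "s <= a" using a(1) by auto
  then have "y:h ` {a/2..<t}" using sub[of "a/2"] st y by auto
  then obtain u where u: "a/2 <= u" "u < t" "y = h u" by auto
  have u0: "0 < u" using u(1) sa st by simp
  have "a <= u"
  proof (rule ccontr)
   assume "~ a <= u"
   then have ua: "u < (u + a)/2" "(u + a)/2 < a" by auto
   then have "y:h ` {(u+a)/2..<t}" using sub[of "(u+a)/2"] u0 y by auto
   then obtain v where v: "(u + a)/2 <= v" "v < t" "y = h v" by auto
   then have "u = v" using inj[of u v] u u0 ua st by auto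
   then show False using v ua by simp
  qed
  then have "u:?K" using u y sa by auto
  then show ?thesis using a(2)[of u] \<open>a <= u\<close> u by auto
 qed
 then show False using cyc_other[OF S, of "h a"] by auto
qed

lemma cyc_arc:
 assumes H: "Hausdorff_space X" and S: "cyc X S"
  and h: "emb {0<..<1::real} X h" "openin X (h ` {0<..<1})"
 shows "h ` {0<..<1} <= S | h ` {0<..<1} Int S = {}"
proof (rule ccontr)
 assume "~ ?thesis"
 then obtain s t where st: "s:{0<..<1}" "h s:S" "t:{0<..<1}" "h t ~: S" by blast
 then consider "s < t" | "t < s" by (metis linorder_neqE_linordered_idom)
 then show False
 proof cases
  case 1
  then show False using cyc_arc_aux[OF H S h, of s t] st by auto
 next
  case 2
  let ?r = "%u. h (1 + (-1) * u)"
  have im: "(%u::real. 1 + (-1) * u) ` {0<..<1} = {0<..<1}"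
  proof (intro set_eqI iffI)
   fix u :: real assume "u:{0<..<1}"
   then show "u:(%u. 1 + (-1) * u) ` {0<..<1}" by (intro image_eqI[of _ _ "1 - u"]) auto
  qed auto
  have "emb {0<..<1} (top_of_set {0<..<1}) (%u::real. 1 + (-1) * u)"
   by (rule embedding_map_affine) (simp, unfold im, rule order_refl)
  then have r: "emb {0<..<1} X ?r" using embedding_map_compose[OF _ h(1)] by (auto simp: o_def)
  have "?r ` {0<..<1} = h ` {0<..<1}" using im by (metis image_image)
  then have "openin X (?r ` {0<..<1})" using h(2) by simp
  from cyc_arc_aux[OF H S r this, of "1 - s" "1 - t"] 2 st show False by auto
 qed
qed

section \<open>Cyclic sets in a graph\<close>

context graph_space
begin

lemma ray_open_arc: "ray X x C h ==> emb {0<..<1} X h"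
 by (rule embedding_map_restrict[of "{0..<1}"]) (auto simp: ray_def)

lemma cyc_branch:
 assumes "cyc X S" "x:topspace X" "C:branches X x"
 shows "C <= S | C Int S = {}"
proof -
 obtain h where h: "ray X x C h" using br_ray[OF assms(2,3)] by blast
 have C: "h ` {0<..<1} = C" using h by (simp add: ray_def)
 show ?thesis using cyc_arc[OF Haus_X assms(1) ray_open_arc[OF h]] br_open[OF assms(2,3)] C by simp
qed

text \<open>If \<open>C'\<close> is not in \<open>S\<close>, then \<open>S\<close> has a dead end at
  \<open>z\<close>: removing \<open>h (1/2)\<close> detaches the stretch around \<open>z\<close>
  from \<open>h (3/4)\<close>.\<close>

lemma cyc_nonessential_aux:
 assumes S: "cyc X S" and z: "z:S" and C: "C:branches X z" "C':branches X z"
  and N: "nnb z = insert z (C Un C')" and sub: "C <= S"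
 shows "C' <= S"
proof (rule ccontr)
 assume "~ C' <= S"
 have zt: "z:topspace X" using z cyc_sub[OF S] by blast
 have dis: "C' Int S = {}" using cyc_branch[OF S zt C(2)] \<open>~ C' <= S\<close> by blast
 obtain h where h: "ray X z C h" using br_ray[OF zt C(1)] by blast
 have emb: "emb {0..<1} X h" and h0: "h 0 = z" and hC: "h ` {0<..<1} = C" using h by (auto simp: ray_def)
 obtain U where U: "openin X U" "z:U" "U Int C <= h ` ({0<..<1/2} Int {0<..<1})"
  using ray_germ[OF h, of "1/2"] by auto
 have "openin (top_of_set {0<..<1}) {0<..<1/2::real}" by (intro open_subset) auto
 then have "openin (subtopology X C) (h ` {0<..<1/2})" using embedding_openin[OF ray_open_arc[OF h]] hC by simp
 then have op: "openin X (h ` {0<..<1/2})" using br_open[OF zt C(1)] openin_trans_full by blast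
 have cl: "closedin X (h ` {0..1/2})" by (rule arc_closed[OF Haus_X emb]) auto
 let ?E = "(U Int nnb z) Un h ` {0<..<1/2}"
 have inE: "y:h ` {0..1/2}" if "y:?E" "y:S" for y
 proof -
  have "y = z | y:h ` {0<..<1/2}" using that U(3) dis unfolding N by (auto simp: subset_iff)
  then show ?thesis using h0 by force
 qed
 have "S - {h (1/2)} <= ?E"
 proof (rule connectedin_two_opens[OF cyc_minus[OF S, of "h (1/2)"], of ?E "topspace X - h ` {0..1/2}" z])
  show "openin X ?E" using U(1) nnb_open[OF zt] op by blast
  show "openin X (topspace X - h ` {0..1/2})" using cl by blast
  show "S - {h (1/2)} <= ?E Un (topspace X - h ` {0..1/2})"
  proof
   fix y assume y: "y:S - {h (1/2)}"
   show "y:?E Un (topspace X - h ` {0..1/2})"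
   proof (cases "y:h ` {0..1/2}")
    case True
    then obtain u where u: "0 <= u" "u <= 1/2" "y = h u" by auto
    have "u ~= 1/2"
    proof
     assume a: "u = 1/2"
     show False using y unfolding u(3) a by blast
    qed
    then show ?thesis using u h0 U(2) N by (cases "u = 0") auto
   next
    case False
    then show ?thesis using y cyc_sub[OF S] by auto
   qed
  qed
  show "?E Int (topspace X - h ` {0..1/2}) Int (S - {h (1/2)}) = {}" using inE by blast
  have "h (1/2):C" using hC by force
  then show "z:S - {h (1/2)}" using z br_notin[OF zt C(1)] by auto
  show "z:?E" using U(2) N by auto
 qed
 moreover have "h (3/4):S - {h (1/2)}"
 proof -
  have "h (3/4):C" using hC by force
  then show ?thesis using sub inj_onD[OF embedding_inj[OF emb], of "3/4" "1/2"] by auto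
 qed
 ultimately have "h (3/4):h ` {0..1/2}" using inE by blast
 then obtain u where "0 <= u" "u <= 1/2" "h (3/4) = h u" by auto
 then show False using inj_onD[OF embedding_inj[OF emb], of "3/4" u] by auto
qed

text \<open>\<open>S\<close> contains one of the two branches, since otherwise \<open>z\<close>
  would be isolated in it; one branch forces the other.\<close>

lemma cyc_nonessential:
 assumes S: "cyc X S" and z: "z:S" "z ~: essential_vertices X"
 shows "nnb z <= S"
proof -
 have zt: "z:topspace X" using z cyc_sub[OF S] by blast
 have "card (branches X z) = 2" using essential_iff[OF Haus_X nnb[OF zt]] z(2) by (simp add: branches_eq)
 then obtain C C' where C: "branches X z = {C, C'}" by (auto simp: card_2_iff)
 have N: "nnb z = insert z (C Un C')" "nnb z = insert z (C' Un C)" using nnb_eq[OF zt] C by auto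
 have br: "C:branches X z" "C':branches X z" using C by auto
 have "C <= S | C' <= S"
 proof (rule ccontr)
  assume "~ ?thesis"
  then have d: "C Int S = {}" "C' Int S = {}" using cyc_branch[OF S zt] br by blast+
  have "S <= nnb z"
  proof (rule connectedin_two_opens[OF cyc_conn[OF S] nnb_open[OF zt], of "topspace X - {z}" z])
   show "openin X (topspace X - {z})"
    by (meson Haus_X Hausdorff_imp_t1_space closedin_t1_singleton openin_diff openin_topspace zt)
   show "S <= nnb z Un (topspace X - {z})" using cyc_sub[OF S] N by auto
   show "nnb z Int (topspace X - {z}) Int S = {}" using d N by auto
  qed (use z N in auto)
  then have "S <= {z}" using d N by auto
  then show False using cyc_other[OF S, of z] by auto
 qed
 then have "C <= S & C' <= S"
  using cyc_nonessential_aux[OF S z(1) br N(1)] cyc_nonessential_aux[OF S z(1) br(2,1) N(2)] by blast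
 then show ?thesis using N z by auto
qed

text \<open>Finitely many normal neighbourhoods cover the graph, and a cyclic set is determined by
  the centres and the branches that it contains.\<close>

lemma finite_cyc: "finite {S. cyc X S}"
proof -
 have "EX \<F>. finite \<F> & \<F> <= nnb ` topspace X & topspace X <= \<Union>\<F>"
 proof -
  have "ALL U:nnb ` topspace X. openin X U" using nnb_open by blast
  moreover have "topspace X <= \<Union>(nnb ` topspace X)" using nnb_eq by blast
  ultimately show ?thesis using compact_X unfolding compact_space_alt by meson
 qed
 then obtain \<F> where "finite \<F>" "\<F> <= nnb ` topspace X" "topspace X <= \<Union>\<F>" by (elim exE conjE)
 then obtain F where F: "finite F" "F <= topspace X" "topspace X <= \<Union>(nnb ` F)" by (metis finite_subset_image)
 let ?B = "\<Union>(branches X ` F)"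
 have finB: "finite ?B" using F br_finite by blast
 have eq: "S = (S Int F) Un \<Union>{C:?B. C <= S}" if S: "cyc X S" for S
 proof
  show "S <= (S Int F) Un \<Union>{C:?B. C <= S}"
  proof
   fix y assume y: "y:S"
   then have "y:topspace X" using cyc_sub[OF S] by blast
   then obtain x where x: "x:F" "y:nnb x" using F(3) by blast
   then have xt: "x:topspace X" using F(2) by blast
   show "y:(S Int F) Un \<Union>{C:?B. C <= S}"
   proof (cases "y = x")
    case False
    then obtain C where C: "C:branches X x" "y:C" using x(2) nnb_eq[OF xt] by blast
    then have "C <= S" using cyc_branch[OF S xt C(1)] y by blast
    then show ?thesis using C x(1) by blast
   qed (use y x in blast)
  qed
 qed blast
 have "inj_on (%S. (S Int F, {C:?B. C <= S})) {S. cyc X S}"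
 proof (rule inj_onI)
  fix S T assume "S:{S. cyc X S}" "T:{S. cyc X S}" "(S Int F, {C:?B. C <= S}) = (T Int F, {C:?B. C <= T})"
  then show "S = T" using eq[of S] eq[of T] by (metis (no_types, lifting) mem_Collect_eq prod.inject)
 qed
 moreover have "(%S. (S Int F, {C:?B. C <= S})) ` {S. cyc X S} <= Pow F \<times> Pow ?B" by blast
 ultimately show ?thesis using F(1) finB by (meson finite_Pow_iff finite_SigmaI inj_on_finite)
qed

lemma cyc_in_cblock:
 assumes "cyc X S" shows "EX T. cblock X T & S <= T"
proof -
 obtain T where "T:{S. cyc X S}" "S <= T" "ALL T':{S. cyc X S}. T <= T' --> T = T'"
  using finite_has_maximal2[OF finite_cyc, of S] assms by auto
 then show ?thesis unfolding cblock_def by blast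
qed

lemma finite_cblock: "finite {S. cblock X S}"
 using finite_cyc by (rule finite_subset[rotated]) (auto simp: cblock_def)

lemma open_minus_point: "openin X U ==> openin X (U - {z})"
proof (cases "z:topspace X")
 case True
 assume "openin X U"
 then show ?thesis using closedin_Hausdorff_singleton[OF Haus_X True] by (rule openin_diff)
next
 case False
 assume U: "openin X U"
 then have "U - {z} = U" using openin_subset False by blast
 then show ?thesis using U by simp
qed

lemma locally_path_connected_X: "locally_path_connected_space X"
 unfolding locally_path_connected_space_def neighbourhood_base_of
proof (intro allI impI)
 fix U x assume U: "openin X U & x:U"
 then have x: "x:topspace X" using openin_subset by blast
 have "EX V Q. path_connectedin X V & x:V & V <= U & openin X Q & x:Q & Q Int C <= V" if C: "C:branches X x" for C
 proof -
  obtain h where h: "ray X x C h" using br_ray[OF x C] by blast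
  have emb: "emb {0..<1} X h" and h0: "h 0 = x" using h by (auto simp: ray_def)
  obtain d where d: "0 < d" "d <= 1" "h ` {0..<d} <= U" using ray_small[OF h, of U] U by auto
  obtain Q where Q: "openin X Q" "x:Q" "Q Int C <= h ` ({0<..<d} Int {0<..<1})" using ray_germ[OF h d(1)] by auto
  have "path_connectedin (top_of_set {0..<1}) {0..<d}"
   using d by (auto simp: path_connectedin_subtopology convex_imp_path_connected)
  then have "path_connectedin X (h ` {0..<d})"
   using path_connectedin_continuous_map_image[OF embedding_cont[OF emb]] by blast
  moreover have "x:h ` {0..<d}" using h0 d by force
  moreover have "Q Int C <= h ` {0..<d}" using Q(3) by force
  ultimately show ?thesis using Q d by blast
 qed
 then obtain V Q where VQ: "!!C. C:branches X x ==>
  path_connectedin X (V C) & x:V C & V C <= U & openin X (Q C) & x:Q C & Q C Int C <= V C" by metis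
 let ?V = "\<Union>(insert {x} (V ` branches X x))" and ?Q = "\<Inter>(insert (nnb x) (Q ` branches X x))"
 have "openin X ?Q" using br_finite[OF x] VQ nnb_open[OF x] by (intro openin_Inter) auto
 moreover have "path_connectedin X ?V" using VQ x by (intro path_connectedin_Union) auto
 moreover have "x:?Q" using VQ nnb_eq[OF x] by auto
 moreover have "?Q <= ?V"
 proof
  fix y assume y: "y:?Q"
  then have "y:nnb x" by blast
  then consider "y = x" | C where "C:branches X x" "y:C" using nnb_eq[OF x] by auto
  then show "y:?V"
  proof cases
   case (2 C)
   then have "y:Q C" using y by blast
   then have "y:V C" using VQ[OF 2(1)] 2(2) by blast
   then show ?thesis using 2(1) by blast
  qed simp
 qed
 moreover have "?V <= U" using VQ U by blast
 ultimately show "EX Q V. openin X Q & path_connectedin X V & x:Q & Q <= V & V <= U" by blast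
qed

text \<open>By local path connectedness, a path component and its complement in \<open>U\<close> are
  both open.\<close>

lemma open_component:
 assumes U: "openin X U" "y:U"
 obtains P where "openin X P" "openin X (U - P)" "y:P" "P <= U" "path_connectedin X P"
proof -
 let ?P = "path_component_of_set (subtopology X U) y"
 have l: "locally_path_connected_space (subtopology X U)"
  using locally_path_connected_space_open_subset[OF locally_path_connected_X U(1)] .
 have top: "topspace (subtopology X U) = U" using openin_subset[OF U(1)] by auto
 have 1: "openin X ?P"
  using openin_path_component_of_locally_path_connected_space[OF l] openin_trans_full[OF _ U(1)] by blast
 have "openin (subtopology X U) (topspace (subtopology X U) - ?P)"
  using closedin_path_component_of_locally_path_connected_space[OF l] by blast
 then have 2: "openin X (U - ?P)" using top openin_trans_full[OF _ U(1)] by metis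
 have pc: "path_connectedin (subtopology X U) ?P" by (rule path_connectedin_path_component_of)
 then have 3: "path_connectedin X ?P" "?P <= U" by (auto simp: path_connectedin_subtopology)
 have "y:?P" using U top by (simp add: path_component_of_refl)
 then show thesis using that 1 2 3 by blast
qed

lemma split_component:
 assumes "x:topspace X" "y:topspace X" "y ~= x"
 obtains K L where "split X x K L" "y:K" "path_connectedin X K"
proof -
 have U: "openin X (topspace X - {x})" "y:topspace X - {x}" using open_minus_point assms by auto
 obtain P where "openin X P" "openin X ((topspace X - {x}) - P)" "y:P" "P <= topspace X - {x}" "path_connectedin X P"
  using open_component[OF U] .
 then show thesis using that[of P "(topspace X - {x}) - P"] by (auto simp: split_def)
qed

lemma split_notin: "split X x K L ==> x ~: K"
 by (auto simp: split_def)

end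

text \<open>The realization in Euclidean space serves \<open>arc_exists\<close>: there, path
  connected sets are arcwise connected.\<close>

locale spatial_graph = graph_space +
 assumes embeds: "EX G::(real ^ 3) set. X homeomorphic_space top_of_set G"
begin

lemma arc_exists:
 assumes U: "path_connectedin X U" "a:U" "b:U" "a ~= b"
 obtains q where "emb {0..1::real} X q" "q ` {0..1} <= U" "q 0 = a" "q 1 = b"
proof -
 obtain G :: "(real ^ 3) set" and k k' where k: "homeomorphic_maps X (top_of_set G) k k'"
  using embeds by (auto simp: homeomorphic_space_def)
 have Ut: "U <= topspace X" using U(1) path_connectedin_subset_topspace by blast
 have ck: "continuous_map X (top_of_set G) k" and ck': "continuous_map (top_of_set G) X k'"
  and kk: "!!x. x:topspace X ==> k' (k x) = x" and kk': "!!g. g:G ==> k (k' g) = g"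
  using k by (auto simp: homeomorphic_maps_def)
 have "path_connectedin (top_of_set G) (k ` U)" by (rule path_connectedin_continuous_map_image[OF ck U(1)])
 then have "path_connected (k ` U)" and kG: "k ` U <= G" by (auto simp: path_connectedin_subtopology)
 moreover have "k a ~= k b" using kk Ut U(2-4) by (metis subsetD)
 ultimately obtain g where g: "arc g" "path_image g <= k ` U" "pathstart g = k a" "pathfinish g = k b"
  using path_connected_arcwise[of "k ` U"] U by (meson imageI)
 have gG: "g t:G" "g t:k ` U" if "t:{0..1}" for t
 proof -
  have "g t:path_image g" using that by (simp add: path_image_def)
  then show "g t:k ` U" using g(2) by blast
  then show "g t:G" using kG by blast
 qed
 have "continuous_map (top_of_set {0..1}) (top_of_set G) g" using g(1) gG by (auto simp: arc_def path_def)
 then have cont: "continuous_map (top_of_set {0..1}) X (k' \<circ> g)" using ck' continuous_map_compose by blast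
 have inj: "inj_on (k' \<circ> g) {0..1}"
 proof (rule inj_onI)
  fix s t :: real assume st: "s:{0..1}" "t:{0..1}" "(k' \<circ> g) s = (k' \<circ> g) t"
  have e: "k (k' (g s)) = k (k' (g t))" using st(3) by simp
  have "g s = g t" using e unfolding kk'[OF gG(1)[OF st(1)]] kk'[OF gG(1)[OF st(2)]] .
  moreover have "inj_on g {0..1}" using g(1) by (simp add: arc_def)
  ultimately show "s = t" using st(1,2) inj_onD[of g "{0..1}" s t] by blast
 qed
 have "emb {0..1} X (k' \<circ> g)"
  by (rule continuous_imp_embedding_map[OF cont _ Haus_X]) (use inj in \<open>auto simp: compact_space_subtopology\<close>)
 moreover have "(k' \<circ> g) ` {0..1} <= U"
 proof
  fix y assume "y:(k' \<circ> g) ` {0..1}"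
  then obtain t where t: "t:{0..1}" "y = k' (g t)" by auto
  then obtain u where "u:U" "g t = k u" using gG(2)[OF t(1)] by blast
  then show "y:U" using t kk[of u] Ut by auto
 qed
 moreover have "(k' \<circ> g) 0 = a" "(k' \<circ> g) 1 = b"
  using g(3,4) kk[of a] kk[of b] U Ut by (auto simp: pathstart_def pathfinish_def)
 ultimately show thesis using that by blast
qed

lemma arc_path_connected:
 assumes "emb A X q" "{a..b::real} <= A"
 shows "path_connectedin X (q ` {a..b})"
proof -
 have "path_connectedin (top_of_set A) {a..b}"
  using assms(2) by (auto simp: path_connectedin_subtopology convex_imp_path_connected)
 then show ?thesis using path_connectedin_continuous_map_image[OF embedding_cont[OF assms(1)]] by blast
qed

text \<open>
  An arc that reaches a branch \<open>C\<close> of \<open>x\<close> from \<open>r\<close> without passing through \<open>x\<close> can be prolonged to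
  \<open>x\<close> in such a way that it arrives along \<open>C\<close>.
\<close>

lemma prolong_arc:
 assumes x: "x:topspace X" and C: "C:branches X x" and P: "path_connectedin X P" "C <= P" "x ~: P" "r:P"
 obtains q d Q where "emb {0..1::real} X q" "q 0 = x" "q 1 = r" "0 < d" "d <= 1" "q ` {0<..<d} <= C"
  "openin X Q" "x:Q" "q ` {0..1} Int Q <= insert x C"
proof -
 obtain h where h: "ray X x C h" using br_ray[OF x C] by blast
 have emb: "emb {0..<1} X h" and h0: "h 0 = x" and hC: "h ` {0<..<1} = C" using h by (auto simp: ray_def)
 have hh: "h (1/2):C" using hC by force
 have inA: "h ` {0..1/2} <= insert x C"
 proof
  fix y assume "y:h ` {0..1/2}"
  then obtain u where "0 <= u" "u <= 1/2" "y = h u" by auto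
  then show "y:insert x C" using h0 hC by (cases "u = 0") auto
 qed
 \<comment> \<open>\<open>B\<close> joins the midpoint of the ray to \<open>r\<close> inside
   \<open>P\<close>. As it is closed and misses \<open>x\<close>, any arc from \<open>x\<close> in
   the union of \<open>B\<close> and the half ray has to start along the ray.\<close>
 obtain B where B: "closedin X B" "path_connectedin X B" "h (1/2):B" "r:B" "B <= P"
 proof (cases "h (1/2) = r")
  case True
  have "r:topspace X" using P path_connectedin_subset_topspace by blast
  then show thesis using that[of "{r}"] P True Haus_X by (auto simp: closedin_Hausdorff_singleton)
 next
  case False
  have "h (1/2):P" using hh P(2) by blast
  then obtain q where q: "emb {0..1::real} X q" "q ` {0..1} <= P" "q 0 = h (1/2)" "q 1 = r"
   using arc_exists[OF P(1) _ P(4) False] by blast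
  have "q 0:q ` {0..1}" "q 1:q ` {0..1}" by auto
  then show thesis using that[of "q ` {0..1}"] q arc_closed[OF Haus_X q(1)] arc_path_connected[OF q(1)] by auto
 qed
 have "path_connectedin X (h ` {0..1/2} Un B)"
 proof (rule path_connectedin_Un)
  show "path_connectedin X (h ` {0..1/2})" by (rule arc_path_connected[OF emb]) auto
  have "h (1/2):h ` {0..1/2}" by auto
  then show "h ` {0..1/2} Int B ~= {}" using B(3) by blast
 qed (rule B(2))
 moreover have "x:h ` {0..1/2} Un B" using h0 by force
 moreover have "x ~= r" using P by blast
 ultimately obtain q where q: "emb {0..1::real} X q" "q ` {0..1} <= h ` {0..1/2} Un B" "q 0 = x" "q 1 = r"
  using arc_exists[of "h ` {0..1/2} Un B" x r] B(4) by blast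
 let ?Q = "topspace X - B"
 have Q: "openin X ?Q" "x:?Q" using B P x by auto
 obtain d where d: "0 < d" "d <= 1" "q ` {0..<d} <= ?Q" using embedding_small[OF q(1), of 0 1 ?Q] Q q(3) by auto
 have "q ` {0<..<d} <= C"
 proof
  fix y assume "y:q ` {0<..<d}"
  then obtain t where t: "0 < t" "t < d" "y = q t" by auto
  then have "y:?Q" using d by (auto simp: image_subset_iff)
  moreover have "y:h ` {0..1/2} Un B" using q(2) t d by (auto simp: image_subset_iff)
  ultimately have "y:insert x C" using inA by blast
  moreover have "y ~= x" using t d q(3) inj_onD[OF embedding_inj[OF q(1)], of t 0] by auto
  ultimately show "y:C" by blast
 qed
 moreover have "q ` {0..1} Int ?Q <= insert x C" using q(2) inA by blast
 ultimately show thesis using that q d Q by blast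
qed

text \<open>An arc that leaves \<open>x\<close> along \<open>C\<close> and returns to
  \<open>S\<close> elsewhere can be added to \<open>S\<close>. By maximality it lies in
  \<open>S\<close> already, and with it \<open>C\<close>.\<close>

lemma cblock_branch:
 assumes S: "cblock X S" and x: "x:S" and C: "C:branches X x"
  and ns: "!!K L. split X x K L ==> S - {x} <= K ==> C <= K"
 shows "C <= S"
proof -
 note cS = cblock_cyc[OF S]
 have xt: "x:topspace X" using x cyc_sub[OF cS] by blast
 obtain r where r: "r:S" "r ~= x" using cyc_other[OF cS] by blast
 then obtain K L where K: "split X x K L" "r:K" "path_connectedin X K"
  using split_component[OF xt] cyc_sub[OF cS] by blast
 have "S - {x} <= K" using split_connected[OF K(1) cyc_minus[OF cS] _ _ K(2)] r by blast
 then have "C <= K" using ns K(1) by blast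
 then obtain q d where q: "emb {0..1::real} X q" "q 0 = x" "q 1 = r" "0 < d" "d <= 1" "q ` {0<..<d} <= C"
  using prolong_arc[OF xt C K(3) _ split_notin[OF K(1)] K(2)] by metis
 have "cyc X (S Un q ` {0..1})" using cyc_add_arc[OF Haus_X cS q(1)] q x r by simp
 then have "S Un q ` {0..1} = S" using cblockD[OF S] by blast
 moreover have "q (d/2):C" "q (d/2):q ` {0..1}" using q by auto
 ultimately have "q (d/2):C Int S" by blast
 then show ?thesis using cyc_branch[OF cS xt C] by blast
qed

text \<open>If \<open>x\<close> does not separate the two blocks, an arc avoiding \<open>x\<close>
  joins them. Their union with this arc has no cut point, as a removed point other than
  \<open>x\<close> leaves them joined at \<open>x\<close>.\<close>

lemma cblock_join:
 assumes S: "cblock X S" and S': "cblock X S'" and x: "x:S" "x:S'"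
  and ns: "!!K L. split X x K L ==> S - {x} <= K ==> S' - {x} <= K"
 shows "S = S'"
proof -
 note cS = cblock_cyc[OF S] and cS' = cblock_cyc[OF S']
 have xt: "x:topspace X" using x cyc_sub[OF cS] by blast
 obtain r where r: "r:S" "r ~= x" using cyc_other[OF cS] by blast
 obtain r' where r': "r':S'" "r' ~= x" using cyc_other[OF cS'] by blast
 obtain K L where K: "split X x K L" "r:K" "path_connectedin X K"
  using split_component[OF xt] cyc_sub[OF cS] r by blast
 have "S - {x} <= K" using split_connected[OF K(1) cyc_minus[OF cS] _ _ K(2)] r by blast
 then have "S' - {x} <= K" using ns K(1) by blast
 then have r'K: "r':K" using r' by blast
 show ?thesis
 proof (cases "r = r'")
  case True
  then show ?thesis using cblock_eqI[OF S S', of x r] r r' x by blast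
 next
  case False
  obtain q where q: "emb {0..1::real} X q" "q ` {0..1} <= K" "q 0 = r" "q 1 = r'"
   using arc_exists[OF K(3,2) r'K False] by blast
  let ?Q = "q ` {0..1}"
  have xQ: "x ~: ?Q" using q(2) split_notin[OF K(1)] by blast
  have Qc: "connectedin X ?Q" by (rule embedding_connected[OF q(1)]) auto
  have inQ: "r:?Q" "r':?Q" using q(3,4) by force+
  have "cyc X (S Un S' Un ?Q)" unfolding cyc_def
  proof (intro conjI allI)
   show "closedin X (S Un S' Un ?Q)"
    using cyc_closed[OF cS] cyc_closed[OF cS'] arc_closed[OF Haus_X q(1)] by (intro closedin_Un) auto
   have SS: "connectedin X (S Un S')" using cyc_conn[OF cS] cyc_conn[OF cS'] x by (intro connectedin_Un) auto
   then show full: "connectedin X (S Un S' Un ?Q)" using connectedin_Un[OF _ Qc, of "S Un S'"] inQ r by auto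
   show "connectedin X (S Un S' Un ?Q - {z})" for z
   proof (cases "z = x")
    case True
    have e: "S Un S' Un ?Q - {z} = ((S - {z}) Un ?Q) Un (S' - {z})" using True xQ by blast
    have "r:(S - {z}) Int ?Q" "r':((S - {z}) Un ?Q) Int (S' - {z})" using inQ r r' True by auto
    then have ne: "(S - {z}) Int ?Q ~= {}" "((S - {z}) Un ?Q) Int (S' - {z}) ~= {}" by blast+
    show ?thesis unfolding e
     by (rule connectedin_Un[OF connectedin_Un[OF cyc_minus[OF cS] Qc ne(1)] cyc_minus[OF cS'] ne(2)])
   next
    case False
    have SSz: "connectedin X ((S - {z}) Un (S' - {z}))"
     using connectedin_Un[OF cyc_minus[OF cS] cyc_minus[OF cS'], of z z] x False by blast
    show ?thesis
    proof (cases "z:?Q")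
     case True
     then obtain t where t: "0 <= t" "t <= 1" "z = q t" by auto
     have A: "connectedin X (q ` {0..<t})" "connectedin X (q ` {t<..1})"
      using t by (auto intro!: embedding_connected[OF q(1)])
     have 0: "q ` {0..<t} = {} | ((S - {z}) Un (S' - {z})) Int q ` {0..<t} ~= {}"
     proof (cases "t = 0")
      case False
      then have "q 0:q ` {0..<t}" using t by auto
      moreover have "q 0 ~= z" using t False inj_onD[OF embedding_inj[OF q(1)], of 0 t] by auto
      ultimately show ?thesis using q(3) r by blast
     qed simp
     have 1: "q ` {t<..1} = {} | ((S - {z}) Un (S' - {z}) Un q ` {0..<t}) Int q ` {t<..1} ~= {}"
     proof (cases "t = 1")
      case False
      then have "q 1:q ` {t<..1}" using t by auto
      moreover have "q 1 ~= z" using t False inj_onD[OF embedding_inj[OF q(1)], of 1 t] by auto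
      ultimately show ?thesis using q(4) r' by blast
     qed simp
     have "connectedin X ((S - {z}) Un (S' - {z}) Un q ` {0..<t} Un q ` {t<..1})"
      using connectedin_add[OF connectedin_add[OF SSz A(1) 0] A(2) 1] .
     moreover have "S Un S' Un ?Q - {z} = (S - {z}) Un (S' - {z}) Un q ` {0..<t} Un q ` {t<..1}"
      using arc_minus[OF q(1) t(1,2)] t(3) by auto
     ultimately show ?thesis by simp
    next
     case False
     then have "S Un S' Un ?Q - {z} = ((S - {z}) Un (S' - {z})) Un ?Q" by blast
     moreover have "r:((S - {z}) Un (S' - {z})) Int ?Q" using r inQ False by auto
     ultimately show ?thesis using connectedin_Un[OF SSz Qc] by (metis empty_iff)
    qed
   qed
   show "EX a:S Un S' Un ?Q. EX b:S Un S' Un ?Q. a ~= b" using x r by blast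
  qed
  then show ?thesis using cblockD[OF S] cblockD[OF S'] by blast
 qed
qed

text \<open>An arc starting along \<open>C\<close> ends in \<open>C'\<close>. The ray along
  \<open>C'\<close> up to its first point on this arc, together with the part of the arc up to
  there, forms a circle containing pieces of both branches.\<close>

lemma branches_in_cblock:
 assumes x: "x:topspace X" and C: "C:branches X x" "C':branches X x" "C ~= C'"
  and ns: "!!K L. split X x K L ==> C <= K ==> C' <= K"
 shows "EX S. cblock X S & x:S & C <= S & C' <= S"
proof -
 obtain h where h: "ray X x C' h" using br_ray[OF x C(2)] by blast
 have emb: "emb {0..<1} X h" and h0: "h 0 = x" and hC: "h ` {0<..<1} = C'" using h by (auto simp: ray_def)
 obtain u where u: "u:C" using br_nonempty[OF x C(1)] by blast
 then have "u:topspace X" "u ~= x" using br_top[OF x C(1)] br_notin[OF x C(1)] by auto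
 then obtain K L where K: "split X x K L" "u:K" "path_connectedin X K" using split_component[OF x] by blast
 have CK: "C <= K" using split_connected[OF K(1) br_conn[OF x C(1)] br_notin[OF x C(1)] u K(2)] .
 then have "C' <= K" using ns K(1) by blast
 moreover have hh: "h (1/2):C'" using hC by force
 ultimately have "h (1/2):K" by blast
 then obtain q d Q where q: "emb {0..1::real} X q" "q 0 = x" "q 1 = h (1/2)" "0 < d" "d <= 1" "q ` {0<..<d} <= C"
  and Q: "openin X Q" "x:Q" "q ` {0..1} Int Q <= insert x C"
  using prolong_arc[OF x C(1) K(3) CK split_notin[OF K(1)]] by metis
 obtain e where e: "0 < e" "e <= 1" "h ` {0..<e} <= Q" using ray_small[OF h Q(1,2)] by auto
 have disj: "C Int C' = {}" using br_disj[OF x C(1,2)] C(3) by blast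
 have no: "h t ~: q ` {0..1}" if t: "0 < t" "t < e" for t
 proof
  assume "h t:q ` {0..1}"
  moreover have "h t:Q" using e(3) t by (auto simp: image_subset_iff)
  ultimately have "h t:insert x C" using Q(3) by blast
  moreover have "h t:C'" using hC t e by force
  ultimately show False using disj br_notin[OF x C(2)] by blast
 qed
 \<comment> \<open>Parameters at which the ray along \<open>C'\<close> hits the arc. There are none
   between 0 and \<open>e\<close>, and the positive lower bound discards the trivial hit at
   \<open>x\<close>; the minimum with \<open>1/2\<close> keeps the parameter \<open>1/2\<close>
   available.\<close>
 let ?T = "{t:{min e (1/2)..1/2}. h t:q ` {0..1}}"
 have "compact ?T"
  by (rule embedding_preimage_compact[OF embedding_map_restrict[OF emb] _ arc_closed[OF Haus_X q(1)]]) (use e in auto)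
 moreover have "1/2:?T" using imageI[of 1 "{0..1::real}" q] q(3) by simp
 ultimately obtain b where b: "b:?T" "!!t. t:?T ==> b <= t" using compact_attains_inf[of ?T] by blast
 have b0: "0 < b" "b <= 1/2" using b(1) e by auto
 obtain \<tau> where \<tau>: "\<tau>:{0..1}" "q \<tau> = h b" using b(1) by auto
 have hb: "h b:C'" using hC b0 by force
 then have "h b ~= x" using br_notin[OF x C(2)] by blast
 then have \<tau>0: "0 < \<tau>" using \<tau> q(2) by (cases "\<tau> = 0") auto
 have first: "h t ~: q ` {0..1}" if t: "0 < t" "t < b" for t
 proof
  assume a: "h t:q ` {0..1}"
  then have "e <= t" using no[OF t(1)] by linarith
  then have "t:?T" using a t b0 by auto
  then show False using b(2) t by fastforce
 qed
 let ?q = "%t. q (0 + (\<tau> - 0) * t)" and ?h = "%t. h (0 + (b - 0) * t)"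
 have 1: "emb {0..1} X ?q" "?q ` {0..1} = q ` {0..\<tau>}" using embedding_subarc[OF q(1) \<tau>0] \<tau> by auto
 have bsub: "{0..b} <= {0..<1}" using b0 by auto
 have 2: "emb {0..1} X ?h" "?h ` {0..1} = h ` {0..b}" by (rule embedding_subarc[OF emb b0(1) bsub])+
 have "?q ` {0..1} Int ?h ` {0..1} <= {?q 0, ?q 1}"
 proof
  fix y assume "y:?q ` {0..1} Int ?h ` {0..1}"
  then have y: "y:q ` {0..\<tau>}" "y:h ` {0..b}" using 1(2) 2(2) by auto
  then obtain t where t: "0 <= t" "t <= b" "y = h t" by auto
  have "y:q ` {0..1}" using y(1) \<tau>(1) by auto
  then have "t = 0 | t = b" using first[of t] t by force
  then show "y:{?q 0, ?q 1}" using t(3) h0 q(2) \<tau>(2) by auto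
 qed
 then have cy: "cyc X (?q ` {0..1} Un ?h ` {0..1})"
  by (intro cyc_cycle[OF Haus_X 1(1) 2(1)]) (use q(2) h0 \<tau>(2) in auto)
 let ?Z = "?q ` {0..1} Un ?h ` {0..1}"
 have "h b:?Z" unfolding 2(2) using b0 by auto
 then have "C' <= ?Z" using cyc_branch[OF cy x C(2)] hb by blast
 moreover have "C <= ?Z"
 proof -
  let ?s = "min \<tau> (d/2)"
  have "q ?s:C" using q(4,6) \<tau>0 by (auto simp: image_subset_iff)
  moreover have "q ?s:?Z" unfolding 1(2) using \<tau>0 q(4) by auto
  ultimately show ?thesis using cyc_branch[OF cy x C(1)] by blast
 qed
 moreover have "x:?Z" unfolding 1(2) using q(2) \<tau>0 by force
 moreover obtain S where "cblock X S" "?Z <= S" using cyc_in_cblock[OF cy] by blast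
 ultimately show ?thesis by blast
qed

end


section \<open>Points of the graph that no point of \<open>D\<close> separates\<close>

locale big_graph = marked_graph X D + spatial_graph X for X :: "'a topology" and D :: "'a set" +
 assumes three: "EX d:D. d ~= a & d ~= b"
begin

text \<open>The image of the arc need not be open in \<open>X\<close>. But near an interior point
  the arc runs inside a branch, where it covers everything between two of its points, and such a
  stretch is open.\<close>

lemma arc_meets_D:
 assumes q: "emb {0..1::real} X q" and t: "0 <= t1" "t1 < t2" "t2 <= 1"
 shows "EX \<tau>:{t1<..<t2}. q \<tau>:D"
proof (rule ccontr)
 assume no: "~ ?thesis"
 define t0 where "t0 = (t1 + t2) / 2"
 have t0: "t1 < t0" "t0 < t2" using t by (auto simp: t0_def)
 let ?z = "q t0"
 have zt: "?z:topspace X" using embedding_into[OF q] t0 t by auto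
 have aff: "(%t. t0 + (t2 - t0) * t) ` {0..<1} <= {0..1}"
 proof -
  have "(%t. t0 + (t2 - t0) * t) ` {0..<1} <= (%t. t0 + (t2 - t0) * t) ` {0..1}" by (rule image_mono) auto
  then show ?thesis using affine_image_closed[OF t0(2)] t0 t by auto
 qed
 have r: "ray X ?z (q ` {t0<..<t2}) (%t. q (t0 + (t2 - t0) * t))"
  using ray_reparam[OF q _ aff] t0 affine_image_right[OF t0(2)] by auto
 interpret nz: nnbhd X ?z "nnb ?z" by (rule nnbhd_nnb[OF zt])
 obtain B U where B: "B:branches X ?z" and U: "openin X U" "?z:U" "U Int q ` {t0<..<t2} <= B"
  using nz.germ_into[OF r] unfolding branches_eq by blast
 obtain e where e: "0 < e" "e <= t2 - t0" "q ` {t0..<t0 + e} <= U"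
  using embedding_small[OF q _ t0(2) U(1,2)] t0 t by auto
 let ?A = "q ` {t0<..<t0 + e}"
 have AB: "?A <= B"
 proof
  fix y assume "y:?A"
  then obtain u where u: "t0 < u" "u < t0 + e" "y = q u" by auto
  then have "y:U" "y:q ` {t0<..<t2}" using e by (auto simp: image_subset_iff)
  then show "y:B" using U(3) by blast
 qed
 have Ac: "connectedin X ?A" by (rule embedding_connected[OF q]) (use t0 t e in auto)
 obtain h where h: "ray X ?z B h" using br_ray[OF zt B] by blast
 have hB: "h ` {0<..<1} = B" using h by (simp add: ray_def)
 have opI: "openin X (h ` {a<..<b})" if "0 <= a" "b <= 1" for a b
 proof -
  have "openin (top_of_set {0<..<1}) {a<..<b}" using that by (intro open_subset) auto
  then have "openin (subtopology X B) (h ` {a<..<b})" using embedding_openin[OF ray_open_arc[OF h]] hB by simp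
  then show ?thesis using br_open[OF zt B] openin_trans_full by blast
 qed
 have injh: "h u = h v \<longleftrightarrow> u = v" if "u:{0<..<1}" "v:{0<..<1}" for u v
  using inj_onD[OF embedding_inj[OF ray_open_arc[OF h]]] that by blast
 have "q (t0 + e/3):?A" "q (t0 + e/2):?A" using e by auto
 then obtain u v where uv: "u:{0<..<1}" "v:{0<..<1}" "h u:?A" "h v:?A" "h u ~= h v"
 proof -
  assume m: "q (t0 + e/3):?A" "q (t0 + e/2):?A"
  then have "q (t0 + e/3):h ` {0<..<1}" "q (t0 + e/2):h ` {0<..<1}" using AB hB by blast+
  moreover have "q (t0 + e/3) ~= q (t0 + e/2)"
   using inj_onD[OF embedding_inj[OF q], of "t0 + e/3" "t0 + e/2"] t0 t e by auto
  ultimately show thesis using that m by (metis imageE)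
 qed
 have "EX u v. u < v & u:{0<..<1} & v:{0<..<1} & h u:?A & h v:?A" using uv by (metis linorder_neqE_linordered_idom)
 then obtain u v where uv: "u < v" "u:{0<..<1}" "v:{0<..<1}" "h u:?A" "h v:?A" by blast
 \<comment> \<open>Leaving out a point \<open>h s\<close> between them would disconnect the piece
   \<open>?A\<close> of the arc, which contains \<open>h u\<close> and \<open>h v\<close>.\<close>
 have sub: "h ` {u<..<v} <= ?A"
 proof
  fix y assume "y:h ` {u<..<v}"
  then obtain s where s: "u < s" "s < v" "y = h s" by auto
  show "y:?A"
  proof (rule ccontr)
   assume ny: "y ~: ?A"
   have "?A <= h ` {0<..<s}"
   proof (rule connectedin_two_opens[OF Ac, of _ "h ` {s<..<1}" "h u"])
    show "openin X (h ` {0<..<s})" "openin X (h ` {s<..<1})" using opI s uv by auto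
    show "?A <= h ` {0<..<s} Un h ` {s<..<1}"
    proof
     fix a assume a: "a:?A"
     then have "a:h ` {0<..<1}" using AB hB by blast
     then obtain w where w: "0 < w" "w < 1" "a = h w" by auto
     then have "w ~= s" using a ny s by auto
     then show "a:h ` {0<..<s} Un h ` {s<..<1}" using w by (cases "w < s") auto
    qed
    have "h ` {0<..<s} Int h ` {s<..<1} = {}" using injh s uv by fastforce
    then show "h ` {0<..<s} Int h ` {s<..<1} Int ?A = {}" by blast
    show "h u:h ` {0<..<s}" using uv s by auto
   qed (rule uv(4))
   then have "h v:h ` {0<..<s}" using uv(5) by (rule subsetD)
   then obtain w where "0 < w" "w < s" "h v = h w" by auto
   then show False using injh[of v w] uv s by auto
  qed
 qed
 have "h ` {u<..<v} ~= {}" using uv(1) by (metis image_is_empty greaterThanLessThan_empty_iff not_le)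
 then obtain d where "d:h ` {u<..<v}" "d:D" using D_meets[OF opI[of u v]] uv by auto
 then have "d:?A" "d:D" using sub by auto
 then obtain \<tau> where "t0 < \<tau>" "\<tau> < t0 + e" "q \<tau>:D" by auto
 then show False using no t0 e by auto
qed

text \<open>Otherwise a third point of \<open>D\<close> would separate them for a trivial reason:
  removing it leaves two open sides, the path component of \<open>y\<close> and the rest.\<close>

lemma same_component:
 assumes y: "y:topspace X" "y':topspace X"
  and ns: "!!x K L. x:D - {y, y'} ==> split X x K L ==> y:K ==> y':K"
 shows "EX P. path_connectedin X P & y:P & y':P"
proof -
 obtain d where d: "d:D" "d ~= y" "d ~= y'" using three by blast
 obtain P where P: "openin X P" "openin X (topspace X - P)" "y:P" "P <= topspace X" "path_connectedin X P"
  using open_component[OF openin_topspace y(1)] .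
 have "split X d (P - {d}) ((topspace X - P) - {d})" using P open_minus_point by (auto simp: split_def)
 then have "y':P - {d}" using ns[of d] d P(3) by auto
 then show ?thesis using P by auto
qed

text \<open>Since \<open>q t\<close> does not separate the ends of the arc, there is a detour
  \<open>r\<close> that avoids it. A part of the detour and the part of \<open>q\<close> that it
  bypasses make a circle through \<open>q t\<close>.\<close>

lemma arc_in_cyc:
 assumes q: "emb {0..1::real} X q" and t: "0 < t" "t < 1" and D: "q t:D"
  and ns: "!!x K L. x:D - {q 0, q 1} ==> split X x K L ==> q 0:K ==> q 1:K"
 shows "EX S a b. cblock X S & 0 <= a & a < t & t < b & b <= 1 & q ` {a..b} <= S"
proof -
 let ?z = "q t"
 have inj: "q u = q v \<longleftrightarrow> u = v" if "u:{0..1}" "v:{0..1}" for u v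
  using inj_onD[OF embedding_inj[OF q]] that by blast
 have z: "?z ~= q 0" "?z ~= q 1" "q 0 ~= q 1" using inj t by auto
 have top: "q u:topspace X" if "u:{0..1}" for u using embedding_into[OF q] that by auto
 obtain K L where K: "split X ?z K L" "q 0:K" "path_connectedin X K"
  using split_component[of ?z "q 0"] top t z by auto
 have "q 1:K" using ns[OF _ K(1,2)] D z by blast
 then obtain r where r: "emb {0..1::real} X r" "r ` {0..1} <= K" "r 0 = q 0" "r 1 = q 1"
  using arc_exists[OF K(3,2) _ z(3)] by blast
 have rz: "r s ~= ?z" if "s:{0..1}" for s using subsetD[OF r(2) imageI[OF that]] split_notin[OF K(1)] by auto
 \<comment> \<open>\<open>s0\<close> is the last parameter at which the detour meets the part of
   \<open>q\<close> before \<open>q t\<close>, and \<open>s1\<close> the first one after it at which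
   the part behind is met. Strictly between them the detour avoids \<open>q\<close>.\<close>
 let ?K0 = "{s:{0..1}. r s:q ` {0..t}}"
 have "compact ?K0" by (rule embedding_preimage_compact[OF r(1) _ arc_closed[OF Haus_X q]]) (use t in auto)
 moreover have "0:?K0" using r(3) t by auto
 ultimately obtain s0 where s0: "s0:?K0" "!!s. s:?K0 ==> s <= s0" using compact_attains_sup[of ?K0] by blast
 obtain a where a: "0 <= a" "a <= t" "r s0 = q a" using s0(1) by auto
 have s01: "s0 < 1"
 proof (rule ccontr)
  assume "~ s0 < 1"
  then have "s0 = 1" using s0(1) by auto
  then show False using a r(4) inj[of 1 a] t by auto
 qed
 have at: "a < t" using a rz[of s0] s0(1) by (cases "a = t") auto
 let ?K1 = "{s:{s0..1}. r s:q ` {t..1}}"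
 have "compact ?K1"
  by (rule embedding_preimage_compact[OF embedding_map_restrict[OF r(1)] _ arc_closed[OF Haus_X q]]) (use t s0 in auto)
 moreover have "1:?K1" using r(4) t s01 by auto
 ultimately obtain s1 where s1: "s1:?K1" "!!s. s:?K1 ==> s1 <= s" using compact_attains_inf[of ?K1] by blast
 obtain b where b: "t <= b" "b <= 1" "r s1 = q b" using s1(1) by auto
 have tb: "t < b" using b rz[of s1] s1(1) s0(1) by (cases "b = t") auto
 have s011: "s0 < s1"
 proof (rule ccontr)
  assume "~ s0 < s1"
  then have "s0 = s1" using s1(1) by auto
  then have "q a = q b" using a b by simp
  then show False using inj[of a b] a b at tb t by auto
 qed
 have s1r: "0 <= s0" "s1 <= 1" using s0(1) s1(1) by auto
 let ?q = "%u. q (a + (b - a) * u)" and ?r = "%u. r (s0 + (s1 - s0) * u)"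
 have ab: "a < b" "{a..b} <= {0..1}" using at tb a b by auto
 have ss: "{s0..s1} <= {0..1}" using s1r by auto
 note 1 = embedding_subarc[OF q ab] and 2 = embedding_subarc[OF r(1) s011 ss]
 have "?q ` {0..1} Int ?r ` {0..1} <= {?q 0, ?q 1}"
 proof
  fix p assume "p:?q ` {0..1} Int ?r ` {0..1}"
  then have p: "p:q ` {a..b}" "p:r ` {s0..s1}" unfolding 1(2) 2(2) by auto
  then obtain u s where us: "a <= u" "u <= b" "p = q u" "s0 <= s" "s <= s1" "p = r s" by auto
  show "p:{?q 0, ?q 1}"
  proof (cases "u <= t")
   case True
   then have "p:q ` {0..t}" using us a by auto
   then have "s:?K0" using us s1r by auto
   then have "s = s0" using s0(2) us by fastforce
   then show ?thesis using us a by simp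
  next
   case False
   then have "p:q ` {t..1}" using us b by auto
   then have "s:?K1" using us s1r by auto
   then have "s = s1" using s1(2) us by fastforce
   then show ?thesis using us b by simp
  qed
 qed
 then have "cyc X (?q ` {0..1} Un ?r ` {0..1})" by (intro cyc_cycle[OF Haus_X 1(1) 2(1)]) (use a b in auto)
 then obtain S where "cblock X S" "q ` {a..b} <= S" using cyc_in_cblock unfolding 1(2) by (metis Un_subset_iff)
 then show ?thesis using a(1) at tb b(2) by blast
qed

text \<open>Around each interior parameter the arc stays in one block. Different blocks share at
  most one point, so by connectedness of the interval there is a single block, and it contains the
  ends because it is closed.\<close>

lemma common_cblock:
 assumes y: "y:topspace X" "y':topspace X" "y ~= y'"
  and ns: "!!x K L. x:D - {y, y'} ==> split X x K L ==> y:K ==> y':K"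
 shows "EX S. cblock X S & y:S & y':S"
proof -
 have "EX P. path_connectedin X P & y:P & y':P" by (rule same_component[OF y(1,2)]) (rule ns)
 then obtain P where P: "path_connectedin X P" "y:P" "y':P" by blast
 obtain q where q: "emb {0..1::real} X q" "q ` {0..1} <= P" "q 0 = y" "q 1 = y'" using arc_exists[OF P y(3)] .
 have inj: "q u = q v \<longleftrightarrow> u = v" if "u:{0..1}" "v:{0..1}" for u v
  using inj_onD[OF embedding_inj[OF q(1)]] that by blast
 have top: "q u:topspace X" if "u:{0..1}" for u using embedding_into[OF q(1)] that by auto
 \<comment> \<open>The parameters around which the arc runs in \<open>S\<close>. These sets are
   open, and disjoint for different blocks.\<close>
 define O' where "O' S = {t:{0<..<1}. EX a b. a < t & t < b & 0 <= a & b <= 1 & q ` {a<..<b} <= S}" for S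
 have openO: "open (O' S)" for S unfolding open_dist
 proof
  fix t assume "t:O' S"
  then obtain a b where ab: "a < t" "t < b" "0 <= a" "b <= 1" "q ` {a<..<b} <= S" by (auto simp: O'_def)
  show "EX e>0. ALL s. dist s t < e --> s:O' S"
  proof (intro exI[of _ "min (t - a) (b - t)"] conjI allI impI)
   show "0 < min (t - a) (b - t)" using ab by simp
   fix s assume "dist s t < min (t - a) (b - t)"
   then have s: "a < s" "s < b" by (auto simp: dist_real_def)
   then have "s:{0<..<1}" using ab by auto
   then show "s:O' S" using ab s unfolding O'_def by blast
  qed
 qed
 have cover: "EX S. cblock X S & t:O' S" if t: "t:{0<..<1}" for t
 proof (cases "q t:D")
  case True
  obtain S a b where S: "cblock X S" "0 <= a" "a < t" "t < b" "b <= 1" "q ` {a..b} <= S"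
   using arc_in_cyc[OF q(1) _ _ True] t ns q(3,4) by auto
  have "q ` {a<..<b} <= S" using S(6) by (meson greaterThanLessThan_subseteq_atLeastAtMost_iff image_mono order_refl order_trans)
  then have "t:O' S" using t S by (auto simp: O'_def)
  then show ?thesis using S(1) by blast
 next
  case False
  have zt: "q t:topspace X" using top t by auto
  have ne: "q t ~: essential_vertices X" using False D_ess by blast
  \<comment> \<open>Were \<open>q t\<close> in none of the finitely many closed blocks, a whole
    stretch of the arc would avoid them; but the stretch meets \<open>D\<close>, where
    \<open>arc_in_cyc\<close> gives a block.\<close>
  have "EX S. cblock X S & q t:S"
  proof (rule ccontr)
   assume no: "~ ?thesis"
   let ?U = "topspace X - \<Union>{S. cblock X S}"
   have "closedin X (\<Union>{S. cblock X S})"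
    using finite_cblock cyc_closed[OF cblock_cyc] by (intro closedin_Union) auto
   then have "openin X ?U" by blast
   moreover have "q t:?U" using zt no by blast
   ultimately obtain e where e: "0 < e" "e <= 1 - t" "q ` {t..<t + e} <= ?U"
    using embedding_small[OF q(1), of t 1 ?U] t by auto
   obtain u where u: "t < u" "u < t + e" "q u:D" using arc_meets_D[OF q(1), of t "t + e"] t e by auto
   then have u1: "0 < u" "u < 1" using t e by auto
   have "EX S a b. cblock X S & 0 <= a & a < u & u < b & b <= 1 & q ` {a..b} <= S"
    by (rule arc_in_cyc[OF q(1) u1 u(3)]) (use ns q(3,4) in auto)
   then obtain S a b where S: "cblock X S" "a < u" "u < b" "q ` {a..b} <= S" by (elim exE conjE)
   then have "q u:S" by auto
   moreover have "q u:?U" using u e(3) by (auto simp: image_subset_iff)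
   ultimately show False using S(1) by blast
  qed
  then obtain S where S: "cblock X S" "q t:S" by blast
  have N: "nnb (q t) <= S" using cyc_nonessential[OF cblock_cyc[OF S(1)] S(2) ne] .
  have zN: "q t:nnb (q t)" using nnb_eq[OF zt] by blast
  have cl: "closedin X (topspace X - nnb (q t))" using nnb_open[OF zt] by blast
  have "openin (top_of_set {0..1}) {s:{0..1}. q s:nnb (q t)}"
   using openin_continuous_map_preimage[OF embedding_cont[OF q(1)] nnb_open[OF zt]] by simp
  then obtain T where T: "open T" "{s:{0..1}. q s:nnb (q t)} = {0..1} Int T" unfolding openin_open by blast
  have "t:{s:{0..1}. q s:nnb (q t)}" using t zN by simp
  then have "t:T" unfolding T(2) by blast
  then obtain e where e: "0 < e" "ball t e <= T" using openE[OF T(1)] by blast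
  let ?a = "max 0 (t - e)" and ?b = "min 1 (t + e)"
  have "q ` {?a<..<?b} <= S"
  proof
   fix p assume "p:q ` {?a<..<?b}"
   then obtain s where s: "?a < s" "s < ?b" "p = q s" by auto
   then have "s:{0..1} Int T" using e(2) by (auto simp: subset_iff dist_real_def)
   then have "s:{s:{0..1}. q s:nnb (q t)}" using T(2) by blast
   then show "p:S" using N s by auto
  qed
  moreover have "?a < t" "t < ?b" "0 <= ?a" "?b <= 1" using t e by auto
  ultimately have "t:O' S" unfolding O'_def using t by blast
  then show ?thesis using S(1) by blast
 qed
 have disj: "S = S'" if S: "cblock X S" "cblock X S'" and t: "t:O' S" "t:O' S'" for S S' t
 proof -
  obtain a b where ab: "a < t" "t < b" "0 <= a" "b <= 1" "q ` {a<..<b} <= S" using t(1) by (auto simp: O'_def)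
  obtain a' b' where ab': "a' < t" "t < b'" "0 <= a'" "b' <= 1" "q ` {a'<..<b'} <= S'" using t(2) by (auto simp: O'_def)
  define u where "u = (t + min b b') / 2"
  have u: "t < u" "u < b" "u < b'" using ab ab' by (auto simp: u_def min_def)
  have "q t:S Int S'" "q u:S Int S'" using ab ab' u by (auto simp: image_subset_iff)
  moreover have "q t ~= q u" using inj[of t u] ab ab' u by auto
  ultimately show ?thesis using cblock_eqI[OF S] by blast
 qed
 obtain S where S: "cblock X S" "1/2:O' S" using cover[of "1/2"] by auto
 have "O' S Int {0<..<1} = {} | (UN T:{T. cblock X T & T ~= S}. O' T) Int {0<..<1} = {}"
 proof (rule connectedD)
  show "connected {0<..<1::real}" by simp
  show "O' S Int (UN T:{T. cblock X T & T ~= S}. O' T) Int {0<..<1} = {}" using disj S(1) by blast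
  show "{0<..<1} <= O' S Un (UN T:{T. cblock X T & T ~= S}. O' T)"
  proof
   fix t :: real assume "t:{0<..<1}"
   then obtain T where "cblock X T" "t:O' T" using cover by blast
   then show "t:O' S Un (UN T:{T. cblock X T & T ~= S}. O' T)" by (cases "T = S") auto
  qed
 qed (use openO in auto)
 moreover have "1/2:O' S Int {0<..<1}" using S(2) by simp
 ultimately have none: "(UN T:{T. cblock X T & T ~= S}. O' T) Int {0<..<1} = {}" by blast
 have inS: "q t:S" if t: "t:{0<..<1}" for t
 proof -
  obtain T where T: "cblock X T" "t:O' T" using cover[OF t] by blast
  then have "T = S" using none t by blast
  then show ?thesis using T(2) by (auto simp: O'_def image_subset_iff)
 qed
 have "compact {s:{0..1}. q s:S}"
  by (rule embedding_preimage_compact[OF q(1) _ cyc_closed[OF cblock_cyc[OF S(1)]]]) simp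
 then have "closed {s:{0..1}. q s:S}" by (rule compact_imp_closed)
 moreover have "{0<..<1} <= {s:{0..1}. q s:S}" using inS by auto
 ultimately have "closure {0<..<1} <= {s:{0..1}. q s:S}" by (rule closure_minimal[rotated])
 then have "{0..1} <= {s:{0..1}. q s:S}" by simp
 then have "0:{s:{0..1}. q s:S}" "1:{s:{0..1}. q s:S}" by (rule subsetD, simp)+
 then show ?thesis using S(1) q(3,4) by auto
qed

section \<open>The members of the amalgam\<close>

text \<open>The condition on the branch concerns points with a central edge; without one the branch
  is empty and the condition holds.\<close>

definition member :: "'a list => 'a set => (('a list => 'a) \<times> 'a set) set" where
 "member t S = {m:M. (ALL w:words (D Int S). fst m (act t w):S) & snd m <= S}"

text \<open>The copies at the two ends of the edge are glued along the ends at \<open>x\<close>, so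
  their parts over \<open>K\<close> have to be taken together to give a clopen set.\<close>

definition csep :: "'a list => 'a => 'a set => (('a list => 'a) \<times> 'a set) set" where
 "csep w x K = {m:M. fst m w:K | fst m (nbr w x):K | central (fst m) w x & snd m <= K}"

lemma words_sub: "w:words (D Int S) ==> w:W"
 using words_mono[of "D Int S" D] by blast

lemma words_Int_iff: "w:words (D Int S) \<longleftrightarrow> w:W & set w <= S"
 by (auto simp: words_def)

text \<open>Cut \<open>v\<close> at the letter outside \<open>S\<close> that is traversed first. The
  projection just before it lies in \<open>S\<close>, hence differs from this letter, and
  \<open>pointing\<close> governs the rest of the walk.\<close>

lemma member_out_aux:
 assumes m: "m:M" "!!w. w:words (D Int S) ==> fst m (act t w):S" and t: "t:W" and v: "v:W" "~ set v <= S"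
 shows "fst m (act t v) = hd v" "y:D ==> ~ central (fst m) (act t v) y"
proof -
 have "EX x:set v. x ~: S" using v(2) by blast
 then obtain v1 x v2 where x: "v = v1 @ x # v2" "x ~: S" "ALL z:set v2. ~ z ~: S"
  using split_list_last_prop[of v "%x. x ~: S"] by blast
 have v2: "v2:words (D Int S)" using x v(1) words_append2[of "v1 @ [x]" v2 D] by (auto simp: words_Int_iff)
 have u: "v1 @ [x]:W" using words_append1[of "v1 @ [x]" v2 D] v(1) x(1) by simp
 have rW: "act t v2:W" using t words_sub[OF v2] by simp
 have e: "act t v = act (act t v2) (v1 @ [x])" unfolding x(1) using act_append[of t "v1 @ [x]" v2] by simp
 have nl: "fst m (act t v2) ~= last (v1 @ [x])" using m(2)[OF v2] x(2) by auto
 have hd: "hd v = hd (v1 @ [x])" using x(1) by (cases v1) auto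
 show "fst m (act t v) = hd v" unfolding e hd by (rule pointing[OF m(1) rW u _ nl]) simp
 show "~ central (fst m) (act t v) y" if "y:D" unfolding e by (rule not_central_beyond[OF m(1) rW u _ nl that]) simp
qed

lemma
 assumes "m:member t S" "t:W" "v:W" "~ set v <= S"
 shows member_out: "fst m (act t v) = hd v"
  and member_not_central: "y:D ==> ~ central (fst m) (act t v) y"
 using member_out_aux(1)[of m S t v] member_out_aux(2)[of m S t v y] assms by (auto simp: member_def)

lemma member_sub: "member t S <= M"
 by (auto simp: member_def)

lemma member_in: "m:member t S ==> w:words (D Int S) ==> fst m (act t w):S"
 by (auto simp: member_def)

text \<open>The words over \<open>D Int S\<close> form a subgroup, so the base vertex may be moved
  within the subtree that they span.\<close>

lemma member_shift:
 assumes "t:W" "v:words (D Int S)"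
 shows "member (act t v) S = member t S"
proof -
 have sub: "member t S <= member (act t v) S" if tv: "t:W" "v:words (D Int S)" for t v
 proof
  fix m assume m: "m:member t S"
  have "fst m (act (act t v) w):S" if w: "w:words (D Int S)" for w
  proof -
   have "act (act t v) w = act t (act v w)" using act_assoc[of t D v w] tv words_sub w by auto
   moreover have "act v w:words (D Int S)" using tv(2) w by simp
   ultimately show ?thesis using member_in[OF m] by simp
  qed
  then show "m:member (act t v) S" using m by (auto simp: member_def)
 qed
 have "act (act t v) (rev v) = act t (act v (rev v))" using act_assoc[of t D v "rev v"] assms words_sub by auto
 also have "act v (rev v) = []" using act_rev[OF assms(2)] .
 finally have e: "act (act t v) (rev v) = t" by simp
 have "act t v:W" using assms words_sub by auto
 then have "member (act t v) S <= member t S" using sub[of "act t v" "rev v"] assms(2) e by auto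
 then show ?thesis using sub[OF assms] by blast
qed

section \<open>The clopen sides of an edge\<close>

lemma csep_sym: "w:W ==> csep (nbr w x) x K = csep w x K"
 using central_sym by (auto simp: csep_def)

text \<open>Off the edge exactly one of the two projections differs from \<open>x\<close>, and it
  decides the side. On the edge the side is that of the branch, which is connected and avoids
  \<open>x\<close>.\<close>

lemma csep_Compl:
 assumes w: "w:W" "x:D" and K: "split X x K L"
 shows "M - csep w x K = csep w x L"
proof (intro set_eqI)
 fix m
 have xt: "x:topspace X" using w D_top by blast
 have KL: "K Int L = {}" "x ~: K" "x ~: L" using K by (auto simp: split_def)
 have w': "nbr w x:W" using w by simp
 show "m:M - csep w x K \<longleftrightarrow> m:csep w x L"
 proof (cases "m:M")
  case m: True
  show ?thesis
  proof (cases "central (fst m) w x")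
   case c: True
   then have e: "fst m w = x" "fst m (nbr w x) = x" by (auto simp: central_def)
   have C: "snd m:branches X x" using M_br[OF m w c] .
   obtain a where a: "a:snd m" using br_nonempty[OF xt C] by blast
   have ax: "a:topspace X" "a ~= x" using a br_top[OF xt C] br_notin[OF xt C] by auto
   have "snd m <= K" if "a:K" using split_connected[OF K br_conn[OF xt C] br_notin[OF xt C] a that] .
   moreover have "snd m <= L" if "a:L"
    using split_connected[OF split_sym[OF K] br_conn[OF xt C] br_notin[OF xt C] a that] .
   ultimately have "(~ snd m <= K) = (snd m <= L)" using split_cases[OF K ax] a KL by blast
   then show ?thesis using m e c KL by (auto simp: csep_def)
  next
   case nc: False
   obtain v where v: "v:W" "fst m v ~= x" "!!K. x ~: K ==> m:csep w x K \<longleftrightarrow> fst m v:K"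
   proof (cases "fst m w = x")
    case True
    then have n: "fst m (nbr w x) ~= x" using nc by (auto simp: central_def)
    show thesis by (rule that[OF w' n]) (use True m nc in \<open>auto simp: csep_def\<close>)
   next
    case False
    then have n: "fst m (nbr w x) = x" using M_cons[OF m w] by blast
    show thesis by (rule that[OF w(1) False]) (use n m nc in \<open>auto simp: csep_def\<close>)
   qed
   have "(fst m v ~: K) = (fst m v:L)" using split_cases[OF K M_top[OF m v(1)] v(2)] KL by blast
   then show ?thesis using v(3)[OF KL(2)] v(3)[OF KL(3)] m by blast
  qed
 qed (auto simp: csep_def)
qed

lemma openin_csep:
 assumes w: "w:W" "x:D" and K: "split X x K L"
 shows "openin RT (csep w x K)"
proof -
 have xt: "x:topspace X" using w D_top by blast
 have oK: "openin X K" using K by (simp add: split_def)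
 have "csep w x K = at_set X D w K Un at_set X D (nbr w x) K Un \<Union>((%C. edge_set X D w x C (topspace X)) ` {C:branches X x. C <= K})"
  (is "_ = ?R")
 proof (intro subset_antisym subsetI)
  fix m assume m: "m:csep w x K"
  then have mM: "m:M" by (simp add: csep_def)
  from m consider "fst m w:K" | "fst m (nbr w x):K" | "central (fst m) w x" "snd m <= K" by (auto simp: csep_def)
  then show "m:?R"
  proof cases
   case 3
   then have "snd m:{C:branches X x. C <= K}" "m:edge_set X D w x (snd m) (topspace X)"
    using M_br[OF mM w] mM by (auto simp: edge_set_def)
   then show ?thesis by blast
  qed (use mM in \<open>auto simp: at_set_def\<close>)
 qed (auto simp: csep_def at_set_def edge_set_def)
 moreover have "openin RT ?R" using openin_at_set[OF w(1) oK] openin_at_set[OF nbr_words[OF w] oK] xt w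
  by (intro openin_Un openin_Union) (auto intro!: openin_edge_set)
 ultimately show ?thesis by simp
qed

lemma closedin_csep:
 assumes w: "w:W" "x:D" and K: "split X x K L"
 shows "closedin RT (csep w x K)"
proof -
 have "openin RT (csep w x L)" by (rule openin_csep[OF w split_sym[OF K]])
 then have "openin RT (topspace RT - csep w x K)" using csep_Compl[OF w K] by simp
 then show ?thesis by (auto simp: closedin_def csep_def)
qed

text \<open>If an end of the edge lies in the subtree of the member, the side is decided by
  \<open>S - {x}\<close>, which is connected. Otherwise the member is constant in the projections at
  both ends of the edge.\<close>

lemma csep_saturated:
 assumes S: "cyc X S" and t: "t:W" and w: "w:W" "x:D" and K: "split X x K L"
 shows "member t S <= csep w x K | member t S Int csep w x K = {}"
proof -
 have xt: "x:topspace X" using w D_top by blast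
 have dis: "csep w x K Int csep w x L = {}" using csep_Compl[OF w K] by blast
 have inT: "member t S <= csep w x K | member t S <= csep w x L"
  if v: "v:words (D Int S)" "w = act t v | nbr w x = act t v" for v
 proof -
  let ?u = "act t v"
  have vW: "v:W" using words_sub[OF v(1)] .
  have u: "?u:W" using t vW by simp
  have eq: "csep w x H = csep ?u x H" for H
  proof (cases "w = ?u")
   case False
   then show ?thesis using csep_sym[OF w(1), of x H] v(2) by simp
  qed simp
  have nu: "nbr ?u x = act t (nbr v x)" using act_nbr[OF t vW w(2)] by simp
  obtain a where a: "a:S" "a ~= x" using cyc_other[OF S] by blast
  have at: "a:topspace X" using a cyc_sub[OF S] by blast
  have K': "S - {x} <= K | S - {x} <= L"
  proof (cases "a:K")
   case True
   then show ?thesis using split_connected[OF K cyc_minus[OF S], of x a] a by blast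
  next
   case False
   then have "a:L" using split_cases[OF K at a(2)] by blast
   then show ?thesis using split_connected[OF split_sym[OF K] cyc_minus[OF S], of x a] a by blast
  qed
  have all: "member t S <= csep ?u x H" if H: "S - {x} <= H" for H
  proof
   fix m assume m: "m:member t S"
   then have mM: "m:M" using member_sub by blast
   have inS: "fst m ?u:S" using member_in[OF m v(1)] .
   show "m:csep ?u x H"
   proof (cases "fst m ?u = x")
    case False
    then show ?thesis using inS H mM by (auto simp: csep_def)
   next
    case ux: True
    then have "x:S" using inS by simp
    then have "nbr v x:words (D Int S)" using v(1) w(2) by simp
    then have n: "fst m (nbr ?u x):S" using member_in[OF m] nu by simp
    show ?thesis
    proof (cases "fst m (nbr ?u x) = x")
     case False
     then show ?thesis using n H mM by (auto simp: csep_def)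
    next
     case True
     then have c: "central (fst m) ?u x" using ux by (simp add: central_def)
     have "x ~: snd m" using br_notin[OF xt M_br[OF mM u w(2) c]] .
     moreover have "snd m <= S" using m by (simp add: member_def)
     ultimately show ?thesis using H c mM by (auto simp: csep_def)
    qed
   qed
  qed
  from K' show ?thesis
  proof
   assume "S - {x} <= K"
   then show ?thesis using all[of K] eq[of K] by simp
  next
   assume "S - {x} <= L"
   then show ?thesis using all[of L] eq[of L] by simp
  qed
 qed
 obtain v where v: "v:W" "w = act t v" using act_surj[OF t w(1)] by auto
 have nv: "nbr w x = act t (nbr v x)" using act_nbr[OF t v(1) w(2)] v(2) by simp
 consider "set v <= S" | "set (nbr v x) <= S" | "~ set v <= S" "~ set (nbr v x) <= S" by blast
 then show ?thesis
 proof cases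
  case 1
  then have "v:words (D Int S)" using v(1) by (simp add: words_Int_iff)
  from inT[OF this disjI1[OF v(2)]] show ?thesis using dis by blast
 next
  case 2
  then have "nbr v x:words (D Int S)" unfolding words_Int_iff using v(1) w(2) by simp
  from inT[OF this disjI2[OF nv]] show ?thesis using dis by blast
 next
  case 3
  have nvW: "nbr v x:W" using v(1) w(2) by simp
  have "m:csep w x K \<longleftrightarrow> hd v:K | hd (nbr v x):K" if m: "m:member t S" for m
   using member_out[OF m t v(1) 3(1)] member_out[OF m t nvW 3(2)] member_not_central[OF m t v(1) 3(1) w(2)]
    member_sub m v(2) nv by (auto simp: csep_def)
  then show ?thesis by blast
 qed
qed

end


section \<open>Ends of the tree and translations of the model\<close>

primrec alt_word :: "'a => 'a => nat => 'a list" where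
 "alt_word z z' 0 = []"
| "alt_word z z' (Suc n) = (if even n then z else z') # alt_word z z' n"

lemma alt_word_length [simp]: "length (alt_word z z' n) = n"
 by (induction n) auto

text \<open>The end of the tree reached from the base vertex through the labels \<open>z\<close>,
  \<open>z'\<close>, \<open>z\<close> and so on: a vertex on this ray points to its successor, any
  other vertex points back towards the base.\<close>

definition end_point :: "'a set => 'a => 'a => ('a list => 'a) \<times> 'a set" where
 "end_point D z z' = ((\<lambda>w\<in>words D. if w = alt_word z z' (length w) then (if even (length w) then z else z') else hd w), {})"

definition shift :: "'a set => 'a list => ('a list => 'a) \<times> 'a set => ('a list => 'a) \<times> 'a set" where
 "shift D r m = ((\<lambda>w\<in>words D. fst m (act r w)), snd m)"

context marked_graph
begin

lemma alt_word_W: "z:D ==> z':D ==> z ~= z' ==> alt_word z z' n:W"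
proof (induction n)
 case (Suc n)
 then show ?case by (cases n) (auto simp: words_Cons)
qed simp

text \<open>Of the two projections at an edge exactly one is its label; so the family is coherent
  and no edge is central.\<close>

lemma end_point_M:
 assumes z: "z:D" "z':D" "z ~= z'"
 shows "end_point D z z':M"
proof -
 let ?l = "%n::nat. if even n then z else z'"
 let ?p = "fst (end_point D z z')"
 have p: "?p w = (if w = alt_word z z' (length w) then ?l (length w) else hd w)" if "w:W" for w
  using that by (simp add: end_point_def)
 have pE: "?p:W \<rightarrow>\<^sub>E topspace X"
 proof (rule PiE_I)
  fix w assume w: "w:W"
  have "hd w:D" if "w ~= []" using w that hd_in_set[of w] by (auto simp: words_def)
  then have "?p w:D" using p[OF w] z by (cases "w = []") auto
  then show "?p w:topspace X" using D_top by blast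
 qed (simp add: end_point_def)
 have c1: "(?p w = x | ?p (x # w) = x) & ~ (?p w = x & ?p (x # w) = x)" if w: "x # w:W" for x w
 proof -
  have w': "w:W" "w = [] | hd w ~= x" using w by (auto simp: words_Cons)
  show ?thesis
  proof (cases "w = alt_word z z' (length w) & x = ?l (length w)")
   case True
   then have "x # w = alt_word z z' (length (x # w))" by simp
   then have "?p (x # w) = ?l (Suc (length w))" using p[OF w] by simp
   moreover have "?p w = x" using p[OF w'(1)] True by simp
   ultimately show ?thesis using True z(3) by auto
  next
   case False
   then have nn: "x # w ~= alt_word z z' (length (x # w))" by auto
   have "?p (x # w) = x" unfolding p[OF w] if_not_P[OF nn] by simp
   moreover have "?p w ~= x" using p[OF w'(1)] False w'(2) by (cases "w = []") auto
   ultimately show ?thesis by blast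
  qed
 qed
 have c: "(?p w = x | ?p (nbr w x) = x) & ~ central ?p w x" if w: "w:W" "x:D" for w x
 proof (cases "w ~= [] & hd w = x")
  case True
  then have e: "w = x # tl w" "nbr w x = tl w" by (auto simp: nbr_def)
  then show ?thesis using c1[of x "tl w"] w unfolding central_def by metis
 next
  case False
  then have "nbr w x = x # w" "x # w:W" using w by (auto simp: nbr_def words_Cons)
  then show ?thesis using c1[of x w] unfolding central_def by metis
 qed
 have "snd (end_point D z z') = {}" by (simp add: end_point_def)
 then show ?thesis using pE c unfolding rpoints_def by (auto simp: case_prod_beta)
qed

lemma end_point_Nil: "fst (end_point D z z') [] = z"
 by (simp add: end_point_def)

lemma shift_coord: "w:W ==> fst (shift D r m) w = fst m (act r w)"
 by (simp add: shift_def)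

lemma shift_central: "w:W ==> x:D ==> r:W ==> central (fst (shift D r m)) w x \<longleftrightarrow> central (fst m) (act r w) x"
 by (simp add: central_def shift_coord act_nbr[of r D w x])

lemma shift_M:
 assumes m: "m:M" and r: "r:W"
 shows "shift D r m:M"
proof -
 let ?p = "fst (shift D r m)"
 have "?p:W \<rightarrow>\<^sub>E topspace X" using M_top[OF m] r by (auto simp: shift_def)
 moreover have "?p w = x | ?p (nbr w x) = x" if w: "w:W" "x:D" for w x
  using M_cons[OF m, of "act r w" x] r w by (auto simp: shift_coord act_nbr[of r D w x])
 moreover have "snd (shift D r m):branches X x" if w: "w:W" "x:D" "central ?p w x" for w x
  using M_br[OF m, of "act r w" x] r w by (simp add: shift_central) (simp add: shift_def)
 moreover have "snd (shift D r m) = {}" if nc: "ALL w:W. ALL x:D. ~ central ?p w x"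
 proof -
  have "~ central (fst m) u x" if u: "u:W" "x:D" for u x
  proof -
   obtain v where v: "v:W" "u = act r v" using act_surj[OF r u(1)] by auto
   then show ?thesis using nc u shift_central[OF v(1) u(2) r, of m] by auto
  qed
  then show ?thesis using M_nocentral[OF m] by (simp add: shift_def)
 qed
 ultimately show ?thesis unfolding rpoints_def by (auto simp: case_prod_beta)
qed

lemma shift_shift:
 assumes m: "m:M" and r: "r:W"
 shows "shift D (rev r) (shift D r m) = m"
proof (rule M_ext)
 show "shift D (rev r) (shift D r m):M" using shift_M m r by simp
 show "fst (shift D (rev r) (shift D r m)) w = fst m w" if w: "w:W" for w
  using w r by (simp add: shift_coord act_act_rev[OF r w])
 show "snd (shift D (rev r) (shift D r m)) = snd m" by (simp add: shift_def)
qed (rule m)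

lemma continuous_shift:
 assumes r: "r:W"
 shows "continuous_map RT RT (shift D r)"
proof (rule continuous_map_into_rtop)
 show "shift D r:topspace RT \<rightarrow> M" using shift_M r by auto
 show "openin RT {m:topspace RT. fst (shift D r m) w:U}" if w: "w:W" and U: "openin X U" for w U
 proof -
  have "{m:topspace RT. fst (shift D r m) w:U} = at_set X D (act r w) U"
   using w by (auto simp: at_set_def shift_coord)
  then show ?thesis using openin_at_set[of "act r w" D X U] U w r by simp
 qed
 fix w x C U assume w: "w:W" "x:D" "C:branches X x" "openin X U" "x:U"
 have "{m:topspace RT. fst (shift D r m) w:U Int C | fst (shift D r m) (nbr w x):U Int C |
   central (fst (shift D r m)) w x & snd (shift D r m) = C} = edge_set X D (act r w) x C U"
  using w r by (auto simp: edge_set_def shift_central shift_coord act_nbr[of r D w x]) (auto simp: shift_def)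
 then show "openin RT {m:topspace RT. fst (shift D r m) w:U Int C | fst (shift D r m) (nbr w x):U Int C |
   central (fst (shift D r m)) w x & snd (shift D r m) = C}" using openin_edge_set[of "act r w" D x C X U] w r by simp
qed

lemma homeomorphic_maps_shift:
 assumes r: "r:W"
 shows "homeomorphic_maps RT RT (shift D r) (shift D (rev r))"
 using continuous_shift[OF r] continuous_shift[of "rev r"] shift_shift[OF _ r] shift_shift[of _ "rev r"] r
 by (auto simp: homeomorphic_maps_def)

lemma fibre_nonempty:
 assumes "t:W" "z:D" "z':D" "z ~= z'"
 shows "EX m:M. fst m t = z"
proof -
 let ?m = "shift D (rev t) (end_point D z z')"
 have "?m:M" using shift_M[OF end_point_M] assms by simp
 moreover have "fst ?m t = z" using assms act_rev'[OF assms(1)] by (simp add: shift_coord end_point_Nil)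
 ultimately show ?thesis by blast
qed

text \<open>A point of \<open>S\<close> outside \<open>D\<close> is non-essential, so a
  neighbourhood of it in \<open>X\<close> lies in \<open>S\<close>, and the density of
  \<open>D\<close> in \<open>X\<close> applies.\<close>

lemma cyc_meets_D:
 assumes S: "cyc X S" and U: "openin X U" "y:U Int S"
 shows "U Int S Int D ~= {}"
proof (cases "y:D")
 case False
 have yt: "y:topspace X" using U cyc_sub[OF S] by blast
 have N: "nnb y <= S" using cyc_nonessential[OF S] U False D_ess by blast
 have "openin X (U Int nnb y)" using U(1) nnb_open[OF yt] by blast
 moreover have "U Int nnb y ~= {}" using U nnb_eq[OF yt] by blast
 ultimately show ?thesis using D_meets[of "U Int nnb y"] N by blast
qed (use U in blast)

lemma cyc_two_in_D:
 assumes S: "cyc X S"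
 obtains z z' where "z:S Int D" "z':S Int D" "z ~= z'"
proof -
 obtain a b where ab: "a:S" "b:S" "a ~= b" using S by (auto simp: cyc_def)
 have top: "a:topspace X" "b:topspace X" using ab cyc_sub[OF S] by auto
 obtain U V where UV: "openin X U" "openin X V" "a:U" "b:V" "disjnt U V"
  using Haus_X top ab(3) unfolding Hausdorff_space_def by metis
 obtain z where "z:U Int S Int D" using cyc_meets_D[OF S UV(1), of a] UV ab by blast
 moreover obtain z' where "z':V Int S Int D" using cyc_meets_D[OF S UV(2), of b] UV ab by blast
 ultimately show thesis using that[of z z'] UV(5) by (auto simp: disjnt_def)
qed

end

section \<open>Inseparable points share a member; disjointness, nullness and density of the
  members\<close>

context big_graph
begin

definition inseparable :: "('a list => 'a) \<times> 'a set => ('a list => 'a) \<times> 'a set => bool" where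
 "inseparable m n \<longleftrightarrow> (ALL w:W. ALL x:D. ALL K L. split X x K L --> (m:csep w x K \<longleftrightarrow> n:csep w x K))"

lemma inseparable_sym: "inseparable m n ==> inseparable n m"
 by (auto simp: inseparable_def)

lemma inseparableD: "inseparable m n ==> w:W ==> x:D ==> split X x K L ==> m:csep w x K \<longleftrightarrow> n:csep w x K"
 unfolding inseparable_def by blast

lemma csep_at:
 assumes "m:M" "w:W" "x:D" "split X x K L" "fst m w ~= x"
 shows "m:csep w x K \<longleftrightarrow> fst m w:K"
 using M_cons[OF assms(1-3,5)] split_notin[OF assms(4)] assms(1,5) by (auto simp: csep_def central_def)

lemma csep_at':
 assumes "m:M" "w:W" "x:D" "split X x K L" "fst m (nbr w x) ~= x"
 shows "m:csep w x K \<longleftrightarrow> fst m (nbr w x):K"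
proof -
 have "fst m w = x" using M_cons[OF assms(1) nbr_words[OF assms(2,3)] assms(3,5)] assms(2) by simp
 then show ?thesis using split_notin[OF assms(4)] assms(1,5) by (auto simp: csep_def central_def)
qed

lemma csep_central:
 assumes "m:M" "w:W" "x:D" "split X x K L" "central (fst m) w x"
 shows "m:csep w x K \<longleftrightarrow> snd m <= K"
 using split_notin[OF assms(4)] assms(1,5) by (auto simp: csep_def central_def)

lemma inseparable_cblock:
 assumes "m:M" "n:M" "inseparable m n" "u:W" "fst m u ~= fst n u"
 shows "EX S. cblock X S & fst m u:S & fst n u:S"
proof (rule common_cblock)
 fix x K L assume x: "x:D - {fst m u, fst n u}" and K: "split X x K L" "fst m u:K"
 have "m:csep u x K" using csep_at[OF assms(1,4) _ K(1)] x K(2) by blast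
 then have "n:csep u x K" using inseparableD[OF assms(3,4) _ K(1)] x by blast
 then show "fst n u:K" using csep_at[OF assms(2,4) _ K(1)] x by blast
qed (use assms M_top in auto)

text \<open>If the projections beyond the edge differ, a block \<open>S'\<close> contains
  \<open>z\<close> and that of \<open>m\<close>. Were it different from \<open>S\<close>, then
  \<open>z\<close> would split the two blocks by \<open>cblock_join\<close>, and this edge would
  separate \<open>m\<close> from \<open>n\<close>.\<close>

lemma inseparable_step_aux:
 assumes mn: "m:M" "n:M" "inseparable m n" and S: "cblock X S" and u: "u:W" and z: "z:D" "z:S"
  and mz: "fst m u = z" "fst n u ~= z" "fst n u:S"
 shows "fst m (nbr u z):S & fst n (nbr u z) = z"
proof -
 have nz: "fst n (nbr u z) = z" using M_cons[OF mn(2) u z(1) mz(2)] .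
 have s: "nbr u z:W" using u z by simp
 have "fst m (nbr u z):S"
 proof (cases "fst m (nbr u z) = z")
  case False
  let ?v = "fst m (nbr u z)"
  obtain S' where S': "cblock X S'" "?v:S'" "z:S'" using inseparable_cblock[OF mn s] False nz by auto
  have "S' = S"
  proof (rule cblock_join[OF S'(1) S S'(3) z(2)])
   fix K L assume K: "split X z K L" "S' - {z} <= K"
   then have "?v:K" using S'(2) False by blast
   then have "m:csep u z K" using csep_at'[OF mn(1) u z(1) K(1) False] by blast
   then have "n:csep u z K" using inseparableD[OF mn(3) u z(1) K(1)] by blast
   then have nK: "fst n u:K" using csep_at[OF mn(2) u z(1) K(1) mz(2)] by blast
   show "S - {z} <= K" by (rule split_connected[OF K(1) cyc_minus[OF cblock_cyc[OF S]] _ _ nK]) (use mz in auto)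
  qed
  then show ?thesis using S'(2) by simp
 qed (use z in simp)
 then show ?thesis using nz by simp
qed

text \<open>The disjunction carries the induction. Once both projections point back along the walk
  they do so ever after; while they differ, either both differ from the next label, or
  \<open>inseparable_step_aux\<close> applies.\<close>

lemma inseparable_coords:
 assumes mn: "m:M" "n:M" "inseparable m n" and S: "cblock X S" and t: "t:W"
  and ne: "fst m t ~= fst n t" "fst m t:S" "fst n t:S" and w: "w:words (D Int S)"
 shows "fst m (act t w):S & fst n (act t w):S &
  (fst m (act t w) ~= fst n (act t w) | w ~= [] & fst m (act t w) = hd w & fst n (act t w) = hd w)" using w
proof (induction w)
 case Nil
 then show ?case using ne by simp
next
 case (Cons z w)
 then have z: "z:D" "z:S" "w:words (D Int S)" "w = [] | hd w ~= z" by (auto simp: words_Cons)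
 let ?u = "act t w"
 have u: "?u:W" using t words_sub[OF z(3)] by simp
 have IH: "fst m ?u:S" "fst n ?u:S" "fst m ?u ~= fst n ?u | w ~= [] & fst m ?u = hd w & fst n ?u = hd w"
  using Cons.IH[OF z(3)] by blast+
 have e: "act t (z # w) = nbr ?u z" by simp
 show ?case
 proof (cases "fst m ?u ~= z & fst n ?u ~= z")
  case True
  then show ?thesis using M_cons[OF mn(1) u z(1)] M_cons[OF mn(2) u z(1)] z(2) by simp
 next
  case False
  then have d: "fst m ?u ~= fst n ?u" using IH(3) z(4) by auto
  then consider "fst m ?u = z" "fst n ?u ~= z" | "fst n ?u = z" "fst m ?u ~= z" using False by blast
  then show ?thesis
  proof cases
   case 1
   from inseparable_step_aux[OF mn S u z(1,2) 1 IH(2)] show ?thesis using z(2) by auto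
  next
   case 2
   from inseparable_step_aux[OF mn(2,1) inseparable_sym[OF mn(3)] S u z(1,2) 2 IH(1)] show ?thesis using z(2) by auto
  qed
 qed
qed

text \<open>If \<open>m\<close> has a central edge, it is not central for \<open>n\<close>, since
  otherwise all projections would agree. So \<open>n\<close> is located in \<open>S\<close> off
  \<open>x\<close>, and inseparability puts the branch of \<open>m\<close> on the same side of every
  splitting, as \<open>cblock_branch\<close> requires.\<close>

lemma inseparable_snd:
 assumes mn: "m:M" "n:M" "inseparable m n" and S: "cblock X S" and t: "t:W"
  and m: "!!w. w:words (D Int S) ==> fst m (act t w):S"
  and n: "!!w. w:words (D Int S) ==> fst n (act t w):S"
  and ne: "EX w:W. fst m w ~= fst n w"
 shows "snd m <= S"
proof (cases "EX w:W. EX x:D. central (fst m) w x")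
 case True
 then obtain u x where u: "u:W" "x:D" "central (fst m) u x" by blast
 obtain v where v: "v:W" "u = act t v" using act_surj[OF t u(1)] by auto
 have "set v <= S"
 proof (rule ccontr)
  assume "~ set v <= S"
  from member_out_aux(2)[of m S t v x, OF mn(1) m t v(1) this u(2)] show False using u(3) v(2) by simp
 qed
 then have vS: "v:words (D Int S)" using v(1) by (simp add: words_Int_iff)
 have ux: "fst m u = x" using u(3) by (simp add: central_def)
 then have xS: "x:S" using m[OF vS] v(2) by simp
 have "nbr v x:words (D Int S)" using vS xS u(2) by simp
 then have n2: "fst n (nbr u x):S" using n[of "nbr v x"] act_nbr[OF t v(1) u(2)] v(2) by simp
 have n1: "fst n u:S" using n[OF vS] v(2) by simp
 have "~ central (fst n) u x" using determined_central[OF mn(1,2) u] ne by blast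
 then have nc: "fst n u ~= x | fst n (nbr u x) ~= x" by (auto simp: central_def)
 show ?thesis
 proof (rule cblock_branch[OF S xS M_br[OF mn(1) u]])
  fix K L assume K: "split X x K L" "S - {x} <= K"
  have "n:csep u x K" using nc n1 n2 K(2) mn(2) by (auto simp: csep_def)
  then have "m:csep u x K" using inseparableD[OF mn(3) u(1,2) K(1)] by blast
  then show "snd m <= K" using csep_central[OF mn(1) u(1,2) K(1) u(3)] by blast
 qed
next
 case False
 then show ?thesis using M_nocentral[OF mn(1)] by blast
qed

lemma inseparable_in_member:
 assumes mn: "m:M" "n:M" "inseparable m n" "m ~= n"
 shows "EX t:W. EX S. cblock X S & m:member t S & n:member t S"
proof (cases "EX t:W. fst m t ~= fst n t")
 case True
 then obtain t where t: "t:W" "fst m t ~= fst n t" by blast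
 obtain S where S: "cblock X S" "fst m t:S" "fst n t:S" using inseparable_cblock[OF mn(1-3) t] by blast
 note co = inseparable_coords[OF mn(1-3) S(1) t S(2,3)]
 have "snd m <= S" using inseparable_snd[OF mn(1-3) S(1) t(1)] co True by blast
 moreover have "snd n <= S" using inseparable_snd[OF mn(2,1) inseparable_sym[OF mn(3)] S(1) t(1)] co True by metis
 ultimately have "m:member t S" "n:member t S" using co mn(1,2) by (auto simp: member_def)
 then show ?thesis using t(1) S(1) by blast
next
 case False
 then have eq: "fst m w = fst n w" if "w:W" for w using that by blast
 then have cn: "snd m ~= snd n" using M_ext[OF mn(1,2)] mn(4) by blast
 have ceq: "central (fst m) w x \<longleftrightarrow> central (fst n) w x" if wx: "w:W" "x:D" for w x
  using eq[OF wx(1)] eq[OF nbr_words[OF wx]] by (simp add: central_def)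
 have "EX w:W. EX x:D. central (fst m) w x"
 proof (rule ccontr)
  assume a: "~ ?thesis"
  then have "snd m = {}" using M_nocentral[OF mn(1)] by blast
  moreover have "snd n = {}" using M_nocentral[OF mn(2)] a ceq by blast
  ultimately show False using cn by simp
 qed
 then obtain t x where t: "t:W" "x:D" "central (fst m) t x" by blast
 then have c': "central (fst n) t x" using ceq by blast
 have xt: "x:topspace X" using t D_top by blast
 \<comment> \<open>The two points differ only in their branches at a common central edge, so the
   block comes from a pair of unseparated branches.\<close>
 have "EX S. cblock X S & x:S & snd m <= S & snd n <= S"
 proof (rule branches_in_cblock[OF xt M_br[OF mn(1) t] M_br[OF mn(2) t(1,2) c'] cn])
  fix K L assume K: "split X x K L" "snd m <= K"
  then have "m:csep t x K" using csep_central[OF mn(1) t(1,2) K(1) t(3)] by blast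
  then have "n:csep t x K" using inseparableD[OF mn(3) t(1,2) K(1)] by blast
  then show "snd n <= K" using csep_central[OF mn(2) t(1,2) K(1) c'] by blast
 qed
 then obtain S where S: "cblock X S" "x:S" "snd m <= S" "snd n <= S" by blast
 have x0: "fst m t = x" "fst m (nbr t x) = x" using t(3) by (auto simp: central_def)
 have inS: "fst m (act t w):S" if w: "w:words (D Int S)" for w
 proof -
  have wW: "w:W" and wS: "set w <= S" using w by (auto simp: words_Int_iff)
  consider "w = []" | "w ~= []" "last w ~= x" | w' where "w = w' @ [x]" by (metis append_butlast_last_id)
  then show ?thesis
  proof cases
   case 2
   then show ?thesis using pointing[OF mn(1) t(1) wW] x0(1) wS hd_in_set[of w] by auto
  next
   case 3
   have e: "act t w = act (nbr t x) w'" using 3 by (simp add: act_append)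
   show ?thesis
   proof (cases "w' = []")
    case False
    have w'W: "w':W" using wW 3 words_append1 by blast
    have "last w' ~= x" using wW 3 False by (auto simp: words_def distinct_adj_append_iff)
    then have "fst m (act t w) = hd w'" using pointing[OF mn(1) nbr_words[OF t(1,2)] w'W False] x0(2) e by simp
    then show ?thesis using wS 3 False hd_in_set[of w'] by auto
   qed (use e x0 S in simp)
  qed (use x0 S in simp)
 qed
 have "fst n (act t w):S" if w: "w:words (D Int S)" for w
  using inS[OF w] eq[of "act t w"] t(1) words_sub[OF w] by simp
 then have "m:member t S" "n:member t S" using inS mn S by (auto simp: member_def)
 then show ?thesis using t(1) S(1) by blast
qed

text \<open>At a common point outside \<open>D\<close>, both blocks would contain the same normal
  neighbourhood, hence further common points.\<close>

lemma cblock_Int: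
 assumes S: "cblock X S" "cblock X S'" "S ~= S'" and z: "z:S" "z:S'"
 shows "z:D" "S Int S' = {z}"
proof -
 show "S Int S' = {z}" using cblock_eqI[OF S(1,2), of z] S(3) z by blast
 show "z:D"
 proof (rule ccontr)
  assume nz: "z ~: D"
  have zt: "z:topspace X" using z cyc_sub[OF cblock_cyc[OF S(1)]] by blast
  have ne: "z ~: essential_vertices X" using nz D_ess by blast
  have N: "nnb z <= S" "nnb z <= S'"
   using cyc_nonessential[OF cblock_cyc[OF S(1)] z(1) ne] cyc_nonessential[OF cblock_cyc[OF S(2)] z(2) ne] by auto
  have "card (branches X z) = 2" using essential_iff[OF Haus_X nnb[OF zt]] ne by (simp add: branches_eq)
  then obtain C where C: "C:branches X z" by fastforce
  obtain y where y: "y:C" using br_nonempty[OF zt C] by blast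
  have "y:nnb z" "y ~= z" using nnb_eq[OF zt] C y br_notin[OF zt C] by auto
  then show False using N \<open>S Int S' = {z}\<close> by blast
 qed
qed

text \<open>At a vertex of both subtrees the point projects to the only common point of two
  different blocks, and so it does across the edge with this label. That edge is then central, and
  its branch would lie in a one-point set that it avoids.\<close>

lemma member_overlap:
 assumes S: "cblock X S" "cblock X S'" and m: "m:member t S" "m:member t' S'" and t: "t:W" "t':W"
  and w: "w:words (D Int S)" "w':words (D Int S')" "act t w = act t' w'"
 shows "S = S' & member t S = member t' S'"
proof -
 have "S = S'"
 proof (rule ccontr)
  assume ne: "S ~= S'"
  let ?u = "act t w"
  have uW: "?u:W" using t words_sub[OF w(1)] by simp
  let ?z = "fst m ?u"
  have z: "?z:S" "?z:S'" using member_in[OF m(1) w(1)] member_in[OF m(2) w(2)] w(3) by auto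
  note I = cblock_Int[OF S ne z]
  have 1: "fst m (nbr ?u ?z):S"
   using member_in[OF m(1), of "nbr w ?z"] w(1) I(1) z(1) act_nbr[OF t(1) words_sub[OF w(1)] I(1)] by simp
  have 2: "fst m (nbr ?u ?z):S'"
   using member_in[OF m(2), of "nbr w' ?z"] w(2) I(1) z(2) act_nbr[OF t(2) words_sub[OF w(2)] I(1)] w(3) by simp
  have c: "central (fst m) ?u ?z" using 1 2 I(2) by (auto simp: central_def)
  have mM: "m:M" using m(1) member_sub by blast
  have C: "snd m:branches X ?z" using M_br[OF mM uW I(1) c] .
  have zt: "?z:topspace X" using I(1) D_top by blast
  have "snd m <= {?z}" using m I(2) by (auto simp: member_def)
  then show False using br_nonempty[OF zt C] br_notin[OF zt C] by blast
 qed
 moreover have "member (act t w) S = member t S" "member (act t' w') S' = member t' S'"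
  using member_shift[OF t(1) w(1)] member_shift[OF t(2) w(2)] .
 ultimately show ?thesis using w(3) by metis
qed

text \<open>If the path between the subtrees leaves the first one by a letter \<open>x\<close>
  outside \<open>S\<close> and meets no common vertex, then \<open>m\<close> projects to
  \<open>x\<close> at the exit vertex as seen from \<open>t'\<close>, but into \<open>S\<close> as
  seen from \<open>t\<close>.\<close>

lemma member_disjoint:
 assumes S: "cblock X S" "cblock X S'" and m: "m:member t S" "m:member t' S'" and t: "t:W" "t':W"
 shows "S = S' & member t S = member t' S'"
proof -
 obtain v where v: "v:W" "t' = act t v" using act_surj[OF t] by auto
 show ?thesis
 proof (cases "set v <= S")
  case True
  then have "v:words (D Int S)" using v(1) by (simp add: words_Int_iff)
  moreover have "act t v = act t' []" using v(2) by simp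
  ultimately show ?thesis by (rule member_overlap[OF S m t _ words_Nil])
 next
  case False
  then obtain v1 x v2 where x: "v = v1 @ x # v2" "x ~: S" "ALL z:set v2. ~ z ~: S"
   using split_list_last_prop[of v "%x. x ~: S"] by blast
  have v2: "v2:words (D Int S)" using x v(1) words_append2[of "v1 @ [x]" v2 D] by (auto simp: words_Int_iff)
  have u: "v1 @ [x]:W" using words_append1[of "v1 @ [x]" v2 D] v(1) x(1) by simp
  let ?r = "act t v2" and ?w = "rev (v1 @ [x])"
  have rW: "?r:W" using t words_sub[OF v2] by simp
  have t': "t' = act ?r (v1 @ [x])" unfolding v(2) x(1) using act_append[of t "v1 @ [x]" v2] by simp
  have wW: "?w:W" using u by (simp only: words_rev)
  have "act t' ?w = act ?r (act (v1 @ [x]) ?w)" unfolding t' using act_assoc[OF rW u wW] by simp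
  also have "act (v1 @ [x]) ?w = []" by (rule act_rev[OF u])
  finally have r: "act t v2 = act t' ?w" by simp
  show ?thesis
  proof (cases "set ?w <= S'")
   case True
   then have "?w:words (D Int S')" using wW by (simp only: words_Int_iff)
   then show ?thesis using member_overlap[OF S m t v2 _ r] by blast
  next
   case False
   have "fst m ?r = hd ?w" using member_out[OF m(2) t(2) wW False] r by simp
   then have "x:S" using member_in[OF m(1) v2] by simp
   then show ?thesis using x(2) by simp
  qed
 qed
qed

lemma member_at:
 assumes "t:W" "w:W" "cblock X S" "m:member t S" "n:member t S"
  "fst m w ~= fst n w | (EX x:D. central (fst m) w x)"
 shows "member t S = member w S"
proof -
 obtain v where v: "v:W" "w = act t v" using act_surj[OF assms(1,2)] by auto
 have "set v <= S"
 proof (rule ccontr)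
  assume ns: "~ set v <= S"
  have "fst m w = fst n w" using member_out[OF assms(4,1) v(1) ns] member_out[OF assms(5,1) v(1) ns] v(2) by simp
  moreover have "~ (EX x:D. central (fst m) w x)" using member_not_central[OF assms(4,1) v(1) ns] v(2) by simp
  ultimately show False using assms(6) by blast
 qed
 then have "v:words (D Int S)" using v(1) by (simp add: words_Int_iff)
 then show ?thesis using member_shift[OF assms(1)] v(2) by simp
qed

text \<open>A member that is non-constant at \<open>w\<close>, or has a central edge there, has
  \<open>w\<close> in its subtree. It is thus determined by \<open>w\<close> and one of finitely
  many blocks.\<close>

lemma spread_members: "spread RT {member t S |t S. t:W & cblock X S} (%A. A)"
proof (rule spread_RT)
 show "A <= M" if "A:{member t S |t S. t:W & cblock X S}" for A using that member_sub by blast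
 show "finite {A:{member t S |t S. t:W & cblock X S}. EX m:A. EX n:A. fst m w ~= fst n w}" if w: "w:W" for w
 proof (rule finite_subset[OF _ finite_imageI[OF finite_cblock, of "member w"]], intro subsetI)
  fix A assume "A:{A:{member t S |t S. t:W & cblock X S}. EX m:A. EX n:A. fst m w ~= fst n w}"
  then obtain t S m n where "A = member t S" "t:W" "cblock X S" "m:A" "n:A" "fst m w ~= fst n w" by blast
  then show "A:member w ` {S. cblock X S}" using member_at[of t w S m n] w by blast
 qed
 show "finite {A:{member t S |t S. t:W & cblock X S}. EX m:A. central (fst m) w x}" if w: "w:W" "x:D" for w x
 proof (rule finite_subset[OF _ finite_imageI[OF finite_cblock, of "member w"]], intro subsetI)
  fix A assume "A:{A:{member t S |t S. t:W & cblock X S}. EX m:A. central (fst m) w x}"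
  then obtain t S m where "A = member t S" "t:W" "cblock X S" "m:A" "central (fst m) w x" by blast
  then show "A:member w ` {S. cblock X S}" using member_at[of t w S m m] w by blast
 qed
qed

lemma member_nonempty:
 assumes S: "cblock X S" and t: "t:W"
 shows "member t S ~= {}"
proof -
 obtain z z' where z: "z:S Int D" "z':S Int D" "z ~= z'" using cyc_two_in_D[OF cblock_cyc[OF S]] .
 let ?m = "shift D (rev t) (end_point D z z')"
 have mM: "?m:M" using shift_M[OF end_point_M] z t by simp
 have "fst ?m (act t w):S" if w: "w:words (D Int S)" for w
 proof -
  have wW: "w:W" "set w <= S" using w by (auto simp: words_Int_iff)
  have "fst ?m (act t w) = fst (end_point D z z') w" using wW t by (simp add: shift_coord act_rev_act[OF t])
  moreover have "hd w:S" if "w ~= []" using wW(2) that hd_in_set[of w] by auto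
  ultimately show ?thesis using z wW(1) by (cases "w = []") (auto simp: end_point_def)
 qed
 moreover have "snd ?m = {}" by (simp add: shift_def end_point_def)
 ultimately have "?m:member t S" using mM by (auto simp: member_def)
 then show ?thesis by blast
qed

text \<open>If \<open>x\<close> is not in \<open>S\<close>, the member through
  \<open>nbr t x\<close> sees \<open>t\<close> across a letter outside \<open>S\<close>. If it is,
  one first turns aside along a label \<open>z\<close> outside \<open>S\<close>, which exists
  because \<open>S\<close> is closed and proper.\<close>

lemma fibre_contains_member:
 assumes S: "cblock X S" "S ~= topspace X" and t: "t:W" "x:D"
 shows "EX t':W. member t' S <= {m:M. fst m t = x}"
proof (cases "x:S")
 case False
 have s: "nbr t x:W" using t by simp
 have e: "t = act (nbr t x) [x]" using t by simp
 have "[x]:W" using t by (simp add: words_Cons)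
 then have "fst m t = x" if "m:member (nbr t x) S" for m using member_out[OF that s, of "[x]"] False e by simp
 then show ?thesis using s member_sub by blast
next
 case True
 have "openin X (topspace X - S)" using cyc_closed[OF cblock_cyc[OF S(1)]] by blast
 moreover have "topspace X - S ~= {}" using S(2) cyc_sub[OF cblock_cyc[OF S(1)]] by blast
 ultimately obtain z where z: "z:D" "z ~: S" using D_meets by blast
 let ?t = "nbr (nbr t x) z"
 have t': "?t:W" using t z by simp
 have e: "t = act ?t [x, z]" using nbr_nbr[OF nbr_words[OF t], of z] nbr_nbr[OF t(1), of x] by simp
 have W2: "[x, z]:W" using t z True by (auto simp: words_Cons)
 have "fst m t = x" if "m:member ?t S" for m using member_out[OF that t' W2] z(2) e by simp
 then show ?thesis using t' member_sub by blast
qed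

lemma open_contains_member:
 assumes "cblock X S" "S ~= topspace X" "openin RT Z" "Z ~= {}"
 shows "EX t:W. member t S <= Z"
 using open_contains_fibre[OF assms(3,4)] fibre_contains_member[OF assms(1,2)] by (meson order_trans)

lemma open_two_points:
 assumes "openin RT Z" "Z ~= {}"
 shows "EX m:Z. EX n:Z. m ~= n"
proof -
 obtain t x where t: "t:W" "x:D" "{m:M. fst m t = x} <= Z" using open_contains_fibre[OF assms] by blast
 have s: "nbr t x:W" using t by simp
 obtain z where z: "z:D" "z ~= x" using three by blast
 obtain z' where z': "z':D" "z' ~= x" "z' ~= z" using three by blast
 obtain m where m: "m:M" "fst m (nbr t x) = z" using fibre_nonempty[OF s z(1) z'(1)] z'(3) by blast
 obtain n where n: "n:M" "fst n (nbr t x) = z'" using fibre_nonempty[OF s z'(1) z(1) z'(3)] by blast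
 have "fst m t = x" "fst n t = x" using M_cons[OF _ s t(2)] m n z z' t by auto
 then have "m:Z" "n:Z" using t(3) m n by auto
 moreover have "m ~= n" using m(2) n(2) z'(3) by auto
 ultimately show ?thesis by blast
qed

text \<open>An open subset of a member contains two disjoint open sets and a member in each of them;
  both would have to coincide with the given one.\<close>

lemma member_complement_dense:
 assumes S: "cblock X S" "S ~= topspace X" and t: "t:W" and Z: "openin RT Z" "Z ~= {}"
 shows "~ Z <= member t S"
proof
 assume sub: "Z <= member t S"
 obtain m n where mn: "m:Z" "n:Z" "m ~= n" using open_two_points[OF Z] by blast
 then have "m:topspace RT" "n:topspace RT" using openin_subset[OF Z(1)] by auto
 then obtain U V where UV: "openin RT U" "openin RT V" "m:U" "n:V" "disjnt U V"
  using Hausdorff_RT mn(3) unfolding Hausdorff_space_def by metis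
 obtain t1 where t1: "t1:W" "member t1 S <= Z Int U"
  using open_contains_member[OF S, of "Z Int U"] Z(1) UV(1,3) mn(1) by blast
 obtain t2 where t2: "t2:W" "member t2 S <= Z Int V"
  using open_contains_member[OF S, of "Z Int V"] Z(1) UV(2,4) mn(2) by blast
 obtain a where a: "a:member t1 S" using member_nonempty[OF S(1) t1(1)] by blast
 obtain b where b: "b:member t2 S" using member_nonempty[OF S(1) t2(1)] by blast
 have "member t1 S = member t S" using member_disjoint[OF S(1) S(1) a _ t1(1) t] a t1(2) sub by blast
 moreover have "member t2 S = member t S" using member_disjoint[OF S(1) S(1) b _ t2(1) t] b t2(2) sub by blast
 ultimately show False using a t1(2) t2(2) UV(5) unfolding disjnt_def by blast
qed

text \<open>An arc in the component of \<open>S\<close> meets \<open>D\<close> arbitrarily near its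
  beginning, so the parameters in question have no minimum.\<close>

lemma cyc_D_infinite:
 assumes S: "cyc X S" shows "infinite D"
proof
 assume fin: "finite D"
 obtain a b where ab: "a:S" "b:S" "a ~= b" using S by (auto simp: cyc_def)
 have top: "a:topspace X" using ab cyc_sub[OF S] by auto
 obtain P where P: "openin X P" "openin X (topspace X - P)" "a:P" "P <= topspace X" "path_connectedin X P"
  using open_component[OF openin_topspace top] .
 have "S <= P" by (rule connectedin_two_opens[OF cyc_conn[OF S] P(1,2) _ _ ab(1) P(3)]) (use cyc_sub[OF S] in auto)
 then obtain q where q: "emb {0..1::real} X q" using arc_exists[OF P(5,3) _ ab(3)] ab(2) by blast
 let ?T = "{\<tau>:{0<..<1}. q \<tau>:D}"
 have "inj_on q ?T" by (rule inj_on_subset[OF embedding_inj[OF q]]) auto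
 moreover have "q ` ?T <= D" by auto
 ultimately have finT: "finite ?T" using fin by (rule inj_on_finite)
 obtain \<tau> where "\<tau>:?T" using arc_meets_D[OF q, of 0 1] by auto
 then have ne: "?T ~= {}" by blast
 define u where "u = Min ?T"
 have "u:?T" unfolding u_def using finT ne by (rule Min_in)
 then have u: "0 < u" "u <= 1" by auto
 obtain \<sigma> where \<sigma>: "\<sigma>:{0<..<u}" "q \<sigma>:D" using arc_meets_D[OF q order_refl u] by blast
 then have "\<sigma>:?T" using u by auto
 then have "u <= \<sigma>" unfolding u_def using finT by (intro Min_le)
 then show False using \<sigma>(1) by simp
qed

text \<open>The fibres over the infinitely many points of \<open>D\<close> are disjoint, and each
  contains a member.\<close>

lemma infinite_members:
 assumes S: "cblock X S" "S ~= topspace X"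
 shows "infinite {member t S |t. t:W}"
proof
 assume fin: "finite {member t S |t. t:W}"
 have "ALL x:D. EX t. t:W & member t S <= {m:M. fst m [] = x}" using fibre_contains_member[OF S words_Nil] by blast
 then obtain f where f: "!!x. x:D ==> f x:W & member (f x) S <= {m:M. fst m [] = x}" by (elim bchoice[THEN exE]) blast
 have "inj_on (%x. member (f x) S) D"
 proof (rule inj_onI)
  fix x y assume xy: "x:D" "y:D" "member (f x) S = member (f y) S"
  obtain m where "m:member (f x) S" using member_nonempty[OF S(1)] f[OF xy(1)] by blast
  then show "x = y" using f[OF xy(1)] f[OF xy(2)] xy(3) by blast
 qed
 moreover have "(%x. member (f x) S) ` D <= {member t S |t. t:W}" using f by blast
 ultimately have "finite D" using fin by (meson inj_on_finite)
 then show False using cyc_D_infinite[OF cblock_cyc[OF S(1)]] by simp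
qed

lemma member_shift_homeomorphic:
 assumes t: "t:W"
 shows "subtopology RT (member t S) homeomorphic_space subtopology RT (member [] S)"
proof -
 have "shift D t ` (topspace RT Int member t S) = topspace RT Int member [] S"
 proof (intro subset_antisym subsetI)
  fix m assume "m:shift D t ` (topspace RT Int member t S)"
  then obtain n where n: "n:member t S" "n:M" "m = shift D t n" by auto
  have "fst m (act [] w):S" if w: "w:words (D Int S)" for w
   using member_in[OF n(1) w] words_sub[OF w] n(3) by (simp add: shift_coord)
  moreover have "snd m <= S" using n by (auto simp: shift_def member_def)
  ultimately show "m:topspace RT Int member [] S" using shift_M[OF n(2) t] n(3) by (auto simp: member_def)
 next
  fix m assume "m:topspace RT Int member [] S"
  then have m: "m:member [] S" "m:M" by auto
  let ?n = "shift D (rev t) m"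
  have nM: "?n:M" using shift_M m t by simp
  have "fst ?n (act t w):S" if w: "w:words (D Int S)" for w
   using member_in[OF m(1) w] words_sub[OF w] t by (simp add: shift_coord act_rev_act[OF t])
  then have "?n:member t S" using nM m(1) by (auto simp: member_def shift_def)
  moreover have "shift D t ?n = m" using shift_shift[OF m(2), of "rev t"] t by simp
  ultimately show "m:shift D t ` (topspace RT Int member t S)" using nM by (metis IntI imageI topspace_rtop)
 qed
 then have "homeomorphic_maps (subtopology RT (member t S)) (subtopology RT (member [] S)) (shift D t) (shift D (rev t))"
  using homeomorphic_maps_subtopologies[OF homeomorphic_maps_shift[OF t]] by blast
 then show ?thesis by (rule homeomorphic_maps_imp_homeomorphic_space)
qed

end


section \<open>Reflection trees of subgraphs\<close>

lemma ray_homeomorphic: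
 assumes "homeomorphic_map Y Z g" "ray Y y C h"
 shows "ray Z (g y) (g ` C) (g \<circ> h)"
proof -
 have "embedding_map Y Z g"
  using assms(1) homeomorphic_imp_surjective_map[OF assms(1)] by (simp add: embedding_map_def)
 then show ?thesis using assms(2) embedding_map_compose unfolding ray_def by (metis comp_apply image_comp)
qed

lemma normal_neighbourhood_homeomorphic:
 assumes H: "Hausdorff_space Y" and g: "homeomorphic_map Y Z g" and N: "normal_neighbourhood Y y N"
 shows "normal_neighbourhood Z (g y) (g ` N)"
  "punctured_components Z (g y) (g ` N) = (`) g ` punctured_components Y y N"
proof -
 interpret nnbhd Y y N using H N by unfold_locales
 have inj: "inj_on g (topspace Y)" by (rule homeomorphic_imp_injective_map[OF g])
 have opn: "openin Y U ==> openin Z (g ` U)" for U using homeomorphic_imp_open_map[OF g] by (simp add: open_map_def)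
 have U: "\<Union>((`) g ` \<C>) = g ` N - {g y}"
 proof -
  have "\<Union>((`) g ` \<C>) = g ` (N - {y})" using Union_C by blast
  also have "\<dots> = g ` N - g ` {y}" by (rule inj_on_image_set_diff[OF inj]) (use N_sub x_top in auto)
  finally show ?thesis by simp
 qed
 have d: "disjoint ((`) g ` \<C>)"
 proof (rule disjointI)
  fix A B assume "A:(`) g ` \<C>" "B:(`) g ` \<C>" "A ~= B"
  then obtain C C' where C: "C:\<C>" "C':\<C>" "A = g ` C" "B = g ` C'" "C ~= C'" by blast
  have "g ` C Int g ` C' = g ` (C Int C')" using inj_on_image_Int[OF inj C_top[OF C(1)] C_top[OF C(2)]] by simp
  moreover have "C Int C' = {}" using C_disjD[OF C(1,2)] C(5) by blast
  ultimately show "A Int B = {}" using C by simp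
 qed
 note * = normal_neighbourhoodI[OF opn[OF N_open] imageI[OF x_in] finite_imageI[OF fin] U d]
 have o: "openin Z C" if "C:(`) g ` \<C>" for C using that C_open opn by blast
 have r: "EX h. ray Z (g y) C h" if "C:(`) g ` \<C>" for C using that C_ray ray_homeomorphic[OF g] by blast
 show "normal_neighbourhood Z (g y) (g ` N)" by (rule *[OF o r])
 show "punctured_components Z (g y) (g ` N) = (`) g ` \<C>" by (rule *[OF o r])
qed

text \<open>Shared by cyclic sets and natural subgraphs. Such a set is itself a graph, and its
  branches at a point are those of \<open>X\<close> contained in it.\<close>

definition saturated :: "'a topology => 'a set => bool" where
 "saturated X S \<longleftrightarrow> closedin X S & (ALL x:S. ALL C:branches X x. C <= S | C Int S = {})"

context graph_space
begin

lemma saturated_normal_nbhd: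
 assumes S: "saturated X S" and x: "x:S"
 shows "normal_neighbourhood (subtopology X S) x (nnb x Int S)"
  "punctured_components (subtopology X S) x (nnb x Int S) = {C:branches X x. C <= S}"
proof -
 have Ssub: "S <= topspace X" using S closedin_subset by (auto simp: saturated_def)
 then have xt: "x:topspace X" using x by blast
 have sat: "C <= S | C Int S = {}" if "C:branches X x" for C using S x that unfolding saturated_def by blast
 have 1: "openin (subtopology X S) (nnb x Int S)" using nnb_open[OF xt] by (auto simp: openin_subtopology)
 have 2: "x:nnb x Int S" using x nnb_eq[OF xt] by blast
 have 3: "finite {C:branches X x. C <= S}" using br_finite[OF xt] by simp
 have 4: "\<Union>{C:branches X x. C <= S} = nnb x Int S - {x}"
  using sat br_notin[OF xt] unfolding nnb_eq[OF xt] by blast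
 have 5: "disjoint {C:branches X x. C <= S}"
 proof (rule disjointI)
  fix A B assume "A:{C:branches X x. C <= S}" "B:{C:branches X x. C <= S}" "A ~= B"
  then show "A Int B = {}" using br_disj[OF xt, of A B] by blast
 qed
 have 6: "openin (subtopology X S) C" if "C:{C:branches X x. C <= S}" for C
  using that br_open[OF xt, of C] by (auto simp: openin_subtopology intro!: exI[of _ C])
 have 7: "EX h. ray (subtopology X S) x C h" if C: "C:{C:branches X x. C <= S}" for C
 proof -
  obtain h where h: "ray X x C h" using br_ray[OF xt] C by blast
  have "h ` {0..<1} <= S" using ray_image[OF h] C x by auto
  then show ?thesis using h Ssub by (auto simp: ray_def embedding_map_in_subtopology)
 qed
 show "normal_neighbourhood (subtopology X S) x (nnb x Int S)" by (rule normal_neighbourhoodI[OF 1 2 3 4 5 6 7])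
 show "punctured_components (subtopology X S) x (nnb x Int S) = {C:branches X x. C <= S}"
  by (rule normal_neighbourhoodI[OF 1 2 3 4 5 6 7])
qed

lemma graph_space_saturated:
 assumes S: "saturated X S" shows "graph_space (subtopology X S)"
proof
 have cl: "closedin X S" using S by (simp add: saturated_def)
 show "compact_space (subtopology X S)"
  using compact_X cl by (simp add: closedin_compact_space compact_space_subtopology)
 show "Hausdorff_space (subtopology X S)" using Haus_X by (simp add: Hausdorff_space_subtopology)
 show "second_countable (subtopology X S)" using second_X by (rule second_countable_subtopology)
 show "EX N. normal_neighbourhood (subtopology X S) x N" if "x:topspace (subtopology X S)" for x
  using saturated_normal_nbhd(1)[OF S] that by auto
qed

lemma cyc_saturated: "cyc X S ==> saturated X S"
 unfolding saturated_def using cyc_closed cyc_branch cyc_sub by blast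

lemma essential_saturated:
 assumes S: "saturated X S" and x: "x:S"
 shows "x:essential_vertices (subtopology X S) \<longleftrightarrow> card {C:branches X x. C <= S} ~= 2"
 using essential_iff[OF _ saturated_normal_nbhd(1)[OF assms]] saturated_normal_nbhd(2)[OF assms] Haus_X
 by (simp add: Hausdorff_space_subtopology)

lemma essential_cyc:
 assumes S: "cyc X S"
 shows "essential_vertices (subtopology X S) <= essential_vertices X Int S"
proof
 fix x assume x: "x:essential_vertices (subtopology X S)"
 then have xS: "x:S" by (auto simp: essential_vertices_def)
 have xt: "x:topspace X" using xS cyc_sub[OF S] by blast
 have "x:essential_vertices X"
 proof (rule ccontr)
  assume ne: "x ~: essential_vertices X"
  have "nnb x <= S" by (rule cyc_nonessential[OF S xS ne])
  then have "{C:branches X x. C <= S} = branches X x" using nnb_eq[OF xt] by blast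
  moreover have "card (branches X x) = 2" using essential_iff[OF Haus_X nnb[OF xt]] ne by (simp add: branches_eq)
  ultimately show False using x essential_saturated[OF cyc_saturated[OF S] xS] by simp
 qed
 then show "x:essential_vertices X Int S" using xS by blast
qed

end

lemma graph_space_homeomorphic:
 assumes X: "graph_space X" and h: "X homeomorphic_space Y"
 shows "graph_space Y"
proof -
 interpret graph_space X by fact
 obtain g where g: "homeomorphic_map X Y g" using h by (auto simp: homeomorphic_space)
 show ?thesis
 proof
  show "compact_space Y" using homeomorphic_compact_space[OF h] compact_X by blast
  show "Hausdorff_space Y" using homeomorphic_Hausdorff_space[OF h] Haus_X by blast
  show "second_countable Y"
   using second_countable_open_map_image[OF homeomorphic_imp_continuous_map[OF g] homeomorphic_imp_open_map[OF g]
    homeomorphic_imp_surjective_map[OF g] second_X] .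
  fix y assume "y:topspace Y"
  then obtain x where x: "x:topspace X" "y = g x" using homeomorphic_imp_surjective_map[OF g] by blast
  show "EX N. normal_neighbourhood Y y N"
   unfolding x(2) using normal_neighbourhood_homeomorphic(1)[OF Haus_X g nnb[OF x(1)]] by blast
 qed
qed

lemma map_nbr:
 assumes "inj_on g A" "set w <= A" "x:A"
 shows "map g (nbr w x) = nbr (map g w) (g x)" using assms by (cases w) (auto simp: nbr_def inj_on_def)

lemma map_words:
 assumes "inj_on g A" "w:words A"
 shows "map g w:words (g ` A)" using assms(2)
proof (induction w)
 case (Cons x w)
 then have "x:A" "w:words A" "w = [] | hd w ~= x" by (auto simp: words_Cons)
 moreover have "hd w:A" if "w ~= []" using \<open>w:words A\<close> that hd_in_set[of w] by (auto simp: words_def)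
 ultimately show ?case using Cons.IH assms(1) by (cases w) (auto simp: words_Cons inj_on_def)
qed simp

text \<open>A point over \<open>Y\<close> is extended to all words by letting it point back outside
  the words over \<open>D Int S\<close>. By \<open>member_out\<close> this is the only extension
  within the member. What needs care is the branches, because \<open>Y\<close> and \<open>X\<close>
  choose their normal neighbourhoods independently.\<close>

lemma (in big_graph) rtop_block:
 fixes Y :: "'b topology"
 assumes mY: "marked_graph Y DY" and S: "cyc X S"
  and g: "homeomorphic_maps Y (subtopology X S) g g'" and gD: "g ` DY = D Int S"
 shows "rtop Y DY homeomorphic_space subtopology RT (member [] S)"
proof -
 interpret Y: marked_graph Y DY by fact
 have gm: "homeomorphic_map Y (subtopology X S) g" using g homeomorphic_maps_imp_map by blast
 have Ssub: "S <= topspace X" by (rule cyc_sub[OF S])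
 have gS: "g y:S" if "y:topspace Y" for y using homeomorphic_imp_surjective_map[OF gm] that by auto
 have g'g: "g' (g y) = y" if "y:topspace Y" for y using g that by (auto simp: homeomorphic_maps_def)
 have gg': "g (g' x) = x" if "x:S" for x using g that Ssub by (auto simp: homeomorphic_maps_def)
 have g'Y: "g' x:topspace Y" if "x:S" for x
 proof -
  have "continuous_map (subtopology X S) Y g'" using g by (simp add: homeomorphic_maps_def)
  moreover have "x:topspace (subtopology X S)" using that Ssub by auto
  ultimately show ?thesis using continuous_map_image_subset_topspace by blast
 qed
 have gcont: "continuous_map Y X g"
  using homeomorphic_imp_continuous_map[OF gm] by (simp add: continuous_map_in_subtopology)
 have g'D: "g' x:DY" if x: "x:D Int S" for x
 proof -
  obtain y where "y:DY" "x = g y" using gD x by (metis imageE)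
  then show ?thesis using g'g[OF Y.D_top] by simp
 qed
 have gDY: "g y:D" "g y:S" if "y:DY" for y using gD that by blast+
 have injD: "inj_on g DY" by (rule inj_on_inverseI[of _ g']) (use g'g Y.D_top in auto)
 have injD': "inj_on g' (D Int S)" by (rule inj_on_inverseI[of _ g]) (use gg' in auto)
 have g'DS: "g' ` (D Int S) = DY"
 proof (intro subset_antisym subsetI)
  fix y assume "y:DY"
  then show "y:g' ` (D Int S)" using g'g[OF Y.D_top] gDY by (metis IntI imageI)
 qed (use g'D in auto)
 have wY: "map g' w:words DY" if "w:words (D Int S)" for w using map_words[OF injD' that] g'DS by simp
 have wX: "map g w:words (D Int S)" if "w:words DY" for w using map_words[OF injD that] gD by simp
 have wYX: "map g (map g' w) = w" if "w:words (D Int S)" for w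
  using that gg' by (auto simp: words_def intro!: map_idI)
 have wXY: "map g' (map g w) = w" if "w:words DY" for w
  using that g'g Y.D_top by (auto simp: words_def intro!: map_idI)
 have nb': "map g' (nbr w x) = nbr (map g' w) (g' x)" if "w:words (D Int S)" "x:D Int S" for w x
  by (rule map_nbr[OF injD']) (use that in \<open>auto simp: words_def\<close>)
 have nb: "map g (nbr w y) = nbr (map g w) (g y)" if "w:words DY" "y:DY" for w y
  by (rule map_nbr[OF injD]) (use that in \<open>auto simp: words_def\<close>)
 \<comment> \<open>Branches of \<open>Y\<close> and branches of \<open>X\<close> inside
   \<open>S\<close> are matched by their germs, since as sets they need not correspond under
   \<open>g\<close>.\<close>
 have exG: "EX \<gamma>. bij_betw \<gamma> (branches Y y) {C:branches X (g y). C <= S} &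
  (ALL C:branches Y y. EX U. openin X U & g y:U & U Int g ` C = U Int \<gamma> C)" if y: "y:topspace Y" for y
 proof -
  have gy: "g y:S" "g y:topspace X" using gS[OF y] Ssub by auto
  note N = normal_neighbourhood_homeomorphic[OF Y.Haus_X gm Y.nnb[OF y]]
  have sat: "C <= S | C Int S = {}" if "C:punctured_components X (g y) (nnb (g y))" for C
   using cyc_branch[OF S gy(2)] that by (simp add: branches_eq)
  obtain \<beta> where \<beta>: "bij_betw \<beta> (punctured_components (subtopology X S) (g y) (g ` Y.nnb y))
    {C:punctured_components X (g y) (nnb (g y)). C <= S}"
   "!!B. B:punctured_components (subtopology X S) (g y) (g ` Y.nnb y) ==> EX U. openin X U & g y:U & U Int B = U Int \<beta> B"
   using germ_bijection[OF Haus_X nnb[OF gy(2)] gy(1) Ssub sat N(1)] by blast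
  have "inj_on ((`) g) (branches Y y)"
  proof (rule inj_onI)
   fix A B assume AB: "A:branches Y y" "B:branches Y y" "g ` A = g ` B"
   have "inj_on g (topspace Y)" by (rule homeomorphic_imp_injective_map[OF gm])
   then show "A = B" using AB Y.br_top[OF y] inj_on_image_eq_iff by metis
  qed
  then have "bij_betw ((`) g) (branches Y y) (punctured_components (subtopology X S) (g y) (g ` Y.nnb y))"
   unfolding N(2) Y.branches_eq by (simp add: bij_betw_def)
  then have "bij_betw (\<beta> \<circ> (`) g) (branches Y y) {C:branches X (g y). C <= S}"
   using \<beta>(1) unfolding branches_eq by (rule bij_betw_trans)
  moreover have "EX U. openin X U & g y:U & U Int g ` C = U Int (\<beta> \<circ> (`) g) C" if "C:branches Y y" for C
   using \<beta>(2)[of "g ` C"] that unfolding N(2) Y.branches_eq by simp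
  ultimately show ?thesis by blast
 qed
 have "ALL y:topspace Y. EX \<gamma>. bij_betw \<gamma> (branches Y y) {C:branches X (g y). C <= S} &
  (ALL C:branches Y y. EX U. openin X U & g y:U & U Int g ` C = U Int \<gamma> C)" by (rule ballI) (rule exG)
 from bchoice[OF this] obtain \<gamma> where \<gamma>0: "ALL y:topspace Y. bij_betw (\<gamma> y) (branches Y y) {C:branches X (g y). C <= S} &
  (ALL C:branches Y y. EX U. openin X U & g y:U & U Int g ` C = U Int \<gamma> y C)" ..
 note \<gamma> = \<gamma>0[THEN bspec, THEN conjunct1] and \<gamma>U = \<gamma>0[THEN bspec, THEN conjunct2, THEN bspec]
 define cent where "cent q y \<longleftrightarrow> y:DY & (EX w:words DY. central q w y)" for q :: "'b list => 'b" and y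
 have cent_unique: "y = z" if "m:Y.M" "cent (fst m) y" "cent (fst m) z" for m y z
  using Y.central_unique[OF that(1)] that(2,3) unfolding cent_def by metis
 \<comment> \<open>The point \<open>y\<close> over which the family has a central edge is unique, so
   the choice only names it; without such a point the branch has to be empty.\<close>
 define Phi where "Phi m = ((\<lambda>w\<in>W. if set w <= S then g (fst m (map g' w)) else hd w),
  if EX y. cent (fst m) y then \<gamma> (SOME y. cent (fst m) y) (snd m) else {})" for m :: "('b list => 'b) \<times> 'b set"
 have Phiin: "fst (Phi m) w = g (fst m (map g' w))" if "w:words (D Int S)" for m w
  using that by (auto simp: Phi_def words_Int_iff)
 have Phiout: "fst (Phi m) w = hd w" if "w:W" "~ set w <= S" for m w using that by (auto simp: Phi_def)
 have PhiS: "fst (Phi m) w:S" if "m:Y.M" "w:words (D Int S)" for m w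
  using Phiin[OF that(2)] gS Y.M_top[OF that(1) wY[OF that(2)]] by simp
 have Phisnd: "snd (Phi m) = \<gamma> y (snd m)" if m: "m:Y.M" and c: "cent (fst m) y" for m y
 proof -
  have "(SOME y. cent (fst m) y) = y" using cent_unique[OF m _ c] someI[of "cent (fst m)", OF c] by blast
  then show ?thesis using c by (auto simp: Phi_def)
 qed
 have Phisnd0: "snd (Phi m) = {}" if "!!y. ~ cent (fst m) y" for m using that by (auto simp: Phi_def)
 have cenS: "central (fst (Phi m)) w x \<longleftrightarrow> central (fst m) (map g' w) (g' x)"
  if m: "m:Y.M" and w: "w:words (D Int S)" "x:D Int S" for m w x
 proof -
  have nw: "nbr w x:words (D Int S)" using w by simp
  have top: "fst m (map g' w):topspace Y" "fst m (map g' (nbr w x)):topspace Y" using Y.M_top[OF m] wY w(1) nw by auto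
  have "g v = x \<longleftrightarrow> v = g' x" if "v:topspace Y" for v using g'g[OF that] gg' w(2) by auto
  then show ?thesis unfolding central_def Phiin[OF w(1)] Phiin[OF nw] nb'[OF w, symmetric] using top by simp
 qed
 have cenout: "~ central (fst (Phi m)) w x" if m: "m:Y.M" and w: "w:W" "x:D" "~ (set w <= S & x:S)" for m w x
 proof
  assume c: "central (fst (Phi m)) w x"
  show False
  proof (cases "set w <= S")
   case True
   then have "fst (Phi m) w:S" using PhiS[OF m, of w] w(1) by (simp add: words_Int_iff)
   then show False using c w(3) True by (simp add: central_def)
  next
   case False
   then have "x = hd w" using c Phiout[OF w(1) False] by (simp add: central_def)
   moreover obtain a u where au: "w = a # u" using False by (cases w) auto
   ultimately have e: "w = x # u" "nbr w x = u" by auto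
   have u: "u:W" "u = [] | hd u ~= x" using w(1) e by (auto simp: words_Cons)
   have pu: "fst (Phi m) u = x" using c e by (simp add: central_def)
   show False
   proof (cases "set u <= S")
    case True
    then have "fst (Phi m) u:S" using PhiS[OF m, of u] u(1) by (simp add: words_Int_iff)
    then show False using pu False True e by auto
   next
    case nu: False
    then show False using Phiout[OF u(1) nu, of m] pu u(2) by (cases u) auto
   qed
  qed
 qed
 have cen: "central (fst (Phi m)) w x \<longleftrightarrow> w:words (D Int S) & x:S & central (fst m) (map g' w) (g' x)"
  if m: "m:Y.M" and w: "w:W" "x:D" for m w x using cenS[OF m, of w x] cenout[OF m w] w by (auto simp: words_Int_iff)
 have Phicons: "fst (Phi m) w = x | fst (Phi m) (nbr w x) = x" if m: "m:Y.M" and w: "w:W" "x:D" for m w x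
 proof (cases "set w <= S")
  case True
  then have wS: "w:words (D Int S)" using w by (simp add: words_Int_iff)
  show ?thesis
  proof (cases "x:S")
   case xS: True
   have nw: "nbr w x:words (D Int S)" using wS xS w by simp
   have "fst m (map g' w) = g' x | fst m (nbr (map g' w) (g' x)) = g' x"
    using Y.M_cons[OF m wY[OF wS]] g'D xS w by blast
   then show ?thesis unfolding Phiin[OF wS] Phiin[OF nw] using nb'[OF wS, of x] gg'[OF xS] xS w(2) by auto
  next
   case False
   then have "nbr w x = x # w" using True by (cases w) (auto simp: nbr_def)
   moreover have "nbr w x:W" using w by simp
   ultimately show ?thesis using Phiout[of "nbr w x" m] False by auto
  qed
 next
  case False
  show ?thesis
  proof (cases "hd w = x")
   case True
   then show ?thesis using Phiout[OF w(1) False] by simp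
  next
   case nh: False
   then have "nbr w x = x # w" by (simp add: nbr_def)
   moreover have "nbr w x:W" using w by simp
   ultimately show ?thesis using Phiout[of "nbr w x" m] False by auto
  qed
 qed
 have \<gamma>in: "\<gamma> y C:branches X (g y) & \<gamma> y C <= S" if "y:topspace Y" "C:branches Y y" for y C
  using bij_betwE[OF \<gamma>[OF that(1)]] that(2) by blast
 have PhiM: "Phi m:member [] S" if m: "m:Y.M" for m
 proof -
  have pE: "fst (Phi m):W \<rightarrow>\<^sub>E topspace X"
  proof (rule PiE_I)
   fix w assume w: "w:W"
   show "fst (Phi m) w:topspace X"
   proof (cases "set w <= S")
    case True
    then show ?thesis using PhiS[OF m, of w] w Ssub by (auto simp: words_Int_iff)
   next
    case False
    then have "hd w:D" using w hd_in_set[of w] by (cases w) (auto simp: words_def)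
    then show ?thesis using Phiout[OF w False] D_top by simp
   qed
  qed (simp add: Phi_def)
  have sndin: "snd (Phi m):branches X x & snd (Phi m) <= S" if w: "w:W" "x:D" "central (fst (Phi m)) w x" for w x
  proof -
   have c: "w:words (D Int S)" "x:S" "central (fst m) (map g' w) (g' x)" using cen[OF m w(1,2)] w(3) by auto
   have y: "g' x:DY" using g'D w(2) c(2) by blast
   have "cent (fst m) (g' x)" unfolding cent_def using y wY[OF c(1)] c(3) by blast
   then have "snd (Phi m) = \<gamma> (g' x) (snd m)" by (rule Phisnd[OF m])
   then show ?thesis using \<gamma>in[OF Y.D_top[OF y] Y.M_br[OF m wY[OF c(1)] y c(3)]] gg'[OF c(2)] by simp
  qed
  have nocent: "snd (Phi m) = {}" if nc: "ALL w:W. ALL x:D. ~ central (fst (Phi m)) w x"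
  proof (rule Phisnd0, rule notI)
   fix y assume "cent (fst m) y"
   then obtain w where w: "y:DY" "w:words DY" "central (fst m) w y" by (auto simp: cent_def)
   have "central (fst (Phi m)) (map g w) (g y)"
    using cenS[OF m wX[OF w(2)], of "g y"] gDY[OF w(1)] w(3) wXY[OF w(2)] g'g[OF Y.D_top[OF w(1)]] by simp
   then show False using nc words_sub[OF wX[OF w(2)]] gDY[OF w(1)] by blast
  qed
  have "Phi m:M" unfolding rpoints_def mem_Collect_eq case_prod_beta using pE Phicons[OF m] sndin nocent by blast
  moreover have "snd (Phi m) <= S" using sndin nocent by blast
  moreover have "fst (Phi m) (act [] w):S" if w: "w:words (D Int S)" for w using PhiS[OF m w] words_sub[OF w] by simp
  ultimately show ?thesis by (auto simp: member_def)
 qed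
 have inj: "inj_on Phi Y.M"
 proof (rule inj_onI)
  fix m n assume mn: "m:Y.M" "n:Y.M" "Phi m = Phi n"
  have eq: "fst m w = fst n w" if w: "w:words DY" for w
  proof -
   have "g (fst m w) = g (fst n w)" using Phiin[OF wX[OF w]] wXY[OF w] mn(3) by metis
   then show ?thesis using g'g[OF Y.M_top[OF mn(1) w]] g'g[OF Y.M_top[OF mn(2) w]] by metis
  qed
  have ceq: "cent (fst m) y \<longleftrightarrow> cent (fst n) y" for y
   unfolding cent_def central_def using eq by (metis nbr_words)
  show "m = n"
  proof (rule Y.M_ext[OF mn(1,2) eq])
   show "snd m = snd n"
   proof (cases "EX y. cent (fst m) y")
    case True
    then obtain y where y: "cent (fst m) y" by blast
    then obtain w where w: "y:DY" "w:words DY" "central (fst m) w y" by (auto simp: cent_def)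
    have w': "central (fst n) w y" using w eq by (simp add: central_def)
    have "\<gamma> y (snd m) = \<gamma> y (snd n)" using Phisnd[OF mn(1) y] Phisnd[OF mn(2)] ceq y mn(3) by metis
    then show ?thesis
     using inj_onD[OF bij_betw_imp_inj_on[OF \<gamma>[OF Y.D_top[OF w(1)]]]] Y.M_br[OF mn(1) w(2,1,3)] Y.M_br[OF mn(2) w(2,1) w'] by blast
   next
    case False
    then have "snd m = {}" "snd n = {}"
     using Y.M_nocentral[OF mn(1)] Y.M_nocentral[OF mn(2)] ceq unfolding cent_def by blast+
    then show ?thesis by simp
   qed
  qed
 qed
 have surj: "member [] S <= Phi ` Y.M"
 proof
  fix n assume n: "n:member [] S"
  then have nM: "n:M" using member_sub by blast
  have nS: "fst n w:S" if "w:words (D Int S)" for w using member_in[OF n that] words_sub[OF that] by simp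
  define q where "q = (\<lambda>w\<in>words DY. g' (fst n (map g w)))"
  have q: "q w = g' (fst n (map g w))" if "w:words DY" for w using that by (simp add: q_def)
  have qx: "q w = y \<longleftrightarrow> fst n (map g w) = g y" if "w:words DY" "y:DY" for w y
  proof
   assume "q w = y"
   then have "g (g' (fst n (map g w))) = g y" using q[OF that(1)] by simp
   then show "fst n (map g w) = g y" unfolding gg'[OF nS[OF wX[OF that(1)]]] .
  next
   assume "fst n (map g w) = g y"
   then show "q w = y" using q[OF that(1)] g'g[OF Y.D_top[OF that(2)]] by simp
  qed
  have qc: "central q w y \<longleftrightarrow> central (fst n) (map g w) (g y)" if w: "w:words DY" "y:DY" for w y
   using qx[OF w] qx[OF nbr_words[OF w] w(2)] nb[OF w] by (simp add: central_def)
  have "EX b. (q, b):Y.M & (ALL y. cent q y --> \<gamma> y b = snd n)"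
  proof (cases "EX y. cent q y")
   case True
   then obtain y w where w: "y:DY" "w:words DY" "central q w y" by (auto simp: cent_def)
   have gw: "map g w:W" using words_sub[OF wX[OF w(2)]] .
   have c: "central (fst n) (map g w) (g y)" using qc w by blast
   have "snd n:{C:branches X (g y). C <= S}" using M_br[OF nM gw _ c] gDY[OF w(1)] n by (simp add: member_def)
   then obtain b where b: "b:branches Y y" "\<gamma> y b = snd n"
    unfolding bij_betw_imp_surj_on[OF \<gamma>[OF Y.D_top[OF w(1)]], symmetric] by blast
   have uniq: "z = y" if "v:words DY" "z:DY" "central q v z" for v z
   proof -
    have "central (fst n) (map g v) (g z)" using qc that by blast
    then have "g y = g z" using central_unique[OF nM gw _ c words_sub[OF wX[OF that(1)]]] gDY w(1) that(2) by blast
    then show ?thesis using g'g[OF Y.D_top[OF w(1)]] g'g[OF Y.D_top[OF that(2)]] by metis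
   qed
   have "(q, b):Y.M" unfolding rpoints_def mem_Collect_eq case_prod_conv
   proof (intro conjI ballI impI)
    show "q:words DY \<rightarrow>\<^sub>E topspace Y" unfolding q_def using g'Y nS wX by auto
    show "q v = z | q (nbr v z) = z" if v: "v:words DY" "z:DY" for v z
     using qx[OF v] qx[OF nbr_words[OF v] v(2)] nb[OF v] M_cons[OF nM words_sub[OF wX[OF v(1)]] gDY(1)[OF v(2)]] by auto
    show "b:branches Y z" if "v:words DY" "z:DY" "central q v z" for v z using uniq[OF that] b(1) by simp
    show "b = {}" if "ALL w:words DY. ALL x:DY. ~ central q w x" using that w by blast
   qed
   moreover have "\<gamma> z b = snd n" if "cent q z" for z using that uniq b(2) unfolding cent_def by blast
   ultimately show ?thesis by blast
  next
   case False
   have "(q, {}):Y.M" unfolding rpoints_def mem_Collect_eq case_prod_conv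
   proof (intro conjI ballI impI)
    show "q:words DY \<rightarrow>\<^sub>E topspace Y" unfolding q_def using g'Y nS wX by auto
    show "q v = z | q (nbr v z) = z" if v: "v:words DY" "z:DY" for v z
     using qx[OF v] qx[OF nbr_words[OF v] v(2)] nb[OF v] M_cons[OF nM words_sub[OF wX[OF v(1)]] gDY(1)[OF v(2)]] by auto
    show "{}:branches Y z" if "v:words DY" "z:DY" "central q v z" for v z using that False unfolding cent_def by blast
   qed simp
   then show ?thesis using False by blast
  qed
  then obtain b where b: "(q, b):Y.M" "!!y. cent q y ==> \<gamma> y b = snd n" by blast
  have "Phi (q, b):M" using PhiM[OF b(1)] member_sub by blast
  moreover have eqw: "fst (Phi (q, b)) w = fst n w" if w: "w:W" for w
  proof (cases "set w <= S")
   case True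
   then have wS: "w:words (D Int S)" using w by (simp add: words_Int_iff)
   show ?thesis using Phiin[OF wS, of "(q, b)"] q[OF wY[OF wS]] wYX[OF wS] gg'[OF nS[OF wS]] by simp
  next
   case False
   have "fst n w = hd w" using member_out[OF n words_Nil w False] w by simp
   then show ?thesis using Phiout[OF w False] by simp
  qed
  moreover have "snd (Phi (q, b)) = snd n"
  proof (cases "EX y. cent q y")
   case True
   then obtain y where y: "cent q y" by blast
   then show ?thesis using Phisnd[OF b(1), of y] b(2)[OF y] by simp
  next
   case False
   have "snd n = {}"
   proof (rule M_nocentral[OF nM])
    fix w x assume w: "w:W" "x:D"
    show "~ central (fst n) w x"
    proof
     assume "central (fst n) w x"
     then have "central (fst (Phi (q, b))) w x" using eqw[OF w(1)] eqw[OF nbr_words[OF w]] by (simp add: central_def)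
     then have "w:words (D Int S)" "x:S" "central q (map g' w) (g' x)" using cen[OF b(1) w] by auto
     then show False using False wY g'D w(2) unfolding cent_def by blast
    qed
   qed
   then show ?thesis using Phisnd0[of "(q, b)"] False by simp
  qed
  ultimately have "Phi (q, b) = n" using M_ext[OF _ nM] by blast
  then show "n:Phi ` Y.M" using b(1) by blast
 qed
 have cont0: "openin Y.RT {m:topspace Y.RT. fst (Phi m) w:U}" if w: "w:W" and U: "openin X U" for w U
 proof (cases "set w <= S")
  case True
  then have wS: "w:words (D Int S)" using w by (simp add: words_Int_iff)
  have oV: "openin Y {y:topspace Y. g y:U}" by (rule openin_continuous_map_preimage[OF gcont U])
  have "{m:topspace Y.RT. fst (Phi m) w:U} = at_set Y DY (map g' w) {y:topspace Y. g y:U}"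
   using Phiin[OF wS] Y.M_top[OF _ wY[OF wS]] by (auto simp: at_set_def)
  then show ?thesis using openin_at_set[OF wY[OF wS] oV] by simp
 next
  case False
  then have "{m:topspace Y.RT. fst (Phi m) w:U} = (if hd w:U then topspace Y.RT else {})"
   using Phiout[OF w False] by auto
  then show ?thesis by (simp del: topspace_rtop)
 qed
 have "continuous_map Y.RT RT Phi"
 proof (rule continuous_map_into_rtop)
  show "Phi:topspace Y.RT \<rightarrow> M"
  proof (rule Pi_I)
   fix m assume "m:topspace Y.RT"
   then have "Phi m:member [] S" using PhiM by simp
   then show "Phi m:M" using member_sub by blast
  qed
  fix w x C U assume w: "w:W" "x:D" and C: "C:branches X x" and U: "openin X U" "x:U"
  have xt: "x:topspace X" using w D_top by blast
  have oUC: "openin X (U Int C)" using U br_open[OF xt C] by blast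
  let ?A = "{m:topspace Y.RT. fst (Phi m) w:U Int C} Un {m:topspace Y.RT. fst (Phi m) (nbr w x):U Int C}"
  let ?G = "{m:topspace Y.RT. fst (Phi m) w:U Int C | fst (Phi m) (nbr w x):U Int C | central (fst (Phi m)) w x & snd (Phi m) = C}"
  have oA: "openin Y.RT ?A" using cont0[OF w(1) oUC] cont0[OF nbr_words[OF w] oUC] by (rule openin_Un)
  show "openin Y.RT ?G"
  proof (cases "set w <= S & x:S & C <= S")
   case False
   have "snd (Phi m) ~= C" if m: "m:Y.M" and c: "central (fst (Phi m)) w x" for m
   proof
    assume "snd (Phi m) = C"
    then have "C <= S" using PhiM[OF m] by (auto simp: member_def)
    then show False using cenout[OF m w] c False by blast
   qed
   then have "?G = ?A" by auto
   then show ?thesis using oA by simp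
  next
   case True
   then have wS: "w:words (D Int S)" and xS: "x:D Int S" using w by (auto simp: words_Int_iff)
   have y: "g' x:DY" "g' x:topspace Y" "g (g' x) = x" using g'D[OF xS] Y.D_top gg' xS by auto
   obtain B where B: "B:branches Y (g' x)" "\<gamma> (g' x) B = C"
   proof -
    have "C:{C:branches X (g (g' x)). C <= S}" using C True y(3) by simp
    then have "C:\<gamma> (g' x) ` branches Y (g' x)" unfolding bij_betw_imp_surj_on[OF \<gamma>[OF y(2)]] .
    then show thesis using that by blast
   qed
   \<comment> \<open>\<open>C\<close> and the image of \<open>B\<close> agree only near
     \<open>x\<close>; the neighbourhood is shrunk to where they do.\<close>
   obtain U' where U': "openin X U'" "x:U'" "U' Int g ` B = U' Int C" using \<gamma>U[OF y(2) B(1)] B(2) y(3) by metis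
   let ?V = "{v:topspace Y. g v:U Int U'}"
   have oV: "openin Y ?V" by (rule openin_continuous_map_preimage[OF gcont openin_Int[OF U(1) U'(1)]])
   have yV: "g' x:?V" using y U U' by simp
   let ?E = "edge_set Y DY (map g' w) (g' x) B ?V"
   have oE: "openin Y.RT ?E" by (rule openin_edge_set[OF wY[OF wS] y(1) B(1) oV yV])
   have nS: "nbr w x:words (D Int S)" using wS xS by simp
   have gV: "g v:U Int C" if "v:?V Int B" for v using that U'(3) by blast
   have "?G = ?A Un ?E"
   proof (intro subset_antisym subsetI)
    fix m assume m: "m:?G"
    then have mM: "m:Y.M" by simp
    from m consider "m:?A" | "central (fst (Phi m)) w x" "snd (Phi m) = C" by blast
    then show "m:?A Un ?E"
    proof cases
     case 2
     then have c: "central (fst m) (map g' w) (g' x)" using cen[OF mM w] by blast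
     then have "cent (fst m) (g' x)" unfolding cent_def using y(1) wY[OF wS] by blast
     then have "\<gamma> (g' x) (snd m) = \<gamma> (g' x) B" using Phisnd[OF mM] 2(2) B(2) by metis
     then have "snd m = B"
      using inj_onD[OF bij_betw_imp_inj_on[OF \<gamma>[OF y(2)]]] Y.M_br[OF mM wY[OF wS] y(1) c] B(1) by blast
     then show ?thesis using c mM by (auto simp: edge_set_def)
    qed blast
   next
    fix m assume "m:?A Un ?E"
    then consider "m:?A" | "m:?E" by blast
    then show "m:?G"
    proof cases
     case 2
     then have mM: "m:Y.M" by (simp add: edge_set_def)
     from 2 consider "fst m (map g' w):?V Int B" | "fst m (nbr (map g' w) (g' x)):?V Int B"
      | "central (fst m) (map g' w) (g' x)" "snd m = B" by (auto simp: edge_set_def)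
     then show ?thesis
     proof cases
      case 1
      then show ?thesis using gV[OF 1] Phiin[OF wS, of m] mM by auto
     next
      case 2
      then show ?thesis using gV[OF 2] Phiin[OF nS, of m] nb'[OF wS xS] mM by auto
     next
      case 3
      then have "cent (fst m) (g' x)" unfolding cent_def using y(1) wY[OF wS] by blast
      then have "snd (Phi m) = C" using Phisnd[OF mM] 3(2) B(2) by simp
      moreover have "central (fst (Phi m)) w x" using cenS[OF mM wS xS] 3(1) by blast
      ultimately show ?thesis using mM by auto
     qed
    qed blast
   qed
   then show ?thesis using oA oE by auto
  qed
 qed (rule cont0)
 then have "continuous_map Y.RT (subtopology RT (member [] S)) Phi"
  using PhiM by (auto simp: continuous_map_in_subtopology)
 moreover have "Phi ` topspace Y.RT = topspace (subtopology RT (member [] S))"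
 proof -
  have "Phi ` Y.M = member [] S" using PhiM surj by blast
  moreover have "topspace (subtopology RT (member [] S)) = member [] S" using member_sub[of "[]" S] by auto
  ultimately show ?thesis by simp
 qed
 ultimately have "homeomorphic_map Y.RT (subtopology RT (member [] S)) Phi"
  using continuous_imp_homeomorphic_map[OF _ Y.compact_RT] Hausdorff_RT inj
  by (metis Hausdorff_space_subtopology topspace_rtop)
 then show ?thesis by (rule homeomorphic_map_imp_homeomorphic_space)
qed


section \<open>Homogeneity of countable dense subsets\<close>

definition order_pairs :: "(real \<times> real) set => bool" where
 "order_pairs P \<longleftrightarrow> (ALL p:P. ALL q:P. fst p < fst q \<longleftrightarrow> snd p < snd q)"

definition dense01 :: "real set => bool" where
 "dense01 A \<longleftrightarrow> A <= {0<..<1} & (ALL l r. 0 <= l & l < r & r <= 1 --> (EX a:A. l < a & a < r))"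

lemma dense01_sub: "dense01 A ==> A <= {0<..<1}"
 by (simp add: dense01_def)

lemma dense01_ex: "dense01 A ==> 0 <= l ==> l < r ==> r <= 1 ==> EX a:A. l < a & a < r"
 by (simp add: dense01_def)

text \<open>One step of a back-and-forth construction: the new value is chosen between those
  belonging to smaller and to larger arguments.\<close>

lemma order_pairs_forth:
 assumes P: "finite P" "P <= A \<times> B" "order_pairs P" and dB: "dense01 B" and a: "a:A"
 shows "EX P'. finite P' & P <= P' & P' <= A \<times> B & order_pairs P' & a:fst ` P'"
proof (cases "a:fst ` P")

 case True
 then show ?thesis using P by blast
next
 case False
 note B = dense01_sub[OF dB] and dense = dense01_ex[OF dB]
 \<comment> \<open>The added bounds 0 and 1 make both sets non-empty and keep the new value in the
   unit interval.\<close>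
 let ?L = "insert 0 (snd ` {p:P. fst p < a})" and ?R = "insert 1 (snd ` {p:P. a < fst p})"
 have fin: "finite ?L" "finite ?R" using P(1) by auto
 have bd: "0 < snd p & snd p < 1" if "p:P" for p using that P(2) B by (cases p) auto
 have L: "Max ?L:?L" using fin(1) by (rule Max_in) simp
 have R: "Min ?R:?R" using fin(2) by (rule Min_in) simp
 have lt: "u < v" if "u:?L" "v:?R" for u v
 proof -
  from that(1) consider "u = 0" | p where "p:P" "fst p < a" "u = snd p" by blast
  then show ?thesis
  proof cases
   case 1
   then show ?thesis using that(2) bd by auto
  next
   case (2 p)
   from that(2) consider "v = 1" | q where "q:P" "a < fst q" "v = snd q" by blast
   then show ?thesis
   proof cases
    case (2 q)
    then have "fst p < fst q" using \<open>fst p < a\<close> by simp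
    then show ?thesis using P(3) \<open>p:P\<close> 2 \<open>u = snd p\<close> unfolding order_pairs_def by blast
   qed (use 2 bd in auto)
  qed
 qed
 have "0 <= Max ?L" using fin(1) by (intro Max_ge) auto
 moreover have "Min ?R <= 1" using fin(2) by (intro Min_le) auto
 ultimately obtain b where b: "b:B" "Max ?L < b" "b < Min ?R" using dense lt[OF L R] by blast
 have bl: "snd p < b" if "p:P" "fst p < a" for p
 proof -
  have "snd p:?L" using that by blast
  then have "snd p <= Max ?L" using fin(1) by (intro Max_ge)
  then show ?thesis using b(2) by simp
 qed
 have br: "b < snd p" if "p:P" "a < fst p" for p
 proof -
  have "snd p:?R" using that by blast
  then have "Min ?R <= snd p" using fin(2) by (intro Min_le)
  then show ?thesis using b(3) by simp
 qed
 have cmp: "(fst p < a \<longleftrightarrow> snd p < b) & (a < fst p \<longleftrightarrow> b < snd p)" if p: "p:P" for p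
 proof -
  have "fst p ~= a" using False p by force
  then consider "fst p < a" | "a < fst p" by linarith
  then show ?thesis using bl[OF p] br[OF p] by cases auto
 qed
 have "order_pairs (insert (a, b) P)" using P(3) cmp unfolding order_pairs_def by auto
 then show ?thesis using P a b by (intro exI[of _ "insert (a, b) P"]) auto
qed

lemma order_pairs_swap: "order_pairs P ==> order_pairs (prod.swap ` P)"
 by (auto simp: order_pairs_def)

text \<open>Cantor's argument: stage \<open>n\<close> provides for the element number
  \<open>n\<close> of both sets.\<close>

lemma order_isomorphism_ex:
 fixes A B :: "real set"
 assumes A: "dense01 A" "countable A" and B: "dense01 B" "countable B"
 obtains R where "R <= A \<times> B" "order_pairs R" "fst ` R = A" "snd ` R = B"
proof -
 have ne: "A ~= {}" "B ~= {}" using dense01_ex[OF A(1), of 0 1] dense01_ex[OF B(1), of 0 1] by auto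
 define Q where "Q P \<longleftrightarrow> finite P & P <= A \<times> B & order_pairs P" for P
 have step: "EX P'. Q P' & P <= P' & from_nat_into A n:fst ` P' & from_nat_into B n:snd ` P'" if "Q P" for P n
 proof -
  have QP: "finite P" "P <= A \<times> B" "order_pairs P" using \<open>Q P\<close> by (auto simp: Q_def)
  from order_pairs_forth[OF QP B(1) from_nat_into[OF ne(1), of n]] obtain P1
   where P1: "finite P1" "P <= P1" "P1 <= A \<times> B" "order_pairs P1" "from_nat_into A n:fst ` P1"
   by (elim exE conjE)
  have S: "finite (prod.swap ` P1)" "prod.swap ` P1 <= B \<times> A" "order_pairs (prod.swap ` P1)"
   using P1(1) P1(3) order_pairs_swap[OF P1(4)] by auto
  from order_pairs_forth[OF S A(1) from_nat_into[OF ne(2), of n]] obtain P2 where P2: "finite P2" "prod.swap ` P1 <= P2" "P2 <= B \<times> A" "order_pairs P2" "from_nat_into B n:fst ` P2"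
   by (elim exE conjE)
  let ?P = "prod.swap ` P2"
  have "P1 <= ?P"
  proof
   fix p assume "p:P1"
   then have "prod.swap p:P2" using P2(2) by blast
   then show "p:?P" by (metis imageI swap_swap)
  qed
  moreover have "Q ?P" unfolding Q_def
  proof (intro conjI)
   show "finite ?P" using P2(1) by simp
   show "?P <= A \<times> B" using P2(3) by auto
   show "order_pairs ?P" by (rule order_pairs_swap[OF P2(4)])
  qed
  moreover have "from_nat_into B n:snd ` ?P" using P2(5) by (simp add: image_image)
  moreover have "P <= ?P" using P1(2) calculation(1) by (rule order_trans)
  moreover have "from_nat_into A n:fst ` ?P" using subsetD[OF image_mono[OF calculation(1)] P1(5)] .
  ultimately show ?thesis by (intro exI[of _ ?P] conjI)
 qed
 have "EX f. ALL n. Q (f n) & (f n <= f (Suc n) & from_nat_into A n:fst ` f (Suc n) & from_nat_into B n:snd ` f (Suc n))"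
 proof (rule dependent_nat_choice)
  show "EX P. Q P" by (rule exI[of _ "{}"]) (auto simp: Q_def order_pairs_def)
 qed (use step in blast)
 then obtain f where F: "ALL n. Q (f n) & (f n <= f (Suc n) & from_nat_into A n:fst ` f (Suc n) & from_nat_into B n:snd ` f (Suc n))" ..
 then have f: "Q (f n)" "f n <= f (Suc n)" "from_nat_into A n:fst ` f (Suc n)"
  "from_nat_into B n:snd ` f (Suc n)" for n by simp_all
 have mono: "f m <= f n" if "m <= n" for m n using lift_Suc_mono_le[of f, OF f(2) that] .
 let ?R = "\<Union>(range f)"
 have 1: "?R <= A \<times> B" using f(1) unfolding Q_def by blast
 have 2: "order_pairs ?R" unfolding order_pairs_def
 proof (intro ballI)
  fix p q assume "p:?R" "q:?R"
  then obtain m n where "p:f m" "q:f n" by blast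
  then have "p:f (max m n)" "q:f (max m n)" using mono[of m "max m n"] mono[of n "max m n"] by auto
  then show "fst p < fst q \<longleftrightarrow> snd p < snd q" using f(1)[of "max m n"] unfolding Q_def order_pairs_def by blast
 qed
 have 3: "A <= fst ` ?R"
 proof
  fix a assume "a:A"
  then obtain n where "a = from_nat_into A n" using A(2) by (metis from_nat_into_surj)
  then have "a:fst ` f (Suc n)" using f(3) by simp
  then show "a:fst ` ?R" by blast
 qed
 have 4: "B <= snd ` ?R"
 proof
  fix b assume "b:B"
  then obtain n where "b = from_nat_into B n" using B(2) by (metis from_nat_into_surj)
  then have "b:snd ` f (Suc n)" using f(4) by simp
  then show "b:snd ` ?R" by blast
 qed
 have "fst ` ?R <= A" "snd ` ?R <= B" using 1 by auto
 then show thesis using that[of ?R] 1 2 3 4 by blast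
qed

text \<open>Extended by the identity outside the unit interval, so that strict monotonicity and
  surjectivity can be used on the whole line. The element 0 covers the arguments below which there
  is no pair.\<close>

definition sup_ext :: "(real \<times> real) set => real => real" where
 "sup_ext R x = (if x < 0 | 1 < x then x else Sup (insert 0 {snd p |p. p:R & fst p <= x}))"

lemma sup_ext_facts:
 fixes A B :: "real set"
 assumes dA: "dense01 A" and dB: "dense01 B"
  and R: "R <= A \<times> B" "order_pairs R" "fst ` R = A" "snd ` R = B"
 shows "sup_ext R 0 = 0" "sup_ext R 1 = 1" "(a, b):R ==> sup_ext R a = b" "strict_mono (sup_ext R)"
  "x:{0..1} ==> sup_ext R x:{0..1}"
proof -
 note A = dense01_sub[OF dA] dense01_ex[OF dA] and B = dense01_sub[OF dB] dense01_ex[OF dB]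
 let ?S = "%x. insert 0 {snd p |p. p:R & fst p <= x}"
 have bd: "0 < fst p" "fst p < 1" "0 < snd p" "snd p < 1" if "p:R" for p
 proof -
  have "fst p:A" "snd p:B" using that R(1) by auto
  then show "0 < fst p" "fst p < 1" "0 < snd p" "snd p < 1" using A(1) B(1) by auto
 qed
 have S1: "u <= 1" if "u:?S x" for u x
 proof -
  from that consider "u = 0" | p where "p:R" "u = snd p" by blast
  then show ?thesis
  proof cases
   case (2 p)
   then show ?thesis using bd(4)[of p] by simp
  qed simp
 qed
 have bdd: "bdd_above (?S x)" for x using S1 by (rule bdd_aboveI)
 have inS: "snd p:?S x" if "p:R" "fst p <= x" for p x using that by blast
 have val: "sup_ext R x = Sup (?S x)" if "x:{0..1}" for x using that by (simp add: sup_ext_def)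
 have "{snd p |p. p:R & fst p <= 0} = {}"
 proof (rule equals0I)
  fix u assume "u:{snd p |p. p:R & fst p <= 0}"
  then obtain p where "p:R" "fst p <= 0" by blast
  then show False using bd(1)[of p] by simp
 qed
 then have S0: "?S 0 = {0}" by (simp only: insert_is_Un[symmetric])
 have "sup_ext R 0 = Sup (?S 0)" by (rule val) simp
 then show z: "sup_ext R 0 = 0" unfolding S0 by simp
 show in01: "sup_ext R x:{0..1}" if x: "x:{0..1}" for x
 proof -
  have "0 <= Sup (?S x)" by (rule cSup_upper[OF _ bdd]) simp
  moreover have "Sup (?S x) <= 1" by (rule cSup_least[OF insert_not_empty]) (rule S1)
  ultimately show ?thesis using val[OF x] by simp
 qed
 show one: "sup_ext R 1 = 1"
 proof (rule ccontr)
  assume "sup_ext R 1 ~= 1"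
  then have "sup_ext R 1 < 1" "0 <= sup_ext R 1" using in01[of 1] by auto
  then obtain b where b: "b:B" "sup_ext R 1 < b" using B(2)[of "sup_ext R 1" 1] by auto
  then obtain p where p: "p:R" "snd p = b" using R(4) by auto
  then have "b:?S 1" using inS[OF p(1), of 1] bd(2)[OF p(1)] by simp
  then have "b <= Sup (?S 1)" by (rule cSup_upper[OF _ bdd])
  then show False using b(2) val[of 1] by simp
 qed
 show pt: "sup_ext R a = b" if ab: "(a, b):R" for a b
 proof -
  have a: "a:{0..1}" using bd[OF ab] by simp
  have "Sup (?S a) = b"
  proof (rule cSup_eq_maximum)
   show "b:?S a" using inS[OF ab, of a] by simp
   fix u assume "u:?S a"
   then consider "u = 0" | p where "p:R" "fst p <= a" "u = snd p" by blast
   then show "u <= b"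
   proof cases
    case 1
    then show ?thesis using bd(3)[OF ab] by simp
   next
    case (2 p)
    have "~ fst (a, b) < fst p" using 2 by simp
    then have "~ snd (a, b) < snd p" using R(2) ab 2(1) unfolding order_pairs_def by blast
    then show ?thesis using 2 by simp
   qed
  qed
  then show ?thesis using val[OF a] by simp
 qed
 have mono: "sup_ext R x <= sup_ext R y" if "x <= y" "x:{0..1}" "y:{0..1}" for x y
  unfolding val[OF that(2)] val[OF that(3)] by (rule cSup_subset_mono[OF _ bdd]) (use that(1) in auto)
 \<comment> \<open>Two elements of \<open>A\<close> between \<open>x\<close> and \<open>y\<close>
   have different partners, and these separate the two suprema.\<close>
 have strict01: "sup_ext R x < sup_ext R y" if xy: "x < y" "x:{0..1}" "y:{0..1}" for x y
 proof -
  obtain a1 where a1: "a1:A" "x < a1" "a1 < y" using A(2)[of x y] xy by auto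
  obtain a2 where a2: "a2:A" "a1 < a2" "a2 < y" using A(2)[of a1 y] xy a1 by auto
  obtain b1 b2 where b: "(a1, b1):R" "(a2, b2):R" using a1 a2 R(3) by force
  have "b1 < b2" using R(2) b a2 unfolding order_pairs_def by fastforce
  moreover have "sup_ext R x <= b1" using mono[of x a1] pt[OF b(1)] a1 xy by simp
  moreover have "b2 <= sup_ext R y" using mono[of a2 y] pt[OF b(2)] a2 a1 xy by simp
  ultimately show ?thesis by simp
 qed
 show "strict_mono (sup_ext R)"
 proof (rule strict_monoI)
  fix x y :: real assume xy: "x < y"
  show "sup_ext R x < sup_ext R y"
  proof (cases "x:{0..1} & y:{0..1}")
   case True
   then show ?thesis using strict01 xy by blast
  next
   case False
   have o: "sup_ext R u = u" if "u ~: {0..1}" for u using that by (auto simp: sup_ext_def)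
   show ?thesis
   proof (cases "x:{0..1}")
    case True
    then have "y ~: {0..1}" "1 < y" using False xy by auto
    then show ?thesis using o[of y] in01[OF True] by simp
   next
    case nx: False
    show ?thesis
    proof (cases "y:{0..1}")
     case True
     then have "x < 0" using nx xy by auto
     then show ?thesis using o[OF nx] in01[OF True] by simp
    qed (use o[OF nx] o[of y] xy in simp)
   qed
  qed
 qed
qed

text \<open>The extensions of the relation and of its converse are inverse to each other; continuity
  then follows because a monotone surjection has no jumps.\<close>

lemma interval_homeomorphism_ex:
 fixes A B :: "real set"
 assumes A: "dense01 A" "countable A" and B: "dense01 B" "countable B"
 obtains F :: "real => real" where "continuous_on {0..1} F" "bij_betw F {0..1} {0..1}" "F 0 = 0" "F 1 = 1" "F ` A = B"
  "bij_betw F {0<..<1} {0<..<1}"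
proof -
 obtain R where R: "R <= A \<times> B" "order_pairs R" "fst ` R = A" "snd ` R = B"
  using order_isomorphism_ex[OF A B] .
 let ?R = "prod.swap ` R"
 have R': "?R <= B \<times> A" "order_pairs ?R" "fst ` ?R = B" "snd ` ?R = A"
  using R order_pairs_swap[OF R(2)] by (auto simp: image_image)
 note F = sup_ext_facts[OF A(1) B(1) R] and G = sup_ext_facts[OF B(1) A(1) R']
 let ?F = "sup_ext R" and ?G = "sup_ext ?R"
 have swapI: "(b, a):?R" if "(a, b):R" for a b using that by force
 \<comment> \<open>A value strictly between \<open>?F (?G y)\<close> and \<open>y\<close> could be
   taken from \<open>B\<close>, and comparing its partner in \<open>A\<close> with
   \<open>?G y\<close> contradicts monotonicity.\<close>
 have FG: "?F (?G y) = y" for y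
 proof (cases "y:{0..1}")
  case y: True
  show ?thesis
  proof (rule ccontr)
   assume "?F (?G y) ~= y"
   then consider "?F (?G y) < y" | "y < ?F (?G y)" by linarith
   then show False
   proof cases
    case 1
    then obtain b where b: "b:B" "?F (?G y) < b" "b < y" using dense01_ex[OF B(1), of "?F (?G y)" y] F(5)[OF G(5)[OF y]] y by auto
    then obtain a where a: "(a, b):R" using R(4) by force
    have "a < ?G y" using strict_monoD[OF G(4) b(3)] G(3)[OF swapI[OF a]] by simp
    then have "b < ?F (?G y)" using strict_monoD[OF F(4)] F(3)[OF a] by metis
    then show False using b(2) by simp
   next
    case 2
    then obtain b where b: "b:B" "y < b" "b < ?F (?G y)" using dense01_ex[OF B(1), of y "?F (?G y)"] F(5)[OF G(5)[OF y]] y by auto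
    then obtain a where a: "(a, b):R" using R(4) by force
    have "?G y < a" using strict_monoD[OF G(4) b(2)] G(3)[OF swapI[OF a]] by simp
    then have "?F (?G y) < b" using strict_monoD[OF F(4)] F(3)[OF a] by metis
    then show False using b(3) by simp
   qed
  qed
 next
  case False
  then have "?G y = y" "?F y = y" by (auto simp: sup_ext_def)
  then show ?thesis by simp
 qed
 have surj: "surj ?F" using FG by (metis surjI)
 have "continuous_on UNIV ?F"
  by (rule continuous_onI_mono) (use surj F(4) in \<open>auto simp: strict_mono_less_eq\<close>)
 then have c: "continuous_on {0..1} ?F" by (rule continuous_on_subset) simp
 have inj: "inj ?F" using F(4) by (rule strict_mono_imp_inj_on)
 have im: "?F ` {0..1} = {0..1}"
 proof (intro subset_antisym subsetI)
  fix y :: real assume "y:{0..1}"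
  then show "y:?F ` {0..1}" using FG[of y] G(5)[of y] by (metis imageI)
 qed (use F(5) in auto)
 have im': "?F ` {0<..<1} = {0<..<1}"
 proof -
  have e: "{0<..<1::real} = {0..1} - {0, 1}" by auto
  show ?thesis unfolding e image_set_diff[OF inj] im using F(1,2) by simp
 qed
 have "?F ` A = B"
 proof (intro subset_antisym subsetI)
  fix b assume "b:?F ` A"
  then obtain a where a: "a:A" "b = ?F a" by blast
  then obtain b' where "(a, b'):R" using R(3) by force
  then show "b:B" using F(3) a R(1) by auto
 next
  fix b assume "b:B"
  then obtain a where a: "(a, b):R" using R(4) by force
  then show "b:?F ` A" using F(3)[OF a] R(1) by force
 qed
 then show thesis using that[of ?F] c im im' F(1,2) inj by (auto simp: bij_betw_def intro: inj_on_subset)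
qed

text \<open>\<open>F\<close> is conjugated by \<open>q\<close> and continued by the identity. Both
  parts are continuous on closed sets, the second because the open arc is open, and they agree at
  the ends of the arc.\<close>

lemma arc_homeomorphism:
 assumes X: "compact_space X" "Hausdorff_space X" and q: "emb {0..1::real} X q" "openin X (q ` {0<..<1})"
  and F: "continuous_on {0..1} F" "bij_betw F {0..1} {0..1}" "F 0 = 0" "F 1 = (1::real)"
 obtains f where "homeomorphic_map X X f" "!!t. t:{0..1} ==> f (q t) = q (F t)" "!!x. x ~: q ` {0..1} ==> f x = x"
proof -
 have inj: "inj_on q {0..1}" by (rule embedding_inj[OF q(1)])
 have qtop: "q ` {0..1} <= topspace X" by (rule embedding_into[OF q(1)])
 define r where "r = inv_into {0..1} q"
 have rq: "r (q t) = t" if "t:{0..1}" for t using that inj by (simp add: r_def)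
 have qr: "q (r x) = x" "r x:{0..1}" if "x:q ` {0..1}" for x
  using f_inv_into_f[OF that] inv_into_into[OF that] by (simp_all only: r_def)
 have Fin: "F t:{0..1}" if "t:{0..1}" for t using F(2) that by (auto simp: bij_betw_def)
 define f where "f x = (if x:q ` {0..1} then q (F (r x)) else x)" for x
 have fq: "f (q t) = q (F t)" if "t:{0..1}" for t using that rq by (simp add: f_def)
 have cl: "closedin X (q ` {0..1})" by (rule arc_closed[OF X(2) q(1)]) simp
 have rcont: "continuous_map (subtopology X (q ` {0..1})) (top_of_set {0..1}) r"
 proof -
  have "homeomorphic_map (top_of_set {0..1}) (subtopology X (q ` {0..1})) q"
   using q(1) by (simp add: embedding_map_def)
  then obtain g where g: "homeomorphic_maps (top_of_set {0..1}) (subtopology X (q ` {0..1})) q g"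
   by (auto simp: homeomorphic_map_maps)
  have "g x = r x" if "x:topspace (subtopology X (q ` {0..1}))" for x
  proof -
   obtain t where t: "t:{0..1}" "x = q t" using \<open>x:_\<close> by auto
   then show ?thesis using g rq by (auto simp: homeomorphic_maps_def)
  qed
  moreover have "continuous_map (subtopology X (q ` {0..1})) (top_of_set {0..1}) g"
   using g by (simp add: homeomorphic_maps_def)
  ultimately show ?thesis by (metis (no_types, lifting) continuous_map_eq)
 qed
 have "continuous_map (top_of_set {0..1}) (top_of_set {0..1}) F" using F(1) Fin by auto
 then have "continuous_map (subtopology X (q ` {0..1})) X (q \<circ> (F \<circ> r))"
  using rcont embedding_cont[OF q(1)] by (intro continuous_map_compose)
 then have c1: "continuous_map (subtopology X (q ` {0..1})) X f" by (rule continuous_map_eq) (auto simp: f_def)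
 have fout: "f x = x" if "x ~: q ` {0<..<1}" for x
 proof (cases "x:q ` {0..1}")
  case True
  then obtain t where t: "t:{0..1}" "x = q t" by auto
  then have "t = 0 | t = 1" using that by force
  then show ?thesis using fq[OF t(1)] t F(3,4) by auto
 qed (simp add: f_def)
 have c2: "continuous_map (subtopology X (topspace X - q ` {0<..<1})) X f"
 proof -
  have "continuous_map (subtopology X (topspace X - q ` {0<..<1})) X id"
   by (rule continuous_map_from_subtopology[OF continuous_map_id])
  then show ?thesis by (rule continuous_map_eq) (use fout in auto)
 qed
 have cont: "continuous_map X X f" unfolding continuous_map_closedin
 proof (intro conjI allI impI)
  show "f:topspace X \<rightarrow> topspace X" using qtop Fin qr by (fastforce simp: f_def)
  fix K assume K: "closedin X K"
  let ?T1 = "q ` {0..1}" and ?T2 = "topspace X - q ` {0<..<1}"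
  have "closedin (subtopology X ?T1) {x:topspace (subtopology X ?T1). f x:K}"
   by (rule closedin_continuous_map_preimage[OF c1 K])
  then have 1: "closedin X {x:topspace (subtopology X ?T1). f x:K}" using cl closedin_trans_full by blast
  have "closedin (subtopology X ?T2) {x:topspace (subtopology X ?T2). f x:K}"
   by (rule closedin_continuous_map_preimage[OF c2 K])
  moreover have "closedin X ?T2" using q(2) by blast
  ultimately have 2: "closedin X {x:topspace (subtopology X ?T2). f x:K}" using closedin_trans_full by blast
  have "{x:topspace X. f x:K} = {x:topspace (subtopology X ?T1). f x:K} Un {x:topspace (subtopology X ?T2). f x:K}"
   using qtop by auto
  then show "closedin X {x:topspace X. f x:K}" using closedin_Un[OF 1 2] by simp
 qed
 have finto: "f x:q ` {0..1} \<longleftrightarrow> x:q ` {0..1}" for x using Fin qr(2) by (auto simp: f_def)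
 have injf: "inj_on f (topspace X)"
 proof (rule inj_onI)
  fix x y assume xy: "x:topspace X" "y:topspace X" "f x = f y"
  show "x = y"
  proof (cases "x:q ` {0..1}")
   case True
   then have "y:q ` {0..1}" using finto xy(3) by metis
   then obtain s t where st: "s:{0..1}" "x = q s" "t:{0..1}" "y = q t" using True by auto
   then have "q (F s) = q (F t)" using xy(3) fq by simp
   then have "F s = F t" using inj_onD[OF inj] Fin st by blast
   then have "s = t" using F(2) st unfolding bij_betw_def by (meson inj_onD)
   then show ?thesis using st by simp
  next
   case False
   then have "y ~: q ` {0..1}" using finto xy(3) by metis
   then show ?thesis using False xy(3) by (simp add: f_def)
  qed
 qed
 have surjf: "f ` topspace X = topspace X"
 proof (intro subset_antisym subsetI)
  fix y assume "y:f ` topspace X"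
  then show "y:topspace X" using continuous_map_image_subset_topspace[OF cont] by blast
 next
  fix y assume y: "y:topspace X"
  show "y:f ` topspace X"
  proof (cases "y:q ` {0..1}")
   case True
   then obtain t where t: "t:{0..1}" "y = q t" by auto
   then obtain s where "s:{0..1}" "t = F s" using F(2) unfolding bij_betw_def by blast
   then have "y = f (q s)" "q s:topspace X" using fq t qtop by auto
   then show ?thesis by blast
  next
   case False
   then show ?thesis using y by (intro image_eqI[of _ _ y]) (auto simp: f_def)
  qed
 qed
 have "homeomorphic_map X X f" using continuous_imp_homeomorphic_map[OF cont X(1,2) surjf injf] .
 then show thesis using that fq by (simp add: f_def)
qed


section \<open>Blocks are maximal cyclic sets\<close>

lemma embedding_concat:
 fixes f g :: "real => 'a"
 assumes H: "Hausdorff_space X" and f: "emb {0..1} X f" and g: "emb {0..1} X g"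
  and fg: "f 1 = g 0" "f ` {0..1} Int g ` {0..1} <= {g 0}"
 shows "EX q. emb {0..1::real} X q & q 0 = f 0 & q 1 = g 1 & q ` {0..1} = f ` {0..1} Un g ` {0..1}"
proof -
 define q where "q t = (if t <= 1/2 then f (2 * t) else g (2 * t - 1))" for t :: real
 have inj: "inj_on f {0..1}" "inj_on g {0..1}" using embedding_inj f g by blast+
 have cont: "continuous_map (top_of_set {0..1}) X q" unfolding q_def
 proof (rule continuous_map_cases_le)
  have "continuous_map (subtopology (top_of_set {0..1}) {t:topspace (top_of_set {0..1::real}). t <= 1/2}) (top_of_set {0..1}) (%t. 2 * t)"
   by (auto simp: subtopology_subtopology intro!: continuous_intros)
  from continuous_map_compose[OF this embedding_cont[OF f]]
  show "continuous_map (subtopology (top_of_set {0..1}) {t:topspace (top_of_set {0..1::real}). t <= 1/2}) X (%t. f (2 * t))" by (simp add: o_def)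
  have "continuous_map (subtopology (top_of_set {0..1}) {t:topspace (top_of_set {0..1::real}). 1/2 <= t}) (top_of_set {0..1}) (%t. 2 * t - 1)"
   by (auto simp: subtopology_subtopology intro!: continuous_intros)
  from continuous_map_compose[OF this embedding_cont[OF g]]
  show "continuous_map (subtopology (top_of_set {0..1}) {t:topspace (top_of_set {0..1::real}). 1/2 <= t}) X (%t. g (2 * t - 1))" by (simp add: o_def)
  fix t :: real assume "t:topspace (top_of_set {0..1})" "t = 1/2"
  then have "2 * t = 1" "2 * t - 1 = 0" by auto
  then show "f (2 * t) = g (2 * t - 1)" using fg(1) by (simp only:)
 qed (auto intro!: continuous_intros)
 have cross: "s = 1 & t = 0" if "s:{0..1}" "t:{0..1}" "f s = g t" for s t
 proof -
  have "f s:f ` {0..1}" "g t:g ` {0..1}" using that(1,2) by blast+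
  then have "g t:f ` {0..1} Int g ` {0..1}" unfolding that(3) by (rule IntI)
  then have "g t = g 0" using fg(2) by blast
  then have "t = 0" "f s = f 1" using inj_onD[OF inj(2)] that(2,3) fg(1) by auto
  then show ?thesis using inj_onD[OF inj(1)] that(1) by auto
 qed
 have "inj_on q {0..1}"
 proof (rule inj_onI)
  fix s t :: real assume st: "s:{0..1}" "t:{0..1}" "q s = q t"
  show "s = t"
  proof (cases "s <= 1/2"; cases "t <= 1/2")
   assume "s <= 1/2" "t <= 1/2"
   then show ?thesis using inj_onD[OF inj(1), of "2 * s" "2 * t"] st by (simp add: q_def)
  next
   assume "~ s <= 1/2" "~ t <= 1/2"
   then show ?thesis using inj_onD[OF inj(2), of "2 * s - 1" "2 * t - 1"] st by (simp add: q_def)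
  next
   assume "s <= 1/2" "~ t <= 1/2"
   then show ?thesis using cross[of "2 * s" "2 * t - 1"] st by (simp add: q_def)
  next
   assume "~ s <= 1/2" "t <= 1/2"
   then show ?thesis using cross[of "2 * t" "2 * s - 1"] st by (simp add: q_def)
  qed
 qed
 then have "emb {0..1} X q"
  by (intro continuous_imp_embedding_map[OF cont _ H]) (auto simp: compact_space_subtopology)
 moreover have "q ` {0..1} = f ` {0..1} Un g ` {0..1}"
 proof (intro subset_antisym subsetI)
  fix y assume "y:q ` {0..1}"
  then obtain t where t: "t:{0..1}" "y = q t" by blast
  show "y:f ` {0..1} Un g ` {0..1}"
  proof (cases "t <= 1/2")
   case True
   then have "y = f (2 * t)" "2 * t:{0..1}" using t by (auto simp: q_def)
   then show ?thesis by blast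
  next
   case False
   then have "y = g (2 * t - 1)" "2 * t - 1:{0..1}" using t by (auto simp: q_def)
   then show ?thesis by blast
  qed
 next
  fix y assume "y:f ` {0..1} Un g ` {0..1}"
  then consider t where "t:{0..1}" "y = f t" | t where "t:{0..1}" "y = g t" by blast
  then show "y:q ` {0..1}"
  proof cases
   case (1 t)
   then show ?thesis by (intro image_eqI[of _ _ "t/2"]) (auto simp: q_def)
  next
   case (2 t)
   show ?thesis
   proof (cases "t = 0")
    case True
    then show ?thesis using 2 fg(1) by (intro image_eqI[of _ _ "1/2"]) (auto simp: q_def)
   next
    case False
    then have "~ (t + 1)/2 <= 1/2" "2 * ((t + 1)/2) - 1 = t" using 2 by (auto simp: field_simps)
    then have "q ((t + 1)/2) = g t" by (simp only: q_def if_False)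
    then show ?thesis using 2 by (intro image_eqI[of _ _ "(t + 1)/2"]) auto
   qed
  qed
 qed
 moreover have "q 0 = f 0" "q 1 = g 1" by (simp_all add: q_def)
 ultimately show ?thesis by (intro exI[of _ q]) simp
qed

lemma embedding_reverse:
 fixes q :: "real => 'a"
 assumes "emb {0..1} X q" shows "emb {0..1} X (%t. q (1 - t))"
proof -
 have im: "(%t. 1 + (-1) * t) ` {0..1::real} = {0..1}"
 proof (intro subset_antisym subsetI)
  fix t :: real assume "t:{0..1}"
  then show "t:(%t. 1 + (-1) * t) ` {0..1}" by (intro image_eqI[of _ _ "1 - t"]) auto
 qed auto
 have "emb {0..1} (top_of_set {0..1}) (%t. 1 + (-1) * t::real)" by (rule embedding_map_affine) (use im in auto)
 from embedding_map_compose[OF this assms] show ?thesis by (simp add: o_def)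
qed

definition open_arc :: "'a topology => (real => 'a) => bool" where
 "open_arc X q \<longleftrightarrow> emb {0..1} X q & openin X (q ` {0<..<1})"

lemma open_arc_sub:
 assumes "open_arc X q" "0 <= l" "r <= 1"
 shows "openin X (q ` {l<..<r})"
proof -
 have e: "emb {0<..<1} X q"
  by (rule embedding_map_restrict[of "{0..1}"]) (use assms in \<open>auto simp: open_arc_def\<close>)
 have "openin (top_of_set {0<..<1}) {l<..<r}" using assms by (intro open_subset) auto
 then have "openin (subtopology X (q ` {0<..<1})) (q ` {l<..<r})" by (rule embedding_openin[OF e])
 then show ?thesis using assms(1) openin_trans_full unfolding open_arc_def by blast
qed

lemma open_arc_dense01:
 assumes q: "open_arc X q" and D: "X closure_of D = topspace X"
 shows "dense01 {t:{0<..<1}. q t:D}" unfolding dense01_def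
proof (intro conjI allI impI)
 fix l r :: real assume lr: "0 <= l & l < r & r <= 1"
 have "openin X (q ` {l<..<r})" using open_arc_sub[OF q] lr by blast
 moreover have "q ((l + r)/2):q ` {l<..<r}" using lr by auto
 ultimately have "D Int q ` {l<..<r} ~= {}" using dense_intersects_open[of X D] D by blast
 then obtain t where "t:{l<..<r}" "q t:D" by blast
 then show "EX a:{t:{0<..<1}. q t:D}. l < a & a < r" using lr by (intro bexI[of _ t]) auto
qed auto

lemma open_arc_countable:
 assumes q: "open_arc X q" and D: "countable D"
 shows "countable {t:{0<..<1}. q t:D}"
proof -
 have "inj_on q {t:{0<..<1}. q t:D}"
  by (rule inj_on_subset[OF embedding_inj[of "{0..1}" X q]]) (use q in \<open>auto simp: open_arc_def\<close>)
 moreover have "countable (q ` {t:{0<..<1}. q t:D})" by (rule countable_subset[OF _ D]) auto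
 ultimately show ?thesis using countable_image_inj_on by blast
qed

lemma match_on_arc:
 assumes X: "compact_space X" "Hausdorff_space X" and q: "open_arc X q"
  and D1: "countable D1" "X closure_of D1 = topspace X" and D2: "countable D2" "X closure_of D2 = topspace X"
 shows "EX f. homeomorphic_map X X f & (ALL x. x ~: q ` {0<..<1} --> f x = x) &
  f ` (D2 Int q ` {0<..<1}) = D1 Int q ` {0<..<1} & (ALL x. f x:q ` {0<..<1} \<longleftrightarrow> x:q ` {0<..<1})"
proof -
 let ?A = "{t:{0<..<1}. q t:D2}" and ?B = "{t:{0<..<1}. q t:D1}"
 have qe: "emb {0..1} X q" "openin X (q ` {0<..<1})" using q by (auto simp: open_arc_def)
 obtain F where F: "continuous_on {0..1} F" "bij_betw F {0..1} {0..1}" "F 0 = 0" "F 1 = 1" "F ` ?A = ?B"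
  "bij_betw F {0<..<1} {0<..<1}"
  using interval_homeomorphism_ex[OF open_arc_dense01[OF q D2(2)] open_arc_countable[OF q D2(1)]
   open_arc_dense01[OF q D1(2)] open_arc_countable[OF q D1(1)]] .
 obtain f where f: "homeomorphic_map X X f" "ALL t:{0..1}. f (q t) = q (F t)" "ALL x. x ~: q ` {0..1} --> f x = x"
  by (rule arc_homeomorphism[OF X qe F(1-4)]) simp
 have fixed: "f x = x" if "x ~: q ` {0<..<1}" for x
 proof (cases "x:q ` {0..1}")
  case True
  then obtain t where t: "t:{0..1}" "x = q t" by auto
  then have "t = 0 | t = 1" using that by force
  then show ?thesis using f(2) t F(3,4) by auto
 qed (use f(3) in blast)
 have im: "f (q t) = q (F t)" "F t:{0<..<1}" if "t:{0<..<1}" for t using f(2) that F(6) by (auto simp: bij_betw_def)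
 have "f ` (D2 Int q ` {0<..<1}) = D1 Int q ` {0<..<1}"
 proof -
  have "D2 Int q ` {0<..<1} = q ` ?A" "D1 Int q ` {0<..<1} = q ` ?B" by auto
  moreover have "f ` q ` ?A = q ` F ` ?A" unfolding image_image by (rule image_cong) (use im in auto)
  ultimately show ?thesis using F(5) by simp
 qed
 moreover have "f x:q ` {0<..<1} \<longleftrightarrow> x:q ` {0<..<1}" for x
 proof (cases "x:q ` {0<..<1}")
  case True
  then show ?thesis using im by auto
 qed (simp add: fixed)
 ultimately show ?thesis using f(1) fixed by (intro exI[of _ f]) simp
qed

context graph_space
begin

lemma branch_piece_open:
 assumes x: "x:topspace X" and C: "C:branches X x" and h: "ray X x C h" and d: "0 < d" "d <= 1"
 shows "openin X (h ` {0<..<d})"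
proof -
 have hC: "h ` {0<..<1} = C" using h by (simp add: ray_def)
 have "openin (top_of_set {0<..<1}) {0<..<d}" using d by (intro open_subset) auto
 then have "openin (subtopology X C) (h ` {0<..<d})" using embedding_openin[OF ray_open_arc[OF h]] hC by simp
 then show ?thesis using br_open[OF x C] openin_trans_full by blast
qed

text \<open>The halves of the two rays at \<open>x\<close>, joined at \<open>x\<close>. That the
  interior is open at \<open>x\<close> follows from the germs of the two branches.\<close>

lemma arc_through_nonessential:
 assumes x: "x:topspace X" "x ~: essential_vertices X"
 obtains q where "open_arc X q" "x:q ` {0<..<1}"
proof -
 have "card (branches X x) = 2" using essential_iff[OF Haus_X nnb[OF x(1)]] x(2) by (simp add: branches_eq)
 then obtain C1 C2 where C: "branches X x = {C1, C2}" "C1 ~= C2" by (auto simp: card_2_iff)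
 have br: "C1:branches X x" "C2:branches X x" using C by auto
 have dis: "C1 Int C2 = {}" using br_disj[OF x(1) br] C(2) by blast
 obtain h1 h2 where h: "ray X x C1 h1" "ray X x C2 h2" using br_ray[OF x(1)] br by metis
 have e: "emb {0..<1} X h1" "emb {0..<1} X h2"
  and h0: "h1 0 = x" "h2 0 = x" and hC: "h1 ` {0<..<1} = C1" "h2 ` {0<..<1} = C2" using h by (auto simp: ray_def)
 let ?f = "%t. h1 (0 + (1/2 - 0) * t)" and ?g = "%t. h2 (0 + (1/2 - 0) * t)"
 let ?f' = "%t. ?f (1 - t)"
 have half: "0 < (1/2::real)" "{0..1/2} <= {0..<1::real}" by auto
 have f: "emb {0..1} X ?f" "?f ` {0..1} = h1 ` {0..1/2}" by (rule embedding_subarc[OF e(1) half])+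
 have g: "emb {0..1} X ?g" "?g ` {0..1} = h2 ` {0..1/2}" by (rule embedding_subarc[OF e(2) half])+
 have rev: "(%t. 1 - t) ` {0..1::real} = {0..1}" by (auto intro!: image_eqI[of _ _ "1 - t" for t])
 have f': "?f' ` {0..1} = h1 ` {0..1/2}" unfolding f(2)[symmetric] by (subst rev[symmetric]) (simp only: image_image)
 have split: "h ` {0..1/2} = insert x (insert (h (1/2)) (h ` {0<..<1/2}))" if "h 0 = x" for h :: "real => 'a"
 proof -
  have "{0..1/2::real} = insert 0 (insert (1/2) {0<..<1/2})" by auto
  then show ?thesis using that by simp
 qed
 have xC: "x ~: C1" "x ~: C2" using br_notin[OF x(1)] br by auto
 have in1: "insert (h1 (1/2)) (h1 ` {0<..<1/2}) <= C1" and in2: "insert (h2 (1/2)) (h2 ` {0<..<1/2}) <= C2"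
  unfolding hC[symmetric] by auto
 have j: "?f' 1 = ?g 0" using h0 by simp
 have j': "?f' ` {0..1} Int ?g ` {0..1} <= {?g 0}"
 proof -
  have "insert x P Int insert x R <= {x}" if "P <= C1" "R <= C2" for P R using that dis by blast
  moreover have "?g 0 = x" using h0 by simp
  ultimately show ?thesis using in1 in2 unfolding f' g(2) split[of h1, OF h0(1)] split[of h2, OF h0(2)] by (simp only:)
 qed
 obtain q where q: "emb {0..1} X q" "q 0 = ?f' 0" "q 1 = ?g 1" "q ` {0..1::real} = ?f' ` {0..1} Un ?g ` {0..1}"
  using embedding_concat[OF Haus_X embedding_reverse[OF f(1)] g(1) j j'] by (elim exE conjE)
 note emb = q(1)
 have img: "q ` {0<..<1} = insert x (h1 ` {0<..<1/2} Un h2 ` {0<..<1/2})"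
 proof -
  have "{0<..<1::real} = {0..1} - {0, 1}" by auto
  then have "q ` {0<..<1} = q ` {0..1} - {q 0, q 1}"
   using inj_on_image_set_diff[OF embedding_inj[OF q(1)], of "{0..1}" "{0, 1}"] by simp
  moreover have ends: "q 0 = h1 (1/2)" "q 1 = h2 (1/2)" using q(2,3) by simp_all
  moreover have "h (1/2) ~: h ` {0<..<1/2}" if "emb {0..<1} X h" for h :: "real => 'a"
   using inj_onD[OF embedding_inj[OF that], of "1/2"] by force
  note n = this[OF e(1)] this[OF e(2)]
  have "(insert x (insert a P) Un insert x (insert b R)) - {a, b} = insert x (P Un R)"
   if "insert a P <= C1" "insert b R <= C2" "a ~: P" "b ~: R" for a b P R using that dis xC by blast
  note this[OF in1 in2 n]
  ultimately show ?thesis unfolding q(4) f' g(2) split[of h1, OF h0(1)] split[of h2, OF h0(2)] ends by (simp only:)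
 qed
 obtain U1 where U1: "openin X U1" "x:U1" "U1 Int C1 <= h1 ` ({0<..<1/2} Int {0<..<1})" using ray_germ[OF h(1), of "1/2"] by auto
 obtain U2 where U2: "openin X U2" "x:U2" "U2 Int C2 <= h2 ` ({0<..<1/2} Int {0<..<1})" using ray_germ[OF h(2), of "1/2"] by auto
 have s: "{0<..<1/2} Int {0<..<1} = {0<..<1/2::real}" by auto
 have N: "nnb x = insert x (C1 Un C2)" using nnb_eq[OF x(1)] C by auto
 have "q ` {0<..<1} = (U1 Int U2 Int nnb x) Un (h1 ` {0<..<1/2} Un h2 ` {0<..<1/2})"
  unfolding img N using U1(2,3) U2(2,3) unfolding s by blast
 moreover have "openin X \<dots>"
  using U1(1) U2(1) nnb_open[OF x(1)] branch_piece_open[OF x(1) br(1) h(1), of "1/2"] branch_piece_open[OF x(1) br(2) h(2), of "1/2"]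
  by (intro openin_Un openin_Int) auto
 ultimately have "open_arc X q" using emb by (simp add: open_arc_def)
 then show thesis using that img by blast
qed

lemma local_arcs:
 assumes x: "x:topspace X"
 shows "EX U Q. openin X U & x:U & finite Q & (ALL q:Q. open_arc X q) & U <= essential_vertices X Un (UN q:Q. q ` {0<..<1})"
proof (cases "x:essential_vertices X")
 case False
 obtain q where q: "open_arc X q" "x:q ` {0<..<1}" using arc_through_nonessential[OF x False] .
 then show ?thesis by (intro exI[of _ "q ` {0<..<1}"] exI[of _ "{q}"]) (auto simp: open_arc_def)
next
 case True
 have "EX U q. openin X U & x:U & open_arc X q & U Int C <= q ` {0<..<1}" if C: "C:branches X x" for C
 proof -
  obtain h where h: "ray X x C h" using br_ray[OF x C] by blast
  have e: "emb {0..<1} X h" using h by (simp add: ray_def)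
  obtain U where U: "openin X U" "x:U" "U Int C <= h ` ({0<..<1/2} Int {0<..<1})" using ray_germ[OF h, of "1/2"] by auto
  let ?q = "%t. h (0 + (1/2 - 0) * t)"
  have 1: "emb {0..1} X ?q" by (rule embedding_subarc(1)[OF e]) auto
  have 2: "?q ` {0<..<1} = h ` {0<..<1/2}"
  proof -
   have "?q ` {0<..<1} = h ` (%t. 0 + (1/2 - 0) * t) ` {0<..<1}" by (simp only: image_image)
   then show ?thesis using affine_image_right(1)[of 0 "1/2::real"] by simp
  qed
  have "openin X (h ` {0<..<1/2})" by (rule branch_piece_open[OF x C h]) auto
  then have "open_arc X ?q" using 1 2 by (simp add: open_arc_def)
  moreover have "U Int C <= ?q ` {0<..<1}" unfolding 2 using U(3) by (rule order_trans) auto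
  ultimately show ?thesis using U(1,2) by blast
 qed
 then have "ALL C:branches X x. EX p. openin X (fst p) & x:fst p & open_arc X (snd p) & fst p Int C <= snd p ` {0<..<1}"
  by (metis fst_conv snd_conv)
 from bchoice[OF this] obtain p where p: "ALL C:branches X x. openin X (fst (p C)) & x:fst (p C) & open_arc X (snd (p C)) &
  fst (p C) Int C <= snd (p C) ` {0<..<1}" ..
 let ?U = "\<Inter>(insert (nnb x) ((%C. fst (p C)) ` branches X x))" and ?Q = "(%C. snd (p C)) ` branches X x"
 have "openin X ?U" using br_finite[OF x] p nnb_open[OF x] by (intro openin_Inter) auto
 moreover have "x:?U" using p nnb_eq[OF x] by auto
 moreover have "finite ?Q" using br_finite[OF x] by simp
 moreover have "ALL q:?Q. open_arc X q" using p by blast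
 moreover have "?U <= essential_vertices X Un (UN q:?Q. q ` {0<..<1})"
 proof
  fix y assume y: "y:?U"
  then have "y:nnb x" by blast
  then consider "y = x" | C where "C:branches X x" "y:C" using nnb_eq[OF x] by auto
  then show "y:essential_vertices X Un (UN q:?Q. q ` {0<..<1})"
  proof cases
   case (2 C)
   then have "y:fst (p C) Int C" using y by blast
   then have "y:snd (p C) ` {0<..<1}" using p 2(1) by blast
   then show ?thesis using 2(1) by blast
  qed (use True in simp)
 qed
 ultimately show ?thesis by blast
qed

lemma finite_arc_cover:
 obtains Q where "finite Q" "!!q. q:Q ==> open_arc X q" "topspace X <= essential_vertices X Un (UN q:Q. q ` {0<..<1})"
proof -
 have "ALL x:topspace X. EX p. openin X (fst p) & x:fst p & finite (snd p) & (ALL q:snd p. open_arc X q) &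
  fst p <= essential_vertices X Un (UN q:snd p. q ` {0<..<1})" using local_arcs by (metis fst_conv snd_conv)
 from bchoice[OF this] obtain p where p: "ALL x:topspace X. openin X (fst (p x)) & x:fst (p x) & finite (snd (p x)) &
  (ALL q:snd (p x). open_arc X q) & fst (p x) <= essential_vertices X Un (UN q:snd (p x). q ` {0<..<1})" ..
 have "ALL U:(%x. fst (p x)) ` topspace X. openin X U" using p by blast
 moreover have "topspace X <= \<Union>((%x. fst (p x)) ` topspace X)" using p by blast
 ultimately have "EX \<F>. finite \<F> & \<F> <= (%x. fst (p x)) ` topspace X & topspace X <= \<Union>\<F>"
  using compact_X unfolding compact_space_alt by meson
 then obtain F where F: "finite F" "F <= topspace X" "topspace X <= \<Union>((%x. fst (p x)) ` F)"
  by (metis finite_subset_image)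
 show thesis
 proof (rule that[of "UN x:F. snd (p x)"])
  show "finite (UN x:F. snd (p x))" using F p by blast
  show "open_arc X q" if "q:(UN x:F. snd (p x))" for q using that F p by blast
  show "topspace X <= essential_vertices X Un (UN q:UN x:F. snd (p x). q ` {0<..<1})"
  proof
   fix y assume "y:topspace X"
   then obtain x where x: "x:F" "y:fst (p x)" using F(3) by blast
   then have "y:essential_vertices X Un (UN q:snd (p x). q ` {0<..<1})" using p F(2) by blast
   then show "y:essential_vertices X Un (UN q:UN x:F. snd (p x). q ` {0<..<1})" using x(1) by blast
  qed
 qed
qed

lemma arc_essential_free:
 assumes "open_arc X q" shows "q ` {0<..<1} Int essential_vertices X = {}"
proof -
 have "q t ~: essential_vertices X" if "t:{0<..<1}" for t
 proof (rule interior_normal_neighbourhood(3)[OF Haus_X])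
  show "emb {0..1} X q" "openin X (q ` {0<..<1})" using assms by (auto simp: open_arc_def)
  show "{0<..<1::real} <= {0..1}" by auto
 qed (use that in auto)
 then show ?thesis by auto
qed

lemma homeomorphic_dense:
 assumes f: "homeomorphic_map X X f" and D: "X closure_of D = topspace X" "D <= topspace X"
 shows "X closure_of (f ` D) = topspace X"
 using homeomorphic_map_closure_of[OF f D(2)] D(1) homeomorphic_imp_surjective_map[OF f] by simp

text \<open>The image of \<open>D2\<close> is corrected on the arcs of a finite cover one after
  another. A correction changes nothing outside its own arc and establishes agreement inside, so the
  agreement on earlier arcs survives. Essential vertices belong to both sets and are never
  moved.\<close>

lemma dense_homogeneous:
 assumes D1: "countable D1" "X closure_of D1 = topspace X" "D1 <= topspace X" "essential_vertices X <= D1"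
  and D2: "countable D2" "X closure_of D2 = topspace X" "D2 <= topspace X" "essential_vertices X <= D2"
 shows "EX f. homeomorphic_map X X f & f ` D2 = D1"
proof -
 obtain Q where Q: "finite Q" "!!q. q:Q ==> open_arc X q" "topspace X <= essential_vertices X Un (UN q:Q. q ` {0<..<1})"
  using finite_arc_cover by blast
 have "EX f. homeomorphic_map X X f & essential_vertices X <= f ` D2 &
   f ` D2 Int (UN q:Q. q ` {0<..<1}) = D1 Int (UN q:Q. q ` {0<..<1})" using Q(1,2)
 proof (induction Q)
  case empty
  have "homeomorphic_map X X (%x. x)" using homeomorphic_map_id[of X X] unfolding id_def by blast
  then show ?case using D2(4) by (intro exI[of _ "%x. x"]) simp
 next
  case (insert q Q)
  let ?U = "UN q:Q. q ` {0<..<1}" and ?I = "q ` {0<..<1}"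
  obtain f where f: "homeomorphic_map X X f" "essential_vertices X <= f ` D2" "f ` D2 Int ?U = D1 Int ?U"
   proof -
   have "open_arc X q'" if "q':Q" for q' using insert.prems that by simp
   note ih = insert.IH[OF this]
   show thesis by (rule exE[OF ih], assumption) (elim conjE, rule that)
  qed
  have c: "countable (f ` D2)" "X closure_of (f ` D2) = topspace X" using D2 homeomorphic_dense[OF f(1)] by auto
  have oq: "open_arc X q" using insert.prems by simp
  obtain g where g: "homeomorphic_map X X g" "ALL x. x ~: ?I --> g x = x" "g ` (f ` D2 Int ?I) = D1 Int ?I"
   "ALL x. g x:?I \<longleftrightarrow> x:?I" using match_on_arc[OF compact_X Haus_X oq D1(1,2) c] by (elim exE conjE)
  have "g ` A Int ?I = g ` (A Int ?I)" for A using g(4) by auto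
  then have 1: "g ` f ` D2 Int ?I = D1 Int ?I" using g(3) by simp
  have "g ` A - ?I = g ` (A - ?I)" for A using g(4) by auto
  moreover have "g ` (A - ?I) = A - ?I" for A using g(2) by simp
  ultimately have 2: "g ` f ` D2 - ?I = f ` D2 - ?I" by simp
  have set: "P Int I = D1 Int I ==> P - I = R - I ==> R Int U = D1 Int U ==> P Int (I Un U) = D1 Int (I Un U)" for P I R U
   by blast
  have "homeomorphic_map X X (g \<circ> f)" using homeomorphic_map_compose[OF f(1) g(1)] .
  moreover have "essential_vertices X <= (g \<circ> f) ` D2"
   using f(2) 2 arc_essential_free[OF oq] unfolding image_comp[symmetric] by blast
  moreover have "(g \<circ> f) ` D2 Int (UN q:insert q Q. q ` {0<..<1}) = D1 Int (UN q:insert q Q. q ` {0<..<1})"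
   unfolding image_comp[symmetric] UN_insert using 1 2 f(3) by (rule set)
  ultimately show ?case by blast
 qed
 then obtain f where f: "homeomorphic_map X X f" "essential_vertices X <= f ` D2"
  "f ` D2 Int (UN q:Q. q ` {0<..<1}) = D1 Int (UN q:Q. q ` {0<..<1})" by (elim exE conjE)
 have "f ` D2 <= topspace X" using D2(3) homeomorphic_imp_surjective_map[OF f(1)] by blast
 moreover have "A = D1" if "A <= topspace X" "essential_vertices X <= A" "A Int U = D1 Int U"
  "topspace X <= essential_vertices X Un U" for A U using that D1(3,4) by blast
 ultimately have "f ` D2 = D1" using f(2,3) Q(3) by (simp only:)
 then show ?thesis using f(1) by blast
qed

end

section \<open>Connectedness\<close>

context marked_graph
begin

text \<open>The central case of \<open>open_contains_fibre\<close>, keeping control of the vertex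
  and of the label.\<close>

lemma central_fibre:
 assumes Z: "openin RT Z" "m:Z" and cen: "t:W" "x:D" "central (fst m) t x"
 shows "EX y:D. y ~= x & {n:M. fst n t = y} <= Z"
proof -
 have m: "m:M" using Z openin_subset[OF Z(1)] by auto
 let ?E = "edge_set X D t x (snd m) (topspace X)"
 have xt: "x:topspace X" using cen D_top by blast
 have C: "snd m:branches X x" using M_br[OF m cen] .
 let ?Z = "Z Int ?E"
 have oE: "openin RT ?E" using openin_edge_set[OF cen(1,2) C openin_topspace xt] .
 obtain Q where Q: "openin (product_topology (%_. X) W) Q" "fst m:Q"
  "!!n. n:M ==> fst n:Q ==> (ALL w:W. ALL y:D. central (fst m) w y --> n:edge_set X D w y (snd m) (topspace X)) ==> n:Z"
  using RT_local[OF Z] by blast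
 have t': "nbr t x:W" using cen by simp
 have cfst: "continuous_map RT (product_topology (%_. X) W) fst"
  unfolding continuous_map_componentwise using continuous_coord by (auto simp: rpoints_def PiE_iff)
 have oQ: "openin RT {n:topspace RT. fst n:Q}" using openin_continuous_map_preimage[OF cfst Q(1)] .
 have "continuous_map RT (prod_topology X X) (%n. (fst n t, fst n (nbr t x)))"
  using continuous_coord[OF cen(1)] continuous_coord[OF t'] by (simp add: continuous_map_paired)
 then have cl: "closed_map RT (prod_topology X X) (%n. (fst n t, fst n (nbr t x)))"
  by (rule continuous_imp_closed_map[OF _ compact_RT]) (simp add: Haus_X Hausdorff_space_prod_topology)
 have fb: "{n:topspace RT. (fst n t, fst n (nbr t x)) = (x, x)} <= {n:topspace RT. fst n:Q}"
 proof (intro subsetI CollectI conjI)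
  fix n assume n: "n:{n:topspace RT. (fst n t, fst n (nbr t x)) = (x, x)}"
  then have nM: "n:M" "central (fst n) t x" by (auto simp: central_def)
  have "fst n:W \<rightarrow>\<^sub>E topspace X" "fst m:W \<rightarrow>\<^sub>E topspace X" using m nM(1) by (auto simp: rpoints_def)
  then have "fst n = fst m" by (rule PiE_ext) (simp add: determined_central[OF m nM(1) cen(1,2,3) nM(2)])
  then show "fst n:Q" using Q by simp
 qed simp
 have "(x, x):topspace (prod_topology X X)" using xt by simp
 from closed_map_tube[OF cl oQ this fb] obtain V where V: "openin (prod_topology X X) V" "(x, x):V"
  "{n:topspace RT. (fst n t, fst n (nbr t x)):V} <= {n:topspace RT. fst n:Q}" .
 obtain U1 U2 where U: "openin X U1" "openin X U2" "x:U1" "x:U2" "U1 \<times> U2 <= V"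
  using V(1)[unfolded openin_prod_topology_alt, rule_format, OF V(2)] by (elim exE conjE)
 have "openin X (U1 Int snd m)" using U(1) br_open[OF xt C] by blast
 moreover have "U1 Int snd m ~= {}" using br_limit[OF xt C U(1,3)] .
 ultimately obtain y where y: "y:U1" "y:snd m" "y:D" using D_meets by blast
 have yx: "y ~= x" using y br_notin[OF xt C] by blast
 have "n:Z" if n: "n:M" "fst n t = y" for n
 proof (rule Q(3)[OF n(1)])
  have "fst n (nbr t x) = x" using M_cons[OF n(1) cen(1,2)] n(2) yx by simp
  then have "(fst n t, fst n (nbr t x)):V" using U y n by auto
  then show "fst n:Q" using V(3) n(1) by auto
  show "ALL w:W. ALL z:D. central (fst m) w z --> n:edge_set X D w z (snd m) (topspace X)"
  proof (intro ballI impI)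
   fix w z assume w: "w:W" "z:D" "central (fst m) w z"
   then have *: "x = z & (w = t | w = nbr t x)" using central_unique[OF m cen w] by blast
   have "y:topspace X Int snd m" using y D_top by blast
   then show "n:edge_set X D w z (snd m) (topspace X)" using * n cen(1) by (auto simp: edge_set_def)
  qed
 qed
 then show ?thesis using y(3) yx by blast
qed

lemma coord_surj:
 assumes two: "!!y. EX z:D. z ~= y" and t: "t:W"
 shows "(%m. fst m t) ` M = topspace X"
proof
 show "(%m. fst m t) ` M <= topspace X" using M_top t by blast
 have "compactin X ((%m. fst m t) ` topspace RT)"
  by (rule image_compactin[OF _ continuous_coord[OF t]]) (use compact_RT in \<open>simp add: compact_space_def\<close>)
 then have "closedin X ((%m. fst m t) ` M)" using compactin_imp_closedin[OF Haus_X] by simp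
 moreover have "D <= (%m. fst m t) ` M"
 proof
  fix z assume "z:D"
  then show "z:(%m. fst m t) ` M" using two[of z] fibre_nonempty[OF t] by blast
 qed
 ultimately have "X closure_of D <= (%m. fst m t) ` M" by (simp add: closure_of_minimal)
 then show "topspace X <= (%m. fst m t) ` M" using D_dense by simp
qed

lemma coord_image_closed:
 assumes "closedin RT K" "t:W"
 shows "closedin X ((%m. fst m t) ` K)"
proof -
 have "compactin RT K" using assms(1) compact_RT closedin_compact_space by blast
 then have "compactin X ((%m. fst m t) ` K)" by (rule image_compactin[OF _ continuous_coord[OF assms(2)]])
 then show ?thesis using compactin_imp_closedin[OF Haus_X] by blast
qed

text \<open>The projections of \<open>K\<close> and \<open>L\<close> are closed, cover the graph and
  meet only over \<open>A\<close>: fibres over \<open>D - A\<close> are undivided by assumption,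
  fibres outside \<open>D\<close> are single points. Connectedness of the complement of
  \<open>A\<close> leaves one of them.\<close>

lemma clopen_coord:
 assumes K: "closedin RT K" "closedin RT L" "K Un L = M" "K Int L = {}" and two: "!!y. EX z:D. z ~= y"
  and t: "t:W" and T: "connectedin X (topspace X - A)" "closedin X A"
  and dec: "!!y. y:D - A ==> {m:M. fst m t = y} <= K | {m:M. fst m t = y} <= L"
 shows "{m:M. fst m t ~: A} <= K | {m:M. fst m t ~: A} <= L"
proof (rule ccontr)
 assume "~ ?thesis"
 then obtain m n where mn: "m:M" "fst m t ~: A" "m ~: K" "n:M" "fst n t ~: A" "n ~: L" by blast
 let ?f = "%m. fst m t"
 have dis: "?f ` K Int ?f ` L <= A"
 proof
  fix v assume "v:?f ` K Int ?f ` L"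
  then obtain a b where ab: "a:K" "b:L" "fst a t = v" "fst b t = v" by auto
  then have M: "a:M" "b:M" using K(3) by auto
  show "v:A"
  proof (rule ccontr)
   assume nA: "v ~: A"
   show False
   proof (cases "v:D")
    case True
    then show False using dec[of v] nA ab M K(4) by blast
   next
    case False
    then have "a = b" using determined_off_D[OF M t] ab by simp
    then show False using ab K(4) by blast
   qed
  qed
 qed
 have cov: "topspace X <= ?f ` K Un ?f ` L" using coord_surj[OF two t] K(3) by (metis image_Un order_refl)
 have cl: "closedin X (?f ` K)" "closedin X (?f ` L)" using coord_image_closed K(1,2) t by auto
 have op: "openin X (topspace X - ?f ` K)" "openin X (topspace X - ?f ` L)" using cl by auto
 have "topspace X - A <= topspace X - ?f ` K"
 proof (rule connectedin_two_opens[OF T(1) op])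
  show "topspace X - A <= (topspace X - ?f ` K) Un (topspace X - ?f ` L)" using dis by blast
  show "(topspace X - ?f ` K) Int (topspace X - ?f ` L) Int (topspace X - A) = {}" using cov by blast
  have mL: "m:L" using mn K(3) by blast
  show "?f m:topspace X - A" using M_top[OF mn(1) t] mn(2) by blast
  show "?f m:topspace X - ?f ` K" using M_top[OF mn(1) t] mL mn(2) dis by blast
 qed
 moreover have "n:K" using mn K(3) by blast
 moreover have "?f n:topspace X - A" using M_top[OF mn(4) t] mn(5) by blast
 ultimately show False by blast
qed

text \<open>Only finitely many shadows meet both parts of a separation. In a longest one, all fibres
  at \<open>s\<close> over labels other than that of its edge are undivided, so by
  \<open>clopen_coord\<close> the shadow itself is undivided. Hence no shadow is divided, and the
  same argument at the base vertex finishes the proof.\<close>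

lemma connected_RT:
 assumes conn: "connected_space X" "!!z. connectedin X (topspace X - {z})" and two: "!!y. EX z:D. z ~= y"
 shows "connected_space RT" unfolding connected_space_closedin_eq
proof
 assume "EX K L. closedin RT K & closedin RT L & K Un L = topspace RT & K Int L = {} & K ~= {} & L ~= {}"
 then obtain K L where K: "closedin RT K" "closedin RT L" "K Un L = M" "K Int L = {}" "K ~= {}" "L ~= {}" by auto
 let ?U = "{s:W - {[]}. shadow s Int K ~= {} & shadow s Int L ~= {}}"
 have cc: "compactin RT K" "compactin RT L" using K(1,2) compact_RT closedin_compact_space by auto
 have finU: "finite ?U" by (rule spread_disjoint_compact[OF spread_shadow cc K(4)])
 have oKL: "openin RT K" "openin RT L"
 proof -
  have "K = topspace RT - L" "L = topspace RT - K" using K(3,4) by auto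
  then show "openin RT K" "openin RT L" using K(1,2) by (metis openin_diff openin_topspace)+
 qed
 have sing: "closedin X {x}" if "x:D" for x using closedin_Hausdorff_singleton[OF Haus_X D_top[OF that]] .
 have "?U = {}"
 proof (rule ccontr)
  assume ne: "?U ~= {}"
  have "Max (length ` ?U):length ` ?U" using finU ne by (intro Max_in) auto
  then obtain s where s1: "s:?U" "length s = Max (length ` ?U)" by (rule imageE) (rule that; simp only:)
  have "length s' <= length s" if "s':?U" for s' unfolding s1(2) using finU that by (intro Max_ge) auto
  note s = s1(1) this
  have sW: "s:W" "s ~= []" using s(1) by auto
  then obtain x t where st: "s = x # t" by (cases s) auto
  have t: "t:W" "x:D" "nbr t x = s" "nbr s x = t" using sW st nbr_Cons[of x t D] by (auto simp: words_Cons)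
  have dec: "{m:M. fst m s = y} <= K | {m:M. fst m s = y} <= L" if y: "y:D - {x}" for y
  proof -
   have "y # s:W" using y sW st by (auto simp: words_Cons)
   moreover have "y # s ~: ?U" using s(2)[of "y # s"] by auto
   ultimately have "shadow (y # s) Int K = {} | shadow (y # s) Int L = {}" by blast
   moreover have "shadow (y # s) = {m:M. fst m s = y}" by (simp add: shadow_def)
   ultimately show ?thesis using K(3) by blast
  qed
  have main: "{m:M. fst m s ~: {x}} <= K | {m:M. fst m s ~: {x}} <= L"
   by (rule clopen_coord[OF K(1-4) two sW(1) conn(2) sing[OF t(2)] dec])
  \<comment> \<open>The points of the shadow not yet decided lie on the edge itself; by
    \<open>central_fibre\<close> they are limits of points beyond it.\<close>
  have all: "shadow s <= H" if H: "{m:M. fst m s ~: {x}} <= H" "H Un H' = M" "H Int H' = {}" "openin RT H'" for H H'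
  proof
   fix m assume m: "m:shadow s"
   then have mM: "m:M" "fst m t = x" by (auto simp: shadow_def st)
   show "m:H"
   proof (rule ccontr)
    assume "m ~: H"
    then have mH: "m:H'" and "fst m s = x" using mM H(1,2) by blast+
    then have c: "central (fst m) s x" using mM t by (simp add: central_def)
    obtain y where y: "y:D" "y ~= x" "{n:M. fst n s = y} <= H'" using central_fibre[OF H(4) mH sW(1) t(2) c] by blast
    obtain n where n: "n:M" "fst n s = y" using fibre_nonempty[OF sW(1) y(1) t(2) y(2)] by blast
    then have "n:H'" "n:H" using y H(1) by auto
    then show False using H(3) by blast
   qed
  qed
  have "L Un K = M" "L Int K = {}" using K(3,4) by auto
  then have "shadow s <= K | shadow s <= L" using main all[OF _ K(3,4) oKL(2)] all[OF _ _ _ oKL(1)] by auto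
  then show False using s(1) K(4) by blast
 qed
 have dec: "{m:M. fst m [] = y} <= K | {m:M. fst m [] = y} <= L" if y: "y:D - {}" for y
 proof -
  have "[y]:W" using y by (simp add: words_Cons)
  then have "shadow [y] Int K = {} | shadow [y] Int L = {}" using \<open>?U = {}\<close> by blast
  moreover have "shadow [y] = {m:M. fst m [] = y}" by (simp add: shadow_def)
  ultimately show ?thesis using K(3) by blast
 qed
 have "{m:M. fst m [] ~: {}} <= K | {m:M. fst m [] ~: {}} <= L"
  by (rule clopen_coord[OF K(1-4) two words_Nil _ closedin_empty dec]) (use conn(1) in \<open>simp add: connectedin_topspace\<close>)
 then show False using K by auto
qed

end

section \<open>A characterization of the Cantor set\<close>

text \<open>The prescribed set is used whenever it divides \<open>A\<close>, some other clopen set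
  otherwise. So every node of the tree has two non-empty halves, and yet each prescribed set gets
  its turn.\<close>

definition pick_clopen :: "'a topology => 'a set => 'a set => 'a set" where
 "pick_clopen Z A B = (if A Int B ~= {} & A - B ~= {} then B
   else (SOME H. openin Z H & closedin Z H & A Int H ~= {} & A - H ~= {}))"

fun clopen_tree :: "'a topology => (nat => 'a set) => bool list => 'a set" where
 "clopen_tree Z B [] = topspace Z"
| "clopen_tree Z B (b # s) =
   (if b then clopen_tree Z B s Int pick_clopen Z (clopen_tree Z B s) (B (length s))
   else clopen_tree Z B s - pick_clopen Z (clopen_tree Z B s) (B (length s)))"

primrec prefix_list :: "(nat => bool) => nat => bool list" where
 "prefix_list c 0 = []"
| "prefix_list c (Suc n) = c n # prefix_list c n"

lemma length_prefix_list [simp]: "length (prefix_list c n) = n"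
 by (induction n) auto

lemma prefix_list_eqD: "prefix_list c n = prefix_list d n ==> k < n ==> c k = d k"
 by (induction n) (auto simp: less_Suc_eq)

text \<open>A compact perfect space with a countable family of clopen sets separating its points is
  coded by an infinite binary tree of clopen sets. Branches have a common point by compactness and
  only one because the family separates points.\<close>

lemma cantor_characterization:
 assumes Z: "compact_space Z" "Hausdorff_space Z" "second_countable Z" "topspace Z ~= {}"
  and perfect: "!!U. openin Z U ==> U ~= {} ==> EX a:U. EX b:U. a ~= b"
  and sep: "!!a b. a:topspace Z ==> b:topspace Z ==> a ~= b ==> EX H. openin Z H & closedin Z H & a:H & b ~: H"
 shows "Z homeomorphic_space cantor_space"
proof -
 obtain \<B> where \<B>: "countable \<B>" "!!V. V:\<B> ==> openin Z V"
  "!!U x. openin Z U ==> x:U ==> EX V:\<B>. x:V & V <= U" by (rule second_countableE[OF Z(3)]) (rule that)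
 \<comment> \<open>Choosing one clopen set for each pair of basic sets that can be separated makes
   the separating family countable.\<close>
 define good where "good p H \<longleftrightarrow> openin Z H & closedin Z H & fst p <= H & snd p Int H = {}" for p H
 define I where "I = {p:\<B> \<times> \<B>. EX H. good p H}"
 define G where "G p = (SOME H. good p H)" for p
 have G: "good p (G p)" if "p:I" for p using that someI_ex[of "good p"] by (auto simp: I_def G_def)
 have cI: "countable I" by (rule countable_subset[of _ "\<B> \<times> \<B>"]) (use \<B>(1) in \<open>auto simp: I_def\<close>)
 have sepG: "EX p:I. a:G p & b ~: G p" if ab: "a:topspace Z" "b:topspace Z" "a ~= b" for a b
 proof -
  obtain H where H: "openin Z H" "closedin Z H" "a:H" "b ~: H" using sep[OF ab] by blast
  obtain U where U: "U:\<B>" "a:U" "U <= H" using \<B>(3)[OF H(1,3)] by blast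
  have "openin Z (topspace Z - H)" using H(2) by blast
  then obtain V where V: "V:\<B>" "b:V" "V <= topspace Z - H" using \<B>(3)[of "topspace Z - H" b] ab H(4) by blast
  have "good (U, V) H" using H U V by (auto simp: good_def)
  then have p: "(U, V):I" using U V by (auto simp: I_def)
  have "a:G (U, V)" "b ~: G (U, V)" using G[OF p] U V by (auto simp: good_def)
  then show ?thesis using p by blast
 qed
 obtain a0 b0 where "a0:topspace Z" "b0:topspace Z" "a0 ~= b0" using perfect[OF openin_topspace Z(4)] by blast
 then have Ine: "I ~= {}" using sepG by blast
 define B where "B n = G (from_nat_into I n)" for n
 have Bclo: "openin Z (B n)" "closedin Z (B n)" for n using G[OF from_nat_into[OF Ine]] by (auto simp: B_def good_def)
 have sepB: "EX n. a:B n & b ~: B n" if ab: "a:topspace Z" "b:topspace Z" "a ~= b" for a b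
 proof -
  obtain p where p: "p:I" "a:G p" "b ~: G p" using sepG[OF ab] by blast
  then obtain n where "p = from_nat_into I n" using cI by (metis from_nat_into_surj)
  then show ?thesis using p by (auto simp: B_def)
 qed
 let ?A = "clopen_tree Z B" and ?p = "%s. pick_clopen Z (clopen_tree Z B s) (B (length s))"
 have pick: "openin Z (pick_clopen Z A (B n)) & closedin Z (pick_clopen Z A (B n)) &
   A Int pick_clopen Z A (B n) ~= {} & A - pick_clopen Z A (B n) ~= {}" if A: "openin Z A" "A ~= {}" for A n
 proof (cases "A Int B n ~= {} & A - B n ~= {}")
  case True
  then show ?thesis using Bclo by (simp add: pick_clopen_def)
 next
  case False
  obtain a b where ab: "a:A" "b:A" "a ~= b" using perfect[OF A] by blast
  have "a:topspace Z" "b:topspace Z" using ab openin_subset[OF A(1)] by auto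
  then obtain H where "openin Z H" "closedin Z H" "a:H" "b ~: H" using sep ab(3) by blast
  then have "EX H. openin Z H & closedin Z H & A Int H ~= {} & A - H ~= {}" using ab by blast
  from someI_ex[OF this] show ?thesis unfolding pick_clopen_def if_not_P[OF False] .
 qed
 have A: "openin Z (?A s) & closedin Z (?A s) & ?A s ~= {}" for s
 proof (induction s)
  case Nil
  show ?case using Z(4) by simp
 next
  case (Cons b s)
  have "openin Z (?p s)" "closedin Z (?p s)" "?A s Int ?p s ~= {}" "?A s - ?p s ~= {}"
   using pick[of "?A s" "length s"] Cons by auto
  then show ?case using Cons by (cases b) (auto intro: openin_Int openin_diff closedin_Int closedin_diff)
 qed
 \<comment> \<open>The node of level \<open>n\<close> to which \<open>z\<close> belongs.\<close>
 define path where "path = (%z. rec_nat [] (%n s. (z:?p s) # s))"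
 have path0: "path z 0 = []" and pathS: "path z (Suc n) = (z:?p (path z n)) # path z n" for z n
  by (simp_all add: path_def)
 have plen: "length (path z n) = n" for z n by (induction n) (auto simp: path0 pathS)
 have pin: "z:?A (path z n)" if "z:topspace Z" for z n
  by (induction n) (use that in \<open>auto simp: path0 pathS\<close>)
 have puniq: "path z n = s" if "z:?A s" "length s = n" for z n s using that
 proof (induction s arbitrary: n)
  case (Cons b s)
  then have "z:?A s" by (auto split: if_splits)
  then have "path z (length s) = s" using Cons.IH by blast
  then have "path z n = (z:?p s) # s" using pathS[of z "length s"] Cons.prems(2) by simp
  moreover have "(z:?p s) = b" using Cons.prems(1) by (cases b) auto
  ultimately show ?case by simp
 qed (simp add: path0)
 define e where "e z n = (z:?p (path z n))" for z n
 have pe: "path z n = prefix_list (e z) n" for z n by (induction n) (auto simp: path0 pathS e_def)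
 have "continuous_map Z cantor_space e" unfolding cantor_space_def continuous_map_componentwise_UNIV
 proof
  fix n
  have op: "openin Z {z:topspace Z. e z n = b}" for b
  proof -
   have "{z:topspace Z. e z n = b} = (UN s:{s. length s = n}. ?A (b # s))"
   proof (intro subset_antisym subsetI)
    fix z assume "z:{z:topspace Z. e z n = b}"
    then have z: "z:topspace Z" "e z n = b" by auto
    have "path z (Suc n) = b # path z n" using z(2) by (simp add: pathS e_def)
    then have "z:?A (b # path z n)" using pin[OF z(1), of "Suc n"] by simp
    then show "z:(UN s:{s. length s = n}. ?A (b # s))" using plen by blast
   next
    fix z assume "z:(UN s:{s. length s = n}. ?A (b # s))"
    then obtain s where s: "length s = n" "z:?A (b # s)" by blast
    have "path z (Suc n) = b # s" by (rule puniq[OF s(2)]) (simp add: s(1))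
    then have "e z n = b" unfolding pathS e_def list.inject by (rule conjunct1)
    moreover have "z:topspace Z" using s(2) A[of "b # s"] openin_subset by blast
    ultimately show "z:{z:topspace Z. e z n = b}" by simp
   qed
   also have "openin Z \<dots>" using A by (intro openin_Union) blast
   finally show ?thesis .
  qed
  show "continuous_map Z (discrete_topology UNIV) (%z. e z n)" unfolding continuous_map_def
  proof (intro conjI allI impI)
   fix U :: "bool set"
   have "{z:topspace Z. e z n:U} = (UN b:U. {z:topspace Z. e z n = b})" by blast
   then show "openin Z {z:topspace Z. e z n:U}" using op by auto
  qed simp
 qed
 moreover have "e ` topspace Z = topspace cantor_space"
 proof
  show "topspace cantor_space <= e ` topspace Z"
  proof
   fix c :: "nat => bool"
   have dec: "?A (prefix_list c (Suc n)) <= ?A (prefix_list c n)" for n by auto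
   have mono: "decseq (%n. ?A (prefix_list c n))" by (rule decseq_SucI) (rule dec)
   have "(\<Inter>n. ?A (prefix_list c n)) ~= {}" using A mono by (intro compact_space_imp_nest[OF Z(1)]) auto
   then obtain z where z: "z:?A (prefix_list c n)" for n by blast
   have zt: "z:topspace Z" using z[of 0] by simp
   have eqp: "prefix_list (e z) n = prefix_list c n" for n unfolding pe[symmetric] by (rule puniq[OF z]) simp
   have "e z k = c k" for k by (rule prefix_list_eqD[OF eqp[of "Suc k"]]) simp
   then have "e z = c" ..
   then show "c:e ` topspace Z" using zt by blast
  qed
 qed (simp add: cantor_space_def)
 moreover have "inj_on e (topspace Z)"
 proof (rule inj_onI, rule ccontr)
  fix a b assume ab: "a:topspace Z" "b:topspace Z" "e a = e b" "a ~= b"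
  obtain n where n: "a:B n" "b ~: B n" using sepB ab by blast
  have p: "path a n = path b n" using ab(3) by (simp add: pe)
  let ?s = "path a n"
  have "a:?A ?s" "b:?A ?s" using pin[OF ab(1), of n] pin[OF ab(2), of n] unfolding p by auto
  \<comment> \<open>Both points lie in the same node of level \<open>n\<close>, so
    \<open>B n\<close> divides that node and was the set chosen there.\<close>
  then have "?A ?s Int B n ~= {} & ?A ?s - B n ~= {}" using n by blast
  then have "?p ?s = B n" by (simp add: pick_clopen_def plen)
  then have "e a n" "~ e b n" using n p by (auto simp: e_def)
  then show False using ab(3) by simp
 qed
 moreover have "Hausdorff_space cantor_space" by (simp add: cantor_space_def Hausdorff_space_product_topology)
 ultimately have "homeomorphic_map Z cantor_space e" using continuous_imp_homeomorphic_map Z(1) by blast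
 then show ?thesis by (rule homeomorphic_map_imp_homeomorphic_space)
qed


section \<open>The inverse limit and its coordinates\<close>

locale labelled_tree = marked_graph +
 fixes V :: "'v set" and E :: "'v set set" and lab :: "'v set => 'a"
 assumes tree: "is_tree V E" and lab: "t:V ==> bij_betw lab {e:E. t:e} D"
begin

definition step :: "'v => 'a => 'v" where "step t x = (THE s. {t, s}:E & lab {t, s} = x)"

lemma edge_ends: "{s, t}:E ==> s:V & t:V & s ~= t"
proof -
 assume "{s, t}:E"
 then obtain a b where "a:V" "b:V" "a ~= b" "{s, t} = {a, b}" using tree unfolding is_tree_def by meson
 then show ?thesis by (auto simp: doubleton_eq_iff)
qed

lemma edge_pair: "e:E ==> t:e ==> EX s. e = {t, s}"
proof -
 assume e: "e:E" "t:e"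
 then obtain a b where "e = {a, b}" using tree unfolding is_tree_def by meson
 then show ?thesis using e(2) by auto
qed

lemma step_ex1:
 assumes t: "t:V" and x: "x:D"
 shows "EX! s. {t, s}:E & lab {t, s} = x"
proof -
 have b: "inj_on lab {e:E. t:e}" "lab ` {e:E. t:e} = D" using lab[OF t] by (auto simp: bij_betw_def)
 then obtain e where "e:E" "t:e" "lab e = x" using x by blast
 then obtain s where s: "{t, s}:E" "lab {t, s} = x" using edge_pair by blast
 show ?thesis
 proof (rule ex1I[of _ s])
  fix s' assume "{t, s'}:E & lab {t, s'} = x"
  then have "{t, s} = {t, s'}" using inj_onD[OF b(1), of "{t, s}" "{t, s'}"] s by auto
  then show "s' = s" by (auto simp: doubleton_eq_iff)
 qed (use s in simp)
qed

lemma step: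
 assumes "t:V" "x:D"
 shows step_edge: "{t, step t x}:E" and step_lab: "lab {t, step t x} = x"
 using theI'[OF step_ex1[OF assms]] by (auto simp: step_def)

lemma step_V [simp]: "t:V ==> x:D ==> step t x:V"
 using step_edge edge_ends by blast

lemma step_neq [simp]: "t:V ==> x:D ==> step t x ~= t"
 using step_edge edge_ends by metis

lemma step_eq:
 assumes "{t, s}:E" shows "lab {t, s}:D" "step t (lab {t, s}) = s"
proof -
 have t: "t:V" using edge_ends assms by blast
 then show d: "lab {t, s}:D" using lab[OF t] assms by (auto simp: bij_betw_def)
 show "step t (lab {t, s}) = s" unfolding step_def by (rule the1_equality[OF step_ex1[OF t d]]) (use assms in simp)
qed

lemma step_step [simp]: "t:V ==> x:D ==> step (step t x) x = t"
 using step_edge[of t x] step_lab[of t x] step_eq[of "step t x" t] by (simp add: insert_commute)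

text \<open>As in \<open>act\<close>, the last letter is the first step. \<open>trail\<close> lists
  the visited vertices against the direction of travel, ending with \<open>t\<close>.\<close>

primrec go :: "'v => 'a list => 'v" where
 "go t [] = t" | "go t (x # w) = step (go t w) x"

primrec trail :: "'v => 'a list => 'v list" where
 "trail t [] = [t]" | "trail t (x # w) = step (go t w) x # trail t w"

lemma go_V [simp]: "t:V ==> w:W ==> go t w:V"
 by (induction w) (auto simp: words_Cons)

lemma go_append: "go t (u @ v) = go (go t v) u"
 by (induction u) auto

lemma go_nbr: "t:V ==> w:W ==> x:D ==> go t (nbr w x) = step (go t w) x"
 by (cases w) (auto simp: nbr_def words_Cons)

lemma go_act: "t:V ==> v:W ==> w:W ==> go t (act v w) = go (go t v) w"
 by (induction w) (auto simp: words_Cons go_nbr)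

lemma trail_simps [simp]: "trail t w ~= []" "hd (trail t w) = go t w" "last (trail t w) = t" "length (trail t w) = Suc (length w)"
 by (induction w) auto

lemma go_in_trail: "go t w:set (trail t w)"
 using hd_in_set[OF trail_simps(1)] by simp

lemma trail_tl: "w ~= [] ==> go t (tl w):set (trail t w)"
 by (cases w) (auto simp: go_in_trail)

lemma trail_last: "w ~= [] ==> step t (last w):set (trail t w)"
 by (induction w) auto

lemma trail_path: "t:V ==> w:W ==> successively (%u v. {u, v}:E) (trail t w)"
proof (induction w)
 case (Cons x w)
 then have "successively (%u v. {u, v}:E) (trail t w)" "{step (go t w) x, go t w}:E"
  using step_edge[of "go t w" x] by (auto simp: words_Cons insert_commute)
 then show ?case by (simp add: successively_Cons)
qed simp

lemma no_long_path: "path_in E s p t ==> 3 <= length p ==> {s, t} ~: E"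
 using tree unfolding is_tree_def by blast

text \<open>A repeated vertex either closes a path of at least three vertices, which a tree
  excludes, or is an immediate return along an edge, which a reduced word excludes.\<close>

lemma trail_distinct: "t:V ==> w:W ==> distinct (trail t w)"
proof (induction w)
 case (Cons x w)
 let ?s = "step (go t w) x"
 have w: "w:W" "x:D" "t:V" "w ~= [] ==> hd w ~= x" using Cons by (auto simp: words_Cons)
 note d = Cons.IH[OF w(3,1)] and g = go_V[OF w(3,1)]
 have "?s ~: set (trail t w)"
 proof
  assume "?s:set (trail t w)"
  then obtain p q where pq: "trail t w = p @ ?s # q" by (meson split_list)
  then have pne: "p ~= []" using trail_simps(2)[of t w] step_neq[OF g w(2)] by (cases p) auto
  then have hp: "hd p = go t w" using trail_simps(2)[of t w] pq by simp
  have "successively (%u v. {u, v}:E) ((p @ [?s]) @ q)" using trail_path[OF w(3,1)] pq by simp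
  then have "path_in E (go t w) (p @ [?s]) ?s" using d pq pne hp unfolding path_in_def
   by (auto simp: successively_append_iff)
  then have "length p < 2" using no_long_path step_edge[OF g w(2)] by fastforce
  then have "p = [go t w]" using pne hp by (cases p) auto
  then obtain y v where yv: "w = y # v" "?s = go t v" using pq trail_simps(2)[of t "tl w"] by (cases w) auto
  then have "y:D" "v:W" using w(1) by (auto simp: words_Cons)
  then have "lab {go t w, ?s} = y" using yv step_lab[of "go t v" y] w(3) by (simp add: insert_commute)
  then show False using step_lab[OF g w(2)] w(4) yv(1) by simp
 qed
 then show ?case using d by simp
qed simp

lemma go_loop: "t:V ==> w:W ==> go t w = t ==> w = []"
proof (cases w)
 case (Cons x v)
 assume a: "t:V" "w:W" "go t w = t"
 have "t:set (trail t v)" using last_in_set[OF trail_simps(1)] by (metis trail_simps(3))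
 then show ?thesis using trail_distinct[OF a(1,2)] a(3) Cons by auto
qed

lemma go_inj: "t:V ==> u:W ==> v:W ==> go t u = go t v ==> u = v"
proof -
 assume a: "t:V" "u:W" "v:W" "go t u = go t v"
 obtain w where w: "w:W" "u = act v w" using act_surj[OF a(3,2)] by blast
 then have "w = []" using go_loop[of "go t v" w] a go_act[of t v w] by simp
 then show ?thesis using w by simp
qed

text \<open>The labels along the path spell the word; two equal consecutive labels would lead back
  to an earlier vertex of the path.\<close>

lemma path_trail: "path_in E s p t ==> t:V ==> EX w:W. p = trail t w & s = go t w"
proof (induction p arbitrary: s)
 case (Cons a p)
 show ?case
 proof (cases "p = []")
  case True
  then show ?thesis using Cons.prems by (intro bexI[of _ "[]"]) (auto simp: path_in_def)
 next
  case False
  then have "path_in E (hd p) p t" "{a, hd p}:E" "a ~: set p" "a = s"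
   using Cons.prems(1) by (auto simp: path_in_def successively_Cons)
  moreover then obtain w where w: "w:W" "p = trail t w" "hd p = go t w" using Cons.IH Cons.prems(2) by blast
  ultimately have e: "{go t w, a}:E" "a ~: set (trail t w)" "a = s" by (auto simp: insert_commute)
  let ?x = "lab {go t w, a}"
  note x = step_eq[OF e(1)]
  have "?x # w:W"
  proof (cases w)
   case (Cons y v)
   have "y ~= ?x"
   proof
    assume "y = ?x"
    then have "a = go t v" using x Cons w(1) Cons.prems(2) by (simp add: words_Cons)
    then show False using e(2) Cons go_in_trail[of t v] by simp
   qed
   then show ?thesis using x w(1) Cons by (simp add: words_Cons)
  qed (use x in \<open>simp add: words_Cons\<close>)
  then show ?thesis using w x e(3) by (intro bexI[of _ "?x # w"]) auto
 qed
qed (simp add: path_in_def)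

lemma trail_path_in: "t:V ==> w:W ==> path_in E (go t w) (trail t w) t"
 using trail_path trail_distinct by (auto simp: path_in_def)

lemma go_surj: "s:V ==> t:V ==> EX w:W. s = go t w"
 using tree path_trail unfolding is_tree_def by meson

lemma tree_path_eq: "t:V ==> w:W ==> tree_path E (go t w) t = trail t w"
 unfolding tree_path_def
proof (rule the_equality)
 fix p assume a: "t:V" "w:W" "path_in E (go t w) p t"
 then obtain v where "v:W" "p = trail t v" "go t w = go t v" using path_trail by blast
 then show "p = trail t w" using go_inj[of t w v] a by simp
qed (rule trail_path_in)

abbreviation "\<F> \<equiv> finite_subtrees V E"
text \<open>The points at which the copy at \<open>t\<close> is blown up in the stage
  \<open>F\<close>.\<close>

definition J :: "'v set => 'v => 'a set" where "J F t = lab ` adjacent_edges E F t"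

lemma subtreeD: "F:\<F> ==> F <= V & finite F & F ~= {}"
 by (simp add: finite_subtrees_def is_tree_def)

lemma path_stays:
 assumes "successively (%u v. {u, v}:edges_of E F) p" "p ~= []" "last p:F"
 shows "set p <= F" using assms by (induction p) (auto simp: successively_Cons edges_of_def split: if_splits)

text \<open>The path inside the subtree is also a path of the whole tree, hence equal to the
  trail.\<close>

lemma subtree_convex:
 assumes F: "F:\<F>" and t: "t:F" and w: "w:W" "go t w:F"
 shows "set (trail t w) <= F"
proof -
 obtain p where p: "path_in (edges_of E F) (go t w) p t"
  using F t w(2) unfolding finite_subtrees_def is_tree_def by blast
 then have "path_in E (go t w) p t" unfolding path_in_def edges_of_def by (auto elim: successively_mono)
 moreover have tV: "t:V" using F t subtreeD by blast
 ultimately obtain v where "v:W" "p = trail t v" "go t w = go t v" using path_trail by blast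
 then have "p = trail t w" using go_inj[of t w v] tV w by simp
 then show ?thesis using p path_stays[of F p] t by (auto simp: path_in_def)
qed

lemma J_iff: "F <= V ==> t:F ==> x:J F t \<longleftrightarrow> x:D & step t x:F"
proof
 assume F: "F <= V" "t:F" and "x:J F t"
 then obtain e where e: "e:E" "e <= F" "t:e" "x = lab e" by (auto simp: J_def adjacent_edges_def edges_of_def)
 moreover then obtain s where "e = {t, s}" using edge_pair by blast
 ultimately show "x:D & step t x:F" using step_eq[of t s] by simp
next
 assume F: "F <= V" "t:F" and x: "x:D & step t x:F"
 then have "{t, step t x}:adjacent_edges E F t" using step_edge[of t x] by (auto simp: adjacent_edges_def edges_of_def)
 then show "x:J F t" unfolding J_def using step_lab[of t x] x F by (metis image_eqI subsetD)
qed

lemma small_subtree: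
 assumes "t:V" "s:V" "s = t | {t, s}:E"
 shows "{t, s}:\<F>"
proof -
 let ?E = "edges_of E {t, s}"
 have "EX p. path_in ?E a p b" if "a:{t, s}" "b:{t, s}" for a b
 proof (cases "a = b")
  case True
  then show ?thesis by (intro exI[of _ "[a]"]) (simp add: path_in_def)
 next
  case False
  then have "{a, b} = {t, s}" using that by auto
  then have "{a, b}:?E" using assms(3) False that by (auto simp: edges_of_def)
  then show ?thesis using False by (intro exI[of _ "[a, b]"]) (simp add: path_in_def)
 qed
 moreover have False if p: "path_in ?E a p b" "3 <= length p" "{a, b}:?E" for a p b
 proof -
  have "b:{t, s}" using p(3) by (auto simp: edges_of_def)
  then have "set p <= {t, s}" using path_stays[of "{t, s}" p] p(1) by (simp add: path_in_def)
  then have "card (set p) <= card {t, s}" by (intro card_mono) auto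
  then show False using p(1,2) distinct_card[of p] by (auto simp: path_in_def card_insert_if split: if_splits)
 qed
 moreover have "EX a:{t, s}. EX b:{t, s}. a ~= b & e = {a, b}" if e: "e:?E" for e
 proof -
  have "e:E" "e <= {t, s}" using e by (auto simp: edges_of_def)
  moreover then obtain a b where "a ~= b" "e = {a, b}" using tree unfolding is_tree_def by meson
  ultimately show ?thesis by blast
 qed
 ultimately have "is_tree {t, s} ?E" unfolding is_tree_def by (intro conjI) (simp, meson, meson, meson)
 then show ?thesis using assms by (simp add: finite_subtrees_def)
qed

text \<open>The data of \<open>collapse\<close> in terms of words: \<open>w\<close> leads from
  \<open>t\<close> to the closest vertex, and \<open>hd w\<close> is the label of the edge by which
  it arrives. This edge leaves \<open>F\<close>, since its other end would be closer to
  \<open>t\<close>.\<close>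

lemma closest:
 assumes F: "F:\<F>" and t: "t:V" "t ~: F"
 obtains w where "w:W" "w ~= []" "closest_vertex E F t = go t w" "go t w:F" "hd w ~: J F (go t w)"
  "lab (first_edge E (go t w) t) = hd w"
proof -
 let ?s = "closest_vertex E F t"
 obtain s0 where "s0:F" using subtreeD[OF F] by blast
 then have s: "?s:F" "!!u. u:F ==> length (tree_path E ?s t) <= length (tree_path E u t)" unfolding closest_vertex_def
  using arg_min_nat_lemma[of "%s. s:F" s0 "%s. length (tree_path E s t)"] by blast+
 then have "?s:V" using subtreeD[OF F] by blast
 then obtain w where w: "w:W" "?s = go t w" using go_surj t(1) by blast
 have ne: "w ~= []" using s(1) w(2) t(2) by auto
 then obtain x v where xv: "w = x # v" by (cases w) auto
 then have v: "v:W" "x:D" using w(1) by (auto simp: words_Cons)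
 have "go t v ~: F"
 proof
  assume "go t v:F"
  then have "length (trail t w) <= length (trail t v)" using s(2) w tree_path_eq[OF t(1)] v(1) by metis
  then show False using xv by simp
 qed
 moreover have "step (go t w) (hd w) = go t v" using xv v t(1) by simp
 ultimately have "hd w ~: J F (go t w)" using J_iff[of F "go t w"] subtreeD[OF F] s(1) w(2) by auto
 moreover have "trail t w ! 0 = step (go t v) x" "trail t w ! 1 = go t v"
  using xv hd_conv_nth[OF trail_simps(1), of t v] by auto
 then have "first_edge E (go t w) t = {step (go t v) x, go t v}"
  by (simp only: first_edge_def tree_path_eq[OF t(1) w(1)])
 then have "lab (first_edge E (go t w) t) = hd w" using step_lab[of "go t v" x] v t(1) xv by (simp add: insert_commute)
 ultimately show thesis using that w ne s(1) by simp
qed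

section \<open>Classes of the stages determined by a family of projections\<close>

definition coherent :: "('v => 'a) => bool" where
 "coherent q \<longleftrightarrow> (ALL t:V. ALL x:D. q t = x | q (step t x) = x)"

text \<open>This lemma and the next two are \<open>pointing\<close>,
  \<open>not_central_beyond\<close> and \<open>central_unique\<close> for families on the vertices
  of the given tree, needed before such a family is known to be a point of the model.\<close>

lemma go_pointing:
 "coherent q ==> t:V ==> w:W ==> w ~= [] ==> q t ~= last w ==> q (go t w) = hd w"
proof (induction w)
 case (Cons x w)
 have w: "x:D" "w:W" "w ~= [] ==> hd w ~= x" using Cons.prems(3) by (auto simp: words_Cons)
 then have "q (go t w) ~= x" using Cons by (cases "w = []") auto
 moreover have "go t w:V" using w Cons.prems(2) by simp
 ultimately show ?case using Cons.prems(1) w(1) by (auto simp: coherent_def)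
qed simp

lemma no_centre_beyond:
 assumes q: "coherent q" "t:V" and w: "w:W" "w ~= []" "q t ~= last w"
 shows "q (step (go t w) (q (go t w))) ~= q (go t w)"
proof -
 obtain x v where xv: "w = x # v" using w(2) by (cases w) auto
 have v: "x:D" "v:W" "v ~= [] ==> hd v ~= x" using w(1) xv by (auto simp: words_Cons)
 have "q (go t w) = x" using go_pointing[OF q w] xv by simp
 moreover have "step (go t w) x = go t v" using xv v q(2) by simp
 moreover have "q (go t v) ~= x" using go_pointing[OF q v(2)] v(3) w(3) xv by (cases "v = []") auto
 ultimately show ?thesis by simp
qed

lemma centre_unique:
 assumes q: "coherent q" and t: "t:V" "q t:D" "q (step t (q t)) = q t" and s: "s:V" "q (step s (q s)) = q s"
 shows "q s = q t & (s = t | s = step t (q t))"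
proof -
 obtain w where w: "w:W" "s = go t w" using go_surj s(1) t(1) by blast
 show ?thesis
 proof (cases "w = []")
  case False
  then have l: "last w = q t" using no_centre_beyond[OF q t(1) w(1) False] s(2) unfolding w(2) by metis
  let ?t = "step t (q t)"
  obtain v where v: "w = v @ [q t]" using l False by (metis append_butlast_last_id)
  then have vW: "v:W" "v ~= [] ==> last v ~= q t"
   using w(1) words_append1 by (auto simp: words_def distinct_adj_append_iff)
  have sv: "s = go ?t v" using w(2) v by (simp add: go_append)
  show ?thesis
  proof (cases "v = []")
   case False
   then have "q (step s (q s)) ~= q s" unfolding sv using t vW by (intro no_centre_beyond[OF q]) auto
   then show ?thesis using s(2) by simp
  qed (use sv t in simp)
 qed (use w in simp)
qed

text \<open>The equivalence class in the stage \<open>F\<close> of the point with projections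
  \<open>q\<close> and branch \<open>c\<close>. Collecting over all vertices avoids choosing the
  copy in which it lies.\<close>

definition pts :: "('v => 'a) => 'a set => 'v set => ('v \<times> 'a blow_up_point) set" where
 "pts q c F = {(t, Pt (q t)) |t. t:F & q t ~: J F t} Un
   {(t, End (q t) c) |t. t:F & q t:J F t & q (step t (q t)) = q t}"

text \<open>If one vertex of \<open>F\<close> does not point into \<open>F\<close>, all the others
  point towards it. If every vertex points into \<open>F\<close>, a walk following the projections
  must stop by finiteness, and it can stop only at an edge with both ends pointing to each
  other.\<close>

lemma pts_cases:
 assumes q: "coherent q" and F: "F:\<F>"
 shows "(EX t:F. q t ~: J F t & pts q c F = {(t, Pt (q t))}) |
  (EX t:F. q t:J F t & q (step t (q t)) = q t & pts q c F = {(t, End (q t) c), (step t (q t), End (q t) c)})"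
proof -
 have FV: "F <= V" and finF: "finite F" using subtreeD[OF F] by auto
 have point: "q s:J F s & q (step s (q s)) ~= q s" if t: "t:F" "q t ~: J F t" and s: "s:F" "s ~= t" for s t
 proof -
  have V: "t:V" "s:V" using FV t s by auto
  obtain w where w: "w:W" "s = go t w" using go_surj[OF V(2,1)] by blast
  have ne: "w ~= []" using w(2) s(2) by auto
  have sub: "set (trail t w) <= F" using subtree_convex[OF F t(1) w(1)] s(1) w(2) by simp
  have D: "set w <= D" using w(1) by (simp add: words_def)
  have "step t (last w):F" "last w:D" using trail_last[OF ne, of t] sub D ne by auto
  then have "last w:J F t" using J_iff[OF FV t(1)] by simp
  then have l: "q t ~= last w" using t(2) by metis
  obtain x v where xv: "w = x # v" using ne by (cases w) auto
  then have v: "x:D" "v:W" using w(1) by (auto simp: words_Cons)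
  have "step s x = go t v" using w(2) xv v V by simp
  moreover have "go t v:F" using trail_tl[OF ne, of t] sub xv by auto
  ultimately have "x:J F s" using J_iff[OF FV s(1)] v by simp
  moreover have "q s = x" using go_pointing[OF q V(1) w(1) ne l] xv w(2) by simp
  ultimately show ?thesis using no_centre_beyond[OF q V(1) w(1) ne l] w(2) by simp
 qed
 show ?thesis
 proof (cases "EX t:F. q t ~: J F t")
  case True
  then obtain t where t: "t:F" "q t ~: J F t" by blast
  then have "pts q c F = {(t, Pt (q t))}" using point[OF t] by (auto simp: pts_def)
  then show ?thesis using t by blast
 next
  case False
  then have all: "q t:J F t" if "t:F" for t using that by blast
  obtain t0 where t0: "t0:F" using subtreeD[OF F] by blast
  then have t0V: "t0:V" using FV by blast
  \<comment> \<open>Walks in \<open>F\<close> from \<open>t0\<close> whose last vertex does not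
    point straight back. One of maximal length cannot be continued, so the projection across its
    next edge points back.\<close>
  let ?S = "{w:W. go t0 w:F & (w = [] | q (go t0 w) ~= hd w)}"
  have "inj_on (go t0) ?S" using go_inj[OF t0V] by (auto intro!: inj_onI)
  then have "finite ?S" by (rule inj_on_finite[of _ _ F]) (use finF in auto)
  moreover have "[]:?S" using t0 by simp
  ultimately have "Max (length ` ?S):length ` ?S" and up: "!!v. v:?S ==> length v <= Max (length ` ?S)"
   by (blast intro: Max_in, simp)
  from this(1) obtain w where w: "w:?S" "Max (length ` ?S) = length w" by (rule imageE) (rule that)
  let ?t = "go t0 w" let ?x = "q ?t"
  have t: "?t:F" "?x:J F ?t" "?t:V" using w(1) all FV by auto
  then have x: "?x:D" "step ?t ?x:F" using J_iff[OF FV t(1)] by auto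
  have c: "q (step ?t ?x) = ?x"
  proof (rule ccontr)
   assume "q (step ?t ?x) ~= ?x"
   then have "?x # w:?S" using w(1) x by (auto simp: words_Cons)
   then show False using up[of "?x # w"] w(2) by simp
  qed
  have "pts q c F = {(?t, End ?x c), (step ?t ?x, End ?x c)}"
  proof -
   have "(step ?t ?x, End ?x c):pts q c F" using all[OF x(2)] c x t by (auto simp: pts_def)
   moreover have "(?t, End ?x c):pts q c F" using t c by (auto simp: pts_def)
   moreover have "pts q c F <= {(?t, End ?x c), (step ?t ?x, End ?x c)}"
    using centre_unique[OF q t(3) x(1) c] all FV by (auto simp: pts_def)
   ultimately show ?thesis by blast
  qed
  then show ?thesis using t c by blast
 qed
qed

lemma topspace_pieces: "topspace (pieces X E lab F) =
  {(t, Pt y) |t y. t:F & y:topspace X - J F t} Un {(t, End x C) |t x C. t:F & x:J F t Int topspace X & C:branches X x}"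
 by (auto simp: pieces_def J_def[symmetric] blow_up_points_def) blast

lemma gluing_Pt:
 "(t, Pt y):topspace (pieces X E lab F) ==> gluing X E lab F `` {(t, Pt y)} = {(t, Pt y)}" by (auto simp: gluing_def)

lemma gluing_End:
 assumes F: "F <= V" "t:F" and x: "x:J F t" and C: "C:branches X x"
 shows "gluing X E lab F `` {(t, End x C)} = {(t, End x C), (step t x, End x C)}"
proof -
 have s: "x:D" "step t x:F" using x J_iff[OF F] by auto
 have tV: "t:V" using F by blast
 note e = step_edge[OF tV s(1)] step_lab[OF tV s(1)]
 have "(t, End x C):topspace (pieces X E lab F)" unfolding topspace_pieces using F x C D_top[OF s(1)] by auto
 moreover have "{t, step t x}:edges_of E F" using e F s by (simp add: edges_of_def)
 then have "((t, End x C), (step t x, End x C)):gluing X E lab F"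
  unfolding gluing_def using e C step_neq[OF tV s(1)] by (intro UnI2 CollectI) metis
 moreover have "p:{(t, End x C), (step t x, End x C)}" if "((t, End x C), p):gluing X E lab F" for p
  using that step_eq[of t] by (auto simp: gluing_def edges_of_def)
 ultimately show ?thesis by (auto simp: gluing_def)
qed

definition valid :: "('v => 'a) => 'a set => bool" where
 "valid q c \<longleftrightarrow> coherent q & q:V \<rightarrow> topspace X & (ALL t:V. q t:D --> q (step t (q t)) = q t --> c:branches X (q t))"

lemma pts_class:
 assumes q: "valid q c" and F: "F:\<F>" and p: "p:pts q c F"
 shows "p:topspace (pieces X E lab F)" "gluing X E lab F `` {p} = pts q c F"
proof -
 have co: "coherent q" and FV: "F <= V" using q subtreeD[OF F] by (auto simp: valid_def)
 have "p:topspace (pieces X E lab F) & gluing X E lab F `` {p} = pts q c F" using pts_cases[OF co F, of c]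
 proof (elim disjE bexE conjE)
  fix t assume t: "t:F" "q t ~: J F t" "pts q c F = {(t, Pt (q t))}"
  then have "q t:topspace X" using q FV by (auto simp: valid_def)
  then have "p:topspace (pieces X E lab F)" using t p unfolding topspace_pieces by auto
  then show ?thesis using gluing_Pt t(3) p by auto
 next
  fix t assume t: "t:F" "q t:J F t" "q (step t (q t)) = q t"
   "pts q c F = {(t, End (q t) c), (step t (q t), End (q t) c)}"
  let ?x = "q t" and ?s = "step t (q t)"
  have s: "?x:D" "?s:F" "t:V" using t J_iff[OF FV t(1)] FV by auto
  then have C: "c:branches X ?x" using q t(3) by (auto simp: valid_def)
  have sJ: "?x:J F ?s" using J_iff[OF FV s(2)] s t by simp
  have "(t, End ?x c):topspace (pieces X E lab F)" "(?s, End ?x c):topspace (pieces X E lab F)"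
   unfolding topspace_pieces using t s C sJ D_top[OF s(1)] by auto
  moreover have "gluing X E lab F `` {(t, End ?x c)} = pts q c F" "gluing X E lab F `` {(?s, End ?x c)} = pts q c F"
   using gluing_End[OF FV t(1,2) C] gluing_End[OF FV s(2) sJ C] s unfolding t(4) by (auto simp: insert_commute)
  moreover have "p = (t, End ?x c) | p = (?s, End ?x c)" using p unfolding t(4) by simp
  ultimately show ?thesis by metis
 qed
 then show "p:topspace (pieces X E lab F)" "gluing X E lab F `` {p} = pts q c F" by auto
qed

lemma pts_nonempty: "coherent q ==> F:\<F> ==> pts q c F ~= {}"
 using pts_cases[of q F c] by auto

lemma topspace_stage: "topspace (stage X E lab F) = (%p. gluing X E lab F `` {p}) ` topspace (pieces X E lab F)"
 using quotient_imp_surjective_map[OF quotient_map_quotient_topology, of "gluing X E lab F" "pieces X E lab F"] by (simp add: stage_def)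

lemma stage_cases:
 assumes F: "F <= V" and c: "c:topspace (stage X E lab F)"
 shows "(EX t:F. EX y:topspace X - J F t. c = {(t, Pt y)}) |
  (EX t:F. EX x:J F t. EX C:branches X x. c = {(t, End x C), (step t x, End x C)})"
proof -
 obtain p where p: "p:topspace (pieces X E lab F)" "c = gluing X E lab F `` {p}" using c unfolding topspace_stage by blast
 from p(1) consider t y where "p = (t, Pt y)" "t:F" "y:topspace X - J F t"
  | t x C where "p = (t, End x C)" "t:F" "x:J F t" "C:branches X x" unfolding topspace_pieces by blast
 then show ?thesis
 proof cases
  case 1
  then show ?thesis using p gluing_Pt by blast
 next
  case (2 t x C)
  then have "c = {(t, End x C), (step t x, End x C)}" using p gluing_End[OF F 2(2-4)] by simp
  then show ?thesis using 2(2-4) by blast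
 qed
qed

lemma pts_stage: "valid q c ==> F:\<F> ==> pts q c F:topspace (stage X E lab F)"
proof -
 assume a: "valid q c" "F:\<F>"
 then obtain p where "p:pts q c F" using pts_nonempty[of q F c] by (auto simp: valid_def)
 from pts_class[OF a this] show ?thesis unfolding topspace_stage by (metis image_eqI)
qed

text \<open>A point located outside \<open>F\<close> is seen from the closest vertex of
  \<open>F\<close> at the label of the first edge towards it; this is \<open>go_pointing\<close>
  along the path to that vertex.\<close>

lemma collapse_pts:
 assumes q: "coherent q" and F: "F:\<F>" "F':\<F>" "F <= F'" and p: "p:pts q c F'"
 shows "collapse E lab F p:pts q c F"
proof -
 have FV: "F <= V" "F' <= V" using subtreeD F by auto
 obtain t where t: "t:F'" "p = (t, Pt (q t)) & q t ~: J F' t | p = (t, End (q t) c) & q t:J F' t & q (step t (q t)) = q t"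
  using p by (auto simp: pts_def)
 have JJ: "J F t <= J F' t" using F(3) by (auto simp: J_def adjacent_edges_def edges_of_def)
 show ?thesis
 proof (cases "t:F")
  case True
  then show ?thesis using t JJ by (auto simp: collapse_def pts_def J_def[symmetric])
 next
  case False
  have tV: "t:V" using t FV by blast
  obtain w where w: "w:W" "w ~= []" "closest_vertex E F t = go t w" "go t w:F" "hd w ~: J F (go t w)"
   "lab (first_edge E (go t w) t) = hd w" using closest[OF F(1) tV False] .
  have sub: "set (trail t w) <= F'" using subtree_convex[OF F(2) t(1) w(1)] w(4) F(3) by blast
  have l: "last w:D" "step t (last w):F'" using trail_last[OF w(2), of t] sub w(1,2) by (auto simp: words_def)
  then have lJ: "last w:J F' t" using J_iff[OF FV(2) t(1)] by simp
  have "q (go t w) = hd w"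
  proof (cases "q t = last w")
   case eq: True
   \<comment> \<open>The path starts across the central edge, so \<open>go_pointing\<close> is
     applied from the other end of that edge.\<close>
   let ?t = "step t (q t)"
   obtain v where v: "w = v @ [q t]" using eq w(2) by (metis append_butlast_last_id)
   then have vW: "v:W" "v ~= [] ==> last v ~= q t"
    using w(1) words_append1 by (auto simp: words_def distinct_adj_append_iff)
   have c: "q ?t = q t" "?t:V" using t(2) lJ eq l tV by auto
   show ?thesis
   proof (cases "v = []")
    case False
    then have "q (go ?t v) = hd v" using vW c by (intro go_pointing[OF q]) auto
    then show ?thesis using v False by (simp add: go_append)
   qed (use v c in simp)
  qed (rule go_pointing[OF q tV w(1,2)])
  then have "(go t w, Pt (hd w)):pts q c F" using w by (auto simp: pts_def)
  moreover have "collapse E lab F p = (go t w, Pt (hd w))" using t(2) False w(3,6) by (auto simp: collapse_def)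
  ultimately show ?thesis by simp
 qed
qed

lemma bonding_pts:
 assumes q: "valid q c" and F: "F:\<F>" "F':\<F>" "F <= F'"
 shows "bonding X E lab F' F (pts q c F') = pts q c F"
proof -
 have co: "coherent q" using q by (simp add: valid_def)
 obtain p where p: "p:pts q c F'" using pts_nonempty[OF co F(2), of c] by blast
 have "gluing X E lab F `` {collapse E lab F p'} = pts q c F" if "p':pts q c F'" for p'
  by (rule pts_class(2)[OF q F(1) collapse_pts[OF co F that]])
 then have "(UN p':pts q c F'. gluing X E lab F `` {collapse E lab F p'}) = pts q c F" using p by auto
 moreover have "bonding X E lab F' F (pts q c F') = (UN p':pts q c F'. gluing X E lab F `` {collapse E lab F p'})"
  unfolding bonding_def by blast
 ultimately show ?thesis by simp
qed

lemma openin_stage: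
 "openin (stage X E lab F) Q \<longleftrightarrow> Q <= topspace (stage X E lab F) &
  (ALL t:F. openin (blow_up X (J F t)) {q. (t, q):topspace (pieces X E lab F) & gluing X E lab F `` {(t, q)}:Q})"
proof -
 have "topspace (pieces X E lab F) // gluing X E lab F = topspace (stage X E lab F)"
  unfolding topspace_stage by (auto simp: quotient_def)
 moreover have "{x:topspace (pieces X E lab F). gluing X E lab F `` {x}:Q} <= Sigma F (%t. topspace (blow_up X (J F t)))"
  by (auto simp: pieces_def J_def[symmetric])
 ultimately show ?thesis
  unfolding stage_def openin_quotient_topology by (simp add: pieces_def openin_sum_topology J_def[symmetric])
qed

section \<open>Reading coordinates off a thread, and the inverse construction\<close>

definition base :: 'v where "base = (SOME r. r:V)"
definition word :: "'v => 'a list" where "word t = inv_into W (go base) t"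

lemma base: "base:V"
proof -
 have "EX r. r:V" using tree by (auto simp: is_tree_def)
 then show ?thesis unfolding base_def by (rule someI_ex)
qed

lemma word_go [simp]: "w:W ==> word (go base w) = w"
 unfolding word_def by (rule inv_into_f_f) (auto intro!: inj_onI dest: go_inj[OF base])

lemma word: "t:V ==> word t:W & go base (word t) = t"
 using go_surj[OF _ base, of t] by auto

lemma word_step: "t:V ==> x:D ==> word (step t x) = nbr (word t) x"
 using word[of t] go_nbr[OF base, of "word t" x] word_go[of "nbr (word t) x"] by simp

definition zeta :: "('a list => 'a) \<times> 'a set => 'v set => ('v \<times> 'a blow_up_point) set" where
 "zeta m = (\<lambda>F\<in>\<F>. pts (%t. fst m (word t)) (snd m) F)"

abbreviation "Z \<equiv> reflection_tree X V E lab"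

lemma valid_M: "m:M ==> valid (%t. fst m (word t)) (snd m)"
proof -
 assume m: "m:M"
 have "coherent (%t. fst m (word t))" unfolding coherent_def using M_cons[OF m] word word_step by metis
 then show ?thesis using word word_step M_top[OF m] M_br[OF m] by (auto simp: valid_def central_def)
qed

lemma topspace_Z: "z:topspace Z \<longleftrightarrow> z:(\<Pi>\<^sub>E F\<in>\<F>. topspace (stage X E lab F)) &
  (ALL F:\<F>. ALL F':\<F>. F <= F' --> bonding X E lab F' F (z F') = z F)"
 by (auto simp: reflection_tree_def inverse_limit_def)

lemma zeta_Z: "m:M ==> zeta m:topspace Z"
 using pts_stage[OF valid_M] bonding_pts[OF valid_M] by (auto simp: topspace_Z zeta_def)

text \<open>Projections are read off the one-vertex stages, where nothing is blown up, and the
  branch off the two-vertex stages. At most one branch occurs, so the union names it, and the empty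
  union gives the empty branch required in \<open>rpoints\<close>.\<close>

definition coords :: "('v set => ('v \<times> 'a blow_up_point) set) => ('a list => 'a) \<times> 'a set" where
 "coords z = (\<lambda>w\<in>W. THE y. (go base w, Pt y):z {go base w},
   \<Union>{C. EX t:V. EX x:D. (t, End x C):z {t, step t x}})"

lemma vertex_subtree: "t:V ==> {t}:\<F>"
 using small_subtree[of t t] by simp

lemma edge_subtree: "t:V ==> x:D ==> {t, step t x}:\<F>"
 using small_subtree[of t "step t x"] step_edge by simp

lemma J_vertex: "t:V ==> J {t} t = {}"
 using J_iff[of "{t}" t] by auto

lemma J_edge: "t:V ==> x:D ==> J {t, step t x} t = {x}"
proof -
 assume a: "t:V" "x:D"
 have "y = x" if "y:D" "step t y = step t x" for y using step_lab a that by metis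
 then show ?thesis using J_iff[of "{t, step t x}" t] a by auto
qed

lemma J_edge': "t:V ==> x:D ==> J {t, step t x} (step t x) = {x}"
 using J_edge[of "step t x" x] by (simp add: insert_commute)

lemma stage_vertex:
 assumes z: "z:topspace Z" and t: "t:V"
 shows "EX y:topspace X. z {t} = {(t, Pt y)}"
proof -
 have "z {t}:topspace (stage X E lab {t})" using z vertex_subtree[OF t] by (auto simp: topspace_Z)
 then obtain p where p: "p:topspace (pieces X E lab {t})" "z {t} = gluing X E lab {t} `` {p}"
  unfolding topspace_stage by blast
 then obtain y where "p = (t, Pt y)" "y:topspace X" unfolding topspace_pieces using J_vertex[OF t] by auto
 then show ?thesis using p gluing_Pt[of t y "{t}"] by auto
qed

text \<open>Bonding to one-vertex stages identifies the base points of the class. Bonding to the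
  edge in question preserves a glued end, so its branch can be compared across stages.\<close>

lemma stage_point:
 assumes z: "z:topspace Z" and F: "F:\<F>"
  and q: "q = (%t. THE y. (t, Pt y):z {t})"
 shows "(EX t:F. q t ~: J F t & z F = {(t, Pt (q t))}) |
  (EX t:F. EX C. q t:J F t & q (step t (q t)) = q t & C:branches X (q t) &
   z F = {(t, End (q t) C), (step t (q t), End (q t) C)} & z {t, step t (q t)} = z F)"
proof -
 have FV: "F <= V" using subtreeD[OF F] by simp
 have zF: "z F:topspace (stage X E lab F)" using z F by (auto simp: topspace_Z)
 have bond: "bonding X E lab F G (z F) = z G" if "G:\<F>" "G <= F" for G using z F that by (auto simp: topspace_Z)
 have down: "q t = y" if "t:F" "(t, p):z F" "blow_down {} p = Pt y" for t p y
 proof -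
  have t: "t:V" using FV that(1) by blast
  obtain y' where y': "z {t} = {(t, Pt y')}" using stage_vertex[OF z t] by blast
  have "collapse E lab {t} (t, p) = (t, Pt y)" using that(3) J_vertex[OF t] by (simp add: collapse_def J_def)
  moreover have "y:topspace X" using stage_cases[OF FV zF] that(2,3) D_top J_iff[OF FV] by (elim disjE bexE) auto
  then have "(t, Pt y):topspace (pieces X E lab {t})" unfolding topspace_pieces using J_vertex[OF t] by simp
  then have "((t, Pt y), (t, Pt y)):gluing X E lab {t}" by (auto simp: gluing_def)
  ultimately have "(t, Pt y):bonding X E lab F {t} (z F)" using that(2) unfolding bonding_def by (metis ImageI image_eqI)
  then have "y = y'" using bond[OF vertex_subtree[OF t]] that(1) y' by auto
  then show ?thesis using y' by (simp add: q)
 qed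
 from stage_cases[OF FV zF] consider t y where "t:F" "y:topspace X - J F t" "z F = {(t, Pt y)}"
  | t x C where "t:F" "x:J F t" "C:branches X x" "z F = {(t, End x C), (step t x, End x C)}"
  by (elim disjE bexE) simp_all
 then show ?thesis
 proof cases
  case (1 t y)
  then have "q t = y" using down[of t "Pt y" y] by simp
  then show ?thesis using 1 by blast
 next
  case (2 t x C)
  have t: "t:V" using 2 FV by blast
  let ?s = "step t x"
  have s: "x:D" "?s:F" using J_iff[OF FV 2(1)] 2(2) by auto
  note zt = 2(4)
  then have "q t = x" "q ?s = x" using down[of t "End x C" x] down[of ?s "End x C" x] 2(1) s by auto
  moreover have "bonding X E lab F {t, ?s} (z F) = z F"
  proof -
   have "collapse E lab {t, ?s} (t, End x C) = (t, End x C)" "collapse E lab {t, ?s} (?s, End x C) = (?s, End x C)"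
    using J_edge[OF t s(1)] J_edge'[OF t s(1)] by (simp_all add: collapse_def J_def)
   moreover have "gluing X E lab {t, ?s} `` {(t, End x C)} = z F" "gluing X E lab {t, ?s} `` {(?s, End x C)} = z F"
    using gluing_End[of "{t, ?s}" t x C] gluing_End[of "{t, ?s}" ?s x C] J_edge[OF t s(1)] J_edge'[OF t s(1)] t s 2(3)
    unfolding zt by (auto simp: insert_commute)
   moreover have "gluing X E lab {t, ?s} `` {a, b} = gluing X E lab {t, ?s} `` {a} Un gluing X E lab {t, ?s} `` {b}" for a b by blast
   ultimately show ?thesis unfolding bonding_def zt by simp
  qed
  moreover have "bonding X E lab F {t, ?s} (z F) = z {t, ?s}" by (rule bond[OF edge_subtree[OF t s(1)]]) (use 2 s in simp)
  ultimately have "q t:J F t" "q (step t (q t)) = q t" "C:branches X (q t)"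
   "z F = {(t, End (q t) C), (step t (q t), End (q t) C)}" "z {t, step t (q t)} = z F" using 2(2-4) by simp_all
  then show ?thesis using 2(1) by blast
 qed
qed

lemma coords_inverse:
 assumes z: "z:topspace Z"
 shows "coords z:M" "zeta (coords z) = z"
proof -
 define q where q: "q = (%t. THE y. (t, Pt y):z {t})"
 define c where "c = snd (coords z)"
 have qc: "fst (coords z) w = q (go base w)" if "w:W" for w using that by (simp add: coords_def q)
 have qX: "q t:topspace X" if t: "t:V" for t
 proof -
  obtain y where "y:topspace X" "z {t} = {(t, Pt y)}" using stage_vertex[OF z t] by blast
  then show ?thesis by (simp add: q)
 qed
 have bond: "bonding X E lab F G (z F) = z G" if "F:\<F>" "G:\<F>" "G <= F" for F G using z that by (auto simp: topspace_Z)
 have co: "coherent q" unfolding coherent_def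
 proof (intro ballI)
  fix t x assume tx: "t:V" "x:D"
  let ?s = "step t x"
  \<comment> \<open>A class lying in the copy at \<open>v\<close> off the gluing locus is collapsed,
    in the copy at \<open>u\<close>, to the label of the edge.\<close>
  have away: "q u = x" if u: "{t, ?s} = {u, v}" "u ~= v" "z {u, v} = {(v, Pt y)}" for u v y
  proof -
   have "{u, v}:\<F>" using edge_subtree[OF tx] unfolding u(1) .
   then have V: "u:V" "{u, v}:\<F>" using subtreeD by blast+
   have e: "{u, v}:E" "lab {u, v} = x" using step_edge[OF tx] step_lab[OF tx] u(1) by auto
   obtain w where w: "w:W" "w ~= []" "closest_vertex E {u} v = go v w" "go v w:{u}" "lab (first_edge E (go v w) v) = hd w"
    using closest[OF vertex_subtree[OF V(1)], of v] u(2) edge_ends[OF e(1)] by blast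
   have "u = step v x" using step_eq[of v u] e by (simp add: insert_commute)
   then have "go v w = go v [x]" using w(4) by simp
   then have "w = [x]" using go_inj[of v w "[x]"] w(1) edge_ends[OF e(1)] tx(2) by (simp add: words_Cons)
   then have "collapse E lab {u} (v, Pt y) = (u, Pt x)" using u(2) w(3-5) by (simp add: collapse_def Let_def)
   moreover have "(u, Pt x):topspace (pieces X E lab {u})" unfolding topspace_pieces using D_top[OF tx(2)] J_vertex[OF V(1)] by simp
   ultimately have "bonding X E lab {u, v} {u} (z {u, v}) = {(u, Pt x)}" unfolding bonding_def u(3) using gluing_Pt[of u x "{u}"] by simp
   then have "z {u} = {(u, Pt x)}" using bond[OF V(2) vertex_subtree[OF V(1)]] by auto
   then show ?thesis by (simp add: q)
  qed
  show "q t = x | q ?s = x" using stage_point[OF z edge_subtree[OF tx] q]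
  proof (elim disjE bexE exE conjE)
   fix u assume u: "u:{t, ?s}" "z {t, ?s} = {(u, Pt (q u))}"
   then show ?thesis using away[of t ?s "q u"] away[of ?s t "q u"] step_neq[OF tx] by (auto simp: insert_commute)
  next
   fix u C assume "u:{t, ?s}" "q u:J {t, ?s} u"
   then show ?thesis using J_edge[OF tx] J_edge'[OF tx] by auto
  qed
 qed
 have centre: "z {t, step t (q t)} = {(t, End (q t) c), (step t (q t), End (q t) c)} & c:branches X (q t)"
  if t: "t:V" "q t:D" "q (step t (q t)) = q t" for t
 proof -
  have E: "EX C. C:branches X (q u) & z {u, step u (q u)} = {(u, End (q u) C), (step u (q u), End (q u) C)}"
   if u: "u:V" "q u:D" "q (step u (q u)) = q u" for u
   using stage_point[OF z edge_subtree[OF u(1,2)] q] J_edge[OF u(1,2)] J_edge'[OF u(1,2)] u by (auto simp: insert_commute)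
  obtain C where C: "C:branches X (q t)" "z {t, step t (q t)} = {(t, End (q t) C), (step t (q t), End (q t) C)}"
   using E[OF t] by blast
  have "C' = C" if C': "s:V" "x:D" "(s, End x C'):z {s, step s x}" for C' s x
  proof -
   have "q s = x & q (step s x) = x" using stage_point[OF z edge_subtree[OF C'(1,2)] q] C'(3) C'(1,2) by auto
   then have "q (step s (q s)) = q s" "q s = x" by auto
   then have "x = q t" "s = t | s = step t (q t)" using centre_unique[OF co t, of s] C'(1) by auto
   then have "z {s, step s x} = z {t, step t (q t)}" using t by (auto simp: insert_commute)
   then show ?thesis using C'(3) C(2) by auto
  qed
  note uniq = this
  have hit: "(t, End (q t) C):z {t, step t (q t)}" using C(2) by simp
  have "{C. EX t:V. EX x:D. (t, End x C):z {t, step t x}} = {C}"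
  proof (intro set_eqI iffI)
   fix C' assume "C':{C. EX t:V. EX x:D. (t, End x C):z {t, step t x}}"
   then show "C':{C}" by (elim CollectE bexE) (drule uniq, assumption+, simp only: singleton_iff)
  next
   fix C' assume "C':{C}"
   then have "C' = C" by simp
   then show "C':{C. EX t:V. EX x:D. (t, End x C):z {t, step t x}}"
    by (intro CollectI) (simp only:, rule bexI[OF _ t(1)], rule bexI[OF _ t(2)], rule hit)
  qed
  then have "c = C" unfolding c_def coords_def snd_conv by (simp only: cSup_singleton)
  then show ?thesis using C by simp
 qed
 have nocentre: "c = {}" if nc: "!!t. t:V ==> q t:D ==> q (step t (q t)) ~= q t"
 proof -
  have False if C': "s:V" "x:D" "(s, End x C'):z {s, step s x}" for C' s x
   using stage_point[OF z edge_subtree[OF C'(1,2)] q]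
  proof (elim disjE bexE exE conjE)
   fix u C assume u: "u:{s, step s x}" "q u:J {s, step s x} u" "q (step u (q u)) = q u"
   have "q u = x" using u(1,2) J_edge[OF C'(1,2)] J_edge'[OF C'(1,2)] by auto
   moreover have "u:V" using u(1) C'(1,2) by auto
   ultimately show False using nc[of u] u(3) C'(2) by simp
  qed (use C'(3) in simp)
  then have "{C. EX t:V. EX x:D. (t, End x C):z {t, step t x}} = {}" by blast
  then show ?thesis by (simp add: c_def coords_def)
 qed
 have cen: "central (fst (coords z)) w x \<longleftrightarrow> q (go base w) = x & q (step (go base w) x) = x" if "w:W" "x:D" for w x
  using that by (simp add: central_def qc go_nbr base)
 show M: "coords z:M"
 proof -
  have "fst (coords z):W \<rightarrow>\<^sub>E topspace X" using qX base by (auto simp: coords_def q)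
  moreover have "ALL w:W. ALL x:D. fst (coords z) w = x | fst (coords z) (nbr w x) = x"
   using co base by (simp add: qc go_nbr coherent_def)
  moreover have "ALL w:W. ALL x:D. central (fst (coords z)) w x --> c:branches X x"
   using centre base by (auto simp: cen)
  moreover have "c = {}" if "ALL w:W. ALL x:D. ~ central (fst (coords z)) w x"
  proof (rule nocentre)
   fix t assume t: "t:V" "q t:D"
   have "word t:W" "go base (word t) = t" using word[OF t(1)] by auto
   then show "q (step t (q t)) ~= q t" using that cen[of "word t" "q t"] t by auto
  qed
  ultimately show ?thesis unfolding rpoints_def c_def by (cases "coords z") simp
 qed
 have vc: "valid q c" using co qX centre by (auto simp: valid_def)
 show "zeta (coords z) = z"
 proof
  fix F
  show "zeta (coords z) F = z F"
  proof (cases "F:\<F>")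
   case True
   have FV: "F <= V" using subtreeD[OF True] by simp
   have "pts (%t. fst (coords z) (word t)) c F = pts q c F"
   proof -
    have "fst (coords z) (word t) = q t" if "t:V" for t using word[OF that] by (simp add: qc)
    moreover have "step t (q t):V" if "t:F" "q t:J F t" for t using that J_iff[OF FV] FV by blast
    ultimately show ?thesis using FV by (auto simp: pts_def subset_iff)
   qed
   moreover have "z F = pts q c F" using stage_point[OF z True q]
   proof (elim disjE bexE exE conjE)
    fix t assume t: "t:F" "q t ~: J F t" "z F = {(t, Pt (q t))}"
    then have p: "(t, Pt (q t)):pts q c F" by (auto simp: pts_def)
    show ?thesis using pts_class[OF vc True p] gluing_Pt[of t "q t" F] t(3) by simp
   next
    fix t C assume t: "t:F" "q t:J F t" "q (step t (q t)) = q t" "z {t, step t (q t)} = z F"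
    then have p: "(t, End (q t) c):pts q c F" by (auto simp: pts_def)
    have "t:V" "q t:D" using t FV J_iff[OF FV] by auto
    from centre[OF this t(3)] show ?thesis using pts_class[OF vc True p] gluing_End[OF FV t(1,2)] t(4) by simp
   qed
   ultimately show ?thesis using True by (simp add: zeta_def c_def)
  next
   case False
   then show ?thesis using z by (auto simp: zeta_def topspace_Z PiE_def extensional_def)
  qed
 qed
qed

lemma coords_zeta:
 assumes m: "m:M" shows "coords (zeta m) = m"
proof -
 have Z: "zeta m:topspace Z" by (rule zeta_Z[OF m])
 have co: "coherent (%t. fst m (word t))" using valid_M[OF m] by (simp add: valid_def)
 have q: "fst (coords (zeta m)) w = fst m w" if w: "w:W" for w
 proof -
  let ?t = "go base w"
  have "?t:V" using w base by simp
  then have "zeta m {?t} = {(?t, Pt (fst m w))}" using w by (auto simp: zeta_def vertex_subtree pts_def J_vertex)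
  then show ?thesis using w by (simp add: coords_def)
 qed
 show ?thesis
 proof (rule M_ext[OF coords_inverse(1)[OF Z] m q])
  show "snd (coords (zeta m)) = snd m"
  proof (cases "EX w:W. EX x:D. central (fst m) w x")
   case True
   then obtain w x where w: "w:W" "x:D" "central (fst m) w x" by blast
   let ?t = "go base w" let ?F = "{?t, step ?t x}"
   have t: "?t:V" using w base by simp
   have F: "?F:\<F>" by (rule edge_subtree[OF t w(2)])
   have cm: "central (fst (coords (zeta m))) w x" using w q[of w] q[of "nbr w x"] by (simp add: central_def)
   have "zeta (coords (zeta m)) ?F = zeta m ?F" using coords_inverse(2)[OF Z] by simp
   moreover have "(?t, End x (snd n)):zeta n ?F" if "central (fst n) w x" for n
    using that w F t J_edge[OF t w(2)] by (auto simp: zeta_def pts_def central_def word_step)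
   moreover have "c = snd n" if "(?t, End x c):zeta n ?F" for n c using that F by (auto simp: zeta_def pts_def)
   ultimately show ?thesis using w(3) cm by metis
  next
   case False
   then have "snd m = {}" using M_nocentral[OF m] by blast
   moreover have "snd (coords (zeta m)) = {}"
    by (rule M_nocentral[OF coords_inverse(1)[OF Z]]) (use False q in \<open>auto simp: central_def\<close>)
   ultimately show ?thesis by simp
  qed
 qed (use q in simp)
qed

section \<open>Continuity of the coordinates and of their inverse\<close>

lemma closed_finite: "finite A ==> A <= topspace X ==> openin X (topspace X - A)"
 using closedin_Hausdorff_finite[OF Haus_X] by blast

lemma J_finite: "F:\<F> ==> t:F ==> finite (J F t) & J F t <= topspace X"
proof -
 assume F: "F:\<F>" "t:F"
 have "finite (edges_of E F)" by (rule finite_subset[of _ "Pow F"]) (use subtreeD[OF F(1)] in \<open>auto simp: edges_of_def\<close>)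
 moreover have "J F t <= D" using J_iff[of F t] subtreeD[OF F(1)] F(2) by auto
 ultimately show ?thesis using D_top by (auto simp: J_def adjacent_edges_def)
qed

lemma openin_blow_upD:
 assumes "openin (blow_up X K) B" "finite K" "K <= topspace X"
 shows "openin X {y. Pt y:B}"
proof -
 have "openin (subtopology X (topspace X - K)) {y. Pt y:B}" using assms(1) unfolding openin_blow_up by (rule blow_up_openD(2))
 then show ?thesis by (rule openin_trans_full) (rule closed_finite[OF assms(2,3)])
qed

lemma zeta_continuous: "continuous_map RT Z zeta"
proof -
 have "openin RT {m:topspace RT. zeta m F:Q}" if F: "F:\<F>" and Q: "openin (stage X E lab F) Q" for F Q
 proof (subst openin_subopen, intro ballI)
  fix m assume "m:{m:topspace RT. zeta m F:Q}"
  then have m: "m:M" "zeta m F:Q" by auto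
  have FV: "F <= V" using subtreeD[OF F] by simp
  let ?q = "%n t. fst n (word t)"
  have zF: "zeta n F = pts (?q n) (snd n) F" for n using F by (simp add: zeta_def)
  have cl: "gluing X E lab F `` {p} = zeta n F & p:topspace (pieces X E lab F)" if "n:M" "p:zeta n F" for n p
   using pts_class[OF valid_M[OF that(1)] F] that(2) unfolding zF by blast
  let ?B = "%t. {q. (t, q):topspace (pieces X E lab F) & gluing X E lab F `` {(t, q)}:Q}"
  have oB: "openin (blow_up X (J F t)) (?B t)" if "t:F" for t using Q that unfolding openin_stage by blast
  have hit: "zeta n F:Q" if "n:M" "(t, q):zeta n F" "q:?B t" for n t q using cl[OF that(1,2)] that(3) by simp
  have hitB: "q:?B t" if "n:M" "zeta n F:Q" "(t, q):zeta n F" for n t q using cl[OF that(1,3)] that(2) by simp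
  have co: "coherent (?q m)" using valid_M[OF m(1)] by (simp add: valid_def)
  show "EX T. openin RT T & m:T & T <= {m:topspace RT. zeta m F:Q}" using pts_cases[OF co F, of "snd m"]
  proof (elim disjE bexE conjE)
   fix t assume t: "t:F" "?q m t ~: J F t" "pts (?q m) (snd m) F = {(t, Pt (?q m t))}"
   have w: "word t:W" using word t FV by blast
   let ?U = "{y. Pt y:?B t}"
   have U: "openin X ?U" using openin_blow_upD[OF oB[OF t(1)]] J_finite[OF F t(1)] by simp
   have "?U Int J F t = {}" unfolding topspace_pieces by auto
   then have "(t, Pt (?q n t)):zeta n F" if "?q n t:?U" for n using that t(1) unfolding zF pts_def by blast
   then have "zeta n F:Q" if "n:M" "?q n t:?U" for n
    by (intro hit[OF that(1), of t "Pt (?q n t)"]) (use that(2) in blast)+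
   then have "at_set X D (word t) ?U <= {m:topspace RT. zeta m F:Q}" unfolding at_set_def by auto
   moreover have "m:at_set X D (word t) ?U" using hitB[OF m] t(3) m unfolding at_set_def zF by simp
   ultimately show ?thesis using openin_at_set[OF w U] by blast
  next
   fix t assume t: "t:F" "?q m t:J F t" "?q m (step t (?q m t)) = ?q m t"
    "pts (?q m) (snd m) F = {(t, End (?q m t) (snd m)), (step t (?q m t), End (?q m t) (snd m))}"
   let ?x = "?q m t" let ?s = "step t ?x" let ?C = "snd m"
   have s: "?x:D" "?s:F" "t:V" using t J_iff[OF FV t(1)] FV by auto
   have w: "word t:W" "word ?s = nbr (word t) ?x" using word[OF s(3)] word_step[OF s(3,1)] by auto
   have cen: "central (fst m) (word t) ?x" using t(3) w by (simp add: central_def)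
   have C: "?C:branches X ?x" by (rule M_br[OF m(1) w(1) s(1) cen])
   have "EX U. openin X U & ?x:U & Pt ` (U Int ?C - J F u) <= ?B u" if u: "u:{t, ?s}" for u
   proof -
    have uF: "u:F" using u t(1) s(2) by auto
    have "End ?x ?C:?B u" by (rule hitB[OF m]) (use u in \<open>auto simp: zF t(4)\<close>)
    then show ?thesis by (rule blow_up_openD(3)[OF oB[OF uF, unfolded openin_blow_up]])
   qed
   from this[of t] this[of ?s] obtain U U' where U: "openin X U" "?x:U" "Pt ` (U Int ?C - J F t) <= ?B t"
    and U': "openin X U'" "?x:U'" "Pt ` (U' Int ?C - J F ?s) <= ?B ?s" by auto
   \<comment> \<open>The other blow-up points of the two copies are removed, so that nearby
     projections in the branch appear as ordinary points of the stage.\<close>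
   let ?K = "J F t Un J F ?s - {?x}"
   let ?U = "U Int U' Int (topspace X - ?K)"
   have oU: "openin X ?U" using U(1) U'(1) closed_finite[of ?K] J_finite[OF F t(1)] J_finite[OF F s(2)] by auto
   have xU: "?x:?U" using U(2) U'(2) D_top[OF s(1)] by simp
   have nx: "?x ~: ?C" using br_notin[OF D_top[OF s(1)] C] .
   have "zeta n F:Q" if n: "n:edge_set X D (word t) ?x ?C ?U" for n
   proof -
    have nM: "n:M" using n by (simp add: edge_set_def)
    from n consider "?q n t:?U Int ?C" | "?q n ?s:?U Int ?C" | "central (fst n) (word t) ?x" "snd n = ?C"
     unfolding edge_set_def w(2) by auto
    then show ?thesis
    proof cases
     case 1
     then have "?q n t:U Int ?C - J F t" using nx by auto
     then show ?thesis using U(3) t(1) by (intro hit[OF nM, of t "Pt (?q n t)"]) (auto simp: zF pts_def)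
    next
     case 2
     then have "?q n ?s:U' Int ?C - J F ?s" using nx by auto
     then show ?thesis using U'(3) s(2) by (intro hit[OF nM, of ?s "Pt (?q n ?s)"]) (auto simp: zF pts_def)
    next
     case 3
     then have "(t, End ?x ?C):zeta n F" using t(1,2) w(2) by (auto simp: zF pts_def central_def)
     then show ?thesis using hitB[OF m, of t "End ?x ?C"] by (intro hit[OF nM]) (auto simp: zF t(4))
    qed
   qed
   then have "edge_set X D (word t) ?x ?C ?U <= {m:topspace RT. zeta m F:Q}" by (auto simp: edge_set_def)
   moreover have "m:edge_set X D (word t) ?x ?C ?U" using m cen by (simp add: edge_set_def)
   ultimately show ?thesis using openin_edge_set[OF w(1) s(1) C oU xU] by blast
  qed
 qed
 moreover have "zeta m F:topspace (stage X E lab F)" if "m:M" "F:\<F>" for m F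
  using zeta_Z[OF that(1)] that(2) unfolding topspace_Z by (blast dest: PiE_mem)
 ultimately have "continuous_map RT (stage X E lab F) (%m. zeta m F)" if "F:\<F>" for F
  using that by (simp add: continuous_map_def)
 then have "continuous_map RT (product_topology (stage X E lab) \<F>) zeta"
  unfolding continuous_map_componentwise by (auto simp: zeta_def)
 then show ?thesis
  using zeta_Z unfolding reflection_tree_def inverse_limit_def by (auto simp: continuous_map_in_subtopology image_subset_iff Pi_iff)
qed

lemma stage_projection: "F:\<F> ==> openin (stage X E lab F) Q ==> openin Z {z:topspace Z. z F:Q}"
proof -
 assume a: "F:\<F>" "openin (stage X E lab F) Q"
 have "continuous_map Z (stage X E lab F) (%z. z F)" unfolding reflection_tree_def inverse_limit_def
  by (intro continuous_map_from_subtopology continuous_map_product_projection a(1))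
 then show ?thesis using a(2) openin_continuous_map_preimage by blast
qed

lemma coords_continuous: "continuous_map Z RT coords"
proof (rule continuous_map_into_rtop)
 show "coords:topspace Z \<rightarrow> M" using coords_inverse(1) by blast
next
 fix w U assume w: "w:W" and U: "openin X U"
 let ?t = "go base w" let ?Q = "(%y. {(?t, Pt y)}) ` U"
 have t: "?t:V" using w base by simp
 have UX: "U <= topspace X" by (rule openin_subset[OF U])
 have gl: "gluing X E lab {?t} `` {(?t, Pt y)} = {(?t, Pt y)}" "(?t, Pt y):topspace (pieces X E lab {?t})" if "y:topspace X" for y
 proof -
  show "(?t, Pt y):topspace (pieces X E lab {?t})" unfolding topspace_pieces using that J_vertex[OF t] by simp
  then show "gluing X E lab {?t} `` {(?t, Pt y)} = {(?t, Pt y)}" by (rule gluing_Pt)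
 qed
 have "{q. (?t, q):topspace (pieces X E lab {?t}) & gluing X E lab {?t} `` {(?t, q)}:?Q} = Pt ` U"
  using gl UX unfolding topspace_pieces J_vertex[OF t] by (auto simp: J_vertex[OF t])
 moreover have "openin (blow_up X {}) (Pt ` U)"
  unfolding openin_blow_up by (rule blow_up_openI) (use U UX in \<open>auto simp: blow_up_points_def inj_image_mem_iff image_iff\<close>)
 moreover have "?Q <= topspace (stage X E lab {?t})"
 proof
  fix c assume "c:?Q"
  then obtain y where "y:topspace X" "c = {(?t, Pt y)}" using UX by blast
  then show "c:topspace (stage X E lab {?t})" unfolding topspace_stage using gl by (intro image_eqI[of _ _ "(?t, Pt y)"]) simp_all
 qed
 ultimately have "openin (stage X E lab {?t}) ?Q" unfolding openin_stage by (simp add: J_vertex[OF t])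
 note o = stage_projection[OF vertex_subtree[OF t] this]
 have "{z:topspace Z. fst (coords z) w:U} = {z:topspace Z. z {?t}:?Q}"
 proof -
  have "fst (coords z) w:U \<longleftrightarrow> z {?t}:?Q" if z: "z:topspace Z" for z
  proof -
   obtain y where y: "z {?t} = {(?t, Pt y)}" using stage_vertex[OF z t] by blast
   then have "fst (coords z) w = y" using w by (simp add: coords_def)
   then show ?thesis using y by auto
  qed
  then show ?thesis by blast
 qed
 then show "openin Z {z:topspace Z. fst (coords z) w:U}" using o by simp
next
 fix w x C U assume w: "w:W" and x: "x:D" and C: "C:branches X x" and U: "openin X U" "x:U"
 let ?t = "go base w" let ?s = "step ?t x" let ?F = "{?t, ?s}"
 have t: "?t:V" "?s:V" using w base x by auto
 have F: "?F:\<F>" by (rule edge_subtree[OF t(1) x])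
 note J = J_edge[OF t(1) x] J_edge'[OF t(1) x]
 have xX: "x:topspace X" and nx: "x ~: C" using D_top[OF x] br_notin[OF _ C] by auto
 have oUC: "openin X (U Int C)" using U br_open[OF xX C] by auto
 have UX: "U Int C <= topspace X" by (rule openin_subset[OF oUC])
 let ?N = "insert (End x C) (Pt ` (U Int C))"
 \<comment> \<open>The classes that meet, in either copy, the basic neighbourhood \<open>?N\<close>
   of the end \<open>C\<close>; the preimage in each copy is \<open>?N\<close> again because the end
   is glued to its counterpart only.\<close>
 let ?Q = "{c:topspace (stage X E lab ?F). EX u:?F. EX q:?N. (u, q):c}"
 have gP: "gluing X E lab ?F `` {(u, Pt y)} = {(u, Pt y)}" if "(u, Pt y):topspace (pieces X E lab ?F)" for u y
  by (rule gluing_Pt[OF that])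
 have gE: "gluing X E lab ?F `` {(u, End x C')} = {(?t, End x C'), (?s, End x C')}" if u: "u:?F" and C': "C':branches X x" for u C'
 proof -
  have "{(u, End x C'), (step u x, End x C')} = {(?t, End x C'), (?s, End x C')}" using u t x by auto
  moreover have "x:J ?F u" using u J by auto
  ultimately show ?thesis using gluing_End[OF _ u _ C'] t by simp
 qed
 have pre: "{q. (u, q):topspace (pieces X E lab ?F) & gluing X E lab ?F `` {(u, q)}:?Q} = ?N" if u: "u:?F" for u
 proof -
  have Ju: "J ?F u = {x}" using u J by auto
  have top: "(u, q):topspace (pieces X E lab ?F) \<longleftrightarrow> (EX y. q = Pt y & y:topspace X - {x}) | (EX C'. q = End x C' & C':branches X x)" for q
   unfolding topspace_pieces using u Ju xX by auto
  have st: "gluing X E lab ?F `` {(u, q)}:topspace (stage X E lab ?F)" if "(u, q):topspace (pieces X E lab ?F)" for q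
   unfolding topspace_stage using that by blast
  have "(u, q):topspace (pieces X E lab ?F) & (EX u':?F. EX q':?N. (u', q'):gluing X E lab ?F `` {(u, q)}) \<longleftrightarrow> q:?N" for q
  proof (cases q)
   case (Pt y)
   show ?thesis
   proof (cases "y:topspace X - {x}")
    case True
    then have "(u, q):topspace (pieces X E lab ?F)" "gluing X E lab ?F `` {(u, q)} = {(u, q)}" using Pt top gP[of u y] by auto
    then show ?thesis using u Pt by (auto simp del: Image_singleton_iff)
   qed (use Pt top UX nx in auto)
  next
   case (End x' C')
   show ?thesis
   proof (cases "x' = x & C':branches X x")
    case True
    then have "(u, q):topspace (pieces X E lab ?F)" "gluing X E lab ?F `` {(u, q)} = {(?t, q), (?s, q)}" using End top gE[OF u, of C'] by auto
    then show ?thesis by (auto simp del: Image_singleton_iff)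
   qed (use End top C in auto)
  qed
  then show ?thesis using st by blast
 qed
 have "openin (blow_up X (J ?F u)) ?N" if u: "u:?F" for u
 proof -
  have Ju: "J ?F u = {x}" using u J by auto
  have "{y. Pt y:?N} = U Int C" by auto
  then have "openin (subtopology X (topspace X - {x})) {y. Pt y:?N}"
   using oUC UX nx by (auto simp: openin_subtopology_alt intro!: image_eqI[of _ _ "U Int C"])
  then show ?thesis unfolding Ju openin_blow_up
   by (intro blow_up_openI) (use U C xX UX nx in \<open>auto simp: blow_up_points_def\<close>)
 qed
 then have "openin (stage X E lab ?F) ?Q" unfolding openin_stage using pre by auto
 note o = stage_projection[OF F this]
 have "{z:topspace Z. fst (coords z) w:U Int C | fst (coords z) (nbr w x):U Int C |
   central (fst (coords z)) w x & snd (coords z) = C} = {z:topspace Z. z ?F:?Q}"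
 proof -
  have "(fst m w:U Int C | fst m (nbr w x):U Int C | central (fst m) w x & snd m = C) \<longleftrightarrow> zeta m ?F:?Q" if m: "m:M" for m
  proof -
   have ws: "word ?t = w" "word ?s = nbr w x" using w word_step[OF t(1) x] by auto
   have z: "zeta m ?F = {(u, Pt (fst m (word u))) |u. u:?F & fst m (word u) ~= x} Un
     {(u, End x (snd m)) |u. u:?F & central (fst m) w x}"
    using F J t ws x by (auto simp: zeta_def pts_def central_def)
   have "zeta m ?F:topspace (stage X E lab ?F)" using zeta_Z[OF m] F by (auto simp: topspace_Z)
   moreover have "(EX u:?F. EX q:?N. (u, q):zeta m ?F) \<longleftrightarrow>
     fst m w:U Int C | fst m (nbr w x):U Int C | central (fst m) w x & snd m = C" unfolding z using nx ws by auto
   ultimately show ?thesis by blast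
  qed
  from this[OF coords_inverse(1)] show ?thesis using coords_inverse(2) by auto
 qed
 then show "openin Z {z:topspace Z. fst (coords z) w:U Int C | fst (coords z) (nbr w x):U Int C |
   central (fst (coords z)) w x & snd (coords z) = C}" using o by simp
qed

lemma reflection_tree_homeomorphic: "Z homeomorphic_space RT"
 unfolding homeomorphic_space_def homeomorphic_maps_def
 using coords_continuous zeta_continuous coords_inverse(2) coords_zeta by (intro exI[of _ coords] exI[of _ zeta]) simp

end


section \<open>Non-separable graphs with a cut point are arcs; blocks are the maximal cyclic
  sets\<close>

lemma reverse_image: "(%t. q (1 - t)) ` {a..b} = q ` {1 - b..1 - a::real}" "(%t. q (1 - t)) ` {a<..<b} = q ` {1 - b<..<1 - a::real}"
 "(%t. q (1 - t)) ` {a<..b} = q ` {1 - b..<1 - a::real}" "(%t. q (1 - t)) ` {a..<b} = q ` {1 - b<..1 - a::real}"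
 by (auto intro!: image_eqI[of _ _ "1 - t" for t])

context graph_space
begin

text \<open>Induction on the number of end points of covering arcs in the side \<open>A\<close>.
  From \<open>x\<close> one follows a covering arc into \<open>A\<close> up to its end
  \<open>q 1\<close>. Either \<open>A\<close> is used up, or \<open>q 1\<close> is again a cut
  point, hence not essential, and the rest of \<open>A\<close> contains fewer end points.\<close>

lemma cut_side_arc:
 assumes conn: "connected_space X" and ns: "!!v. v:essential_vertices X ==> connectedin X (topspace X - {v})"
  and Q: "!!q. q:Q ==> open_arc X q" "topspace X <= essential_vertices X Un (UN q:Q. q ` {0<..<1})"
  and P: "finite P" "!!q. q:Q ==> q 0:P & q 1:P"
  and x: "x:topspace X" "x ~: essential_vertices X" and AB: "split X x A B" "A ~= {}" "B ~= {}"
 shows "EX f. emb {0..1::real} X f & f 0 = x & f ` {0..1} = insert x A" using x AB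
proof (induction "card (A Int P)" arbitrary: x A B rule: less_induct)
 case less
 note x = less.prems(1,2) and AB = less.prems(3-5)
 have s: "openin X A" "openin X B" "A Int B = {}" "A Un B = topspace X - {x}" using AB(1) by (auto simp: split_def)
 \<comment> \<open>A covering arc through \<open>x\<close>, oriented so that it passes from
   \<open>B\<close> into \<open>A\<close>.\<close>
 have side: "EX q s::real. emb {0..1} X q & openin X (q ` {0<..<1}) & 0 < s & s < 1 & q s = x &
   q ` {s<..1} <= A & q ` {0..<s} <= B & q 1:P"
 proof -
  have "x:(UN q:Q. q ` {0<..<1})" using Q(2) x by blast
  then obtain q s where q: "q:Q" "0 < s" "s < 1" "q s = x" by auto
  have e: "emb {0..1} X q" "openin X (q ` {0<..<1})" using Q(1)[OF q(1)] by (auto simp: open_arc_def)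
  have inj: "inj_on q {0..1}" using embedding_inj[OF e(1)] .
  have half: "q ` I <= A | q ` I <= B" if "I <= {0..1}" "connected I" "s ~: I" for I
  proof (cases "I = {}")
   case False
   then obtain t where t: "t:I" by blast
   have c: "connectedin X (q ` I)" by (rule embedding_connected[OF e(1) that(1,2)])
   have n: "x ~: q ` I"
   proof
    assume "x:q ` I"
    then obtain t where "t:I" "q s = q t" using q(4) by auto
    then show False using inj_onD[OF inj, of s t] that(1,3) q(2,3) by auto
   qed
   have "q t:A | q t:B" using connectedin_subset_topspace[OF c] n t s(4) by blast
   then show ?thesis using split_connected[OF AB(1) c n imageI[OF t]] split_connected[OF split_sym[OF AB(1)] c n imageI[OF t]] by blast
  qed simp
  have h: "q ` {s<..1} <= A | q ` {s<..1} <= B" "q ` {0..<s} <= A | q ` {0..<s} <= B" by (rule half; use q in auto)+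
  have I: "q ` {0<..<1} <= insert x (q ` {s<..1} Un q ` {0..<s})"
  proof
   fix y assume "y:q ` {0<..<1}"
   then obtain t where "0 < t" "t < 1" "y = q t" by auto
   moreover then have "t = s | t:{s<..1} | t:{0..<s}" by auto
   ultimately show "y:insert x (q ` {s<..1} Un q ` {0..<s})" using q(4) by blast
  qed
  \<comment> \<open>If both halves of the arc lay on one side, the other side would be open and
    closed, contradicting connectedness.\<close>
  have no: False if K: "split X x K L" "K ~= {}" "q ` {s<..1} <= L" "q ` {0..<s} <= L" for K L
  proof -
   have k: "openin X K" "openin X L" "K Int L = {}" "K Un L = topspace X - {x}" using K(1) by (auto simp: split_def)
   have "openin X (L Un q ` {0<..<1})" using k(2) e(2) by (rule openin_Un)
   moreover have "x:q ` {0<..<1}" using q by auto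
   moreover have "q ` {0<..<1} <= insert x L" using I K(3,4) by (meson Un_least insert_mono subset_trans)
   moreover have "topspace X - K = L Un J" if "J <= insert x L" "x:J" for J
    using that k(3,4) x(1) split_notin[OF K(1)] by blast
   ultimately have "openin X (topspace X - K)" by simp
   then have "closedin X K" using openin_subset[OF k(1)] by (simp add: closedin_def)
   then have "K = topspace X" using conn k(1) K(2) by (auto simp: connected_space_clopen_in)
   then show False using split_notin[OF K(1)] x by blast
  qed
  have "~ (q ` {s<..1} <= B & q ` {0..<s} <= B)" "~ (q ` {s<..1} <= A & q ` {0..<s} <= A)"
   using no[OF AB(1,2)] no[OF split_sym[OF AB(1)] AB(3)] by blast+
  then consider "q ` {s<..1} <= A" "q ` {0..<s} <= B" | "q ` {s<..1} <= B" "q ` {0..<s} <= A" using h by blast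
  then show ?thesis
  proof cases
   case 1
   then show ?thesis using e q P(2)[OF q(1)] by (intro exI[of _ q] exI[of _ s]) simp
  next
   case 2
   define q' where "q' = (%t. q (1 - t))"
   have "q' ` {0<..<1} = q ` {0<..<1}" "q' ` {1 - s<..1} = q ` {0..<s}" "q' ` {0..<1 - s} = q ` {s<..1}" "q' 1 = q 0" "q' (1 - s) = x"
    unfolding q'_def reverse_image using q(4) by simp_all
   moreover have "emb {0..1} X q'" unfolding q'_def by (rule embedding_reverse[OF e(1)])
   ultimately show ?thesis using e(2) q(2,3) P(2)[OF q(1)] 2 by (intro exI[of _ q'] exI[of _ "1 - s"]) simp
  qed
 qed
 then obtain q and s :: real where e: "emb {0..1} X q" "openin X (q ` {0<..<1})" and q: "0 < s" "s < 1" "q s = x"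
  "q ` {s<..1} <= A" "q ` {0..<s} <= B" "q 1:P" by (elim exE conjE)
 have inj: "inj_on q {0..1}" using embedding_inj[OF e(1)] .
 let ?p = "q 1" let ?a = "%t. q (s + (1 - s) * t)" let ?A = "A - q ` {s..1}" let ?B = "B Un q ` {0<..<1}"
 have a: "emb {0..1} X ?a" "?a ` {0..1} = q ` {s..1}" using embedding_subarc[OF e(1) q(2)] q(1) by auto
 have pA: "?p:A" using q by auto
 have seg: "q ` {s..1} = insert x (q ` {s<..1})"
 proof -
  have "{s..1} = insert s {s<..1}" using q by auto
  then show ?thesis using q(3) by simp
 qed
 have seg2: "q ` {s<..1} = insert ?p (q ` {s<..<1})"
 proof -
  have "{s<..1} = insert 1 {s<..<1}" using q by auto
  then show ?thesis by simp
 qed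
 have seg3: "q ` {0<..<1} = q ` {0<..<s} Un insert x (q ` {s<..<1})"
 proof -
  have "{0<..<1} = {0<..<s} Un insert s {s<..<1}" using q by auto
  then show ?thesis using q(3) by (simp add: image_Un)
 qed
 have B0: "q ` {0<..<s} <= B" by (rule order_trans[OF image_mono q(5)]) auto
 have p1: "?p ~: q ` {0<..<1}" using inj_onD[OF inj, of 1] by force
 have "closedin X (q ` {s..1})"
  by (intro compactin_imp_closedin[OF Haus_X] embedding_compact[OF e(1)]) (use q in auto)
 then have "openin X ?A" using s(1) by (rule openin_diff[rotated])
 moreover have "openin X ?B" using s(2) e(2) by (rule openin_Un)
 moreover have xn: "x ~: A" "x ~: B" using s(4) by auto
 have dis: "?A Int ?B = {}" using s(3) xn(1) B0 unfolding seg seg2 seg3 by blast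
 moreover have "?A Un ?B = topspace X - {?p}"
 proof -
  have "q ` {s<..<1} <= A" using q(4) seg2 by blast
  moreover have "?p ~: B" "?p ~= x" using pA s(3) xn by auto
  moreover have "?p ~: q ` {s<..<1}" using p1 seg3 by blast
  ultimately show ?thesis using s(4) B0 p1 q(4) x(1) pA unfolding seg seg2 seg3 by blast
 qed
 ultimately have sp: "split X ?p ?A ?B" by (simp add: split_def)
 have pt: "?p:topspace X" using pA openin_subset[OF s(1)] by blast
 show ?case
 proof (cases "?A = {}")
  case True
  then have "insert x A = q ` {s..1}" using q(4) unfolding seg by blast
  then show ?thesis using a q(3) by (intro exI[of _ ?a]) simp
 next
  case False
  have Bne: "?B ~= {}" using AB(3) by blast
  have pe: "?p ~: essential_vertices X"
  proof
   assume "?p:essential_vertices X"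
   note c = ns[OF this]
   obtain a where a: "a:?A" using False by blast
   have un: "?A Un ?B = topspace X - {?p}" using sp by (simp only: split_def)
   have "topspace X - {?p} <= ?A" by (rule split_connected[OF sp c _ _ a]) (simp, unfold un[symmetric], rule UnI1[OF a])
   then show False using dis Bne unfolding un[symmetric] by blast
  qed
  have lt: "card (?A Int P) < card (A Int P)" by (rule psubset_card_mono) (use P(1) pA q(6) seg seg2 in auto)
  obtain f where f: "emb {0..1} X f" "f 0 = ?p" "f ` {0..1::real} = insert ?p ?A"
   using less.hyps[OF lt pt pe sp False Bne] by (elim exE conjE)
  have j: "?a 1 = f 0" using f(2) by simp
  have j': "?a ` {0..1} Int f ` {0..1} <= {f 0}" unfolding a(2) f(2,3) by blast
  obtain g where g: "emb {0..1} X g" "g 0 = ?a 0" "g 1 = f 1" "g ` {0..1::real} = ?a ` {0..1} Un f ` {0..1}"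
   using embedding_concat[OF Haus_X a(1) f(1) j j'] by (elim exE conjE)
  have "g ` {0..1} = insert x A" unfolding g(4) a(2) f(3) using q(4) pA unfolding seg by blast
  then show ?thesis using g(1,2) q(3) by (intro exI[of _ g]) simp
 qed
qed

text \<open>Each of the two sides, together with \<open>x\<close>, is an arc starting at
  \<open>x\<close>; the two arcs are joined there.\<close>

lemma non_separable_cut_point_arc:
 assumes ns: "non_separable X" and x: "x:topspace X" "~ connectedin X (topspace X - {x})"
 shows "X homeomorphic_space top_of_set {0..1::real}"
proof -
 have conn: "connected_space X" and nsv: "!!v. v:essential_vertices X ==> connectedin X (topspace X - {v})"
  using ns by (auto simp: non_separable_def connectedin_def)
 have xe: "x ~: essential_vertices X" using x nsv by blast
 obtain Q where Q: "finite Q" "!!q. q:Q ==> open_arc X q" "topspace X <= essential_vertices X Un (UN q:Q. q ` {0<..<1})"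
  using finite_arc_cover by blast
 let ?P = "(%q. q 0) ` Q Un (%q. q 1) ` Q"
 have P: "finite ?P" "!!q. q:Q ==> q 0:?P & q 1:?P" using Q(1) by auto
 have o: "openin X (topspace X - {x})" by (rule open_minus_point[OF openin_topspace])
 obtain A B where AB: "split X x A B" "A ~= {}" "B ~= {}"
 proof -
  have "~ connected_space (subtopology X (topspace X - {x}))" using x(2) by (auto simp: connectedin_def)
  then obtain A B where ab: "openin (subtopology X (topspace X - {x})) A" "openin (subtopology X (topspace X - {x})) B"
   "A Un B = topspace (subtopology X (topspace X - {x}))" "A Int B = {}" "A ~= {}" "B ~= {}"
   unfolding connected_space_eq by blast
  have "split X x A B" unfolding split_def using openin_trans_full[OF ab(1) o] openin_trans_full[OF ab(2) o] ab(3,4) by auto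
  then show thesis using that ab by blast
 qed
 obtain f where f: "emb {0..1} X f" "f 0 = x" "f ` {0..1::real} = insert x A"
  using cut_side_arc[OF conn nsv Q(2,3) P x(1) xe AB] by blast
 obtain g where g: "emb {0..1} X g" "g 0 = x" "g ` {0..1::real} = insert x B"
  using cut_side_arc[OF conn nsv Q(2,3) P x(1) xe split_sym[OF AB(1)] AB(3,2)] by blast
 let ?f = "%t. f (1 - t)"
 have im: "?f ` {0..1} = f ` {0..1}" unfolding reverse_image by simp
 have j: "?f 1 = g 0" using f(2) g(2) by simp
 have j': "?f ` {0..1} Int g ` {0..1} <= {g 0}" unfolding im f(3) g(2,3) using AB(1) by (auto simp: split_def)
 obtain q where q: "emb {0..1} X q" "q ` {0..1::real} = ?f ` {0..1} Un g ` {0..1}"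
  using embedding_concat[OF Haus_X embedding_reverse[OF f(1)] g(1) j j'] by (elim exE conjE)
 have "q ` {0..1} = topspace X" unfolding q(2) im f(3) g(3) using AB(1) x(1) by (auto simp: split_def)
 then have "homeomorphic_map (top_of_set {0..1}) X q" using q(1) by (simp add: embedding_map_def)
 then show ?thesis using homeomorphic_map_imp_homeomorphic_space homeomorphic_space_sym by blast
qed

lemma edge_facts:
 assumes "e:essential_edges X"
 shows edge_connected: "connectedin X e" and edge_sub: "e <= topspace X - essential_vertices X" and edge_nonempty: "e ~= {}"
proof -
 have "e:connected_components_of (subtopology X (topspace X - essential_vertices X))" using assms by (simp add: essential_edges_def)
 from connectedin_connected_components_of[OF this] connected_components_of_subset[OF this] nonempty_connected_components_of[OF this]
 show "connectedin X e" "e <= topspace X - essential_vertices X" "e ~= {}" by (auto simp: connectedin_subtopology)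
qed

lemma edge_maximal: "e:essential_edges X ==> connectedin X T ==> T Int essential_vertices X = {} ==> T Int e ~= {} ==> T <= e"
 unfolding essential_edges_def
 by (erule connected_components_of_maximal) (auto simp: connectedin_subtopology disjnt_def dest: connectedin_subset_topspace)

lemma edge_ex: "x:topspace X ==> x ~: essential_vertices X ==> EX e:essential_edges X. x:e"
proof -
 assume "x:topspace X" "x ~: essential_vertices X"
 then have "x:\<Union>(essential_edges X)" unfolding essential_edges_def Union_connected_components_of by simp
 then show ?thesis by blast
qed

lemma branch_no_essential: "x:topspace X ==> C:branches X x ==> C Int essential_vertices X = {}"
 using nnbhd.C_nonessential[OF nnbhd_nnb] by (auto simp: branches_eq)

lemma branch_in_edge: "x:topspace X ==> C:branches X x ==> e:essential_edges X ==> C Int e ~= {} ==> C <= e"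
 using edge_maximal[OF _ br_conn branch_no_essential] by blast

lemma nnb_in_edge:
 assumes e: "e:essential_edges X" and x: "x:e" shows "nnb x <= e"
proof -
 have xt: "x:topspace X" "x ~: essential_vertices X" using edge_sub[OF e] x by auto
 have "C <= e" if C: "C:branches X x" for C
 proof -
  obtain h where h: "ray X x C h" using br_ray[OF xt(1) C] by blast
  then have "connectedin X (h ` {0..<1})" by (intro embedding_connected[of "{0..<1}"]) (auto simp: ray_def)
  then have "connectedin X (insert x C)" using ray_image[OF h] by simp
  then have "insert x C <= e" using branch_no_essential[OF xt(1) C] xt(2) x by (intro edge_maximal[OF e]) auto
  then show ?thesis by simp
 qed
 then show ?thesis using nnb_eq[OF xt(1)] x by auto
qed

lemma edge_open: "e:essential_edges X ==> openin X e"
 using nnb_in_edge nnb_open nnb_eq edge_sub by (subst openin_subopen) (metis Diff_iff insertI1 subsetD)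

lemma natural_saturated:
 assumes S: "natural_subgraph X S" shows "saturated X S" unfolding saturated_def
proof (intro conjI ballI)
 show cl: "closedin X S" using S by (simp add: natural_subgraph_def)
 fix x C assume x: "x:S" and C: "C:branches X x"
 obtain V \<E> where VE: "V <= essential_vertices X" "\<E> <= essential_edges X" "S = V Un \<Union>\<E>" using S unfolding natural_subgraph_def by blast
 have xt: "x:topspace X" using x closedin_subset[OF cl] by blast
 show "C <= S | C Int S = {}"
 proof (rule disjCI)
  assume "C Int S ~= {}"
  then obtain e where "e:\<E>" "C Int e ~= {}" using VE branch_no_essential[OF xt C] by blast
  then show "C <= S" using branch_in_edge[OF xt C] VE by blast
 qed
qed

text \<open>Edges are open, so the closure adds only essential vertices. Removing one of these
  leaves a set between \<open>e\<close> and its closure, hence connected. Points of \<open>e\<close>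
  keep both branches and stay non-essential in the closure.\<close>

lemma edge_closure:
 assumes e: "e:essential_edges X"
 shows "natural_subgraph X (X closure_of e)" "non_separable (subtopology X (X closure_of e))" "e <= X closure_of e"
proof -
 let ?S = "X closure_of e"
 note ec = edge_connected[OF e] and es = edge_sub[OF e]
 show sub: "e <= ?S" by (rule closure_of_subset) (use es in blast)
 have "y:essential_vertices X" if y: "y:?S" "y ~: e" for y
 proof (rule ccontr)
  assume n: "y ~: essential_vertices X"
  have "y:topspace X" using y(1) closure_of_subset_topspace[of X e] by blast
  then obtain e' where e': "e':essential_edges X" "y:e'" using edge_ex n by blast
  then have "e' Int e ~= {}" using y(1) edge_open[OF e'(1)] by (auto simp: in_closure_of)
  then have "e' <= e" using edge_maximal[OF e edge_connected[OF e'(1)]] edge_sub[OF e'(1)] by blast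
  then show False using e'(2) y(2) by blast
 qed
 then have V: "?S - e <= essential_vertices X" by blast
 have "?S = (?S - e) Un \<Union>{e}" "{e} <= essential_edges X" using sub e by auto
 with V show nat: "natural_subgraph X ?S"
  unfolding natural_subgraph_def by (intro conjI closedin_closure_of exI[of _ "?S - e"] exI[of _ "{e}"])
 have c: "connectedin X ?S" by (rule connectedin_closure_of[OF ec])
 show "non_separable (subtopology X ?S)" unfolding non_separable_def
 proof (intro conjI ballI)
  show "connected_space (subtopology X ?S)" using c by (simp add: connectedin_def)
  fix v assume v: "v:essential_vertices (subtopology X ?S)"
  then have vS: "v:?S" by (auto simp: essential_vertices_def)
  have "v ~: e"
  proof
   assume ve: "v:e"
   have vt: "v:topspace X" "v ~: essential_vertices X" using ve es by auto
   have "{C:branches X v. C <= ?S} = branches X v" using nnb_in_edge[OF e ve] nnb_eq[OF vt(1)] sub by blast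
   then have "card (branches X v) ~= 2" using v essential_saturated[OF natural_saturated[OF nat] vS] by simp
   then show False using vt essential_iff[OF Haus_X nnb[OF vt(1)]] by (simp add: branches_eq)
  qed
  then have "connectedin X (?S - {v})" using sub by (intro connectedin_intermediate_closure_of[OF ec]) auto
  moreover have "topspace (subtopology X ?S) - {v} = ?S - {v}" using closure_of_subset_topspace[of X e] by auto
  ultimately show "connected_space (subtopology (subtopology X ?S) (topspace (subtopology X ?S) - {v}))"
   by (simp add: connectedin_def subtopology_subtopology Int_absorb1)
 qed
qed

text \<open>By \<open>cyc_nonessential\<close> the intersection of \<open>S\<close> with an
  essential edge is open, and it is relatively closed; so the edge lies in \<open>S\<close> as soon
  as it meets it.\<close>

lemma cyc_natural: assumes S: "cyc X S" shows "natural_subgraph X S"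
proof -
 let ?E = "{e:essential_edges X. e <= S}"
 have "y:\<Union>?E" if y: "y:S" "y ~: essential_vertices X" for y
 proof -
  have yt: "y:topspace X" using y cyc_sub[OF S] by blast
  obtain e where e: "e:essential_edges X" "y:e" using edge_ex[OF yt y(2)] by blast
  have et: "e <= topspace X" using edge_sub[OF e(1)] by blast
  have 1: "openin X (e Int S)"
  proof (subst openin_subopen, intro ballI)
   fix z assume z: "z:e Int S"
   then have zt: "z:topspace X" "z ~: essential_vertices X" using edge_sub[OF e(1)] by auto
   have "nnb z <= e Int S" using nnb_in_edge[OF e(1)] cyc_nonessential[OF S _ zt(2)] z by blast
   then show "EX T. openin X T & z:T & T <= e Int S" using nnb_open[OF zt(1)] nnb_eq[OF zt(1)] by blast
  qed
  have 2: "openin X (topspace X - S)" using S by (auto simp: cyc_def)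
  have "e <= e Int S"
  proof (rule connectedin_two_opens[OF edge_connected[OF e(1)] 1 2])
   show "e <= e Int S Un (topspace X - S)" using et by blast
   show "e Int S Int (topspace X - S) Int e = {}" by blast
  qed (use e y in auto)
  then show ?thesis using e by blast
 qed
 then have "S = (S Int essential_vertices X) Un \<Union>?E" by blast
 moreover have "closedin X S" using S by (simp add: cyc_def)
 moreover have "S Int essential_vertices X <= essential_vertices X" "?E <= essential_edges X" by auto
 ultimately show ?thesis unfolding natural_subgraph_def by (intro conjI exI[of _ "S Int essential_vertices X"] exI[of _ ?E])
qed

lemma cyc_non_separable: assumes S: "cyc X S" shows "non_separable (subtopology X S)"
proof -
 have t: "topspace (subtopology X S) = S" using cyc_sub[OF S] by auto
 have "connectedin X S" "!!z. connectedin X (S - {z})" using S by (auto simp: cyc_def)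
 then show ?thesis unfolding non_separable_def t connectedin_def by (simp add: subtopology_subtopology Int_absorb1)
qed

text \<open>By the intermediate value theorem the middle of two values on \<open>S\<close> is taken
  at some \<open>z\<close>, and then also on the connected set \<open>S - {z}\<close>, against
  injectivity.\<close>

lemma cyc_not_in_arc:
 assumes S: "cyc X S" "S <= T" and T: "subtopology X T homeomorphic_space top_of_set {0..1::real}"
 shows False
proof -
 obtain f g where fg: "homeomorphic_maps (subtopology X T) (top_of_set {0..1::real}) f g" using T by (auto simp: homeomorphic_space_def)
 then have c: "continuous_map (subtopology X T) (top_of_set {0..1}) f" and inj: "!!y. y:topspace X Int T ==> g (f y) = y"
  by (auto simp: homeomorphic_maps_def)
 have St: "S <= topspace X Int T" using S cyc_sub by blast
 have con: "connected (f ` R)" if "connectedin X R" "R <= S" for R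
 proof -
  have "connectedin (subtopology X T) R" using that S(2) by (simp add: connectedin_subtopology)
  from connectedin_continuous_map_image[OF c this] show ?thesis by (simp add: connectedin_subtopology)
 qed
 obtain a b where ab: "a:S" "b:S" "a ~= b" using S(1) by (auto simp: cyc_def)
 then have "f a ~= f b" using inj St by (metis subsetD)
 then obtain a b where ab: "a:S" "b:S" "f a < f b" using ab by (metis linorder_neqE_linordered_idom)
 let ?m = "(f a + f b)/2"
 have m: "f a < ?m" "?m < f b" using ab(3) by auto
 have "connected (f ` S)" using con S(1) by (auto simp: cyc_def)
 then have "?m:f ` S" using connectedD_interval[of "f ` S" "f a" "f b" ?m] ab m by auto
 then obtain z where z: "z:S" "f z = ?m" by auto
 have "connected (f ` (S - {z}))" using con[of "S - {z}"] S(1) by (auto simp: cyc_def)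
 moreover have "a:S - {z}" "b:S - {z}" using ab z m by auto
 ultimately have "?m:f ` (S - {z})" using connectedD_interval[of "f ` (S - {z})" "f a" "f b" ?m] m by auto
 then obtain z' where "z':S - {z}" "f z' = ?m" by (elim imageE) (rule that, assumption, simp only:)
 then have "z':S" "z' ~= z" "f z' = f z" using z(2) by simp_all
 then show False using inj St z(1) by (metis subsetD)
qed

lemma non_separable_cases:
 assumes S: "natural_subgraph X S" "non_separable (subtopology X S)"
 shows "cyc X S | subtopology X S homeomorphic_space top_of_set {0..1::real} | S = {} | (EX v. S = {v})"
proof -
 note sat = natural_saturated[OF S(1)]
 have cl: "closedin X S" using S(1) by (simp add: natural_subgraph_def)
 have t: "topspace (subtopology X S) = S" using closedin_subset[OF cl] by auto
 interpret Y: graph_space "subtopology X S" by (rule graph_space_saturated[OF sat])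
 have cs: "connectedin (subtopology X S) R \<longleftrightarrow> connectedin X R" if "R <= S" for R using that by (simp add: connectedin_subtopology)
 have c: "connectedin X S" using S(2) closedin_subset[OF cl] by (simp add: non_separable_def connectedin_def)
 show ?thesis
 proof (cases "EX z:S. ~ connectedin X (S - {z})")
  case True
  then obtain z where "z:S" "~ connectedin X (S - {z})" by blast
  then show ?thesis using Y.non_separable_cut_point_arc[OF S(2), of z] cs[of "S - {z}"] unfolding t by simp
 next
  case False
  then have "connectedin X (S - {z})" for z using c by (cases "z:S") auto
  moreover have "(EX a:S. EX b:S. a ~= b) | S = {} | (EX v. S = {v})" by blast
  ultimately show ?thesis using cl c unfolding cyc_def by blast
 qed
qed

text \<open>Non-separable subgraphs are cyclic sets, arcs, points or empty, and arcs contain no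
  cyclic set. The empty set is never maximal in a non-empty graph, and a point that is not isolated
  lies in the closure of an adjacent edge.\<close>

lemma block_iff_cblock:
 assumes ne: "topspace X ~= {}"
 shows "block X S \<longleftrightarrow> cblock X S"
proof
 assume b: "cblock X S"
 then have S: "cyc X S" by (rule cblock_cyc)
 have "S' = S" if S': "natural_subgraph X S'" "non_separable (subtopology X S')" "S <= S'" for S'
  using non_separable_cases[OF S'(1,2)]
 proof (elim disjE exE)
  assume "subtopology X S' homeomorphic_space top_of_set {0..1::real}"
  then show ?thesis using cyc_not_in_arc[OF S S'(3)] by blast
 qed (use S S'(3) cblockD[OF b] in \<open>auto simp: cyc_def\<close>)
 moreover have "~ subtopology X S homeomorphic_space top_of_set {0..1::real}" using cyc_not_in_arc[OF S] by blast
 moreover have "~ (EX v. S = {v} & openin X {v})" using S by (auto simp: cyc_def)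
 ultimately show "block X S" unfolding block_def using cyc_natural[OF S] cyc_non_separable[OF S] by blast
next
 assume b: "block X S"
 then have S: "natural_subgraph X S" "non_separable (subtopology X S)"
  and max: "!!S'. natural_subgraph X S' ==> non_separable (subtopology X S') ==> S <= S' ==> S' = S"
  and na: "~ subtopology X S homeomorphic_space top_of_set {0..1::real}" and ni: "!!v. S = {v} ==> ~ openin X {v}"
  unfolding block_def by blast+
 have "S ~= {}"
 proof
  assume E: "S = {}"
  obtain x where x: "x:topspace X" using ne by blast
  show False
  proof (cases "x:essential_vertices X")
   case True
   have "natural_subgraph X {x}" unfolding natural_subgraph_def
    using closedin_Hausdorff_singleton[OF Haus_X x] True by (intro conjI exI[of _ "{x}"] exI[of _ "{}"]) auto
   moreover have "non_separable (subtopology X {x})"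
   proof -
    have t: "topspace (subtopology X {x}) = {x}" using x by auto
    have "connectedin X {x}" "connectedin X ({x} - {v})" for v using x by (auto simp: insert_Diff_if)
    then show ?thesis unfolding non_separable_def t connectedin_def by (simp add: subtopology_subtopology Int_absorb1)
   qed
   ultimately show False using max[of "{x}"] E by blast
  next
   case False
   then obtain e where e: "e:essential_edges X" "x:e" using edge_ex x by blast
   then show False using max[OF edge_closure(1,2)[OF e(1)]] edge_closure(3)[OF e(1)] E by blast
  qed
 qed
 moreover have "S ~= {v}" for v
 proof
  assume E: "S = {v}"
  have vt: "v:topspace X" using E S(1) closedin_subset unfolding natural_subgraph_def by blast
  have "branches X v ~= {}" using ni[OF E] nnb_open[OF vt] nnb_eq[OF vt] by auto
  then obtain C where C: "C:branches X v" by blast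
  then obtain z where z: "z:C" using br_nonempty[OF vt] by blast
  have zt: "z:topspace X" "z ~: essential_vertices X" "z ~= v"
   using z br_top[OF vt C] branch_no_essential[OF vt C] br_notin[OF vt C] by auto
  obtain e where e: "e:essential_edges X" "z:e" using edge_ex[OF zt(1,2)] by blast
  have "C <= e" using branch_in_edge[OF vt C e(1)] z e(2) by blast
  then have "v:X closure_of e" using br_limit[OF vt C] vt unfolding in_closure_of by blast
  then have "X closure_of e = S" using max[OF edge_closure(1,2)[OF e(1)]] E by blast
  then show False using e(2) edge_closure(3)[OF e(1)] E zt(3) by blast
 qed
 ultimately have "cyc X S" using non_separable_cases[OF S] na by blast
 then show "cblock X S" unfolding cblock_def using max cyc_natural cyc_non_separable by blast
qed

end

section \<open>Polyhedra of dimension one\<close>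

text \<open>A small ball meets only segments through \<open>x\<close>, in finitely many radii.
  Segments may overlap, so the branches are indexed by unit directions and not by segments.\<close>

lemma segments_normal_neighbourhood:
 fixes x :: "'a::euclidean_space"
 assumes L: "finite L" and x: "x:(\<Union>(a, b)\<in>L. closed_segment a b)"
 shows "EX N. normal_neighbourhood (top_of_set (\<Union>(a, b)\<in>L. closed_segment a b)) x N"
proof -
 let ?G = "\<Union>(a, b)\<in>L. closed_segment a b"
 \<comment> \<open>End points, other than \<open>x\<close>, to which \<open>x\<close> can be joined
   by a segment inside the graph. The ball is taken so small that it reaches none of them.\<close>
 define T where "T = {b:fst ` L Un snd ` L. b ~= x & closed_segment x b <= ?G}"
 let ?F = "\<Union>(a, b)\<in>{(a, b):L. x ~: closed_segment a b}. closed_segment a b"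
 have finT: "finite T" using L by (simp add: T_def)
 have "finite {(a, b):L. x ~: closed_segment a b}" by (rule finite_subset[OF _ L]) auto
 then have "closed ?F" by (intro closed_UN) (auto simp: closed_segment)
 then have op: "open (- (?F Un T))" by (intro open_Compl closed_Un finite_imp_closed[OF finT])
 have xF: "x:- (?F Un T)" by (auto simp: T_def)
 from bspec[OF iffD1[OF open_contains_cball op] xF] obtain d where d: "0 < d" "cball x d <= - (?F Un T)" by (elim exE conjE)
 define u where "u b = (1 / norm (b - x)) *\<^sub>R (b - x)" for b
 have nu: "norm (u b) = 1" if "b:T" for b using that by (simp add: u_def T_def)
 have far: "d < norm (b - x)" if "b:T" for b
 proof (rule ccontr)
  assume "~ d < norm (b - x)"
  then have "b:cball x d" by (simp add: dist_norm norm_minus_commute)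
  then show False using d(2) that by blast
 qed
 have seg: "x + r *\<^sub>R u b:?G" if "b:T" "0 <= r" "r <= d" for r b
 proof -
  have "x + r *\<^sub>R u b = (1 - r / norm (b - x)) *\<^sub>R x + (r / norm (b - x)) *\<^sub>R b" by (simp add: u_def algebra_simps)
  moreover have n: "0 < norm (b - x)" using far[OF that(1)] d(1) by linarith
  then have "0 <= r / norm (b - x)" "r / norm (b - x) <= 1" unfolding pos_divide_le_eq[OF n] using far[OF that(1)] that(2,3) by auto
  ultimately have "x + r *\<^sub>R u b:closed_segment x b" by (auto simp: in_segment)
  then show ?thesis using that(1) by (auto simp: T_def)
 qed
 have near: "EX b:T. EX r. 0 < r & r < d & y = x + r *\<^sub>R u b" if y: "y:?G" "y:ball x d" "y ~= x" for y
 proof -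
  obtain a b where ab: "(a, b):L" "y:closed_segment a b" using y(1) by auto
  have xs: "x:closed_segment a b"
  proof (rule ccontr)
   assume "x ~: closed_segment a b"
   then have "y:?F" using ab by auto
   moreover have "y:cball x d" using y(2) by auto
   ultimately show False using d(2) by blast
  qed
  have "EX c. c:fst ` L Un snd ` L & y:closed_segment x c & closed_segment x c <= ?G"
  proof -
   have un: "closed_segment a x Un closed_segment x b = closed_segment a b" by (rule Un_closed_segment[OF xs])
   have "closed_segment a b <= ?G" using ab(1) by auto
   moreover have "a:fst ` L Un snd ` L" "b:fst ` L Un snd ` L" using ab(1) by force+
   ultimately have c: "a:fst ` L Un snd ` L" "b:fst ` L Un snd ` L" "closed_segment x a <= ?G" "closed_segment x b <= ?G"
    unfolding un[symmetric] closed_segment_commute[of a x] by simp_all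
   consider "y:closed_segment x a" | "y:closed_segment x b" using ab(2) unfolding un[symmetric] closed_segment_commute[of a x] by blast
   then show ?thesis by cases (use c in metis)+
  qed
  then obtain c where c: "c:fst ` L Un snd ` L" "y:closed_segment x c" "closed_segment x c <= ?G" by blast
  then have "c ~= x" using y(3) by auto
  then have cT: "c:T" using c by (simp add: T_def)
  obtain s where s: "0 <= s" "s <= 1" "y = (1 - s) *\<^sub>R x + s *\<^sub>R c" using c(2) by (auto simp: in_segment)
  let ?r = "s * norm (c - x)"
  have yx: "y - x = s *\<^sub>R (c - x)" using s(3) by (simp add: algebra_simps)
  then have "norm (y - x) = ?r" using s(1) by simp
  moreover have "0 < norm (y - x)" "norm (y - x) < d" using y(2,3) by (auto simp: dist_norm norm_minus_commute)
  ultimately have "0 < ?r" "?r < d" by simp_all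
  moreover have "?r *\<^sub>R u c = y - x" using \<open>c ~= x\<close> unfolding yx by (simp add: u_def)
  then have "y = x + ?r *\<^sub>R u c" by (simp add: algebra_simps)
  ultimately show ?thesis using cT by blast
 qed
 let ?U = "u ` T"
 let ?R = "%v. (%r. x + r *\<^sub>R v) ` {0<..<d}"
 have nU: "norm v = 1" if "v:?U" for v using that nu by auto
 have polar: "r = r' & v = v'" if "v:?U" "v':?U" "0 <= r" "0 < r'" "x + r *\<^sub>R v = x + r' *\<^sub>R v'" for r r' v v'
 proof -
  have e: "r *\<^sub>R v = r' *\<^sub>R v'" using that(5) by simp
  then have "norm (r *\<^sub>R v) = norm (r' *\<^sub>R v')" by simp
  then have "r = r'" using nU[OF that(1)] nU[OF that(2)] that(3,4) by simp
  then show ?thesis using e that(4) by simp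
 qed
 let ?N = "?G Int ball x d"
 have Neq: "\<Union>(?R ` ?U) = ?N - {x}"
 proof (intro subset_antisym subsetI)
  fix y assume "y:\<Union>(?R ` ?U)"
  then obtain b r where br: "b:T" "0 < r" "r < d" "y = x + r *\<^sub>R u b" by auto
  then have "dist x y = r" using nu[OF br(1)] by (simp add: dist_norm)
  then show "y:?N - {x}" using br seg[OF br(1), of r] by auto
 next
  fix y assume "y:?N - {x}"
  then obtain b r where "b:T" "0 < r" "r < d" "y = x + r *\<^sub>R u b" using near[of y] by blast
  then have "y:?R (u b)" "u b:?U" by (auto intro: image_eqI[of _ _ r])
  then show "y:\<Union>(?R ` ?U)" by blast
 qed
 have "normal_neighbourhood (top_of_set ?G) x ?N"
 proof (rule normal_neighbourhoodI(1)[of _ _ _ "?R ` ?U"])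
  show "openin (top_of_set ?G) ?N" by (simp add: openin_open_Int)
  show "x:?N" using x d(1) by simp
  show "finite (?R ` ?U)" using finT by simp
  show "\<Union>(?R ` ?U) = ?N - {x}" by (rule Neq)
  show "disjoint (?R ` ?U)"
  proof (rule pairwiseI)
   fix A B assume AB: "A:?R ` ?U" "B:?R ` ?U" "A ~= B"
   obtain v where v1: "A = ?R v" "v:?U" using AB(1) by (rule imageE)
   obtain v' where v2: "B = ?R v'" "v':?U" using AB(2) by (rule imageE)
   have "v ~= v'" using AB(3) v1 v2 by metis
   note v = v1(2) v2(2) v1(1) v2(1) this
   have "x + r *\<^sub>R v ~= x + r' *\<^sub>R v'" if "0 < r" "0 < r'" for r r' using polar[OF v(1,2), of r r'] that v(5) by auto
   then show "disjnt A B" unfolding v(3,4) disjnt_def by fastforce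
  qed
 next
  fix C assume "C:?R ` ?U"
  then obtain v where v: "v:?U" "C = ?R v" by blast
  \<comment> \<open>The closed radii in the other directions; removing this closed set from the ball
    shows that a single radius is relatively open.\<close>
  let ?K = "UN v':?U - {v}. (%r. x + r *\<^sub>R v') ` {0..d}"
  have "closed ?K" using finT
   by (intro closed_UN finite_Diff finite_imageI ballI compact_imp_closed compact_continuous_image continuous_intros compact_Icc) auto
  then have "open (ball x d - insert x ?K)" by (intro open_Diff open_ball closed_insert)
  moreover have "C = ?G Int (ball x d - insert x ?K)"
  proof (intro subset_antisym subsetI)
   fix y assume y: "y:C"
   then obtain r where r: "0 < r" "r < d" "y = x + r *\<^sub>R v" unfolding v(2) by auto
   have "y:?N - {x}" using y v Neq by blast
   moreover have "y ~: ?K"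
   proof
    assume "y:?K"
    then obtain v' where v': "v':?U - {v}" "y:(%r. x + r *\<^sub>R v') ` {0..d}" by (rule UN_E)
    obtain r' where r': "y = x + r' *\<^sub>R v'" "r':{0..d}" using v'(2) by (rule imageE)
    then have "v':?U" "v' ~= v" "0 <= r'" using v'(1) by auto
    note this r'(1)
    then show False using polar[of v' v r' r] v(1) r by metis
   qed
   ultimately show "y:?G Int (ball x d - insert x ?K)" by blast
  next
   fix y assume y: "y:?G Int (ball x d - insert x ?K)"
   then have "y:\<Union>(?R ` ?U)" unfolding Neq by blast
   then obtain v' where v'U: "v':?U" "y:?R v'" by (rule UN_E)
   obtain r where "y = x + r *\<^sub>R v'" "r:{0<..<d}" using v'U(2) by (rule imageE)
   with v'U(1) have v': "v':?U" "0 < r" "r < d" "y = x + r *\<^sub>R v'" by auto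
   have "v' = v"
   proof (rule ccontr)
    assume "v' ~= v"
    then have "y:?K" using v' by (intro UN_I[of v'] image_eqI[of _ _ r]) auto
    then show False using y by blast
   qed
   then show "y:C" unfolding v(2) using v' by auto
  qed
  ultimately show "openin (top_of_set ?G) C" using openin_open by blast
  let ?h = "%t. x + (d * t) *\<^sub>R v"
  have hG: "?h t:?G" if "t:{0..1}" for t
  proof -
   obtain b where b: "b:T" "v = u b" using v(1) by blast
   have "0 <= d * t" "d * t <= d" using that d(1) by (auto simp: mult_le_cancel_left1)
   then show ?thesis unfolding b(2) by (rule seg[OF b(1)])
  qed
  have "continuous_map (top_of_set {0..1}) (top_of_set ?G) ?h" using hG by (auto intro!: continuous_intros)
  moreover have "inj_on ?h {0..1}" using nU[OF v(1)] d(1) by (intro inj_onI) auto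
  ultimately have "emb {0..1} (top_of_set ?G) ?h"
   by (intro continuous_imp_embedding_map) (auto simp: compact_space_subtopology Hausdorff_space_subtopology)
  then have "emb {0..<1} (top_of_set ?G) ?h" by (rule embedding_map_restrict) auto
  moreover have "?h ` {0<..<1} = C"
  proof -
   have "(%t. d * t) ` {0<..<1} = {0<..<d}" using affine_image_right(1)[of 0 d] d(1) by simp
   then have "(%r. x + r *\<^sub>R v) ` (%t. d * t) ` {0<..<1} = C" using v(2) by simp
   then show ?thesis by (simp only: image_image)
  qed
  ultimately show "EX h. ray (top_of_set ?G) x C h" unfolding ray_def by (intro exI[of _ ?h]) simp
 qed
 then show ?thesis by blast
qed

lemma topological_graph_spatial:
 assumes "topological_graph X" shows "spatial_graph X"
proof -
 obtain K :: "(real ^ 3) set set" where K: "simplicial_complex K" "ALL S:K. aff_dim S <= 1" "X homeomorphic_space top_of_set (\<Union>K)"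
  using assms by (auto simp: topological_graph_def)
 have fin: "finite K" using K(1) by (simp add: simplicial_complex_def)
 \<comment> \<open>A non-empty simplex of dimension at most one has one or two vertices; a single
   vertex counts as a degenerate segment.\<close>
 have "EX p. S = closed_segment (fst p) (snd p)" if S: "S:K - {{}}" for S
 proof -
  obtain n where "n simplex S" using S K(1) unfolding simplicial_complex_def by blast
  then obtain C where C: "~ affine_dependent C" "S = convex hull C" by (auto simp: simplex_def)
  have fC: "finite C" by (rule aff_independent_finite[OF C(1)])
  have "aff_dim C <= 1" using K(2) S C(2) aff_dim_convex_hull[of C] by auto
  then have "int (card C) - 1 <= 1" using aff_dim_affine_independent[OF C(1)] by simp
  moreover have "card C ~= 0" using S C(2) fC by auto
  ultimately have "card C = 1 | card C = 2" by linarith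
  then obtain a b where "C = {a, b}" by (metis card_1_singletonE card_2_iff insert_absorb2)
  then show ?thesis using C(2) by (intro exI[of _ "(a, b)"]) (simp add: segment_convex_hull)
 qed
 then have "ALL S:K - {{}}. EX p. S = closed_segment (fst p) (snd p)" by blast
 from bchoice[OF this] obtain p where p: "ALL S:K - {{}}. S = closed_segment (fst (p S)) (snd (p S))" ..
 let ?L = "p ` (K - {{}})" let ?G = "\<Union>(a, b)\<in>?L. closed_segment a b"
 have G: "\<Union>K = ?G"
 proof -
  have "?G = (UN S:K - {{}}. closed_segment (fst (p S)) (snd (p S)))" by (simp add: case_prod_unfold)
  also have "\<dots> = \<Union>(K - {{}})" using p by simp
  finally show ?thesis by auto
 qed
 have fL: "finite ?L" using fin by simp
 have "compact ?G" using fL by (intro compact_UN) auto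
 obtain \<B> :: "(real ^ 3) set set" where B: "countable \<B>" "!!C. C:\<B> ==> open C" "!!S. open S ==> EX U. U <= \<B> & S = \<Union>U"
  using univ_second_countable by blast
 have sc: "second_countable (euclidean :: (real ^ 3) topology)"
 proof (rule second_countableI[OF B(1)])
  fix U :: "(real ^ 3) set" and x assume "openin euclidean U" "x:U"
  then obtain \<U> where "\<U> <= \<B>" "U = \<Union>\<U>" using B(3)[of U] by auto
  then show "EX V:\<B>. x:V & V <= U" using \<open>x:U\<close> by blast
 qed (use B(2) in simp)
 then have "graph_space (top_of_set ?G)"
 proof unfold_locales
  show "compact_space (top_of_set ?G)" using \<open>compact ?G\<close> by (intro compact_space_subtopology) simp
  show "Hausdorff_space (top_of_set ?G)" by (simp add: Hausdorff_space_subtopology)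
  show "second_countable (top_of_set ?G)" by (rule second_countable_subtopology[OF sc])
  show "EX N. normal_neighbourhood (top_of_set ?G) x N" if "x:topspace (top_of_set ?G)" for x
   using that unfolding topspace_euclidean_subtopology by (rule segments_normal_neighbourhood[OF fL])
 qed
 then have "graph_space X" using graph_space_homeomorphic K(3) homeomorphic_space_sym unfolding G by blast
 moreover have "EX G::(real ^ 3) set. X homeomorphic_space top_of_set G" using K(3) by blast
 ultimately show ?thesis by (simp add: spatial_graph_def spatial_graph_axioms_def)
qed


section \<open>The dense amalgam\<close>

lemma spread_homeomorphic:
 assumes f: "homeomorphic_map Z Z' f" and S: "spread Z \<S> (%S. S)" "\<Union>\<S> <= topspace Z"
 shows "spread Z' ((`) f ` \<S>) (%S. S)" unfolding spread_def
proof (intro ballI impI)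
 fix a' b' assume "a':topspace Z'" "b':topspace Z'" "a' ~= b'"
 then obtain a b where ab: "a:topspace Z" "b:topspace Z" "a ~= b" "a' = f a" "b' = f b"
  using homeomorphic_imp_surjective_map[OF f] by (metis imageE)
 obtain U V where UV: "openin Z U" "openin Z V" "a:U" "b:V" "finite {S:\<S>. S Int U ~= {} & S Int V ~= {}}"
  using spreadD[OF S(1) ab(1-3)] by blast
 have inj: "inj_on f (topspace Z)" by (rule homeomorphic_imp_injective_map[OF f])
 have int: "f ` T Int f ` Q = f ` (T Int Q)" if "T:\<S>" "openin Z Q" for T Q
  using inj_on_image_Int[OF inj, of T Q] S(2) that(1) openin_subset[OF that(2)] by blast
 have "{T:(`) f ` \<S>. T Int f ` U ~= {} & T Int f ` V ~= {}} <= (`) f ` {S:\<S>. S Int U ~= {} & S Int V ~= {}}"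
 proof
  fix T' assume "T':{T:(`) f ` \<S>. T Int f ` U ~= {} & T Int f ` V ~= {}}"
  then have T': "T':(`) f ` \<S>" "T' Int f ` U ~= {}" "T' Int f ` V ~= {}" by simp_all
  then obtain T where "T' = f ` T" "T:\<S>" by (elim imageE)
  with T' have T: "T:\<S>" "T' = f ` T" "f ` T Int f ` U ~= {}" "f ` T Int f ` V ~= {}" by simp_all
  then have "T:{S:\<S>. S Int U ~= {} & S Int V ~= {}}" using int[OF T(1) UV(1)] int[OF T(1) UV(2)] by simp
  then show "T':(`) f ` {S:\<S>. S Int U ~= {} & S Int V ~= {}}" unfolding T(2) by (rule imageI)
 qed
 then have "finite {T:(`) f ` \<S>. T Int f ` U ~= {} & T Int f ` V ~= {}}" by (rule finite_subset[OF _ finite_imageI[OF UV(5)]])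
 moreover have "openin Z' (f ` U)" "openin Z' (f ` V)" using homeomorphic_imp_open_map[OF f] UV by (auto simp: open_map_def)
 ultimately show "EX U V. openin Z' U & openin Z' V & a':U & b':V & finite {T:(`) f ` \<S>. T Int U ~= {} & T Int V ~= {}}"
  using UV(3,4) ab(4,5) by (intro exI[of _ "f ` U"] exI[of _ "f ` V"]) simp
qed

lemma dense_homeomorphic:
 assumes f: "homeomorphic_map Z Z' f" and S: "S <= topspace Z" "Z closure_of S = topspace Z"
 shows "Z' closure_of (f ` S) = topspace Z'"
 using homeomorphic_map_closure_of[OF f S(1)] S(2) homeomorphic_imp_surjective_map[OF f] by simp

lemma (in graph_space) essential_homeomorphic:
 assumes g: "homeomorphic_map X Y g" shows "essential_vertices Y <= g ` essential_vertices X"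
proof
 fix y assume y: "y:essential_vertices Y"
 have HY: "Hausdorff_space Y" using homeomorphic_Hausdorff_space[of X Y] Haus_X g by (auto simp: homeomorphic_space)
 obtain x where x: "x:topspace X" "y = g x" using y homeomorphic_imp_surjective_map[OF g] by (auto simp: essential_vertices_def)
 note n = normal_neighbourhood_homeomorphic[OF Haus_X g nnb[OF x(1)]]
 have "inj_on ((`) g) (branches X x)"
  using inj_on_image_eq_iff[OF homeomorphic_imp_injective_map[OF g]] br_top[OF x(1)] by (intro inj_onI) blast
 then have "card (branches X x) ~= 2"
  using essential_iff[OF HY n(1)] y n(2) by (simp add: x(2) card_image branches_eq)
 then have "x:essential_vertices X" using essential_iff[OF Haus_X nnb[OF x(1)]] by (simp add: branches_eq)
 then show "y:g ` essential_vertices X" using x(2) by blast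
qed

lemma reflection_data_locales:
 assumes X: "graph_space X" and d: "reflection_data X D V E lab"
 shows "marked_graph X D" "labelled_tree X D V E lab"
proof -
 interpret graph_space X by fact
 show m: "marked_graph X D" by unfold_locales (use d in \<open>auto simp: reflection_data_def\<close>)
 interpret marked_graph X D by fact
 show "labelled_tree X D V E lab" by unfold_locales (use d in \<open>auto simp: reflection_data_def\<close>)
qed

context big_graph
begin

text \<open>The dense set of \<open>Y\<close> is carried to \<open>S\<close> and then moved onto
  \<open>D Int S\<close> by \<open>dense_homogeneous\<close>, after which \<open>rtop_block\<close>
  applies.\<close>

lemma rtop_of_block:
 fixes Y :: "'b topology"
 assumes Y: "marked_graph Y DY" and S: "cyc X S" and h: "subtopology X S homeomorphic_space Y" and t: "t:W"
 shows "rtop Y DY homeomorphic_space subtopology RT (member t S)"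
proof -
 interpret Y: marked_graph Y DY by fact
 let ?XS = "subtopology X S"
 interpret S: graph_space ?XS by (rule graph_space_saturated[OF cyc_saturated[OF S]])
 have top: "topspace ?XS = S" using cyc_sub[OF S] by auto
 obtain g where g: "homeomorphic_map Y ?XS g" using h homeomorphic_space_sym by (auto simp: homeomorphic_space)
 have gD: "g ` DY <= S" using homeomorphic_imp_surjective_map[OF g] Y.D_sub top by auto
 have "EX f. homeomorphic_map ?XS ?XS f & f ` (g ` DY) = D Int S"
 proof (rule S.dense_homogeneous)
  show "countable (D Int S)" "countable (g ` DY)" using D_count Y.D_count by auto
  show "D Int S <= topspace ?XS" "g ` DY <= topspace ?XS" using top gD by auto
  show "essential_vertices ?XS <= D Int S" using essential_cyc[OF S] D_ess by blast
  show "essential_vertices ?XS <= g ` DY" using Y.essential_homeomorphic[OF g] Y.D_ess by blast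
  show "?XS closure_of (g ` DY) = topspace ?XS" by (rule dense_homeomorphic[OF g Y.D_sub Y.D_dense])
  show "?XS closure_of (D Int S) = topspace ?XS" unfolding dense_intersects_open
  proof (intro allI impI)
   fix T assume T: "openin ?XS T & T ~= {}"
   then obtain U where U: "openin X U" "T = U Int S" by (auto simp: openin_subtopology)
   then obtain y where "y:U Int S" using T by blast
   then show "D Int S Int T ~= {}" using cyc_meets_D[OF S U(1)] U(2) by blast
  qed
 qed
 then obtain f where f: "homeomorphic_map ?XS ?XS f" "f ` (g ` DY) = D Int S" by blast
 have "homeomorphic_map Y ?XS (f \<circ> g)" by (rule homeomorphic_map_compose[OF g f(1)])
 then obtain k where k: "homeomorphic_maps Y ?XS (f \<circ> g) k" by (auto simp: homeomorphic_map_maps)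
 have "rtop Y DY homeomorphic_space subtopology RT (member [] S)"
  by (rule rtop_block[OF Y S k]) (use f(2) in \<open>simp add: image_comp\<close>)
 then show ?thesis using member_shift_homeomorphic[OF t] homeomorphic_space_sym homeomorphic_space_trans by blast
qed

lemma separation:
 assumes mn: "m:M" "n:M" "m ~= n" and no: "~ (EX t:W. EX S. cblock X S & m:member t S & n:member t S)"
 shows "EX H. openin RT H & closedin RT H & m:H & n ~: H & (ALL t:W. ALL S. cblock X S --> member t S <= H | member t S Int H = {})"
proof -
 have "~ inseparable m n" using inseparable_in_member[OF mn(1,2) _ mn(3)] no by blast
 then obtain w x K L where w: "w:W" "x:D" "split X x K L" "~ (m:csep w x K \<longleftrightarrow> n:csep w x K)"
  unfolding inseparable_def by blast
 have H: "openin RT (csep w x K) & closedin RT (csep w x K) & (ALL t:W. ALL S. cblock X S --> member t S <= csep w x K | member t S Int csep w x K = {})"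
  if "split X x K L" for K L
  using openin_csep[OF w(1,2) that] closedin_csep[OF w(1,2) that] csep_saturated[OF cblock_cyc _ w(1,2) that] by blast
 have "M - csep w x K = csep w x L" by (rule csep_Compl[OF w(1-3)])
 then have "(m:csep w x K & n ~: csep w x K) | (m:csep w x L & n ~: csep w x L)" using w(4) mn(1,2) by blast
 then show ?thesis using H[OF w(3)] H[OF split_sym[OF w(3)]] by metis
qed

lemma dense_amalgam:
 fixes Y :: "nat => 'b topology" and B :: "nat => 'c topology"
 assumes f: "homeomorphic_map RT Z f" and nc: "~ connected_space RT"
  and types: "!!i. i < k ==> EX S. cblock X S & subtopology X S homeomorphic_space Y i"
  and all: "!!S. cblock X S ==> EX i<k. subtopology X S homeomorphic_space Y i"
  and distinct: "!!i j. i < k ==> j < k ==> Y i homeomorphic_space Y j ==> i = j"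
  and cm: "!!i. i < k ==> compact_space (B i) & metrizable_space (B i)"
  and B: "!!i S t. i < k ==> cblock X S ==> subtopology X S homeomorphic_space Y i ==> t:W ==>
   subtopology RT (member t S) homeomorphic_space B i"
 shows "is_dense_amalgam k B Z"
proof -
 have hZ: "RT homeomorphic_space Z" using f by (auto simp: homeomorphic_space)
 have cZ: "compact_space Z" "metrizable_space Z"
  using homeomorphic_compact_space[OF hZ] homeomorphic_metrizable_space[OF hZ] compact_RT metrizable_RT by auto
 have St: "S ~= topspace X" if S: "cblock X S" for S
 proof
  assume "S = topspace X"
  then have "connected_space X" "!!z. connectedin X (topspace X - {z})" using cblock_cyc[OF S] by (auto simp: cyc_def connectedin_topspace)
  moreover have "EX z:D. z ~= y" for y using three by blast
  ultimately show False using connected_RT nc by blast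
 qed
 \<comment> \<open>Members are non-empty, so the convention that discards empty spaces does not
   intervene.\<close>
 have Bne: "topspace (B i) ~= {}" if i: "i < k" for i
 proof -
  obtain S where S: "cblock X S" "subtopology X S homeomorphic_space Y i" using types[OF i] by blast
  have "topspace (subtopology RT (member [] S)) ~= {}" using member_nonempty[OF S(1) words_Nil] member_sub by auto
  then show ?thesis using homeomorphic_empty_space_eq[of "B i"] B[OF i S words_Nil] homeomorphic_empty_space by fastforce
 qed
 let ?I = "{i. i < k & topspace (B i) ~= {}}"
 have I: "?I = {..<k}" using Bne by auto
 have "if ?I = {} then Z homeomorphic_space cantor_space else EX \<A>. dense_amalgam_family Z ?I B \<A>"
 proof (cases "k = 0")
  case True
  then have nb: "~ cblock X S" for S using all by blast
  have "RT homeomorphic_space cantor_space"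
  proof (rule cantor_characterization[OF compact_RT Hausdorff_RT second_countable_RT])
   show "topspace RT ~= {}" using nc connectedin_topspace[of RT] connectedin_empty[of RT] by metis
   show "EX a:U. EX b:U. a ~= b" if "openin RT U" "U ~= {}" for U using open_two_points[OF that] .
   show "EX H. openin RT H & closedin RT H & a:H & b ~: H" if "a:topspace RT" "b:topspace RT" "a ~= b" for a b
    using separation[of a b] that nb by auto
  qed
  then have "Z homeomorphic_space cantor_space" using hZ homeomorphic_space_sym homeomorphic_space_trans by blast
  then show ?thesis using I True by simp
 next
  case False
  define A where "A = (%i. {f ` member t S |t S. t:W & cblock X S & subtopology X S homeomorphic_space Y i})"
  have inj: "inj_on f M" using homeomorphic_imp_injective_map[OF f] by simp
  have onto: "f ` M = topspace Z" using homeomorphic_imp_surjective_map[OF f] by simp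
  have fe: "P = Q" if "P <= M" "Q <= M" "f ` P = f ` Q" for P Q using inj_on_image_eq_iff[OF inj that(1,2)] that(3) by simp
  have fI: "f ` P Int f ` Q = f ` (P Int Q)" if "P <= M" "Q <= M" for P Q using inj_on_image_Int[OF inj that] by simp
  have AU: "(\<Union>i<k. A i) = (`) f ` {member t S |t S. t:W & cblock X S}" using all unfolding A_def by blast
  have AE: "EX t:W. EX S. cblock X S & T = f ` member t S" if "T:(\<Union>i<k. A i)" for T using that unfolding AU by blast
  have "{member t S |t S. t:W & cblock X S} = (%(t, S). member t S) ` (W \<times> {S. cblock X S})" by auto
  moreover have "countable (W \<times> {S. cblock X S})"
   by (intro countable_SIGMA countable_words[OF D_count] countable_finite[OF finite_cblock])
  ultimately have 1: "countable (\<Union>i<k. A i)" unfolding AU by (intro countable_image) (simp only: countable_image)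
  obtain S0 where S0: "cblock X S0" using types[of 0] False by blast
  have "inj_on ((`) f) {member t S0 |t. t:W}" by (intro inj_onI fe) (use member_sub in auto)
  then have "infinite ((`) f ` {member t S0 |t. t:W})" using infinite_members[OF S0 St[OF S0]] finite_image_iff by blast
  moreover have "(`) f ` {member t S0 |t. t:W} <= (\<Union>i<k. A i)" unfolding AU using S0 by blast
  ultimately have 2: "infinite (\<Union>i<k. A i)" using finite_subset by blast
  have meet: "S = S' & member t S = member t' S'" if "t:W" "t':W" "cblock X S" "cblock X S'" "f ` member t S Int f ` member t' S' ~= {}" for t t' S S'
  proof -
   have "member t S Int member t' S' ~= {}" using that(5) fI[OF member_sub member_sub] by auto
   then show ?thesis using member_disjoint[OF that(3,4) _ _ that(1,2)] by blast
  qed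
  have 3: "disjoint_family_on A {..<k}" unfolding disjoint_family_on_def
  proof (intro ballI impI)
   fix i j assume ij: "i:{..<k}" "j:{..<k}" "i ~= j"
   have False if Tij: "T:A i" "T:A j" for T
   proof -
    obtain t S where S: "T = f ` member t S" "t:W" "cblock X S" "subtopology X S homeomorphic_space Y i" using Tij(1) unfolding A_def by blast
    obtain t' S' where S': "T = f ` member t' S'" "t':W" "cblock X S'" "subtopology X S' homeomorphic_space Y j" using Tij(2) unfolding A_def by blast
    have "f ` member t S Int f ` member t' S' ~= {}" using S(1) S'(1) member_nonempty[OF S(3,2)] by auto
    then have "S = S'" using meet[OF S(2) S'(2) S(3) S'(3)] by blast
    then have "Y i homeomorphic_space Y j" using S(4) S'(4) homeomorphic_space_sym homeomorphic_space_trans by blast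
    then show False using distinct ij by auto
   qed
   then show "A i Int A j = {}" by blast
  qed
  have 4: "disjoint (\<Union>i<k. A i)" unfolding disjoint_def
  proof (intro ballI impI)
   fix T T' assume T: "T:(\<Union>i<k. A i)" "T':(\<Union>i<k. A i)" "T ~= T'"
   obtain t S where S: "t:W" "cblock X S" "T = f ` member t S" using AE[OF T(1)] by blast
   obtain t' S' where S': "t':W" "cblock X S'" "T' = f ` member t' S'" using AE[OF T(2)] by blast
   show "T Int T' = {}" using meet[OF S(1) S'(1) S(2) S'(2)] S(3) S'(3) T(3) by metis
  qed
  have 5: "ALL i<k. ALL T:A i. T <= topspace Z & subtopology Z T homeomorphic_space B i"
  proof (intro allI impI ballI)
   fix i T assume i: "i < k" and "T:A i"
   then obtain t S where S: "T = f ` member t S" "t:W" "cblock X S" "subtopology X S homeomorphic_space Y i" unfolding A_def by blast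
   have "homeomorphic_map (subtopology RT (member t S)) (subtopology Z T) f"
    by (rule homeomorphic_map_subtopologies[OF f]) (use S(1) member_sub[of t S] onto in auto)
   then have "subtopology RT (member t S) homeomorphic_space subtopology Z T" by (auto simp: homeomorphic_space)
   then have "subtopology Z T homeomorphic_space B i" using B[OF i S(3,4,2)] homeomorphic_space_sym homeomorphic_space_trans by blast
   moreover have "T <= topspace Z" using S(1) member_sub[of t S] onto by blast
   ultimately show "T <= topspace Z & subtopology Z T homeomorphic_space B i" by blast
  qed
  have "spread Z (\<Union>i<k. A i) (%S. S)" unfolding AU
   by (rule spread_homeomorphic[OF f spread_members]) (use member_sub in auto)
  moreover have "\<Union>(\<Union>i<k. A i) <= topspace Z" using 5 by blast
  ultimately have 6: "null_family Z (\<Union>i<k. A i)" by (rule spread_null_family[OF cZ(1)])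
  have 7: "Z closure_of (topspace Z - T) = topspace Z" if T: "T:(\<Union>i<k. A i)" for T
  proof -
   obtain t S where S: "t:W" "cblock X S" "T = f ` member t S" using AE[OF T] by blast
   have "RT closure_of (M - member t S) = topspace RT" unfolding dense_intersects_open
   proof (intro allI impI)
    fix U assume U: "openin RT U & U ~= {}"
    then have "U <= M" using openin_subset by fastforce
    moreover have "~ U <= member t S" using member_complement_dense[OF S(2) St[OF S(2)] S(1)] U by blast
    ultimately show "(M - member t S) Int U ~= {}" by blast
   qed
   then have "Z closure_of (f ` (M - member t S)) = topspace Z" by (intro dense_homeomorphic[OF f]) auto
   moreover have "f ` (M - member t S) = topspace Z - T"
    using inj_on_image_set_diff[OF inj _ member_sub] onto S(3) by auto
   ultimately show ?thesis by simp
  qed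
  have 8: "Z closure_of \<Union>(A i) = topspace Z" if i: "i < k" for i
  proof -
   obtain S where S: "cblock X S" "subtopology X S homeomorphic_space Y i" using types[OF i] by blast
   let ?P = "UN t:W. member t S"
   have "RT closure_of ?P = topspace RT" unfolding dense_intersects_open
   proof (intro allI impI)
    fix U assume U: "openin RT U & U ~= {}"
    obtain t where t: "t:W" "member t S <= U" using open_contains_member[OF S(1) St[OF S(1)]] U by blast
    then show "?P Int U ~= {}" using member_nonempty[OF S(1) t(1)] by blast
   qed
   moreover have "?P <= topspace RT" using member_sub by auto
   ultimately have "Z closure_of (f ` ?P) = topspace Z" by (intro dense_homeomorphic[OF f])
   moreover have "f ` ?P <= \<Union>(A i)" unfolding A_def using S by blast
   ultimately show ?thesis using closure_of_mono[of "f ` ?P" "\<Union>(A i)" Z] closure_of_subset_topspace[of Z "\<Union>(A i)"] by simp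
  qed
  have 9: "EX H. openin Z H & closedin Z H & x:H & y ~: H & (ALL T:(\<Union>i<k. A i). T <= H | T Int H = {})"
   if xy: "x:topspace Z" "y:topspace Z" "x ~= y" "~ (EX T:(\<Union>i<k. A i). x:T & y:T)" for x y
  proof -
   obtain m n where mn: "m:M" "n:M" "x = f m" "y = f n" using xy(1,2) onto by blast
   have "~ (EX t:W. EX S. cblock X S & m:member t S & n:member t S)" using xy(4) mn(3,4) unfolding AU by blast
   moreover have "m ~= n" using xy(3) mn(3,4) by blast
   ultimately obtain H where H: "openin RT H" "closedin RT H" "m:H" "n ~: H"
    "ALL t:W. ALL S. cblock X S --> member t S <= H | member t S Int H = {}" using separation[OF mn(1,2)] by blast
   have HM: "H <= M" using openin_subset[OF H(1)] by simp
   have "openin Z (f ` H)" "closedin Z (f ` H)"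
    using homeomorphic_imp_open_map[OF f] homeomorphic_imp_closed_map[OF f] H(1,2) by (auto simp: open_map_def closed_map_def)
   moreover have "y ~: f ` H" using mn H(4) inj_on_image_mem_iff[OF inj mn(2) HM] by simp
   moreover have "T <= f ` H | T Int f ` H = {}" if T: "T:(\<Union>i<k. A i)" for T
   proof -
    obtain t S where S: "t:W" "cblock X S" "T = f ` member t S" using AE[OF T] by blast
    then have "member t S <= H | member t S Int H = {}" using H(5) by blast
    then show ?thesis using S(3) fI[OF member_sub HM, of t S] by auto
   qed
   ultimately show ?thesis using mn(3) H(3) by (intro exI[of _ "f ` H"]) blast
  qed
  have "dense_amalgam_family Z {..<k} B A" unfolding dense_amalgam_family_def using 1 2 3 4 5 6 7 8 9 by auto
  then show ?thesis unfolding I using False by auto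
 qed
 then show ?thesis unfolding is_dense_amalgam_def Let_def using cm cZ by blast
qed

end

theorem proposition3p8:
  fixes X :: "'a topology" and D :: "'a set"
    and V :: "'v set" and E :: "'v set set" and lab :: "'v set \<Rightarrow> 'a"
    and m :: nat and Y :: "nat \<Rightarrow> 'b topology" and DY :: "nat \<Rightarrow> 'b set"
    and VY :: "nat \<Rightarrow> 'w set" and EY :: "nat \<Rightarrow> 'w set set" and labY :: "nat \<Rightarrow> 'w set \<Rightarrow> 'b"
  assumes graph: "topological_graph X"
    and not_singleton: "card (topspace X) \<noteq> 1"
    and not_doubleton: "card (topspace X) \<noteq> 2"
    and data: "reflection_data X D V E lab"
    and not_connected: "\<not> connected_space (reflection_tree X V E lab)"
    and types_of_blocks: "\<And>i. i < m \<Longrightarrow> \<exists>S. block X S \<and> subtopology X S homeomorphic_space Y i"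
    and all_types: "\<And>S. block X S \<Longrightarrow> \<exists>i<m. subtopology X S homeomorphic_space Y i"
    and distinct_types: "\<And>i j. i < m \<Longrightarrow> j < m \<Longrightarrow> Y i homeomorphic_space Y j \<Longrightarrow> i = j"
    and dataY: "\<And>i. i < m \<Longrightarrow> reflection_data (Y i) (DY i) (VY i) (EY i) (labY i)"
  shows "is_dense_amalgam m (\<lambda>i. reflection_tree (Y i) (VY i) (EY i) (labY i))
           (reflection_tree X V E lab)"
proof -
 interpret spatial_graph X by (rule topological_graph_spatial[OF graph])
 interpret labelled_tree X D V E lab by (rule reflection_data_locales(2)[OF graph_space_axioms data])
 have hom: "RT homeomorphic_space reflection_tree X V E lab" using reflection_tree_homeomorphic homeomorphic_space_sym by blast
 have nc: "~ connected_space RT" using homeomorphic_connected_space[OF hom] not_connected by blast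
 have ne: "topspace X ~= {}"
 proof
  assume "topspace X = {}"
  then have "topspace RT = {}" using M_top[OF _ words_Nil] by auto
  then show False using nc connectedin_topspace[of RT] connectedin_empty[of RT] by metis
 qed
 \<comment> \<open>A finite set in a Hausdorff space is closed, so a dense one is the whole space.
   This is where singletons and doubletons have to be excluded.\<close>
 have three: "EX d:D. d ~= a & d ~= b" for a b
 proof (rule ccontr)
  assume "~ ?thesis"
  then have sub: "D <= {a, b}" by blast
  then have "finite D" using finite_subset by blast
  then have "X closure_of D = D" using closedin_Hausdorff_finite[OF Haus_X D_sub] by (simp add: closure_of_eq)
  then have X: "topspace X = D" using D_dense by simp
  have "card D <= card {a, b}" by (rule card_mono) (use sub in auto)
  also have "\<dots> <= 2" by (simp add: card_insert_if)
  finally have "card D <= 2" .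
  moreover have "card D ~= 0" using ne X \<open>finite D\<close> by auto
  ultimately show False using not_singleton not_doubleton X by simp
 qed
 interpret big_graph X D using three by unfold_locales
 note bc = block_iff_cblock[OF ne]
 obtain f where f: "homeomorphic_map RT (reflection_tree X V E lab) f" using hom by (auto simp: homeomorphic_space)
 \<comment> \<open>\<open>Y i\<close> is homeomorphic to a block, and this makes it a graph in the
   sense of \<open>graph_space\<close>.\<close>
 have tree: "reflection_tree (Y i) (VY i) (EY i) (labY i) homeomorphic_space rtop (Y i) (DY i) & marked_graph (Y i) (DY i)"
  if i: "i < m" for i
 proof -
  obtain S where S: "block X S" "subtopology X S homeomorphic_space Y i" using types_of_blocks[OF i] by blast
  have "graph_space (subtopology X S)" using graph_space_saturated[OF cyc_saturated[OF cblock_cyc]] S(1) bc by blast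
  then have g: "graph_space (Y i)" using S(2) by (rule graph_space_homeomorphic)
  note l = reflection_data_locales[OF g dataY[OF i]]
  show ?thesis using labelled_tree.reflection_tree_homeomorphic[OF l(2)] l(1) by blast
 qed
 show ?thesis
 proof (rule dense_amalgam[OF f nc])
  show "EX S. cblock X S & subtopology X S homeomorphic_space Y i" if "i < m" for i
   using types_of_blocks[OF that] bc by blast
  show "EX i<m. subtopology X S homeomorphic_space Y i" if "cblock X S" for S using all_types that bc by blast
  show "i = j" if "i < m" "j < m" "Y i homeomorphic_space Y j" for i j using distinct_types[OF that] .
  fix i assume i: "i < m"
  let ?B = "reflection_tree (Y i) (VY i) (EY i) (labY i)"
  note t = tree[OF i]
  then show "compact_space ?B & metrizable_space ?B"
   using homeomorphic_compact_space[of ?B] homeomorphic_metrizable_space[of ?B] marked_graph.compact_RT marked_graph.metrizable_RT by blast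
  show "subtopology RT (member t S) homeomorphic_space ?B"
   if "cblock X S" "subtopology X S homeomorphic_space Y i" "t:W" for S t
   using rtop_of_block[OF conjunct2[OF tree[OF i]] cblock_cyc[OF that(1)] that(2,3)] conjunct1[OF tree[OF i]]
    homeomorphic_space_sym homeomorphic_space_trans by blast
 qed
qed

end
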